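(* For each free label $A_0\in\mathcal F_{n,r}$ put $$C^{(n,r)}_{A_0}=[A_0]-\sum_{P\in\mathcal P_{n,r}}R_{\rho(P),A_0}\,[P]\in\boldsymbol{\mathcal S}_q(n,r),$$ where $R=\operatorname{rref}(M_{n,r})$ is the reduced row echelon form of the center-equation matrix $M_{n,r}$, $\mathcal P_{n,r}$ and $\mathcal F_{n,r}$ are its pivot and free column labels, and $\rho(P)$ is the row containing the pivot of column $P$. Then the set $$\{C^{(n,r)}_{A_0}\mid A_0\in\mathcal F_{n,r}\}$$ forms a $K$-basis of the center $Z(\boldsymbol{\mathcal S}_q(n,r))$.
   Context: Let $\upsilon$ be an indeterminate, $q=\upsilon^2$, $\mathcal A=\mathbb Z[\upsilon,\upsilon^{-1}]$, $K=\mathbb Q(\upsilon)$, $\mathbb N=\{0,1,2,\dots\}$. Hecke algebra: $\mathcal H_{\mathcal A}(r)$ is the Hecke algebra over $\mathcal A$ of the symmetric group $\mathfrak S_r=\langle s_1,\dots,s_{r-1}\rangle$, generated by $T_i=T_{s_i}$ ($1\le i<r$) with $T_i^2=(q-1)T_i+q$, $T_iT_{i+1}T_i=T_{i+1}T_iT_{i+1}$, and $T_iT_j=T_jT_i$ for $|i-j|>1$. $q$-Schur algebra of type $A$: let $\Lambda(n,r)=\{\lambda\in\mathbb N^n\mid \sum_i\lambda_i=r\}$; for $\lambda\in\Lambda(n,r)$ let $\mathfrak S_\lambda$ be the Young subgroup and $x_\lambda=\sum_{w\in\mathfrak S_\lambda}T_w$. Put $\mathcal S_q(n,r)=\operatorname{End}_{\mathcal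 H_{\mathcal A}(r)}\big(\bigoplus_{\lambda\in\Lambda(n,r)}x_\lambda\mathcal H_{\mathcal A}(r)\big)$ and $\boldsymbol{\mathcal S}_q(n,r)=K\otimes_{\mathcal A}\mathcal S_q(n,r)$. Normalized BLM basis: $\Theta(n,r)$ is the set of $n\times n$ matrices $A=(a_{ij})$ over $\mathbb N$ with $\sum_{i,j}a_{ij}=r$; $\operatorname{ro}(A)$ and $\operatorname{co}(A)$ are the vectors of row sums and column sums. If $\operatorname{ro}(A)=\lambda$, $\operatorname{co}(A)=\mu$, then $A$ corresponds to the double coset $D_A=\mathfrak S_\lambda w\mathfrak S_\mu$ with $a_{ij}=|R^\lambda_i\cap wR^\mu_j|$, where $R^\lambda_1,\dots,R^\lambda_n$ are the consecutive blocks of $\{1,\dots,r\}$ of sizes $\lambda_1,\dots,\lambda_n$. Let $e_A\in\mathcal S_q(n,r)$ be given by $e_A(x_\nu h)=\delta_{\nu,\mu}\sum_{w\in D_A}T_wh$, and put $[A]=\upsilon^{-d_A}e_A$ with $d_A=\sum_{i\ge k,\ j<l}a_{ij}a_{kl}$. The set $\{[A]\mid A\in\Theta(n,r)\}$ is a $K$-basis of $\boldsymbol{\mathcal S}_q(n,r)$. Balanced matrices: $\Omega(n,r)=\{A\in\Theta(n,r)\mid \operatorname{ro}(A)=\operatorname{co}(A)\}$. Further notation: $E_{ij}$ is the $n\times n$ matrix unit, $\varepsilon_i$ the $i$-th standard basis vector of $\mathbb Z^n$, $\alpha_h=\varepsilon_h-\varepsilon_{h+1}$, and $\Theta^{\pm}_{n,r}(h)=\{B\in\Theta(n,r)\mid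 \operatorname{ro}(B)-\operatorname{co}(B)=\pm\alpha_h\}$ for $1\le h<n$. For $a\in\mathbb Z$ put $[\![a]\!]=\frac{\upsilon^{2a}-1}{\upsilon^2-1}$, and let the bar denote the ring automorphism of $\mathcal A$ with $\overline{\upsilon}=\upsilon^{-1}$. For $A=(a_{ij})\in\Theta(n,r)$, $1\le h<n$, $1\le p\le n$, put $$\beta_p(A,h)=\sum_{j\ge p}a_{h,j}-\sum_{j>p}a_{h+1,j},\qquad \beta'_p(A,h)=\sum_{j\le p}a_{h+1,j}-\sum_{j<p}a_{h,j},$$ and, with $A^t$ the transpose of $A$, $$L^+_{h,u}(A)=\upsilon^{\beta_u(A,h)}\overline{[\![a_{h,u}+1]\!]},\quad L^-_{h,u}(A)=\upsilon^{\beta'_u(A,h)}\overline{[\![a_{h+1,u}+1]\!]},$$ $$R^+_{h,u}(A)=\upsilon^{\beta'_u(A^t,h)}\overline{[\![a_{u,h+1}+1]\!]},\quad R^-_{h,u}(A)=\upsilon^{\beta_u(A^t,h)}\overline{[\![a_{u,h}+1]\!]}.$$ Center equations, in unknowns $x=(x_A)_{A\in\Omega(n,r)}$: for all $1\le h<n$ and $B=(b_{ij})\in\Theta^+_{n,r}(h)$, $$\sum_{u:\,b_{h,u}>0} x_{B-E_{h,u}+E_{h+1,u}}L^+_{h,u}(B-E_{h,u}+E_{h+1,u})=\sum_{u:\,b_{u,h+1}>0} x_{B+E_{u,h}-E_{u,h+1}}R^+_{h,u}(B+E_{u,h}-E_{u,h+1}),$$ and for all $1\le h<n$ and $B\in\Theta^-_{n,r}(h)$,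 $$\sum_{u:\,b_{h+1,u}>0} x_{B+E_{h,u}-E_{h+1,u}}L^-_{h,u}(B+E_{h,u}-E_{h+1,u})=\sum_{u:\,b_{u,h}>0} x_{B-E_{u,h}+E_{u,h+1}}R^-_{h,u}(B-E_{u,h}+E_{u,h+1}),$$ with $1\le u\le n$ and any term whose subscript matrix is not in $\Omega(n,r)$ read as $0$. Arranging these equations in any fixed order (all terms on one side) gives a homogeneous system $M_{n,r}x=0$, where $M_{n,r}$ is a matrix over $K$ whose columns are labelled by $\Omega(n,r)=\{A_1,\dots,A_{\mathfrak n}\}$ in a fixed order. Reduced row echelon form: let $R=\operatorname{rref}(M_{n,r})$, with $j$-th column labelled by $A_j$. $\mathcal P_{n,r}$ is the set of those $A_j$ whose column contains the leading $1$ of a nonzero row of $R$; $\mathcal F_{n,r}=\Omega(n,r)\setminus\mathcal P_{n,r}$. For $P\in\mathcal P_{n,r}$, $\rho(P)$ is the row of $R$ whose pivot lies in column $P$, and $R_{\rho(P),F}$ denotes the entry of $R$ in row $\rho(P)$ and the column labelled $F$. *)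

theory Defs
  imports
    "HOL-Algebra.QuotRing"
    "HOL-Algebra.IntRing"
    "HOL-Computational_Algebra.Polynomial"
    "HOL-Computational_Algebra.Fraction_Field"
    "HOL-Combinatorics.Permutations"
    "HOL-Combinatorics.Transposition"
    "Jordan_Normal_Form.VS_Connect"
    "Jordan_Normal_Form.Gauss_Jordan_Elimination"
begin

section \<open>Coefficients\<close>

text \<open>The field of rational functions in the indeterminate \<open>\<upsilon>\<close> over the rationals, and inside it
  the ring of Laurent polynomials with integer coefficients.\<close>

type_synonym ratfun = "rat poly fract"

definition ups :: ratfun (\<open>\<upsilon>\<close>) where
  "\<upsilon> = Fraction_Field.Fract [:0, 1:] 1"

abbreviation qq :: ratfun where
  "qq \<equiv> \<upsilon> ^ 2"

abbreviation KK :: "ratfun ring" where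
  "KK \<equiv> class_ring"

definition laurent :: "ratfun set" where
  "laurent = {\<Sum>k\<in>I. of_int (c k) * \<upsilon> powi k | (I :: int set) (c :: int \<Rightarrow> int). finite I}"

definition AA :: "ratfun ring" where
  "AA = KK\<lparr>carrier := laurent\<rparr>"

definition bar :: "ratfun \<Rightarrow> ratfun" where
  "bar = (THE f. f \<in> ring_iso AA AA \<and> f \<in> extensional laurent \<and> f \<upsilon> = \<upsilon> powi (- 1))"

definition dbrack :: "int \<Rightarrow> ratfun" where
  "dbrack a = (\<upsilon> powi (2 * a) - 1) / (\<upsilon> ^ 2 - 1)"


section \<open>General constructions\<close>

text \<open>The monoid ring \<open>R[M]\<close>, as finitely supported functions with convolution.\<close>

definition mr_supp :: "('a, 'x) ring_scheme \<Rightarrow> ('m \<Rightarrow> 'a) \<Rightarrow> 'm set" where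
  "mr_supp R f = {m. f m \<noteq> \<zero>\<^bsub>R\<^esub>}"

definition monoid_ring ::
  "('a, 'x) ring_scheme \<Rightarrow> ('m, 'y) monoid_scheme \<Rightarrow> ('m \<Rightarrow> 'a) ring" where
  "monoid_ring R M =
    \<lparr>carrier = {f. (\<forall>m. f m \<in> carrier R) \<and> finite (mr_supp R f) \<and> mr_supp R f \<subseteq> carrier M},
     mult = (\<lambda>f g x. \<Oplus>\<^bsub>R\<^esub> p \<in> {p \<in> mr_supp R f \<times> mr_supp R g. fst p \<otimes>\<^bsub>M\<^esub> snd p = x}.
                f (fst p) \<otimes>\<^bsub>R\<^esub> g (snd p)),
     one = (\<lambda>x. if x = \<one>\<^bsub>M\<^esub> then \<one>\<^bsub>R\<^esub> else \<zero>\<^bsub>R\<^esub>),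
     zero = (\<lambda>_. \<zero>\<^bsub>R\<^esub>),
     add = (\<lambda>f g x. f x \<oplus>\<^bsub>R\<^esub> g x)\<rparr>"

definition mr_single :: "('a, 'x) ring_scheme \<Rightarrow> 'a \<Rightarrow> 'm \<Rightarrow> 'm \<Rightarrow> 'a" where
  "mr_single R a m = (\<lambda>x. if x = m then a else \<zero>\<^bsub>R\<^esub>)"

text \<open>The scalar extension \<open>K \<otimes>\<^sub>A S\<close> of an algebra \<open>S\<close> over a subring with carrier \<open>A\<close> of a
  commutative ring \<open>K\<close>. It is the free abelian group on pairs \<open>(k, s)\<close>, a ring with
  \<open>(k, s) (k', s') = (k k', s s')\<close>, modulo the bilinearity relations. The additive subgroup spanned
  by these relations is stable under multiplication by pairs, hence equal to the ideal they
  generate. Algebras are module records whose ring fields carry the ring structure.\<close>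

definition tensor_free ::
  "('a, 'x) ring_scheme \<Rightarrow> ('b, 's, 'y) module_scheme \<Rightarrow> ('a \<times> 's \<Rightarrow> int) ring" where
  "tensor_free K S = monoid_ring \<Z> (K \<times>\<times> S)"

definition tensor_rels ::
  "('a, 'x) ring_scheme \<Rightarrow> 'a set \<Rightarrow> ('a, 's, 'y) module_scheme \<Rightarrow> ('a \<times> 's \<Rightarrow> int) set" where
  "tensor_rels K A S =
    (let F = tensor_free K S; t = (\<lambda>k s. mr_single \<Z> 1 (k, s)) in
      {t (k \<oplus>\<^bsub>K\<^esub> k') s \<ominus>\<^bsub>F\<^esub> (t k s \<oplus>\<^bsub>F\<^esub> t k' s)
         | k k' s. k \<in> carrier K \<and> k' \<in> carrier K \<and> s \<in> carrier S}
    \<union> {t k (s \<oplus>\<^bsub>S\<^esub> s') \<ominus>\<^bsub>F\<^esub> (t k s \<oplus>\<^bsub>F\<^esub> t k s')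
         | k s s'. k \<in> carrier K \<and> s \<in> carrier S \<and> s' \<in> carrier S}
    \<union> {t (k \<otimes>\<^bsub>K\<^esub> a) s \<ominus>\<^bsub>F\<^esub> t k (a \<odot>\<^bsub>S\<^esub> s)
         | k a s. k \<in> carrier K \<and> a \<in> A \<and> s \<in> carrier S})"

definition pure_tensor ::
  "('a, 'x) ring_scheme \<Rightarrow> 'a set \<Rightarrow> ('a, 's, 'y) module_scheme \<Rightarrow> 'a \<Rightarrow> 's
    \<Rightarrow> ('a \<times> 's \<Rightarrow> int) set" where
  "pure_tensor K A S k s =
    (Idl\<^bsub>tensor_free K S\<^esub> (tensor_rels K A S)) +>\<^bsub>tensor_free K S\<^esub> (mr_single \<Z> 1 (k, s))"

definition base_change ::
  "('a, 'x) ring_scheme \<Rightarrow> 'a set \<Rightarrow> ('a, 's, 'y) module_scheme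
    \<Rightarrow> ('a, ('a \<times> 's \<Rightarrow> int) set) module" where
  "base_change K A S =
    (let Q = tensor_free K S Quot (Idl\<^bsub>tensor_free K S\<^esub> (tensor_rels K A S)) in
      \<lparr>carrier = carrier Q, mult = mult Q, one = one Q, zero = zero Q, add = add Q,
       smult = (\<lambda>c x. pure_tensor K A S c \<one>\<^bsub>S\<^esub> \<otimes>\<^bsub>Q\<^esub> x)\<rparr>)"

definition ring_center :: "('a, 'x) ring_scheme \<Rightarrow> 'a set" where
  "ring_center R = {z \<in> carrier R. \<forall>y\<in>carrier R. z \<otimes>\<^bsub>R\<^esub> y = y \<otimes>\<^bsub>R\<^esub> z}"


section \<open>The Hecke algebra of the symmetric group\<close>

text \<open>The presented algebra: the free algebra on letters \<open>1, \<dots>, r - 1\<close>, i.e. the monoid ring of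
  the free monoid, modulo the defining relations.\<close>

definition word_monoid :: "nat \<Rightarrow> nat list monoid" where
  "word_monoid r = \<lparr>carrier = lists {1..<r}, mult = (@), one = []\<rparr>"

definition free_alg :: "nat \<Rightarrow> (nat list \<Rightarrow> ratfun) ring" where
  "free_alg r = monoid_ring AA (word_monoid r)"

definition hecke_rels :: "nat \<Rightarrow> (nat list \<Rightarrow> ratfun) set" where
  "hecke_rels r =
    (let F = free_alg r; t = (\<lambda>i. mr_single AA 1 [i]) in
      {t i \<otimes>\<^bsub>F\<^esub> t i \<ominus>\<^bsub>F\<^esub> (mr_single AA (qq - 1) [i] \<oplus>\<^bsub>F\<^esub> mr_single AA qq [])
         | i. i \<in> {1..<r}}
    \<union> {t i \<otimes>\<^bsub>F\<^esub> t (i + 1) \<otimes>\<^bsub>F\<^esub> t i \<ominus>\<^bsub>F\<^esub> t (i + 1) \<otimes>\<^bsub>F\<^esub> t i \<otimes>\<^bsub>F\<^esub> t (i + 1)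
         | i. i \<in> {1..<r} \<and> i + 1 \<in> {1..<r}}
    \<union> {t i \<otimes>\<^bsub>F\<^esub> t j \<ominus>\<^bsub>F\<^esub> t j \<otimes>\<^bsub>F\<^esub> t i
         | i j. i \<in> {1..<r} \<and> j \<in> {1..<r} \<and> \<bar>int i - int j\<bar> > 1})"

type_synonym hecke_elt = "(nat list \<Rightarrow> ratfun) set"

definition hecke :: "nat \<Rightarrow> hecke_elt ring" where
  "hecke r = free_alg r Quot (Idl\<^bsub>free_alg r\<^esub> (hecke_rels r))"

definition hecke_class :: "nat \<Rightarrow> (nat list \<Rightarrow> ratfun) \<Rightarrow> hecke_elt" where
  "hecke_class r f = (Idl\<^bsub>free_alg r\<^esub> (hecke_rels r)) +>\<^bsub>free_alg r\<^esub> f"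

definition hecke_scalar :: "nat \<Rightarrow> ratfun \<Rightarrow> hecke_elt" where
  "hecke_scalar r a = hecke_class r (mr_single AA a [])"

definition word_perm :: "nat list \<Rightarrow> nat \<Rightarrow> nat" where
  "word_perm is = foldr (\<lambda>i w. transpose i (i + 1) \<circ> w) is id"

definition reduced_word :: "nat \<Rightarrow> (nat \<Rightarrow> nat) \<Rightarrow> nat list \<Rightarrow> bool" where
  "reduced_word r w is \<longleftrightarrow> is \<in> lists {1..<r} \<and> word_perm is = w \<and>
    (\<forall>js\<in>lists {1..<r}. word_perm js = w \<longrightarrow> length is \<le> length js)"

text \<open>The class of the word \<open>[i\<^sub>1, \<dots>, i\<^sub>k]\<close> is the product of the corresponding generators; by
  Matsumoto's theorem it does not depend on the chosen reduced word of \<open>w\<close>.\<close>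

definition hecke_T :: "nat \<Rightarrow> (nat \<Rightarrow> nat) \<Rightarrow> hecke_elt" where
  "hecke_T r w = hecke_class r (mr_single AA 1 (SOME is. reduced_word r w is))"


section \<open>The q-Schur algebra\<close>

text \<open>Vectors and matrices are indexed from 1 and vanish outside \<open>{1..n}\<close>.\<close>

type_synonym nvec = "nat \<Rightarrow> nat"
type_synonym nmat = "nat \<Rightarrow> nat \<Rightarrow> nat"

definition Lam :: "nat \<Rightarrow> nat \<Rightarrow> nvec set" where
  "Lam n r = {l. (\<forall>i. i \<notin> {1..n} \<longrightarrow> l i = 0) \<and> (\<Sum>i\<in>{1..n}. l i) = r}"

definition block :: "nvec \<Rightarrow> nat \<Rightarrow> nat set" where
  "block l i = {k. (\<Sum>j\<in>{1..<i}. l j) < k \<and> k \<le> (\<Sum>j\<in>{1..i}. l j)}"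

definition young :: "nat \<Rightarrow> nat \<Rightarrow> nvec \<Rightarrow> (nat \<Rightarrow> nat) set" where
  "young n r l = {w. w permutes {1..r} \<and> (\<forall>i\<in>{1..n}. w ` block l i = block l i)}"

definition hecke_x :: "nat \<Rightarrow> nat \<Rightarrow> nvec \<Rightarrow> hecke_elt" where
  "hecke_x n r l = (\<Oplus>\<^bsub>hecke r\<^esub> w \<in> young n r l. hecke_T r w)"

text \<open>The direct sum of the right ideals generated by the \<open>x\<^sub>\<lambda>\<close>, as a right module over the
  Hecke algebra with componentwise operations.\<close>

type_synonym perm_elt = "nvec \<Rightarrow> hecke_elt"

definition perm_mod :: "nat \<Rightarrow> nat \<Rightarrow> perm_elt set" where
  "perm_mod n r = (\<Pi>\<^sub>E l\<in>Lam n r. (\<lambda>h. hecke_x n r l \<otimes>\<^bsub>hecke r\<^esub> h) ` carrier (hecke r))"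

definition perm_zero :: "nat \<Rightarrow> nat \<Rightarrow> perm_elt" where
  "perm_zero n r = (\<lambda>l\<in>Lam n r. \<zero>\<^bsub>hecke r\<^esub>)"

definition perm_add :: "nat \<Rightarrow> nat \<Rightarrow> perm_elt \<Rightarrow> perm_elt \<Rightarrow> perm_elt" where
  "perm_add n r m m' = (\<lambda>l\<in>Lam n r. m l \<oplus>\<^bsub>hecke r\<^esub> m' l)"

definition perm_act :: "nat \<Rightarrow> nat \<Rightarrow> perm_elt \<Rightarrow> hecke_elt \<Rightarrow> perm_elt" where
  "perm_act n r m h = (\<lambda>l\<in>Lam n r. m l \<otimes>\<^bsub>hecke r\<^esub> h)"

definition perm_inj :: "nat \<Rightarrow> nat \<Rightarrow> nvec \<Rightarrow> hecke_elt \<Rightarrow> perm_elt" where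
  "perm_inj n r l h = (\<lambda>l'\<in>Lam n r. if l' = l then h else \<zero>\<^bsub>hecke r\<^esub>)"

text \<open>Linearity over the Hecke algebra includes linearity over Laurent polynomials, since these act
  through the central elements \<^const>\<open>hecke_scalar\<close>. Endomorphisms are extensional functions on
  \<^const>\<open>perm_mod\<close> and are multiplied by composition.\<close>

type_synonym qschur_elt = "perm_elt \<Rightarrow> perm_elt"

definition qschur :: "nat \<Rightarrow> nat \<Rightarrow> (ratfun, qschur_elt) module" where
  "qschur n r =
    (let M = perm_mod n r; H = hecke r in
      \<lparr>carrier = {f \<in> M \<rightarrow>\<^sub>E M.
          (\<forall>m\<in>M. \<forall>m'\<in>M. f (perm_add n r m m') = perm_add n r (f m) (f m')) \<and>
          (\<forall>m\<in>M. \<forall>h\<in>carrier H. f (perm_act n r m h) = perm_act n r (f m) h)},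
       mult = (\<lambda>f g. compose M f g),
       one = (\<lambda>m\<in>M. m),
       zero = (\<lambda>m\<in>M. perm_zero n r),
       add = (\<lambda>f g. \<lambda>m\<in>M. perm_add n r (f m) (g m)),
       smult = (\<lambda>a f. \<lambda>m\<in>M. perm_act n r (f m) (hecke_scalar r a))\<rparr>)"

definition qschurK :: "nat \<Rightarrow> nat \<Rightarrow> (ratfun, (ratfun \<times> qschur_elt \<Rightarrow> int) set) module" where
  "qschurK n r = base_change KK laurent (qschur n r)"


section \<open>The normalized basis\<close>

definition Theta :: "nat \<Rightarrow> nat \<Rightarrow> nmat set" where
  "Theta n r = {A. (\<forall>i j. i \<notin> {1..n} \<or> j \<notin> {1..n} \<longrightarrow> A i j = 0) \<and>
    (\<Sum>i\<in>{1..n}. \<Sum>j\<in>{1..n}. A i j) = r}"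

definition ro :: "nat \<Rightarrow> nmat \<Rightarrow> nvec" where
  "ro n A = (\<lambda>i. \<Sum>j\<in>{1..n}. A i j)"

definition co :: "nat \<Rightarrow> nmat \<Rightarrow> nvec" where
  "co n A = (\<lambda>j. \<Sum>i\<in>{1..n}. A i j)"

definition Omega :: "nat \<Rightarrow> nat \<Rightarrow> nmat set" where
  "Omega n r = {A \<in> Theta n r. ro n A = co n A}"

definition dcoset :: "nat \<Rightarrow> nat \<Rightarrow> nmat \<Rightarrow> (nat \<Rightarrow> nat) set" where
  "dcoset n r A = (THE D. \<exists>w. w permutes {1..r} \<and>
     (\<forall>i\<in>{1..n}. \<forall>j\<in>{1..n}. A i j = card (block (ro n A) i \<inter> w ` block (co n A) j)) \<and>
     D = {a \<circ> w \<circ> b | a b. a \<in> young n r (ro n A) \<and> b \<in> young n r (co n A)})"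

text \<open>The elements \<open>x\<^sub>\<nu> h\<close>, put into the summand \<open>\<nu>\<close>, generate the direct sum additively, so an
  endomorphism is determined by its values on them.\<close>

definition basis_e :: "nat \<Rightarrow> nat \<Rightarrow> nmat \<Rightarrow> qschur_elt" where
  "basis_e n r A = (THE f. f \<in> carrier (qschur n r) \<and>
     (\<forall>l\<in>Lam n r. \<forall>h\<in>carrier (hecke r).
        f (perm_inj n r l (hecke_x n r l \<otimes>\<^bsub>hecke r\<^esub> h)) =
          (if l = co n A
           then perm_inj n r (ro n A)
                  ((\<Oplus>\<^bsub>hecke r\<^esub> w \<in> dcoset n r A. hecke_T r w) \<otimes>\<^bsub>hecke r\<^esub> h)
           else perm_zero n r)))"

definition d_exp :: "nat \<Rightarrow> nmat \<Rightarrow> nat" where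
  "d_exp n A = (\<Sum>(i, j, k, l) \<in> {(i, j, k, l). i \<in> {1..n} \<and> j \<in> {1..n} \<and> k \<in> {1..n} \<and> l \<in> {1..n} \<and>
      i \<ge> k \<and> j < l}. A i j * A k l)"

definition normalized_e :: "nat \<Rightarrow> nat \<Rightarrow> nmat \<Rightarrow> qschur_elt" where
  "normalized_e n r A = (\<upsilon> powi (- int (d_exp n A))) \<odot>\<^bsub>qschur n r\<^esub> basis_e n r A"

definition BLM :: "nat \<Rightarrow> nat \<Rightarrow> nmat \<Rightarrow> (ratfun \<times> qschur_elt \<Rightarrow> int) set" where
  "BLM n r A = pure_tensor KK laurent (qschur n r) 1 (normalized_e n r A)"


section \<open>The center equations\<close>

definition alpha :: "nat \<Rightarrow> nat \<Rightarrow> int" where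
  "alpha h = (\<lambda>i. of_bool (i = h) - of_bool (i = h + 1))"

definition Theta_plus :: "nat \<Rightarrow> nat \<Rightarrow> nat \<Rightarrow> nmat set" where
  "Theta_plus n r h = {B \<in> Theta n r. \<forall>i\<in>{1..n}. int (ro n B i) - int (co n B i) = alpha h i}"

definition Theta_minus :: "nat \<Rightarrow> nat \<Rightarrow> nat \<Rightarrow> nmat set" where
  "Theta_minus n r h = {B \<in> Theta n r. \<forall>i\<in>{1..n}. int (ro n B i) - int (co n B i) = - alpha h i}"

abbreviation transp :: "nmat \<Rightarrow> nmat" where
  "transp A \<equiv> (\<lambda>i j. A j i)"

definition beta :: "nat \<Rightarrow> nat \<Rightarrow> nmat \<Rightarrow> nat \<Rightarrow> int" where
  "beta n p A h = (\<Sum>j\<in>{p..n}. int (A h j)) - (\<Sum>j\<in>{p<..n}. int (A (h + 1) j))"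

definition beta' :: "nat \<Rightarrow> nmat \<Rightarrow> nat \<Rightarrow> int" where
  "beta' p A h = (\<Sum>j\<in>{1..p}. int (A (h + 1) j)) - (\<Sum>j\<in>{1..<p}. int (A h j))"

definition L_plus :: "nat \<Rightarrow> nat \<Rightarrow> nat \<Rightarrow> nmat \<Rightarrow> ratfun" where
  "L_plus n h u A = \<upsilon> powi (beta n u A h) * bar (dbrack (int (A h u) + 1))"

definition L_minus :: "nat \<Rightarrow> nat \<Rightarrow> nmat \<Rightarrow> ratfun" where
  "L_minus h u A = \<upsilon> powi (beta' u A h) * bar (dbrack (int (A (h + 1) u) + 1))"

definition R_plus :: "nat \<Rightarrow> nat \<Rightarrow> nmat \<Rightarrow> ratfun" where
  "R_plus h u A = \<upsilon> powi (beta' u (transp A) h) * bar (dbrack (int (A u (h + 1)) + 1))"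

definition R_minus :: "nat \<Rightarrow> nat \<Rightarrow> nat \<Rightarrow> nmat \<Rightarrow> ratfun" where
  "R_minus n h u A = \<upsilon> powi (beta n u (transp A) h) * bar (dbrack (int (A u h) + 1))"

text \<open>\<open>move B p p'\<close> is \<open>B - E\<^sub>p + E\<^sub>p\<^sub>'\<close>; it is only used when the entry of \<open>B\<close> at \<open>p\<close> is positive.\<close>

definition move :: "nmat \<Rightarrow> nat \<times> nat \<Rightarrow> nat \<times> nat \<Rightarrow> nmat" where
  "move B p p' = (\<lambda>i j. B i j - of_bool ((i, j) = p) + of_bool ((i, j) = p'))"

datatype center_eq = EqPlus nat nmat | EqMinus nat nmat

definition center_eqs :: "nat \<Rightarrow> nat \<Rightarrow> center_eq set" where
  "center_eqs n r =
    {EqPlus h B | h B. 1 \<le> h \<and> h < n \<and> B \<in> Theta_plus n r h} \<union>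
    {EqMinus h B | h B. 1 \<le> h \<and> h < n \<and> B \<in> Theta_minus n r h}"

text \<open>The coefficient of the unknown \<open>x\<^sub>A\<close> in a center equation, all terms being moved to the left.\<close>

fun eq_coeff :: "nat \<Rightarrow> center_eq \<Rightarrow> nmat \<Rightarrow> ratfun" where
  "eq_coeff n (EqPlus h B) A =
     (\<Sum>u | u \<in> {1..n} \<and> B h u > 0.
        if move B (h, u) (h + 1, u) = A then L_plus n h u A else 0)
   - (\<Sum>u | u \<in> {1..n} \<and> B u (h + 1) > 0.
        if move B (u, h + 1) (u, h) = A then R_plus h u A else 0)"
| "eq_coeff n (EqMinus h B) A =
     (\<Sum>u | u \<in> {1..n} \<and> B (h + 1) u > 0.
        if move B (h + 1, u) (h, u) = A then L_minus h u A else 0)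
   - (\<Sum>u | u \<in> {1..n} \<and> B u h > 0.
        if move B (u, h) (u, h + 1) = A then R_minus n h u A else 0)"

text \<open>The orders of rows and columns are given by a list of the equations and a list of
  \<open>Omega n r\<close>. Rows and columns are numbered from 0.\<close>

definition center_mat :: "nat \<Rightarrow> center_eq list \<Rightarrow> nmat list \<Rightarrow> ratfun mat" where
  "center_mat n eqs As = mat (length eqs) (length As) (\<lambda>(i, j). eq_coeff n (eqs ! i) (As ! j))"


section \<open>The reduced row echelon form and the candidate basis\<close>

text \<open>The predicate \<^const>\<open>row_echelon_form\<close>, which \<^const>\<open>gauss_jordan_single\<close> establishes,
  describes the \<^emph>\<open>reduced\<close> row echelon form: leading entries are 1 and are the only nonzero
  entries of their columns.\<close>

definition rref :: "'a :: field mat \<Rightarrow> 'a mat" where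
  "rref M = gauss_jordan_single M"

definition leading :: "'a :: field mat \<Rightarrow> nat \<Rightarrow> nat \<Rightarrow> bool" where
  "leading R i j \<longleftrightarrow> i < dim_row R \<and> j < dim_col R \<and> R $$ (i, j) \<noteq> 0 \<and> (\<forall>j'<j. R $$ (i, j') = 0)"

definition col_of :: "nmat list \<Rightarrow> nmat \<Rightarrow> nat" where
  "col_of As A = (THE j. j < length As \<and> As ! j = A)"

definition pivots :: "ratfun mat \<Rightarrow> nmat list \<Rightarrow> nmat set" where
  "pivots R As = {A \<in> set As. \<exists>i. leading R i (col_of As A)}"

definition frees :: "ratfun mat \<Rightarrow> nmat list \<Rightarrow> nmat set" where
  "frees R As = set As - pivots R As"

definition pivot_row :: "ratfun mat \<Rightarrow> nmat list \<Rightarrow> nmat \<Rightarrow> nat" where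
  "pivot_row R As P = (THE i. leading R i (col_of As P))"

definition C_elt ::
  "nat \<Rightarrow> nat \<Rightarrow> ratfun mat \<Rightarrow> nmat list \<Rightarrow> nmat \<Rightarrow> (ratfun \<times> qschur_elt \<Rightarrow> int) set" where
  "C_elt n r R As A0 = BLM n r A0 \<ominus>\<^bsub>qschurK n r\<^esub>
     (\<Oplus>\<^bsub>qschurK n r\<^esub> P \<in> pivots R As.
        R $$ (pivot_row R As P, col_of As A0) \<odot>\<^bsub>qschurK n r\<^esub> BLM n r P)"

definition center_space ::
  "nat \<Rightarrow> nat \<Rightarrow> (ratfun, (ratfun \<times> qschur_elt \<Rightarrow> int) set) module" where
  "center_space n r = (qschurK n r)\<lparr>carrier := ring_center (qschurK n r)\<rparr>"

end

theory Submission
  imports Defs "HOL-Computational_Algebra.Polynomial_Factorial"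
begin

text \<open>The Hecke algebra acts faithfully on functions on permutations by Demazure-Lusztig operators,
  so its elements are determined by their \<open>T\<^sub>w\<close>-coefficients, and endomorphisms of the direct sum of the
  \<open>x\<^sub>\<lambda> H\<close> by coefficients that are constant on double cosets. This gives coordinates on the q-Schur algebra
  dual to the \<open>e\<^sub>A\<close>, and they survive base change. If \<open>C\<close> is diagonal up to one entry 1 next to
  the diagonal, then \<open>e\<^sub>C e\<^sub>A\<close> is computed explicitly. With
  \<open>Q(A) = \<Sum> a\<^sub>i\<^sub>j (i - j)\<^sup>2\<close>, every \<open>e\<^sub>A\<close> with \<open>A\<close> not diagonal is, up to a unit and terms of
  smaller \<open>Q\<close>, such a product with a smaller \<open>A\<close>. Hence an element is central iff it commutes with these
  \<open>e\<^sub>C\<close> and the diagonal idempotents. Commuting with the idempotents means being supported on balanced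
  matrices, and commuting with the \<open>e\<^sub>C\<close> is, after rescaling by powers of \<open>\<upsilon>\<close>, the system of center
  equations. The reduced row echelon form then parametrizes the kernel by the free columns.\<close>

text \<open>An algebra given by generators and relations may collapse, so the independence of the
  T_w has to come from a representation and the spanning from normal words; both are read off
  functions on permutations. A permutation is replaced throughout by its inverse \<open>f\<close>,
  so that left multiplication by T_i becomes precomposition with a swap and the length condition a
  comparison of \<open>f i\<close> with \<open>f (Suc i)\<close>. To multiply e_C with e_A, the
  double coset sum of C is written as k x with k an explicit sum of words; e_C is then left
  multiplication by k, and evaluation at an \<open>f\<close> increasing on the row blocks makes
  every operator contribute a plain factor q. The weight (i - j)^2 is chosen for its convexity:
  using column p' in place of p changes the drop of Q by 2(p' - p), so an extremal column singles
  out one top term. In the center equations each term carries the power d_B - d_C - d_A of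
  \<upsilon>, where d_C is a single column sum of B; hence they compare the coefficients of [B] in
  [C][A] and in [A][C].\<close>

section \<open>Monoid rings\<close>

text \<open>The abbreviation \<open>transp\<close> also matches its own unfolding, so contracting it in output does not terminate.\<close>

declare [[show_abbrevs = false]]

abbreviation coeff_ring :: "'a::comm_ring_1 set \<Rightarrow> 'a ring" where
  "coeff_ring C \<equiv> \<lparr>carrier = C, mult = (*), one = 1, zero = 0, add = (+)\<rparr>"

text \<open>The additive extension of \<phi> along a coefficient map \<open>c\<close>. It serves for
  extracting coefficients, for the action of words on functions and, with \<open>c\<close> the
  embedding of the integers, for coordinates of tensors.\<close>

definition ev :: "('a::comm_ring_1 \<Rightarrow> 'k::comm_ring_1) \<Rightarrow> ('m \<Rightarrow> 'k) \<Rightarrow> ('m \<Rightarrow> 'a) \<Rightarrow> 'k" where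
  "ev c \<phi> f = (\<Sum>m | f m \<noteq> 0. c (f m) * \<phi> m)"

text \<open>Coefficients form a subring of a type, so that the Laurent polynomials inside K and the
  ring of all integers are both instances.\<close>

locale coeff_monoid = monoid M for M :: "('m, 'y) monoid_scheme" (structure) +
  fixes C :: "'a::comm_ring_1 set"
  assumes C0: "0 \<in> C" and C1: "1 \<in> C"
    and Cadd: "a \<in> C \<Longrightarrow> b \<in> C \<Longrightarrow> a + b \<in> C"
    and Cmult: "a \<in> C \<Longrightarrow> b \<in> C \<Longrightarrow> a * b \<in> C"
    and Cuminus: "a \<in> C \<Longrightarrow> - a \<in> C"
begin

abbreviation "CR \<equiv> coeff_ring C"
abbreviation "MR \<equiv> monoid_ring CR M"

lemma cring_CR: "cring CR"
proof (rule cringI)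
  show "abelian_group CR"
  proof (rule abelian_groupI)
    fix x assume "x \<in> carrier CR"
    then show "\<exists>y\<in>carrier CR. y \<oplus>\<^bsub>CR\<^esub> x = \<zero>\<^bsub>CR\<^esub>"
      using Cuminus by (intro bexI[of _ "- x"]) auto
  qed (auto simp: C0 Cadd)
  show "Group.comm_monoid CR"
    by (rule Group.comm_monoidI) (auto simp: C1 Cmult)
qed (auto simp: distrib_right)

lemma finsum_CR: "finite S \<Longrightarrow> (\<And>x. x \<in> S \<Longrightarrow> f x \<in> C) \<Longrightarrow> finsum CR f S = sum f S"
proof (induction S rule: finite_induct)
  interpret cring CR by (rule cring_CR)
  case empty then show ?case by simp
next
  interpret cring CR by (rule cring_CR)
  case (insert x S)
  have "finsum CR f (insert x S) = f x \<oplus>\<^bsub>CR\<^esub> finsum CR f S"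
    using insert by (intro finsum_insert) auto
  then show ?case using insert by auto
qed

lemma sum_in_C: "(\<And>x. x \<in> S \<Longrightarrow> f x \<in> C) \<Longrightarrow> sum f S \<in> C"
  by (induction S rule: infinite_finite_induct) (auto simp: C0 Cadd)

lemma MR_carrier: "f \<in> carrier MR \<longleftrightarrow>
  (\<forall>m. f m \<in> C) \<and> finite {m. f m \<noteq> 0} \<and> {m. f m \<noteq> 0} \<subseteq> carrier M"
  by (auto simp: monoid_ring_def mr_supp_def)

lemma MR_zero: "\<zero>\<^bsub>MR\<^esub> = (\<lambda>_. 0)" by (simp add: monoid_ring_def)
lemma MR_one: "\<one>\<^bsub>MR\<^esub> = (\<lambda>x. if x = \<one> then 1 else 0)" by (simp add: monoid_ring_def fun_eq_iff)
lemma MR_add: "f \<oplus>\<^bsub>MR\<^esub> g = (\<lambda>x. f x + g x)" by (simp add: monoid_ring_def)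

lemma MR_mult:
  assumes "f \<in> carrier MR" "g \<in> carrier MR"
    and "finite A" "{m. f m \<noteq> 0} \<subseteq> A" "finite B" "{m. g m \<noteq> 0} \<subseteq> B"
  shows "(f \<otimes>\<^bsub>MR\<^esub> g) x = (\<Sum>a\<in>A. \<Sum>b\<in>B. if a \<otimes> b = x then f a * g b else 0)"
proof -
  have "(f \<otimes>\<^bsub>MR\<^esub> g) x =
      finsum CR (\<lambda>p. f (fst p) * g (snd p)) {p \<in> {m. f m \<noteq> 0} \<times> {m. g m \<noteq> 0}. fst p \<otimes> snd p = x}"
    by (simp add: monoid_ring_def mr_supp_def)
  also have "\<dots> = (\<Sum>p\<in>{p \<in> {m. f m \<noteq> 0} \<times> {m. g m \<noteq> 0}. fst p \<otimes> snd p = x}. f (fst p) * g (snd p))"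
    using assms(1,2) by (intro finsum_CR) (auto simp: MR_carrier Cmult)
  also have "\<dots> = (\<Sum>p\<in>A \<times> B. if fst p \<otimes> snd p = x then f (fst p) * g (snd p) else 0)"
    using assms by (intro sum.mono_neutral_cong_left) auto
  also have "\<dots> = (\<Sum>a\<in>A. \<Sum>b\<in>B. if a \<otimes> b = x then f a * g b else 0)"
    by (simp add: sum.cartesian_product case_prod_unfold)
  finally show ?thesis .
qed

lemma ev_superset:
  assumes "c 0 = 0" "finite A" "{m. f m \<noteq> 0} \<subseteq> A"
  shows "ev c \<phi> f = (\<Sum>m\<in>A. c (f m) * \<phi> m)"
  unfolding ev_def using assms by (intro sum.mono_neutral_cong_left) auto

lemma MR_mult_supp:
  assumes "f \<in> carrier MR" "g \<in> carrier MR"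
  shows "{m. (f \<otimes>\<^bsub>MR\<^esub> g) m \<noteq> 0} \<subseteq> (\<lambda>(a, b). a \<otimes> b) ` ({m. f m \<noteq> 0} \<times> {m. g m \<noteq> 0})"
proof
  fix x assume x: "x \<in> {m. (f \<otimes>\<^bsub>MR\<^esub> g) m \<noteq> 0}"
  show "x \<in> (\<lambda>(a, b). a \<otimes> b) ` ({m. f m \<noteq> 0} \<times> {m. g m \<noteq> 0})"
  proof (rule ccontr)
    assume "\<not> ?thesis"
    then have n: "a \<otimes> b \<noteq> x" if "f a \<noteq> 0" "g b \<noteq> 0" for a b using that by force
    have "(f \<otimes>\<^bsub>MR\<^esub> g) x = (\<Sum>a | f a \<noteq> 0. \<Sum>b | g b \<noteq> 0. if a \<otimes> b = x then f a * g b else 0)"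
      using assms by (intro MR_mult) (auto simp: MR_carrier)
    also have "\<dots> = 0" using n by (intro sum.neutral ballI) auto
    finally show False using x by simp
  qed
qed

lemma MR_mult_closed:
  assumes "f \<in> carrier MR" "g \<in> carrier MR"
  shows "f \<otimes>\<^bsub>MR\<^esub> g \<in> carrier MR"
  unfolding MR_carrier
proof (intro conjI allI)
  have fin: "finite ({m. f m \<noteq> 0} \<times> {m. g m \<noteq> 0})" using assms by (auto simp: MR_carrier)
  show "finite {m. (f \<otimes>\<^bsub>MR\<^esub> g) m \<noteq> 0}"
    using MR_mult_supp[OF assms] fin finite_surj by blast
  show "{m. (f \<otimes>\<^bsub>MR\<^esub> g) m \<noteq> 0} \<subseteq> carrier M"
    by (rule subset_trans[OF MR_mult_supp[OF assms]]) (use assms in \<open>auto simp: MR_carrier subset_iff\<close>)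
  fix x
  have "(f \<otimes>\<^bsub>MR\<^esub> g) x = (\<Sum>a | f a \<noteq> 0. \<Sum>b | g b \<noteq> 0. if a \<otimes> b = x then f a * g b else 0)"
    using assms by (intro MR_mult) (auto simp: MR_carrier)
  also have "\<dots> \<in> C" using assms by (intro sum_in_C) (auto simp: MR_carrier Cmult C0)
  finally show "(f \<otimes>\<^bsub>MR\<^esub> g) x \<in> C" .
qed

lemma ev_add:
  assumes "f \<in> carrier MR" "g \<in> carrier MR" "c 0 = 0" "\<And>a b. c (a + b) = c a + c b"
  shows "ev c \<phi> (f \<oplus>\<^bsub>MR\<^esub> g) = ev c \<phi> f + ev c \<phi> g"
proof -
  let ?A = "{m. f m \<noteq> 0} \<union> {m. g m \<noteq> 0}"
  have fin: "finite ?A" using assms by (auto simp: MR_carrier)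
  have "ev c \<phi> (f \<oplus>\<^bsub>MR\<^esub> g) = (\<Sum>m\<in>?A. c ((f \<oplus>\<^bsub>MR\<^esub> g) m) * \<phi> m)"
    using assms fin by (intro ev_superset) (auto simp: MR_add)
  moreover have "ev c \<phi> f = (\<Sum>m\<in>?A. c (f m) * \<phi> m)" "ev c \<phi> g = (\<Sum>m\<in>?A. c (g m) * \<phi> m)"
    using assms fin by (intro ev_superset; auto)+
  ultimately show ?thesis by (simp add: MR_add assms(4) distrib_right sum.distrib)
qed

text \<open>\<phi> is an arbitrary function, not a homomorphism: evaluating a convolution is
  evaluating twice, with the monoid product inside. Ring laws and action laws both result from
  choosing \<phi>.\<close>

lemma ev_mult:
  assumes "f \<in> carrier MR" "g \<in> carrier MR" "c 0 = 0"
    "\<And>a b. c (a + b) = c a + c b" "\<And>a b. c (a * b) = c a * c b"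
  shows "ev c \<phi> (f \<otimes>\<^bsub>MR\<^esub> g) = ev c (\<lambda>a. ev c (\<lambda>b. \<phi> (a \<otimes> b)) g) f"
proof -
  let ?A = "{m. f m \<noteq> 0}" and ?B = "{m. g m \<noteq> 0}"
  let ?P = "(\<lambda>(a, b). a \<otimes> b) ` (?A \<times> ?B)"
  have fin: "finite ?A" "finite ?B" using assms by (auto simp: MR_carrier)
  then have finP: "finite ?P" by auto
  have csum: "c (sum h S) = (\<Sum>x\<in>S. c (h x))" for h :: "'m \<Rightarrow> 'a" and S
    by (induction S rule: infinite_finite_induct) (auto simp: assms)
  have "ev c \<phi> (f \<otimes>\<^bsub>MR\<^esub> g) = (\<Sum>m\<in>?P. c ((f \<otimes>\<^bsub>MR\<^esub> g) m) * \<phi> m)"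
    using MR_mult_supp[OF assms(1,2)] assms finP by (intro ev_superset) auto
  also have "\<dots> = (\<Sum>m\<in>?P. (\<Sum>a\<in>?A. \<Sum>b\<in>?B. if a \<otimes> b = m then c (f a) * c (g b) * \<phi> m else 0))"
  proof (rule sum.cong[OF refl])
    fix m
    have "(f \<otimes>\<^bsub>MR\<^esub> g) m = (\<Sum>a\<in>?A. \<Sum>b\<in>?B. if a \<otimes> b = m then f a * g b else 0)"
      using assms by (intro MR_mult fin) auto
    then have "c ((f \<otimes>\<^bsub>MR\<^esub> g) m) * \<phi> m = (\<Sum>a\<in>?A. \<Sum>b\<in>?B. c (if a \<otimes> b = m then f a * g b else 0) * \<phi> m)"
      by (simp add: csum sum_distrib_right)
    also have "\<dots> = (\<Sum>a\<in>?A. \<Sum>b\<in>?B. if a \<otimes> b = m then c (f a) * c (g b) * \<phi> m else 0)"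
      by (intro sum.cong refl) (simp add: assms)
    finally show "c ((f \<otimes>\<^bsub>MR\<^esub> g) m) * \<phi> m = \<dots>" .
  qed
  also have "\<dots> = (\<Sum>a\<in>?A. \<Sum>m\<in>?P. \<Sum>b\<in>?B. if a \<otimes> b = m then c (f a) * c (g b) * \<phi> m else 0)"
    by (rule sum.swap)
  also have "\<dots> = (\<Sum>a\<in>?A. \<Sum>b\<in>?B. \<Sum>m\<in>?P. if a \<otimes> b = m then c (f a) * c (g b) * \<phi> m else 0)"
    by (rule sum.cong[OF refl], rule sum.swap)
  also have "\<dots> = (\<Sum>a\<in>?A. \<Sum>b\<in>?B. c (f a) * c (g b) * \<phi> (a \<otimes> b))"
  proof (intro sum.cong refl)
    fix a b assume "a \<in> ?A" "b \<in> ?B"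
    then have "a \<otimes> b \<in> ?P" by auto
    then show "(\<Sum>m\<in>?P. if a \<otimes> b = m then c (f a) * c (g b) * \<phi> m else 0) = c (f a) * c (g b) * \<phi> (a \<otimes> b)"
      using finP by (simp add: sum.delta')
  qed
  also have "\<dots> = ev c (\<lambda>a. ev c (\<lambda>b. \<phi> (a \<otimes> b)) g) f"
    by (simp add: ev_def sum_distrib_left mult.assoc)
  finally show ?thesis .
qed

lemma ev_cong: "(\<And>m. f m \<noteq> 0 \<Longrightarrow> \<phi> m = \<psi> m) \<Longrightarrow> ev c \<phi> f = ev c \<psi> f"
  by (auto simp: ev_def intro: sum.cong)

lemma ev_delta: "f \<in> carrier MR \<Longrightarrow> ev id (\<lambda>m. if m = x then 1 else 0) f = f x"
  by (auto simp: ev_def MR_carrier if_distrib[of "\<lambda>z. _ * z"] sum.delta' cong: if_cong)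

lemma MR_mult_apply:
  assumes "f \<in> carrier MR" "g \<in> carrier MR"
  shows "(f \<otimes>\<^bsub>MR\<^esub> g) x = ev id (\<lambda>a. ev id (\<lambda>b. if a \<otimes> b = x then 1 else 0) g) f"
  using ev_delta[OF MR_mult_closed[OF assms], of x] ev_mult[OF assms, of id] by simp

lemma ev_fun_add: "f \<in> carrier MR \<Longrightarrow> ev c (\<lambda>m. \<phi> m + \<psi> m) f = ev c \<phi> f + ev c \<psi> f"
  by (auto simp: ev_def distrib_left sum.distrib)

lemma MR_one_closed: "\<one>\<^bsub>MR\<^esub> \<in> carrier MR"
  by (auto simp: MR_carrier MR_one C0 C1)

lemma ev_single:
  assumes "c 0 = 0"
  shows "ev c \<phi> (mr_single CR a m) = c a * \<phi> m"
  using assms by (cases "a = 0") (auto simp: ev_def mr_single_def)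

lemma MR_add_closed:
  assumes "f \<in> carrier MR" "g \<in> carrier MR" shows "f \<oplus>\<^bsub>MR\<^esub> g \<in> carrier MR"
proof -
  have "{m. f m + g m \<noteq> 0} \<subseteq> {m. f m \<noteq> 0} \<union> {m. g m \<noteq> 0}" by auto
  then show ?thesis using assms unfolding MR_carrier MR_add
    by (auto simp: Cadd intro: finite_subset)
qed

lemma ring_MR: "ring MR"
proof (rule ringI)
  show "abelian_group MR"
  proof (rule abelian_groupI)
    fix f assume "f \<in> carrier MR"
    then show "\<exists>g\<in>carrier MR. g \<oplus>\<^bsub>MR\<^esub> f = \<zero>\<^bsub>MR\<^esub>"
      by (intro bexI[of _ "\<lambda>x. - f x"]) (auto simp: MR_carrier MR_add MR_zero Cuminus)
  qed (simp_all only: MR_add_closed, auto simp: MR_add MR_zero add_ac, auto simp: MR_carrier C0)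
  show "monoid MR"
  proof (rule monoidI)
    fix f g h assume fgh: "f \<in> carrier MR" "g \<in> carrier MR" "h \<in> carrier MR"
    show "f \<otimes>\<^bsub>MR\<^esub> g \<otimes>\<^bsub>MR\<^esub> h = f \<otimes>\<^bsub>MR\<^esub> (g \<otimes>\<^bsub>MR\<^esub> h)"
    proof
      fix x :: 'm
      \<comment> \<open>The indicator of \<open>x\<close> turns the coefficient at \<open>x\<close>
        into an evaluation, so that associativity of convolution becomes associativity in the monoid
        under three nested evaluations.\<close>
      let ?\<phi> = "\<lambda>m. if m = x then 1 else (0 :: 'a)"
      have "(f \<otimes>\<^bsub>MR\<^esub> g \<otimes>\<^bsub>MR\<^esub> h) x = ev id ?\<phi> (f \<otimes>\<^bsub>MR\<^esub> g \<otimes>\<^bsub>MR\<^esub> h)"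
        using fgh by (simp add: ev_delta MR_mult_closed)
      also have "\<dots> = ev id (\<lambda>a. ev id (\<lambda>b. ev id (\<lambda>c. ?\<phi> (a \<otimes> b \<otimes> c)) h) g) f"
        using fgh by (simp add: ev_mult MR_mult_closed)
      also have "\<dots> = ev id (\<lambda>a. ev id (\<lambda>b. ev id (\<lambda>c. ?\<phi> (a \<otimes> (b \<otimes> c))) h) g) f"
        using fgh by (intro ev_cong) (auto simp: MR_carrier subset_iff m_assoc intro!: ev_cong)
      also have "\<dots> = ev id ?\<phi> (f \<otimes>\<^bsub>MR\<^esub> (g \<otimes>\<^bsub>MR\<^esub> h))"
        using fgh by (simp add: ev_mult MR_mult_closed)
      also have "\<dots> = (f \<otimes>\<^bsub>MR\<^esub> (g \<otimes>\<^bsub>MR\<^esub> h)) x"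
        using fgh by (simp add: ev_delta MR_mult_closed)
      finally show "(f \<otimes>\<^bsub>MR\<^esub> g \<otimes>\<^bsub>MR\<^esub> h) x = (f \<otimes>\<^bsub>MR\<^esub> (g \<otimes>\<^bsub>MR\<^esub> h)) x" .
    qed
  next
    have one: "\<one>\<^bsub>MR\<^esub> = mr_single CR 1 \<one>" by (simp add: MR_one mr_single_def fun_eq_iff)
    fix f assume f: "f \<in> carrier MR"
    show "\<one>\<^bsub>MR\<^esub> \<otimes>\<^bsub>MR\<^esub> f = f"
    proof
      fix x
      have "(\<one>\<^bsub>MR\<^esub> \<otimes>\<^bsub>MR\<^esub> f) x = ev id (\<lambda>b. if \<one> \<otimes> b = x then 1 else 0) f"
        using f by (simp add: MR_mult_apply MR_one_closed, simp add: one ev_single)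
      also have "\<dots> = ev id (\<lambda>b. if b = x then 1 else 0) f"
        using f by (intro ev_cong) (auto simp: MR_carrier)
      finally show "(\<one>\<^bsub>MR\<^esub> \<otimes>\<^bsub>MR\<^esub> f) x = f x" using f by (simp add: ev_delta)
    qed
    show "f \<otimes>\<^bsub>MR\<^esub> \<one>\<^bsub>MR\<^esub> = f"
    proof
      fix x
      have "(f \<otimes>\<^bsub>MR\<^esub> \<one>\<^bsub>MR\<^esub>) x = ev id (\<lambda>b. if b \<otimes> \<one> = x then 1 else 0) f"
        using f by (simp add: MR_mult_apply MR_one_closed, simp add: one ev_single)
      also have "\<dots> = ev id (\<lambda>b. if b = x then 1 else 0) f"
        using f by (intro ev_cong) (auto simp: MR_carrier)
      finally show "(f \<otimes>\<^bsub>MR\<^esub> \<one>\<^bsub>MR\<^esub>) x = f x" using f by (simp add: ev_delta)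
    qed
  qed (auto simp: MR_mult_closed MR_one_closed)
next
  fix f g h assume fgh: "f \<in> carrier MR" "g \<in> carrier MR" "h \<in> carrier MR"
  show "(f \<oplus>\<^bsub>MR\<^esub> g) \<otimes>\<^bsub>MR\<^esub> h = f \<otimes>\<^bsub>MR\<^esub> h \<oplus>\<^bsub>MR\<^esub> g \<otimes>\<^bsub>MR\<^esub> h"
    using fgh by (intro ext) (simp add: MR_mult_apply MR_add_closed ev_add, simp add: MR_add MR_mult_apply)
  show "h \<otimes>\<^bsub>MR\<^esub> (f \<oplus>\<^bsub>MR\<^esub> g) = h \<otimes>\<^bsub>MR\<^esub> f \<oplus>\<^bsub>MR\<^esub> h \<otimes>\<^bsub>MR\<^esub> g"
    using fgh by (intro ext) (simp add: MR_mult_apply MR_add_closed ev_add, simp add: MR_add MR_mult_apply ev_fun_add)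
qed

lemma single_closed: "a \<in> C \<Longrightarrow> m \<in> carrier M \<Longrightarrow> mr_single CR a m \<in> carrier MR"
  by (auto simp: MR_carrier mr_single_def C0)

lemma single_mult:
  assumes "a \<in> C" "b \<in> C" "m \<in> carrier M" "k \<in> carrier M"
  shows "mr_single CR a m \<otimes>\<^bsub>MR\<^esub> mr_single CR b k = mr_single CR (a * b) (m \<otimes> k)"
  using assms
  by (intro ext) (auto simp: MR_mult_apply single_closed ev_single, auto simp: mr_single_def)

lemma single_add:
  "mr_single CR a m \<oplus>\<^bsub>MR\<^esub> mr_single CR b m = mr_single CR (a + b) m"
  by (auto simp: MR_add mr_single_def)

lemma MR_minus:
  assumes "f \<in> carrier MR" "g \<in> carrier MR"
  shows "f \<ominus>\<^bsub>MR\<^esub> g = (\<lambda>x. f x - g x)"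
proof -
  interpret ring MR by (rule ring_MR)
  have g': "(\<lambda>x. - g x) \<in> carrier MR" using assms by (auto simp: MR_carrier Cuminus)
  have "\<ominus>\<^bsub>MR\<^esub> g = (\<lambda>x. - g x)"
    by (rule minus_equality[OF _ assms(2) g']) (auto simp: MR_add MR_zero)
  then show ?thesis by (simp add: a_minus_def MR_add)
qed

lemma ev_minus:
  assumes "f \<in> carrier MR" "g \<in> carrier MR" "c 0 = 0" "\<And>a b. c (a + b) = c a + c b"
  shows "ev c \<phi> (f \<ominus>\<^bsub>MR\<^esub> g) = ev c \<phi> f - ev c \<phi> g"
proof -
  interpret ring MR by (rule ring_MR)
  have "ev c \<phi> ((f \<ominus>\<^bsub>MR\<^esub> g) \<oplus>\<^bsub>MR\<^esub> g) = ev c \<phi> (f \<ominus>\<^bsub>MR\<^esub> g) + ev c \<phi> g"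
    using assms by (intro ev_add) auto
  moreover have "(f \<ominus>\<^bsub>MR\<^esub> g) \<oplus>\<^bsub>MR\<^esub> g = f" using assms by (auto simp: MR_minus MR_add)
  ultimately show ?thesis by simp
qed

lemma MR_induct [consumes 1, case_names zero add single]:
  assumes "f \<in> carrier MR"
    and "P (\<zero>\<^bsub>MR\<^esub>)"
    and "\<And>f g. f \<in> carrier MR \<Longrightarrow> g \<in> carrier MR \<Longrightarrow> P f \<Longrightarrow> P g \<Longrightarrow> P (f \<oplus>\<^bsub>MR\<^esub> g)"
    and "\<And>a m. a \<in> C \<Longrightarrow> m \<in> carrier M \<Longrightarrow> P (mr_single CR a m)"
  shows "P f"
proof -
  have "finite S \<Longrightarrow> {m. f m \<noteq> 0} \<subseteq> S \<Longrightarrow> f \<in> carrier MR \<Longrightarrow> P f" for S f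
  proof (induction S arbitrary: f rule: finite_induct)
    case empty
    then have "f = \<zero>\<^bsub>MR\<^esub>" by (auto simp: MR_zero)
    then show ?case using assms by simp
  next
    case (insert x S)
    let ?g = "\<lambda>m. if m = x then 0 else f m"
    have sub: "{m. ?g m \<noteq> 0} \<subseteq> {m. f m \<noteq> 0}" by auto
    have g: "?g \<in> carrier MR" using insert.prems finite_subset[OF sub] sub
      by (auto simp: MR_carrier C0)
    have "P ?g" using insert.prems g by (intro insert.IH) auto
    show ?case
    proof (cases "f x = 0")
      case True
      then have "?g = f" by auto
      then show ?thesis using \<open>P ?g\<close> by simp
    next
      case False
      have "f = mr_single CR (f x) x \<oplus>\<^bsub>MR\<^esub> ?g" by (auto simp: MR_add mr_single_def)
      moreover have x: "x \<in> carrier M" "f x \<in> C" using False insert.prems by (auto simp: MR_carrier)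
      have "P (mr_single CR (f x) x \<oplus>\<^bsub>MR\<^esub> ?g)"
        by (rule assms(3)[OF single_closed[OF x(2,1)] g assms(4)[OF x(2,1)] \<open>P ?g\<close>])
      ultimately show ?thesis by simp
    qed
  qed
  then show ?thesis using assms(1) by (auto simp: MR_carrier)
qed

end

section \<open>Laurent polynomials and the bar involution\<close>

lemma ups_to_fract: "\<upsilon> = to_fract [:0, 1:]"
  by (simp add: ups_def to_fract_def)

lemma to_fract_of_int: "to_fract (of_int a) = of_int a"
  by (induction a rule: int_induct[of _ 0]) simp_all

lemma to_fract_power: "to_fract (p ^ k) = to_fract p ^ k"
  by (induction k) auto

lemma to_fract_monom: "to_fract (monom (of_int a) k) = of_int a * \<upsilon> ^ k"
proof -
  have "monom (of_int a :: rat) k = of_int a * [:0, 1:] ^ k"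
    by (simp add: monom_altdef of_int_poly)
  then show ?thesis by (simp only: to_fract_mult to_fract_power to_fract_of_int ups_to_fract)
qed

lemma ups_nonzero: "\<upsilon> \<noteq> 0"
  by (simp add: ups_to_fract)

text \<open>Lists of pairs (coefficient, exponent), repetitions allowed, present Laurent
  polynomials: concatenation presents sums and negating exponents presents conjugation. The price is
  the well-definedness proved in \<open>lval_zero_lbar_zero\<close>.\<close>

definition lval :: "(int \<times> int) list \<Rightarrow> ratfun" where
  "lval xs = (\<Sum>(a, e)\<leftarrow>xs. of_int a * \<upsilon> powi e)"

definition lbar :: "(int \<times> int) list \<Rightarrow> ratfun" where
  "lbar xs = lval (map (\<lambda>(a, e). (a, - e)) xs)"

definition lprod :: "(int \<times> int) list \<Rightarrow> (int \<times> int) list \<Rightarrow> (int \<times> int) list" where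
  "lprod xs ys = concat (map (\<lambda>(a, e). map (\<lambda>(b, f). (a * b, e + f)) ys) xs)"

lemma lval_simps [simp]:
  "lval [] = 0" "lval (x # xs) = of_int (fst x) * \<upsilon> powi (snd x) + lval xs"
  "lval (xs @ ys) = lval xs + lval ys"
  by (simp_all add: lval_def case_prod_unfold)

lemma lbar_simps [simp]:
  "lbar [] = 0" "lbar (x # xs) = of_int (fst x) * \<upsilon> powi (- snd x) + lbar xs"
  "lbar (xs @ ys) = lbar xs + lbar ys"
  by (simp_all add: lbar_def case_prod_unfold)

lemma lval_map_mult: "lval (map (\<lambda>(b, f). (a * b, e + f)) ys) = of_int a * \<upsilon> powi e * lval ys"
  by (induction ys) (auto simp: algebra_simps power_int_add power_int_diff power_int_minus ups_nonzero divide_simps)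

lemma lval_lprod: "lval (lprod xs ys) = lval xs * lval ys"
  by (induction xs) (auto simp: lprod_def lval_map_mult algebra_simps)

lemma lbar_map_mult: "lbar (map (\<lambda>(b, f). (a * b, e + f)) ys) = of_int a * \<upsilon> powi (- e) * lbar ys"
  by (induction ys) (auto simp: algebra_simps power_int_add power_int_diff power_int_minus ups_nonzero divide_simps)

lemma lbar_lprod: "lbar (lprod xs ys) = lbar xs * lbar ys"
  by (induction xs) (auto simp: lprod_def lbar_map_mult algebra_simps)

lemma lval_uminus: "lval (map (\<lambda>(a, e). (- a, e)) xs) = - lval xs"
  by (induction xs) auto

lemma lbar_uminus: "lbar (map (\<lambda>(a, e). (- a, e)) xs) = - lbar xs"
  by (induction xs) auto

lemma laurent_lval: "laurent = range lval"
proof (intro equalityI subsetI)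
  fix x assume "x \<in> laurent"
  then obtain I c where x: "x = (\<Sum>k\<in>I. of_int (c k) * \<upsilon> powi k)" "finite I"
    by (auto simp: laurent_def)
  obtain ks where ks: "set ks = I" "distinct ks" using finite_distinct_list[OF x(2)] by auto
  then have "x = lval (map (\<lambda>k. (c k, k)) ks)"
    by (simp add: x lval_def sum_list_distinct_conv_sum_set o_def)
  then show "x \<in> range lval" by simp
next
  fix x assume "x \<in> range lval"
  then obtain xs where "x = lval xs" by auto
  moreover have "lval xs \<in> laurent" for xs
  proof (induction xs)
    case Nil
    then show ?case unfolding laurent_def by (auto intro!: exI[of _ "{}"])
  next
    case (Cons p xs)
    obtain a e where p: "p = (a, e)" by (cases p)
    from Cons obtain I c where x: "lval xs = (\<Sum>k\<in>I. of_int (c k) * \<upsilon> powi k)" "finite I"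
      by (auto simp: laurent_def)
    define d where "d k = (if k \<in> I then c k else 0) + (if k = e then a else 0)" for k
    have "(\<Sum>k\<in>insert e I. of_int (d k) * \<upsilon> powi k)
        = (\<Sum>k\<in>insert e I. (if k \<in> I then of_int (c k) * \<upsilon> powi k else 0))
          + (\<Sum>k\<in>insert e I. (if k = e then of_int a * \<upsilon> powi k else 0))"
      unfolding sum.distrib[symmetric] d_def by (intro sum.cong) (auto simp: algebra_simps)
    also have "(\<Sum>k\<in>insert e I. (if k \<in> I then of_int (c k) * \<upsilon> powi k else 0)) = lval xs"
      unfolding x using \<open>finite I\<close> by (intro sum.mono_neutral_cong_right) auto
    also have "(\<Sum>k\<in>insert e I. (if k = e then of_int a * \<upsilon> powi k else 0)) = of_int a * \<upsilon> powi e"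
      using \<open>finite I\<close> by (simp add: sum.delta)
    finally have "lval (p # xs) = (\<Sum>k\<in>insert e I. of_int (d k) * \<upsilon> powi k)" by (simp add: p)
    then show ?case unfolding laurent_def using \<open>finite I\<close>
      by (auto intro!: exI[of _ "insert e I"] exI[of _ d])
  qed
  ultimately show "x \<in> laurent" by simp
qed

text \<open>After multiplication by a large power of \<upsilon> both sums are honest polynomials,
  and negating the exponents reverses the sequence of coefficients.\<close>

lemma lval_zero_lbar_zero:
  assumes "lval xs = 0" shows "lbar xs = 0"
proof -
  \<comment> \<open>\<open>N\<close> bounds the absolute values of all exponents, so
    \<open>\<upsilon> powi N\<close> clears the negative powers of the list and of its conjugate
    alike; the inserted 0 covers the empty list.\<close>
  define N where "N = Max (insert 0 ((\<lambda>x. \<bar>snd x\<bar>) ` set xs))"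
  have N: "\<bar>snd x\<bar> \<le> N" if "x \<in> set xs" for x unfolding N_def using that by (intro Max_ge) auto
  have pow: "\<upsilon> powi N * (of_int a * \<upsilon> powi e) = to_fract (monom (of_int a) (nat (N + e)))"
    if "\<bar>e\<bar> \<le> N" for a e
  proof -
    have "\<upsilon> powi N * \<upsilon> powi e = \<upsilon> powi (N + e)" by (simp add: power_int_add ups_nonzero)
    also have "\<dots> = \<upsilon> ^ nat (N + e)" using that by (simp add: power_int_def)
    finally show ?thesis by (simp add: to_fract_monom ac_simps)
  qed
  let ?P = "\<lambda>xs. \<Sum>(a, e)\<leftarrow>xs. monom (of_int a :: rat) (nat (N + e))"
  have P: "\<upsilon> powi N * lval ys = to_fract (?P ys)" if "\<forall>x\<in>set ys. \<bar>snd x\<bar> \<le> N" for ys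
    using that by (induction ys) (auto simp: distrib_left pow to_fract_add)
  have "to_fract (?P xs) = 0" using P[of xs] N assms by auto
  then have P0: "?P xs = 0" by simp
  \<comment> \<open>Up to degree 2N the coefficients are reflected about N. Beyond it
    \<open>nat\<close> would fold the index to 0, so \<open>cf2\<close> shows separately that those
    coefficients vanish.\<close>
  have cf: "coeff (?P (map (\<lambda>(a, e). (a, - e)) ys)) k = coeff (?P ys) (nat (2 * N - int k))"
    if "\<forall>x\<in>set ys. \<bar>snd x\<bar> \<le> N" "int k \<le> 2 * N" for ys k
    using that by (induction ys) (auto simp: nat_eq_iff)
  have cf2: "coeff (?P (map (\<lambda>(a, e). (a, - e)) ys)) k = 0"
    if "\<forall>x\<in>set ys. \<bar>snd x\<bar> \<le> N" "int k > 2 * N" for ys k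
    using that by (induction ys) auto
  have "?P (map (\<lambda>(a, e). (a, - e)) xs) = 0"
  proof (rule poly_eqI)
    fix k show "coeff (?P (map (\<lambda>(a, e). (a, - e)) xs)) k = coeff 0 k"
      using cf[of xs k] cf2[of xs k] P0 N by (cases "int k \<le> 2 * N") auto
  qed
  then have "\<upsilon> powi N * lbar xs = 0"
    using P[of "map (\<lambda>(a, e). (a, - e)) xs"] N unfolding lbar_def by force
  then show ?thesis by (simp add: ups_nonzero)
qed

lemma lval_eq_lbar_eq:
  assumes "lval xs = lval ys" shows "lbar xs = lbar ys"
  using lval_zero_lbar_zero[of "xs @ map (\<lambda>(a, e). (- a, e)) ys"] assms
  by (simp add: lval_uminus lbar_uminus)

lemma laurent_0: "0 \<in> laurent" and laurent_1: "1 \<in> laurent"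
  and laurent_add: "a \<in> laurent \<Longrightarrow> b \<in> laurent \<Longrightarrow> a + b \<in> laurent"
  and laurent_mult: "a \<in> laurent \<Longrightarrow> b \<in> laurent \<Longrightarrow> a * b \<in> laurent"
  and laurent_uminus: "a \<in> laurent \<Longrightarrow> - a \<in> laurent"
  and laurent_powi: "\<upsilon> powi k \<in> laurent"
proof -
  show "0 \<in> laurent" unfolding laurent_lval by (rule range_eqI[of _ _ "[]"]) simp
  show "1 \<in> laurent" unfolding laurent_lval by (rule range_eqI[of _ _ "[(1, 0)]"]) simp
  show "\<upsilon> powi k \<in> laurent" unfolding laurent_lval by (rule range_eqI[of _ _ "[(1, k)]"]) simp
  show "a + b \<in> laurent" if "a \<in> laurent" "b \<in> laurent"
  proof -
    from that obtain xs ys where "a = lval xs" "b = lval ys" by (auto simp: laurent_lval)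
    then show ?thesis unfolding laurent_lval by (intro range_eqI[of _ _ "xs @ ys"]) simp
  qed
  show "a * b \<in> laurent" if "a \<in> laurent" "b \<in> laurent"
  proof -
    from that obtain xs ys where "a = lval xs" "b = lval ys" by (auto simp: laurent_lval)
    then show ?thesis unfolding laurent_lval by (intro range_eqI[of _ _ "lprod xs ys"]) (simp add: lval_lprod)
  qed
  show "- a \<in> laurent" if "a \<in> laurent"
  proof -
    from that obtain xs where "a = lval xs" by (auto simp: laurent_lval)
    then show ?thesis unfolding laurent_lval
      by (intro range_eqI[of _ _ "map (\<lambda>(a, e). (- a, e)) xs"]) (simp add: lval_uminus)
  qed
qed

lemma AA_eq: "AA = coeff_ring laurent"
  by (simp add: AA_def)

lemma laurent_ups: "\<upsilon> \<in> laurent"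
  using laurent_powi[of 1] by simp

lemma laurent_qq: "qq \<in> laurent"
  using laurent_powi[of 2] by simp

lemma coeff_monoid_laurent: "monoid M \<Longrightarrow> coeff_monoid M laurent"
  unfolding coeff_monoid_def coeff_monoid_axioms_def
  using laurent_0 laurent_1 laurent_add laurent_mult laurent_uminus by simp

lemma cring_AA: "cring AA"
proof -
  have "monoid (word_monoid 0)" by (rule monoidI) (auto simp: word_monoid_def)
  then show ?thesis unfolding AA_eq by (intro coeff_monoid.cring_CR[OF coeff_monoid_laurent])
qed

text \<open>The definite description in \<open>bar\<close> needs existence and uniqueness. Existence
  comes from the list presentation; a ring homomorphism is determined by its value at \<upsilon>,
  and extensionality fixes the values outside the Laurent polynomials.\<close>

lemma bar_lval: "bar (lval xs) = lbar xs"
proof -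
  \<comment> \<open>Any presentation of the argument may be chosen, by
    \<open>lval_eq_lbar_eq\<close>.\<close>
  define f where "f = (\<lambda>x\<in>laurent. lbar (SOME xs. x = lval xs))"
  have f: "f (lval xs) = lbar xs" for xs
  proof -
    have "lval xs = lval (SOME ys. lval xs = lval ys)" by (rule someI[of _ xs]) simp
    then have "lbar (SOME ys. lval xs = lval ys) = lbar xs" by (intro lval_eq_lbar_eq) (rule sym)
    then show ?thesis by (simp add: f_def laurent_lval)
  qed
  have lbb: "lbar (map (\<lambda>(a, e). (a, - e)) xs) = lval xs" for xs by (induction xs) auto
  have flb: "f (lbar xs) = lval xs" for xs by (subst lbar_def) (simp only: f lbb)
  have "f \<in> ring_iso AA AA"
  proof (rule ring_iso_memI)
    fix x assume "x \<in> carrier AA"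
    then obtain xs where x: "x = lval xs" by (auto simp: AA_def laurent_lval)
    show "f x \<in> carrier AA" by (simp add: x f lbar_def AA_def laurent_lval)
    fix y assume "y \<in> carrier AA"
    then obtain ys where y: "y = lval ys" by (auto simp: AA_def laurent_lval)
    show "f (x \<otimes>\<^bsub>AA\<^esub> y) = f x \<otimes>\<^bsub>AA\<^esub> f y"
      by (simp add: AA_def x y f lbar_lprod flip: lval_lprod)
    show "f (x \<oplus>\<^bsub>AA\<^esub> y) = f x \<oplus>\<^bsub>AA\<^esub> f y"
      using f[of "xs @ ys"] by (simp add: AA_def x y f)
  next
    show "f \<one>\<^bsub>AA\<^esub> = \<one>\<^bsub>AA\<^esub>" using f[of "[(1, 0)]"] by (simp add: AA_def)
    show "bij_betw f (carrier AA) (carrier AA)"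
      by (rule bij_betw_byWitness[where f' = f]) (auto simp: AA_def laurent_lval f flb, auto simp: lbar_def)
  qed
  moreover have "f \<in> extensional laurent" by (simp add: f_def)
  moreover have "f \<upsilon> = \<upsilon> powi (- 1)" using f[of "[(1, 1)]"] by simp
  moreover have "g = f" if g: "g \<in> ring_iso AA AA" "g \<in> extensional laurent" "g \<upsilon> = \<upsilon> powi (- 1)" for g
  proof (rule extensionalityI[OF g(2) \<open>f \<in> extensional laurent\<close>])
    interpret cring AA by (rule cring_AA)
    interpret g: ring_hom_cring AA AA g
      by (rule ring_hom_cringI[OF ring_hom_ringI2 cring_AA cring_AA])
        (use g(1) ring_axioms in \<open>auto simp: ring_iso_def\<close>)
    have gadd: "g (a + b) = g a + g b" if "a \<in> laurent" "b \<in> laurent" for a b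
      using g.hom_add[of a b] that by (simp add: AA_def)
    have gmult: "g (a * b) = g a * g b" if "a \<in> laurent" "b \<in> laurent" for a b
      using g.hom_mult[of a b] that by (simp add: AA_def)
    have g1: "g 1 = 1" using g.hom_one by (simp add: AA_def)
    have g0: "g 0 = 0" using g.hom_zero by (simp add: AA_def)
    have of_int_l: "of_int k \<in> laurent" for k
      unfolding laurent_lval by (rule range_eqI[of _ _ "[(k, 0)]"]) simp
    have gint: "g (of_int k) = of_int k" for k
    proof (induction k rule: int_induct[of _ 0])
      case (step1 i) then show ?case by (simp add: gadd of_int_l laurent_1 g1)
    next
      case (step2 i)
      have "g (of_int (i - 1) + 1) = g (of_int (i - 1)) + 1"
        by (simp only: gadd of_int_l laurent_1 g1)
      then show ?case using step2 by simp
    qed (simp add: g0)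
    have gpow: "g (\<upsilon> ^ n) = inverse (\<upsilon> ^ n)" for n
    proof (induction n)
      case (Suc n)
      have "\<upsilon> ^ n \<in> laurent" using laurent_powi[of "int n"] by simp
      then show ?case using Suc by (simp add: gmult laurent_ups g(3))
    qed (simp add: g1)
    have gpowi: "g (\<upsilon> powi e) = \<upsilon> powi (- e)" for e
    proof (cases "e \<ge> 0")
      case True then show ?thesis using gpow[of "nat e"] by (simp add: power_int_def power_inverse)
    next
      case False
      define n where "n = nat (- e)"
      have e: "e = - int n" using False by (simp add: n_def)
      have "g (\<upsilon> powi e) * g (\<upsilon> ^ n) = g (\<upsilon> powi e * \<upsilon> ^ n)"
        using laurent_powi[of e] laurent_powi[of "int n"] by (simp add: gmult)
      also have "\<upsilon> powi e * \<upsilon> ^ n = 1" by (simp add: e power_int_minus ups_nonzero)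
      finally have "g (\<upsilon> powi e) * inverse (\<upsilon> ^ n) = 1" by (simp add: gpow g1)
      then show ?thesis by (simp add: e ups_nonzero field_simps)
    qed
    fix x assume "x \<in> laurent"
    then obtain xs where x: "x = lval xs" by (auto simp: laurent_lval)
    have "g (lval ys) = lbar ys" for ys
    proof (induction ys)
      case (Cons p ys)
      have lp: "of_int (fst p) * \<upsilon> powi snd p \<in> laurent" "lval ys \<in> laurent"
        by (intro laurent_mult of_int_l laurent_powi) (simp add: laurent_lval)
      then have "g (lval (p # ys)) = g (of_int (fst p)) * g (\<upsilon> powi snd p) + g (lval ys)"
        unfolding lval_simps(2) gadd[OF lp] gmult[OF of_int_l laurent_powi] by simp
      then show ?case unfolding Cons gint gpowi lbar_simps(2) .
    qed (simp add: g0)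
    then show "g x = f x" by (simp add: x f)
  qed
  ultimately have "bar = f" unfolding bar_def by (intro the_equality) blast+
  then show ?thesis using f by simp
qed

section \<open>Quantum integers\<close>

definition qint :: "nat \<Rightarrow> ratfun" where
  "qint m = (\<Sum>i<m. qq ^ i)"

text \<open>A degree comparison. It makes the quantum integers nonzero, so that they can be
  cancelled as leading coefficients later.\<close>

lemma ups_ne_root:
  assumes "0 < k" shows "\<upsilon> ^ k \<noteq> 1"
proof
  assume "\<upsilon> ^ k = 1"
  then have "to_fract (monom (of_int 1 :: rat) k) = to_fract 1" unfolding to_fract_monom by simp
  then have "monom (of_int 1) k = (1 :: rat poly)" by (rule to_fract_eq_iff[THEN iffD1])
  then have "degree (monom (of_int 1) k :: rat poly) = degree (1 :: rat poly)" by simp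
  then show False using assms by (simp add: degree_monom_eq)
qed

lemma dbrack_qint: "dbrack (int m) = qint m"
proof -
  have "\<upsilon> powi (2 * int m) = \<upsilon> ^ (2 * m)"
    using power_int_of_nat[of \<upsilon> "2 * m"] by (simp only: of_nat_mult of_nat_numeral)
  then have "dbrack (int m) = (qq ^ m - 1) / (qq - 1)"
    by (simp only: dbrack_def power_mult)
  also have "\<dots> = qint m"
    unfolding qint_def by (rule geometric_sum[symmetric], rule ups_ne_root) simp
  finally show ?thesis .
qed

lemma qint_nonzero:
  assumes "0 < m" shows "qint m \<noteq> 0"
proof
  assume "qint m = 0"
  moreover have "(qq - 1) * qint m = qq ^ m - 1"
    unfolding qint_def by (rule power_diff_1_eq[symmetric])
  ultimately have "\<upsilon> ^ (2 * m) = 1" by (simp add: power_mult)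
  then show False using ups_ne_root[of "2 * m"] assms by simp
qed

text \<open>Conjugation reverses the geometric sum 1 + q + ... + q^m up to the factor
  q^(-m).\<close>

lemma bar_dbrack: "bar (dbrack (int m + 1)) = \<upsilon> powi (- 2 * int m) * qint (Suc m)"
proof -
  define xs where "xs = map (\<lambda>i. (1::int, 2 * int i)) [0..<Suc m]"
  have "dbrack (int m + 1) = qint (Suc m)" using dbrack_qint[of "Suc m"] by (simp add: add.commute)
  also have "\<dots> = lval xs"
    by (simp add: xs_def lval_def qint_def o_def interv_sum_list_conv_sum_set_nat power_int_def nat_mult_distrib
        power_mult lessThan_atLeast0 del: upt_Suc)
  finally have "bar (dbrack (int m + 1)) = lbar xs" by (simp add: bar_lval)
  also have "\<dots> = (\<Sum>i<Suc m. \<upsilon> powi (- 2 * int i))"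
    by (simp add: xs_def lbar_def lval_def o_def interv_sum_list_conv_sum_set_nat lessThan_atLeast0 del: upt_Suc)
  also have "\<dots> = (\<Sum>i<Suc m. \<upsilon> powi (- 2 * int (m - i)))"
    by (subst sum.nat_diff_reindex[symmetric]) simp
  also have "\<dots> = (\<Sum>i<Suc m. \<upsilon> powi (- 2 * int m) * qq ^ i)"
  proof (rule sum.cong[OF refl])
    fix i assume "i \<in> {..<Suc m}"
    then have "- 2 * int (m - i) = - 2 * int m + int (2 * i)" by (simp add: of_nat_diff)
    then show "\<upsilon> powi (- 2 * int (m - i)) = \<upsilon> powi (- 2 * int m) * qq ^ i"
      by (simp only: power_int_add ups_nonzero simp_thms power_int_of_nat power_mult)
  qed
  finally show ?thesis by (simp only: qint_def sum_distrib_left)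
qed

section \<open>Operators on functions on permutations\<close>

abbreviation sw :: "nat \<Rightarrow> nat \<Rightarrow> nat" where
  "sw i \<equiv> transpose i (Suc i)"

type_synonym pfun = "(nat \<Rightarrow> nat) \<Rightarrow> ratfun"

text \<open>Left multiplication by T_i on coefficient functions, the coefficient of T_w being stored
  at the inverse \<open>f\<close> of w: s_i w then corresponds to \<open>f \<circ> sw i\<close>, and
  it is longer than w iff \<open>f i < f (Suc i)\<close>. The formula makes sense for every map
  \<open>f\<close>; if the two values agree, both branches give \<open>qq * y f\<close>.\<close>

definition Lop :: "nat \<Rightarrow> pfun \<Rightarrow> pfun" where
  "Lop i y f = (if f i < f (Suc i) then qq * y (f \<circ> sw i) else y (f \<circ> sw i) + (qq - 1) * y f)"

definition Lword :: "nat list \<Rightarrow> pfun \<Rightarrow> pfun" where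
  "Lword = foldr Lop"

lemma Lword_simps [simp]:
  "Lword [] y = y" "Lword (i # w) y = Lop i (Lword w y)"
  by (simp_all add: Lword_def)

lemma Lword_append: "Lword (u @ w) y = Lword u (Lword w y)"
  by (induction u) auto

lemma Lop_lin: "Lop i (\<lambda>f. a * x f + y f) = (\<lambda>f. a * Lop i x f + Lop i y f)"
  by (auto simp: Lop_def fun_eq_iff algebra_simps)

lemma Lop_zero: "Lop i (\<lambda>_. 0) = (\<lambda>_. 0)"
  by (auto simp: Lop_def)

lemma Lop_sum: "Lop i (\<lambda>f. \<Sum>k\<in>S. a k * y k f) = (\<lambda>f. \<Sum>k\<in>S. a k * Lop i (y k) f)"
  by (induction S rule: infinite_finite_induct) (simp_all add: Lop_lin Lop_zero)

lemma Lword_sum: "Lword w (\<lambda>f. \<Sum>k\<in>S. a k * y k f) = (\<lambda>f. \<Sum>k\<in>S. a k * Lword w (y k) f)"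
  by (induction w) (simp_all add: Lop_sum)

lemma comp_sw_eq: "f i = f (Suc i) \<Longrightarrow> f \<circ> sw i = f"
  by (auto simp: fun_eq_iff transpose_def)

lemma Lop_quadratic: "Lop i (Lop i y) f = (qq - 1) * Lop i y f + qq * y f"
proof (cases "f i" "f (Suc i)" rule: linorder_cases)
  case equal then show ?thesis by (simp add: Lop_def comp_sw_eq) (simp add: algebra_simps)
qed (simp_all add: Lop_def comp_assoc algebra_simps)

lemma Lop_commute:
  assumes "i \<noteq> j" "Suc i \<noteq> j" "i \<noteq> Suc j"
  shows "Lop i (Lop j y) = Lop j (Lop i y)"
proof -
  have c: "f \<circ> sw i \<circ> sw j = f \<circ> sw j \<circ> sw i" for f :: "nat \<Rightarrow> nat"
    using assms by (auto simp: fun_eq_iff transpose_def)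
  show ?thesis
  proof
    fix f :: "nat \<Rightarrow> nat"
    have "(f \<circ> sw i) j = f j" "(f \<circ> sw i) (Suc j) = f (Suc j)"
      "(f \<circ> sw j) i = f i" "(f \<circ> sw j) (Suc i) = f (Suc i)"
      using assms by (auto simp: transpose_def)
    then show "Lop i (Lop j y) f = Lop j (Lop i y) f"
      unfolding Lop_def c[of f] by (simp add: algebra_simps)
  qed
qed

text \<open>Both sides involve only rearrangements of the values at three consecutive positions, so
  \<open>f\<close> may be replaced by a triple and the identity checked for each relative order,
  ties included.\<close>

lemma Lop_braid: "Lop i (Lop (Suc i) (Lop i y)) = Lop (Suc i) (Lop i (Lop (Suc i) y))"
proof
  fix f :: "nat \<Rightarrow> nat"
  define F where "F a b c = f(i := a, Suc i := b, Suc (Suc i) := c)" for a b c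
  have sws: "F a b c \<circ> sw i = F b a c" "F a b c \<circ> sw (Suc i) = F a c b"
    and vals: "F a b c i = a" "F a b c (Suc i) = b" "F a b c (Suc (Suc i)) = c" for a b c
    by (auto simp: F_def fun_eq_iff transpose_def)
  have Li: "Lop i x (F a b c) = (if a < b then qq * x (F b a c) else x (F b a c) + (qq - 1) * x (F a b c))"
    and Lj: "Lop (Suc i) x (F a b c) = (if b < c then qq * x (F a c b) else x (F a c b) + (qq - 1) * x (F a b c))"
    for x a b c by (simp_all add: Lop_def sws vals)
  have "Lop i (Lop (Suc i) (Lop i y)) (F a b c) = Lop (Suc i) (Lop i (Lop (Suc i) y)) (F a b c)" for a b c
    by (cases a b rule: linorder_cases; cases b c rule: linorder_cases; cases a c rule: linorder_cases)
      (simp_all add: Li Lj, simp_all add: algebra_simps)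
  from this[of "f i" "f (Suc i)" "f (Suc (Suc i))"]
  show "Lop i (Lop (Suc i) (Lop i y)) f = Lop (Suc i) (Lop i (Lop (Suc i) y)) f"
    by (simp add: F_def fun_upd_idem)
qed

definition pdelta :: "(nat \<Rightarrow> nat) \<Rightarrow> pfun" where
  "pdelta g f = (if f = g then 1 else 0)"

text \<open>The length-increasing case T_i T_w = T_v with v = s_i w, where the quadratic relation
  does not interfere.\<close>

lemma Lop_pdelta:
  assumes "g i < g (Suc i)" shows "Lop i (pdelta g) = pdelta (g \<circ> sw i)"
proof
  fix f
  have "f \<circ> sw i = g \<longleftrightarrow> f = g \<circ> sw i" by (auto simp: comp_assoc)
  moreover have "g \<circ> sw i \<noteq> g"
  proof
    assume "g \<circ> sw i = g"
    then have "(g \<circ> sw i) i = g i" by simp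
    then show False using assms by simp
  qed
  ultimately
  show "Lop i (pdelta g) f = pdelta (g \<circ> sw i) f"
    using assms by (auto simp: Lop_def pdelta_def)
qed

definition Lact :: "(nat list \<Rightarrow> ratfun) \<Rightarrow> pfun \<Rightarrow> pfun" where
  "Lact x y f = ev id (\<lambda>w. Lword w y f) x"

lemma monoid_word: "monoid (word_monoid r)"
  by (rule monoidI) (auto simp: word_monoid_def)

section \<open>The presented algebra acts on functions\<close>

locale hecke_rank = fixes r :: nat
begin

sublocale coeff_monoid "word_monoid r" laurent
  by (rule coeff_monoid_laurent[OF monoid_word])

abbreviation "F \<equiv> free_alg r"
abbreviation "H \<equiv> hecke r"
abbreviation "I \<equiv> Idl\<^bsub>F\<^esub> (hecke_rels r)"

lemma F_eq: "F = MR" by (simp add: free_alg_def AA_eq)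

sublocale F: ring F unfolding F_eq by (rule ring_MR)

lemma word_simps [simp]: "x \<otimes>\<^bsub>word_monoid r\<^esub> y = x @ y" "\<one>\<^bsub>word_monoid r\<^esub> = []"
  "carrier (word_monoid r) = lists {1..<r}"
  by (simp_all add: word_monoid_def)

lemma Lact_mult:
  assumes "x \<in> carrier F" "x' \<in> carrier F"
  shows "Lact (x \<otimes>\<^bsub>F\<^esub> x') y = Lact x (Lact x' y)"
proof
  fix f
  have "Lact (x \<otimes>\<^bsub>F\<^esub> x') y f = ev id (\<lambda>a. ev id (\<lambda>b. Lword a (Lword b y) f) x') x"
    using assms by (simp add: Lact_def F_eq ev_mult Lword_append)
  also have "(\<lambda>a. ev id (\<lambda>b. Lword a (Lword b y) f) x') = (\<lambda>a. Lword a (Lact x' y) f)"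
    by (simp add: Lact_def[abs_def] ev_def Lword_sum)
  finally show "Lact (x \<otimes>\<^bsub>F\<^esub> x') y f = Lact x (Lact x' y) f" by (simp add: Lact_def id_def)
qed

lemma Lact_add:
  "x \<in> carrier F \<Longrightarrow> x' \<in> carrier F \<Longrightarrow> Lact (x \<oplus>\<^bsub>F\<^esub> x') y f = Lact x y f + Lact x' y f"
  by (simp add: Lact_def F_eq ev_add)

lemma Lact_minus:
  "x \<in> carrier F \<Longrightarrow> x' \<in> carrier F \<Longrightarrow> Lact (x \<ominus>\<^bsub>F\<^esub> x') y f = Lact x y f - Lact x' y f"
  by (simp add: Lact_def F_eq ev_minus)

lemma Lact_single: "Lact (mr_single AA a w) y f = a * Lword w y f"
  by (simp add: Lact_def AA_eq ev_single)

lemma Lact_zero: "Lact x (\<lambda>_. 0) = (\<lambda>_. 0)"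
proof -
  have "Lword w (\<lambda>_. 0) = (\<lambda>_. 0)" for w by (induction w) (auto simp: Lop_zero)
  then show ?thesis by (simp add: Lact_def[abs_def] ev_def)
qed

lemma single_in_F: "a \<in> laurent \<Longrightarrow> w \<in> lists {1..<r} \<Longrightarrow> mr_single AA a w \<in> carrier F"
  unfolding F_eq AA_eq by (rule single_closed) auto

text \<open>The annihilator of a representation is two-sided, so once it contains the defining
  relations it contains the ideal they generate and the action descends to the quotient.\<close>

lemma Lact_kernel_ideal: "ideal {x \<in> carrier F. \<forall>y f. Lact x y f = 0} F" (is "ideal ?K F")
proof (rule idealI)
  show "ring F" by (rule F.ring_axioms)
  have z: "Lact \<zero>\<^bsub>F\<^esub> y f = 0" for y f
    using Lact_add[of "\<zero>\<^bsub>F\<^esub>" "\<zero>\<^bsub>F\<^esub>" y f] by simp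
  show "subgroup ?K (add_monoid F)"
  proof (rule group.subgroupI)
    show "group (add_monoid F)" using F.a_group .
    show "?K \<noteq> {}" using z by auto
    fix a assume a: "a \<in> ?K"
    have "Lact (\<zero>\<^bsub>F\<^esub> \<ominus>\<^bsub>F\<^esub> a) y f = 0" for y f using a z by (simp add: Lact_minus)
    then have "\<ominus>\<^bsub>F\<^esub> a \<in> ?K" using a by (simp add: a_minus_def)
    then show "inv\<^bsub>add_monoid F\<^esub> a \<in> ?K" by (simp add: a_inv_def)
  qed (auto simp: Lact_add)
next
  fix a x assume a: "a \<in> ?K" and x: "x \<in> carrier F"
  have "Lact a y = (\<lambda>_. 0)" for y using a by auto
  then show "x \<otimes>\<^bsub>F\<^esub> a \<in> ?K" "a \<otimes>\<^bsub>F\<^esub> x \<in> ?K" using a x by (auto simp: Lact_mult Lact_zero)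
qed

lemma rels_subset: "hecke_rels r \<subseteq> carrier F"
  unfolding hecke_rels_def Let_def
  using laurent_1 laurent_qq laurent_add[OF laurent_qq laurent_uminus[OF laurent_1]]
  by (auto intro!: F.minus_closed F.add.m_closed F.m_closed single_in_F)

lemma I_ideal: "ideal I F" by (rule F.genideal_ideal[OF rels_subset])

lemma I_kernel: "I \<subseteq> {x \<in> carrier F. \<forall>y f. Lact x y f = 0}"
proof (rule F.genideal_minimal[OF Lact_kernel_ideal], rule subsetI)
  have l: "1 \<in> laurent" "qq \<in> laurent" "qq - 1 \<in> laurent"
    using laurent_1 laurent_qq laurent_add[OF laurent_qq laurent_uminus[OF laurent_1]] by auto
  note cl = F.minus_closed F.add.m_closed F.m_closed single_in_F l
  have S: "Lact (mr_single AA a w) y = (\<lambda>f. a * Lword w y f)" for a w y by (auto simp: Lact_single)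
  have S1: "Lact (mr_single AA 1 w) y = Lword w y" for w y by (auto simp: Lact_single)
  fix x assume x: "x \<in> hecke_rels r"
  have "\<forall>y f. Lact x y f = 0"
    using x unfolding hecke_rels_def Let_def
  proof (elim UnE CollectE exE conjE)
    fix i assume x: "x = mr_single AA 1 [i] \<otimes>\<^bsub>F\<^esub> mr_single AA 1 [i] \<ominus>\<^bsub>F\<^esub>
      (mr_single AA (qq - 1) [i] \<oplus>\<^bsub>F\<^esub> mr_single AA qq [])" and i: "i \<in> {1..<r}"
    then show ?thesis
      by (simp add: cl Lact_minus Lact_mult Lact_add S S1 Lop_quadratic)
  next
    fix i assume x: "x = mr_single AA 1 [i] \<otimes>\<^bsub>F\<^esub> mr_single AA 1 [i + 1] \<otimes>\<^bsub>F\<^esub> mr_single AA 1 [i] \<ominus>\<^bsub>F\<^esub>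
       mr_single AA 1 [i + 1] \<otimes>\<^bsub>F\<^esub> mr_single AA 1 [i] \<otimes>\<^bsub>F\<^esub> mr_single AA 1 [i + 1]"
      and i: "i \<in> {1..<r}" "i + 1 \<in> {1..<r}"
    then show ?thesis
      by (simp add: cl Lact_minus Lact_mult Lact_add S1 Lop_braid)
  next
    fix i j assume x: "x = mr_single AA 1 [i] \<otimes>\<^bsub>F\<^esub> mr_single AA 1 [j] \<ominus>\<^bsub>F\<^esub>
       mr_single AA 1 [j] \<otimes>\<^bsub>F\<^esub> mr_single AA 1 [i]"
      and i: "i \<in> {1..<r}" "j \<in> {1..<r}" "\<bar>int i - int j\<bar> > 1"
    then show ?thesis
      by (simp add: cl Lact_minus Lact_mult Lact_add S1 Lop_commute[of i j])
  qed
  then show "x \<in> {x \<in> carrier F. \<forall>y f. Lact x y f = 0}" using x rels_subset by auto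
qed

sublocale I: ideal I F by (rule I_ideal)
sublocale H: ring H unfolding hecke_def by (rule I.quotient_is_ring)

abbreviation cls :: "(nat list \<Rightarrow> ratfun) \<Rightarrow> hecke_elt" where "cls \<equiv> hecke_class r"

lemma cls_hom: "cls \<in> Ring.ring_hom F H"
  using I.rcos_ring_hom unfolding hecke_class_def[abs_def] hecke_def .

lemma cls_closed: "x \<in> carrier F \<Longrightarrow> cls x \<in> carrier H"
  and cls_mult: "x \<in> carrier F \<Longrightarrow> y \<in> carrier F \<Longrightarrow> cls (x \<otimes>\<^bsub>F\<^esub> y) = cls x \<otimes>\<^bsub>H\<^esub> cls y"
  and cls_add: "x \<in> carrier F \<Longrightarrow> y \<in> carrier F \<Longrightarrow> cls (x \<oplus>\<^bsub>F\<^esub> y) = cls x \<oplus>\<^bsub>H\<^esub> cls y"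
  and cls_one: "cls \<one>\<^bsub>F\<^esub> = \<one>\<^bsub>H\<^esub>"
  using cls_hom by (auto simp: ring_hom_closed ring_hom_mult ring_hom_add ring_hom_one)

lemma cls_zero: "cls \<zero>\<^bsub>F\<^esub> = \<zero>\<^bsub>H\<^esub>"
  using ring_hom_zero[OF cls_hom F.ring_axioms H.ring_axioms] .

lemma cls_surj: "h \<in> carrier H \<Longrightarrow> \<exists>x\<in>carrier F. h = cls x"
  by (auto simp: hecke_def FactRing_def A_RCOSETS_def RCOSETS_def hecke_class_def a_r_coset_def)

lemma cls_eqI:
  assumes "x \<in> carrier F" "x' \<in> carrier F" "x \<ominus>\<^bsub>F\<^esub> x' \<in> I"
  shows "cls x = cls x'"
  unfolding hecke_class_def
  using F.quotient_eq_iff_same_a_r_cos[OF I_ideal assms(1,2)] assms(3) by simp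

text \<open>A class acts through a chosen representative; \<open>Hact_cls\<close> shows that every
  representative acts in the same way.\<close>

definition Hact :: "hecke_elt \<Rightarrow> pfun \<Rightarrow> pfun" where
  "Hact h = Lact (SOME x. x \<in> h)"

lemma Hact_cls:
  assumes "x \<in> carrier F" shows "Hact (cls x) = Lact x"
proof -
  have "x \<in> cls x" unfolding hecke_class_def using assms by (rule I.a_rcos_self)
  then have "(SOME x'. x' \<in> cls x) \<in> cls x" by (rule someI[of "\<lambda>z. z \<in> cls x"])
  then obtain k where k: "k \<in> I" "(SOME x'. x' \<in> cls x) = k \<oplus>\<^bsub>F\<^esub> x"
    unfolding hecke_class_def a_r_coset_def' by auto
  then have "k \<in> carrier F" "\<And>y f. Lact k y f = 0" using I_kernel by auto
  then show ?thesis unfolding Hact_def k using assms by (auto simp: fun_eq_iff Lact_add)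
qed

end

section \<open>Elements of the Hecke algebra as functions on permutations\<close>

text \<open>Words \<open>s\<^sub>j \<dots> s\<^sub>m\<close> followed by a normal form for a smaller symmetric group, one for each permutation.\<close>

fun NF :: "nat \<Rightarrow> nat list set" where
  "NF 0 = {[]}"
| "NF (Suc m) = {[j..<Suc m] @ u | j u. 1 \<le> j \<and> j \<le> Suc m \<and> u \<in> NF m}"

lemma finite_NF: "finite (NF m)"
proof (induction m)
  case (Suc m)
  have "NF (Suc m) = (\<lambda>(j, u). [j..<Suc m] @ u) ` ({1..Suc m} \<times> NF m)"
    by (auto simp del: upt_Suc) blast
  then show ?case using Suc by simp
qed simp

lemma NF_lists: "u \<in> NF m \<Longrightarrow> set u \<subseteq> {1..<m}"
  by (induction m arbitrary: u) (fastforce simp del: upt_Suc)+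

text \<open>The inverse of \<open>word_perm w\<close>, built by precomposition in step with
  \<open>Lop\<close>.\<close>

definition wfun :: "nat list \<Rightarrow> nat \<Rightarrow> nat" where
  "wfun w = foldr (\<lambda>i g. g \<circ> sw i) w id"

lemma wfun_simps [simp]: "wfun [] = id" "wfun (i # w) = wfun w \<circ> sw i"
  by (simp_all add: wfun_def)

lemma wfun_append: "wfun (u @ w) = wfun w \<circ> wfun u"
  by (induction u) (auto simp: comp_assoc)

lemma wfun_permutes: "set w \<subseteq> {1..<r} \<Longrightarrow> wfun w permutes {1..r}"
proof (induction w)
  case (Cons i w)
  then show ?case by (auto intro!: permutes_compose permutes_swap_id simp del: o_apply)
qed (simp add: permutes_id)

abbreviation pinv :: "('a \<Rightarrow> 'a) \<Rightarrow> 'a \<Rightarrow> 'a" where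
  "pinv f \<equiv> inv_into UNIV f"

lemma wfun_inv: "wfun w = pinv (word_perm w)" and bij_word_perm: "bij (word_perm w)"
proof -
  have step: "word_perm (i # w) = sw i \<circ> word_perm w" for i w by (simp add: word_perm_def)
  have bij: "bij (word_perm w)" for w
  proof (induction w)
    case (Cons i w) then show ?case unfolding step by (intro bij_comp) auto
  qed (simp add: word_perm_def bij_betw_def inj_on_def)
  show "bij (word_perm w)" by (rule bij)
  show "wfun w = pinv (word_perm w)"
  proof (induction w)
    case (Cons i w) then show ?case unfolding step by (subst o_inv_distrib) (auto simp: bij)
  qed (simp add: word_perm_def)
qed

text \<open>The value \<open>Suc m\<close> sits at position \<open>Suc m\<close> at first, and each
  letter of the cycle moves it one place to the left. Being maximal, it produces an ascent every
  time, so deltas are carried to deltas.\<close>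

lemma NF_cycle_fun:
  assumes "u \<in> NF m" "1 \<le> j" "j \<le> Suc m"
  shows "wfun ([j..<Suc m] @ u) j = Suc m \<and> Lword [j..<Suc m] (pdelta (wfun u)) = pdelta (wfun ([j..<Suc m] @ u))"
  using assms(3,2)
proof (induction j rule: inc_induct)
  case base
  have "wfun u permutes {1..m}" using wfun_permutes NF_lists[OF assms(1)] by blast
  then show ?case by (simp add: permutes_not_in)
next
  case (step j)
  have up: "[j..<Suc m] = j # [Suc j..<Suc m]" using step.hyps by (simp add: upt_conv_Cons del: upt_Suc)
  let ?g = "wfun ([Suc j..<Suc m] @ u)"
  have IH: "?g (Suc j) = Suc m" "Lword [Suc j..<Suc m] (pdelta (wfun u)) = pdelta ?g"
    using step by auto
  have "?g permutes {1..Suc m}"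
    by (rule wfun_permutes) (use NF_lists[OF assms(1)] step.prems in auto)
  then have "?g j \<in> {1..Suc m}" "?g j \<noteq> ?g (Suc j)"
    using permutes_in_image[of ?g "{1..Suc m}" j] step.hyps step.prems
    by (auto simp: permutes_inj inj_eq simp del: upt_Suc)
  then have "?g j < ?g (Suc j)" using IH by auto
  then show ?case unfolding up using IH by (simp add: Lop_pdelta comp_def del: upt_Suc)
qed

lemma NF_Lword: "u \<in> NF m \<Longrightarrow> Lword u (pdelta id) = pdelta (wfun u)"
proof (induction m arbitrary: u)
  case (Suc m)
  then obtain j v where u: "u = [j..<Suc m] @ v" "1 \<le> j" "j \<le> Suc m" "v \<in> NF m" by auto
  then show ?case using Suc.IH[OF u(4)] NF_cycle_fun[OF u(4,2,3)]
    by (simp add: Lword_append del: upt_Suc)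
qed simp

text \<open>The position of the largest value recovers the start \<open>j\<close> of the cycle;
  after cancelling the cycle, induction identifies the remaining words.\<close>

lemma wfun_inj_NF: "inj_on wfun (NF m)"
proof (induction m)
  case (Suc m)
  show ?case
  proof (rule inj_onI)
    fix u u' assume "u \<in> NF (Suc m)" "u' \<in> NF (Suc m)" and eq: "wfun u = wfun u'"
    then obtain j v j' v' where u: "u = [j..<Suc m] @ v" "1 \<le> j" "j \<le> Suc m" "v \<in> NF m"
      and u': "u' = [j'..<Suc m] @ v'" "1 \<le> j'" "j' \<le> Suc m" "v' \<in> NF m" by auto
    have "wfun u j = Suc m" "wfun u' j' = Suc m"
      using NF_cycle_fun[OF u(4,2,3)] NF_cycle_fun[OF u'(4,2,3)] u u' by auto
    moreover have "inj (wfun u)" unfolding wfun_inv by (simp add: bij_word_perm bij_imp_bij_inv bij_is_inj)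
    ultimately have j: "j = j'" using eq by (metis injD)
    have "surj (wfun [j..<Suc m])" unfolding wfun_inv by (simp add: bij_word_perm bij_imp_bij_inv bij_is_surj)
    moreover have "wfun v \<circ> wfun [j..<Suc m] = wfun v' \<circ> wfun [j..<Suc m]"
      using eq unfolding u u' j wfun_append .
    ultimately have "wfun v = wfun v'" by (metis surj_fun_eq)
    then show "u = u'" using inj_onD[OF Suc.IH] u u' j by blast
  qed
qed simp

context hecke_rank
begin

definition hw :: "nat list \<Rightarrow> hecke_elt" where "hw w = cls (mr_single AA 1 w)"
abbreviation sc :: "ratfun \<Rightarrow> hecke_elt" where "sc \<equiv> hecke_scalar r"
definition W :: "nat list set" where "W = lists {1..<r}"

lemma W_simps [simp]: "[] \<in> W" "i # w \<in> W \<longleftrightarrow> i \<in> {1..<r} \<and> w \<in> W"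
  "u @ w \<in> W \<longleftrightarrow> u \<in> W \<and> w \<in> W"
  by (auto simp: W_def)

lemma W_upt: "1 \<le> j \<Longrightarrow> m < r \<Longrightarrow> [j..<Suc m] \<in> W" "1 \<le> j \<Longrightarrow> m \<le> r \<Longrightarrow> [j..<m] \<in> W"
  by (auto simp: W_def simp del: upt_Suc)

lemma single_W: "a \<in> laurent \<Longrightarrow> w \<in> W \<Longrightarrow> mr_single AA a w \<in> carrier F"
  by (simp add: W_def single_in_F)

lemma sc_def': "sc a = cls (mr_single AA a [])" by (simp add: hecke_scalar_def)

lemma single_mult_F:
  "a \<in> laurent \<Longrightarrow> b \<in> laurent \<Longrightarrow> u \<in> W \<Longrightarrow> w \<in> W \<Longrightarrow>
    mr_single AA a u \<otimes>\<^bsub>F\<^esub> mr_single AA b w = mr_single AA (a * b) (u @ w)"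
  using single_mult[of a b u w] by (simp add: F_eq AA_eq W_def)

lemma F_induct [consumes 1, case_names zero add single]:
  assumes "x \<in> carrier F" "P \<zero>\<^bsub>F\<^esub>"
    and "\<And>x y. x \<in> carrier F \<Longrightarrow> y \<in> carrier F \<Longrightarrow> P x \<Longrightarrow> P y \<Longrightarrow> P (x \<oplus>\<^bsub>F\<^esub> y)"
    and "\<And>a m. a \<in> laurent \<Longrightarrow> m \<in> W \<Longrightarrow> P (mr_single AA a m)"
  shows "P x"
  using MR_induct[of x P] assms unfolding F_eq AA_eq W_def by simp

lemma hw_closed [simp]: "w \<in> W \<Longrightarrow> hw w \<in> carrier H"
  by (simp add: hw_def cls_closed single_W laurent_1)

lemma sc_closed [simp]: "a \<in> laurent \<Longrightarrow> sc a \<in> carrier H"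
  by (simp add: sc_def' cls_closed single_W)

lemma hw_append: "u \<in> W \<Longrightarrow> w \<in> W \<Longrightarrow> hw (u @ w) = hw u \<otimes>\<^bsub>H\<^esub> hw w"
  by (simp add: hw_def single_W laurent_1 single_mult_F flip: cls_mult)

lemma hw_Cons: "i \<in> {1..<r} \<Longrightarrow> w \<in> W \<Longrightarrow> hw (i # w) = hw [i] \<otimes>\<^bsub>H\<^esub> hw w"
  using hw_append[of "[i]" w] by simp

lemma one_F: "\<one>\<^bsub>F\<^esub> = mr_single AA 1 []"
  by (simp add: F_eq AA_eq MR_one mr_single_def fun_eq_iff)

lemma hw_Nil: "hw [] = \<one>\<^bsub>H\<^esub>"
  by (simp add: hw_def flip: one_F cls_one)

lemma sc_one: "sc 1 = \<one>\<^bsub>H\<^esub>"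
  by (simp add: sc_def' flip: one_F cls_one)

lemma sc_zero: "sc 0 = \<zero>\<^bsub>H\<^esub>"
proof -
  have "mr_single AA 0 [] = \<zero>\<^bsub>F\<^esub>" by (simp add: F_eq AA_eq MR_zero mr_single_def fun_eq_iff)
  then show ?thesis by (simp add: sc_def' cls_zero)
qed

lemma sc_mult: "a \<in> laurent \<Longrightarrow> b \<in> laurent \<Longrightarrow> sc (a * b) = sc a \<otimes>\<^bsub>H\<^esub> sc b"
  by (simp add: sc_def' single_W single_mult_F flip: cls_mult)

lemma single_add_F: "mr_single AA a w \<oplus>\<^bsub>F\<^esub> mr_single AA b w = mr_single AA (a + b) w"
  by (simp add: F_eq AA_eq single_add)

lemma sc_add: "a \<in> laurent \<Longrightarrow> b \<in> laurent \<Longrightarrow> sc (a + b) = sc a \<oplus>\<^bsub>H\<^esub> sc b"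
  by (simp add: sc_def' single_W flip: cls_add) (simp add: single_add_F)

lemma sc_hw: "a \<in> laurent \<Longrightarrow> w \<in> W \<Longrightarrow> cls (mr_single AA a w) = sc a \<otimes>\<^bsub>H\<^esub> hw w"
  by (simp add: sc_def' hw_def single_W laurent_1 single_mult_F flip: cls_mult)

lemma hecke_induct [consumes 1, case_names zero add single]:
  assumes "h \<in> carrier H" "P \<zero>\<^bsub>H\<^esub>"
    and "\<And>x y. x \<in> carrier H \<Longrightarrow> y \<in> carrier H \<Longrightarrow> P x \<Longrightarrow> P y \<Longrightarrow> P (x \<oplus>\<^bsub>H\<^esub> y)"
    and "\<And>a w. a \<in> laurent \<Longrightarrow> w \<in> W \<Longrightarrow> P (sc a \<otimes>\<^bsub>H\<^esub> hw w)"
  shows "P h"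
proof -
  obtain x where x: "x \<in> carrier F" "h = cls x" using cls_surj[OF assms(1)] by auto
  from x(1) have "P (cls x)"
    by (induction x rule: F_induct) (auto simp: cls_zero cls_add assms sc_hw cls_closed)
  then show ?thesis by (simp add: x)
qed

lemma sc_central:
  assumes "a \<in> laurent" "h \<in> carrier H"
  shows "sc a \<otimes>\<^bsub>H\<^esub> h = h \<otimes>\<^bsub>H\<^esub> sc a"
  using assms(2)
proof (induction h rule: hecke_induct)
  case (single b w)
  then have "sc a \<otimes>\<^bsub>H\<^esub> cls (mr_single AA b w) = cls (mr_single AA b w) \<otimes>\<^bsub>H\<^esub> sc a"
    using assms by (simp add: sc_def' single_W single_mult_F mult.commute flip: cls_mult)
  then show ?case using single by (simp add: sc_hw)
qed (use assms in \<open>auto simp: H.l_distr H.r_distr\<close>)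

lemma Hact_mult:
  "h \<in> carrier H \<Longrightarrow> h' \<in> carrier H \<Longrightarrow> Hact (h \<otimes>\<^bsub>H\<^esub> h') y = Hact h (Hact h' y)"
  using cls_surj[of h] cls_surj[of h'] by (auto simp: Hact_cls Lact_mult simp flip: cls_mult)

lemma Hact_add:
  "h \<in> carrier H \<Longrightarrow> h' \<in> carrier H \<Longrightarrow> Hact (h \<oplus>\<^bsub>H\<^esub> h') y f = Hact h y f + Hact h' y f"
  using cls_surj[of h] cls_surj[of h'] by (auto simp: Hact_cls Lact_add simp flip: cls_add)

lemma Hact_hw: "w \<in> W \<Longrightarrow> Hact (hw w) y = Lword w y"
  by (simp add: hw_def Hact_cls single_W laurent_1 Lact_single fun_eq_iff)

lemma Hact_sc: "a \<in> laurent \<Longrightarrow> Hact (sc a) y f = a * y f"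
  by (simp add: sc_def' Hact_cls single_W Lact_single)

text \<open>The coefficient of \<open>T\<^sub>w\<close> in \<open>h\<close> is the value of \<open>kap h\<close> at the inverse of \<open>w\<close>; with this
  convention left multiplication acts on functions by precomposition.\<close>

definition kap :: "hecke_elt \<Rightarrow> pfun" where "kap h = Hact h (pdelta id)"

lemma kap_add: "h \<in> carrier H \<Longrightarrow> h' \<in> carrier H \<Longrightarrow> kap (h \<oplus>\<^bsub>H\<^esub> h') f = kap h f + kap h' f"
  by (simp add: kap_def Hact_add)

lemma kap_zero: "kap \<zero>\<^bsub>H\<^esub> f = 0"
  using kap_add[of "\<zero>\<^bsub>H\<^esub>" "\<zero>\<^bsub>H\<^esub>" f] by simp

lemma kap_sc: "a \<in> laurent \<Longrightarrow> h \<in> carrier H \<Longrightarrow> kap (sc a \<otimes>\<^bsub>H\<^esub> h) f = a * kap h f"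
  by (simp add: kap_def Hact_mult Hact_sc)

lemma kap_sc_right: "a \<in> laurent \<Longrightarrow> h \<in> carrier H \<Longrightarrow> kap (h \<otimes>\<^bsub>H\<^esub> sc a) f = a * kap h f"
  using sc_central[of a h] kap_sc[of a h f] by simp

lemma kap_hw_mult: "w \<in> W \<Longrightarrow> h \<in> carrier H \<Longrightarrow> kap (hw w \<otimes>\<^bsub>H\<^esub> h) = Lword w (kap h)"
  by (simp add: kap_def Hact_mult Hact_hw)

lemma kap_T_mult: "i \<in> {1..<r} \<Longrightarrow> h \<in> carrier H \<Longrightarrow> kap (hw [i] \<otimes>\<^bsub>H\<^esub> h) = Lop i (kap h)"
  by (simp add: kap_hw_mult)

lemma kap_hw: "w \<in> W \<Longrightarrow> kap (hw w) = Lword w (pdelta id)"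
  by (simp add: kap_def Hact_hw)

lemma kap_finsum:
  "finite S \<Longrightarrow> (\<And>x. x \<in> S \<Longrightarrow> h x \<in> carrier H) \<Longrightarrow> kap (finsum H h S) f = (\<Sum>x\<in>S. kap (h x) f)"
  by (induction S rule: finite_induct) (simp_all add: kap_zero kap_add Pi_def)

lemma T_quad:
  assumes "i \<in> {1..<r}"
  shows "hw [i] \<otimes>\<^bsub>H\<^esub> hw [i] = sc (qq - 1) \<otimes>\<^bsub>H\<^esub> hw [i] \<oplus>\<^bsub>H\<^esub> sc qq"
proof -
  have l: "1 \<in> laurent" "qq \<in> laurent" "qq - 1 \<in> laurent"
    using laurent_1 laurent_qq laurent_add[OF laurent_qq laurent_uminus[OF laurent_1]] by auto
  note cl = F.minus_closed F.add.m_closed F.m_closed single_W l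
  have "mr_single AA 1 [i] \<otimes>\<^bsub>F\<^esub> mr_single AA 1 [i] \<ominus>\<^bsub>F\<^esub> (mr_single AA (qq - 1) [i] \<oplus>\<^bsub>F\<^esub> mr_single AA qq []) \<in> hecke_rels r"
    unfolding hecke_rels_def Let_def using assms by blast
  then have "cls (mr_single AA 1 [i] \<otimes>\<^bsub>F\<^esub> mr_single AA 1 [i]) = cls (mr_single AA (qq - 1) [i] \<oplus>\<^bsub>F\<^esub> mr_single AA qq [])"
    using assms by (intro cls_eqI subsetD[OF F.genideal_self[OF rels_subset]]) (auto simp: cl simp del: append.simps)
  then have "hw [i] \<otimes>\<^bsub>H\<^esub> hw [i] = cls (mr_single AA (qq - 1) [i]) \<oplus>\<^bsub>H\<^esub> cls (mr_single AA qq [])"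
    using assms by (simp add: cls_mult cls_add cl hw_def)
  then show ?thesis using assms by (simp add: sc_hw l hw_Nil)
qed

lemma T_braid:
  assumes "i \<in> {1..<r}" "Suc i \<in> {1..<r}"
  shows "hw [i, Suc i, i] = hw [Suc i, i, Suc i]"
proof -
  note cl = F.minus_closed F.add.m_closed F.m_closed single_W laurent_1
  have "mr_single AA 1 [i] \<otimes>\<^bsub>F\<^esub> mr_single AA 1 [i + 1] \<otimes>\<^bsub>F\<^esub> mr_single AA 1 [i] \<ominus>\<^bsub>F\<^esub>
       mr_single AA 1 [i + 1] \<otimes>\<^bsub>F\<^esub> mr_single AA 1 [i] \<otimes>\<^bsub>F\<^esub> mr_single AA 1 [i + 1] \<in> hecke_rels r"
    unfolding hecke_rels_def Let_def using assms by auto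
  then have "cls (mr_single AA 1 [i] \<otimes>\<^bsub>F\<^esub> mr_single AA 1 [i + 1] \<otimes>\<^bsub>F\<^esub> mr_single AA 1 [i]) =
      cls (mr_single AA 1 [i + 1] \<otimes>\<^bsub>F\<^esub> mr_single AA 1 [i] \<otimes>\<^bsub>F\<^esub> mr_single AA 1 [i + 1])"
    using assms by (intro cls_eqI subsetD[OF F.genideal_self[OF rels_subset]]) (auto simp: cl simp del: append.simps)
  then show ?thesis using assms by (simp add: single_mult_F laurent_1 hw_def)
qed

lemma T_comm:
  assumes "i \<in> {1..<r}" "j \<in> {1..<r}" "Suc i < j \<or> Suc j < i"
  shows "hw [i, j] = hw [j, i]"
proof -
  note cl = F.minus_closed F.add.m_closed F.m_closed single_W laurent_1
  have "\<bar>int i - int j\<bar> > 1" using assms by auto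
  then have "mr_single AA 1 [i] \<otimes>\<^bsub>F\<^esub> mr_single AA 1 [j] \<ominus>\<^bsub>F\<^esub> mr_single AA 1 [j] \<otimes>\<^bsub>F\<^esub> mr_single AA 1 [i] \<in> hecke_rels r"
    unfolding hecke_rels_def Let_def using assms by blast
  then have "cls (mr_single AA 1 [i] \<otimes>\<^bsub>F\<^esub> mr_single AA 1 [j]) = cls (mr_single AA 1 [j] \<otimes>\<^bsub>F\<^esub> mr_single AA 1 [i])"
    using assms by (intro cls_eqI subsetD[OF F.genideal_self[OF rels_subset]]) (auto simp: cl simp del: append.simps)
  then show ?thesis using assms by (simp add: single_mult_F laurent_1 hw_def)
qed

lemma T_comm_word:
  assumes "i \<in> {1..<r}" "w \<in> W" "\<And>j. j \<in> set w \<Longrightarrow> Suc i < j \<or> Suc j < i"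
  shows "hw (i # w) = hw (w @ [i])"
  using assms(2,3)
proof (induction w)
  case (Cons j w)
  have W: "w \<in> W" "[i, j] \<in> W" "[j, i] \<in> W" "i # w \<in> W" "w @ [i] \<in> W" "j \<in> {1..<r}"
    using Cons.prems(1) assms(1) by auto
  have "hw (i # j # w) = hw [i, j] \<otimes>\<^bsub>H\<^esub> hw w"
    using hw_append[OF W(2,1)] by simp
  also have "hw [i, j] = hw [j, i]" using Cons.prems(2) assms(1) W by (intro T_comm) auto
  also have "hw [j, i] \<otimes>\<^bsub>H\<^esub> hw w = hw [j] \<otimes>\<^bsub>H\<^esub> hw (i # w)"
    using hw_append[OF W(3,1)] hw_Cons[OF W(6,4)] by simp
  also have "hw (i # w) = hw (w @ [i])" using Cons W by auto
  also have "hw [j] \<otimes>\<^bsub>H\<^esub> hw (w @ [i]) = hw ((j # w) @ [i])"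
    using hw_Cons[OF W(6,5)] by simp
  finally show ?case .
qed simp

text \<open>The letter \<open>i\<close> commutes past the letters below \<open>i - 1\<close>, one
  braid relation exchanges it for \<open>i - 1\<close>, and this commutes past the letters above
  \<open>i\<close>.\<close>

lemma T_cycle_shift:
  assumes "1 \<le> j" "j < i" "i \<le> m" "m < r"
  shows "hw (i # [j..<Suc m]) = hw ([j..<Suc m] @ [i - 1])"
proof -
  let ?a = "[j..<i - 1]" and ?b = "[Suc i..<Suc m]"
  have split: "[j..<Suc m] = ?a @ [i - 1, i] @ ?b"
  proof -
    have "[j..<Suc m] = ?a @ [i - 1..<Suc m]"
      using upt_add_eq_append[of j "i - 1" "Suc m - (i - 1)"] assms by (simp del: upt_Suc)
    also have "[i - 1..<Suc m] = [i - 1, i] @ ?b"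
      using assms by (simp add: upt_conv_Cons del: upt_Suc)
    finally show ?thesis .
  qed
  have W: "?a \<in> W" "?b \<in> W" "i \<in> {1..<r}" "i - 1 \<in> {1..<r}"
    using assms by (auto intro!: W_upt simp del: upt_Suc)
  have "hw (i # [j..<Suc m]) = hw (i # ?a) \<otimes>\<^bsub>H\<^esub> hw ([i - 1, i] @ ?b)"
    using hw_append[of "i # ?a" "[i - 1, i] @ ?b"] W unfolding split by simp
  also have "hw (i # ?a) = hw (?a @ [i])" using W assms by (intro T_comm_word) auto
  also have "hw (?a @ [i]) \<otimes>\<^bsub>H\<^esub> hw ([i - 1, i] @ ?b) = hw ?a \<otimes>\<^bsub>H\<^esub> hw ([i, i - 1, i]) \<otimes>\<^bsub>H\<^esub> hw ?b"
    using W hw_append[of "?a @ [i]" "[i - 1, i] @ ?b"] hw_append[of ?a "[i, i - 1, i]"] hw_append[of "?a @ [i, i - 1, i]" ?b]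
    by simp
  also have "hw [i, i - 1, i] = hw [i - 1, i, i - 1]"
    using T_braid[of "i - 1"] assms by (cases i) auto
  also have "hw ?a \<otimes>\<^bsub>H\<^esub> hw [i - 1, i, i - 1] \<otimes>\<^bsub>H\<^esub> hw ?b = hw (?a @ [i - 1, i]) \<otimes>\<^bsub>H\<^esub> hw ((i - 1) # ?b)"
    using W hw_append[of "?a @ [i - 1, i]" "(i - 1) # ?b"] hw_append[of ?a "[i - 1, i, i - 1]"] hw_append[of "?a @ [i - 1, i, i - 1]" ?b]
    by simp
  also have "hw ((i - 1) # ?b) = hw (?b @ [i - 1])" using W assms by (intro T_comm_word) auto
  also have "hw (?a @ [i - 1, i]) \<otimes>\<^bsub>H\<^esub> hw (?b @ [i - 1]) = hw ([j..<Suc m] @ [i - 1])"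
    using W hw_append[of "?a @ [i - 1, i]" "?b @ [i - 1]"] unfolding split by simp
  finally show ?thesis .
qed

section \<open>Normal words span, and their functions separate them\<close>

inductive_set Sp :: "nat \<Rightarrow> hecke_elt set" for m where
  zero: "\<zero>\<^bsub>H\<^esub> \<in> Sp m"
| add: "x \<in> Sp m \<Longrightarrow> y \<in> Sp m \<Longrightarrow> x \<oplus>\<^bsub>H\<^esub> y \<in> Sp m"
| gen: "a \<in> laurent \<Longrightarrow> u \<in> NF m \<Longrightarrow> sc a \<otimes>\<^bsub>H\<^esub> hw u \<in> Sp m"

lemma NF_W: "u \<in> NF m \<Longrightarrow> m \<le> r \<Longrightarrow> u \<in> W"
  using NF_lists[of u m] by (auto simp: W_def)

lemma Sp_closed: "x \<in> Sp m \<Longrightarrow> m \<le> r \<Longrightarrow> x \<in> carrier H"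
  by (induction rule: Sp.induct) (auto simp: NF_W)

lemma Sp_sc: "x \<in> Sp m \<Longrightarrow> m \<le> r \<Longrightarrow> b \<in> laurent \<Longrightarrow> sc b \<otimes>\<^bsub>H\<^esub> x \<in> Sp m"
proof (induction rule: Sp.induct)
  case (gen a u)
  then have "sc b \<otimes>\<^bsub>H\<^esub> (sc a \<otimes>\<^bsub>H\<^esub> hw u) = sc (b * a) \<otimes>\<^bsub>H\<^esub> hw u"
    by (simp add: sc_mult H.m_assoc NF_W)
  then show ?case using gen by (simp add: Sp.gen laurent_mult)
qed (auto simp: Sp.zero Sp.add H.r_distr Sp_closed)

lemma Sp_cycle:
  "x \<in> Sp m \<Longrightarrow> m < r \<Longrightarrow> 1 \<le> j \<Longrightarrow> j \<le> Suc m \<Longrightarrow> hw [j..<Suc m] \<otimes>\<^bsub>H\<^esub> x \<in> Sp (Suc m)"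
proof (induction rule: Sp.induct)
  case (gen a u)
  then have W: "u \<in> W" "[j..<Suc m] \<in> W" by (auto simp: NF_W W_upt simp del: upt_Suc)
  have "hw [j..<Suc m] \<otimes>\<^bsub>H\<^esub> (sc a \<otimes>\<^bsub>H\<^esub> hw u) = sc a \<otimes>\<^bsub>H\<^esub> hw ([j..<Suc m] @ u)"
    using gen W sc_central[of a "hw [j..<Suc m]"] H.m_assoc[of "hw [j..<Suc m]" "sc a" "hw u"]
      H.m_assoc[of "sc a" "hw [j..<Suc m]" "hw u"] by (simp add: hw_append del: upt_Suc)
  moreover have "[j..<Suc m] @ u \<in> NF (Suc m)" using gen by (simp del: upt_Suc) blast
  ultimately show ?case using gen by (simp add: Sp.gen del: upt_Suc NF.simps)
next
  case zero
  then have "[j..<Suc m] \<in> W" by (simp add: W_upt del: upt_Suc)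
  then show ?case by (simp add: Sp.zero del: upt_Suc)
next
  case (add x y)
  then have "[j..<Suc m] \<in> W" by (simp add: W_upt del: upt_Suc)
  then show ?case using add by (simp add: Sp.add H.r_distr Sp_closed del: upt_Suc)
qed

text \<open>Let the cycle start at \<open>j\<close>. A letter with \<open>Suc i < j\<close> commutes
  past it, \<open>Suc i = j\<close> lengthens it, \<open>i = j\<close> calls for the quadratic
  relation, and \<open>j < i\<close> passes through it and becomes \<open>i - 1\<close>. What
  emerges on the right is a generator of the smaller group, to which the induction hypothesis
  applies.\<close>

lemma Sp_T: "m \<le> r \<Longrightarrow> x \<in> Sp m \<Longrightarrow> 1 \<le> i \<Longrightarrow> i < m \<Longrightarrow> hw [i] \<otimes>\<^bsub>H\<^esub> x \<in> Sp m"
proof (induction m arbitrary: x i)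
  case (Suc m)
  have key: "hw [i] \<otimes>\<^bsub>H\<^esub> (hw [j..<Suc m] \<otimes>\<^bsub>H\<^esub> z) \<in> Sp (Suc m)"
    if z: "z \<in> Sp m" and j: "1 \<le> j" "j \<le> Suc m" for z j
  proof -
    have i: "i \<in> {1..<r}" "i \<le> m" using Suc.prems by auto
    have W: "[j..<Suc m] \<in> W" "[i] \<in> W" using Suc.prems j by (auto simp: W_upt simp del: upt_Suc)
    have zc: "z \<in> carrier H" by (rule Sp_closed[OF z]) (use Suc.prems in simp)
    have assoc: "hw [i] \<otimes>\<^bsub>H\<^esub> (hw [j..<Suc m] \<otimes>\<^bsub>H\<^esub> z) = hw (i # [j..<Suc m]) \<otimes>\<^bsub>H\<^esub> z"
      using W i zc by (simp add: H.m_assoc hw_Cons[of i "[j..<Suc m]"] del: upt_Suc)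
    consider "Suc i < j" | "Suc i = j" | "i = j" | "j < i" by linarith
    then show ?thesis
    proof cases
      case 1
      have "hw (i # [j..<Suc m]) = hw ([j..<Suc m] @ [i])"
        using 1 i W by (intro T_comm_word) auto
      then have "hw [i] \<otimes>\<^bsub>H\<^esub> (hw [j..<Suc m] \<otimes>\<^bsub>H\<^esub> z) = hw [j..<Suc m] \<otimes>\<^bsub>H\<^esub> (hw [i] \<otimes>\<^bsub>H\<^esub> z)"
        unfolding assoc using W zc by (simp add: hw_append H.m_assoc del: upt_Suc)
      moreover have "hw [i] \<otimes>\<^bsub>H\<^esub> z \<in> Sp m" using 1 Suc.prems j z by (intro Suc.IH) auto
      ultimately show ?thesis using Suc.prems j by (simp add: Sp_cycle del: upt_Suc)
    next
      case 2
      then have "i # [j..<Suc m] = [i..<Suc m]" using i by (simp add: upt_conv_Cons del: upt_Suc)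
      then show ?thesis unfolding assoc using Suc.prems i z
        using Sp_cycle[OF z, of i] by (simp del: upt_Suc)
    next
      case 3
      have up: "[j..<Suc m] = i # [Suc i..<Suc m]" using 3 i by (simp add: upt_conv_Cons del: upt_Suc)
      have W': "[Suc i..<Suc m] \<in> W" using W unfolding up by simp
      have l: "qq \<in> laurent" "qq - 1 \<in> laurent"
        using laurent_1 laurent_qq laurent_add[OF laurent_qq laurent_uminus[OF laurent_1]] by auto
      have "hw [i] \<otimes>\<^bsub>H\<^esub> (hw [j..<Suc m] \<otimes>\<^bsub>H\<^esub> z) = (hw [i] \<otimes>\<^bsub>H\<^esub> hw [i]) \<otimes>\<^bsub>H\<^esub> (hw [Suc i..<Suc m] \<otimes>\<^bsub>H\<^esub> z)"
        unfolding up using W W' i zc by (simp add: hw_Cons[of i "[Suc i..<Suc m]"] H.m_assoc del: upt_Suc)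
      also have "\<dots> = sc (qq - 1) \<otimes>\<^bsub>H\<^esub> (hw [j..<Suc m] \<otimes>\<^bsub>H\<^esub> z) \<oplus>\<^bsub>H\<^esub> sc qq \<otimes>\<^bsub>H\<^esub> (hw [Suc i..<Suc m] \<otimes>\<^bsub>H\<^esub> z)"
        unfolding T_quad[OF i(1)] up using W W' i zc l
        by (simp add: hw_Cons[of i "[Suc i..<Suc m]"] H.m_assoc H.l_distr del: upt_Suc)
      also have "\<dots> \<in> Sp (Suc m)"
        using Suc.prems z j 3 l i by (intro Sp.add Sp_sc Sp_cycle) auto
      finally show ?thesis .
    next
      case 4
      have "hw (i # [j..<Suc m]) = hw ([j..<Suc m] @ [i - 1])"
        using 4 i j Suc.prems by (intro T_cycle_shift) auto
      moreover have W2: "[i - 1] \<in> W" using 4 i j by auto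
      ultimately have "hw [i] \<otimes>\<^bsub>H\<^esub> (hw [j..<Suc m] \<otimes>\<^bsub>H\<^esub> z) = hw [j..<Suc m] \<otimes>\<^bsub>H\<^esub> (hw [i - 1] \<otimes>\<^bsub>H\<^esub> z)"
        unfolding assoc using W zc by (simp add: hw_append H.m_assoc del: upt_Suc)
      moreover have "hw [i - 1] \<otimes>\<^bsub>H\<^esub> z \<in> Sp m" using 4 Suc.prems j z i by (intro Suc.IH) auto
      ultimately show ?thesis using Suc.prems j by (simp add: Sp_cycle del: upt_Suc)
    qed
  qed
  have iW: "[i] \<in> W" using Suc.prems by auto
  from Suc.prems(2) show ?case
  proof (induction rule: Sp.induct)
    case (gen a u)
    then obtain j v where u: "u = [j..<Suc m] @ v" "1 \<le> j" "j \<le> Suc m" "v \<in> NF m" by auto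
    have vW: "v \<in> W" "[j..<Suc m] \<in> W" using NF_W[OF u(4)] Suc.prems u by (auto simp: W_upt simp del: upt_Suc)
    have "sc 1 \<otimes>\<^bsub>H\<^esub> hw v \<in> Sp m" by (rule Sp.gen[OF laurent_1 u(4)])
    then have "hw v \<in> Sp m" using vW by (simp add: sc_one)
    then have "sc a \<otimes>\<^bsub>H\<^esub> (hw [i] \<otimes>\<^bsub>H\<^esub> (hw [j..<Suc m] \<otimes>\<^bsub>H\<^esub> hw v)) \<in> Sp (Suc m)"
      using key u Suc.prems gen by (intro Sp_sc) auto
    moreover have "sc a \<otimes>\<^bsub>H\<^esub> (hw [i] \<otimes>\<^bsub>H\<^esub> (hw [j..<Suc m] \<otimes>\<^bsub>H\<^esub> hw v)) = hw [i] \<otimes>\<^bsub>H\<^esub> (sc a \<otimes>\<^bsub>H\<^esub> hw u)"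
      using iW vW gen u sc_central[of a "hw [i]"]
      by (simp add: hw_append flip: H.m_assoc del: upt_Suc)
    ultimately show ?case by simp
  qed (use iW Suc.prems in \<open>auto simp: Sp.zero Sp.add H.r_distr Sp_closed\<close>)
qed simp

lemma Sp_all: "h \<in> carrier H \<Longrightarrow> h \<in> Sp r"
proof (induction h rule: hecke_induct)
  case (single a w)
  have "[] \<in> NF m" for m
  proof (induction m)
    case (Suc m)
    then have "[Suc m..<Suc m] @ [] \<in> NF (Suc m)"
      by (subst NF.simps(2), intro CollectI exI[of _ "Suc m"] exI[of _ "[]"]) (simp del: upt_Suc)
    then show ?case by (simp del: NF.simps)
  qed simp
  then have "sc 1 \<otimes>\<^bsub>H\<^esub> hw [] \<in> Sp r" by (intro Sp.gen laurent_1)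
  then have one: "\<one>\<^bsub>H\<^esub> \<in> Sp r" by (simp add: sc_one hw_Nil)
  have "hw w \<in> Sp r" using single(2)
  proof (induction w)
    case (Cons i w)
    then have i: "i \<in> {1..<r}" and w: "w \<in> W" and "hw w \<in> Sp r" by auto
    then have "hw [i] \<otimes>\<^bsub>H\<^esub> hw w \<in> Sp r" by (intro Sp_T) auto
    then show ?case by (simp only: hw_Cons[OF i w])
  qed (simp add: hw_Nil one)
  then show ?case using single by (simp add: Sp_sc)
qed (auto simp: Sp.zero Sp.add)

text \<open>Both facts are inherited from the normal words, which span and whose functions are
  deltas at permutations.\<close>

lemma kap_laurent: "h \<in> carrier H \<Longrightarrow> kap h f \<in> laurent"
  and kap_supp: "h \<in> carrier H \<Longrightarrow> \<not> f permutes {1..r} \<Longrightarrow> kap h f = 0"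
proof -
  have "h \<in> Sp r \<Longrightarrow> kap h f \<in> laurent \<and> (\<not> f permutes {1..r} \<longrightarrow> kap h f = 0)" for h f
  proof (induction rule: Sp.induct)
    case (add x y) then show ?case by (auto simp: kap_add Sp_closed laurent_add)
  next
    case (gen a u)
    have p: "wfun u permutes {1..r}" using gen NF_lists[of u r] by (intro wfun_permutes) auto
    have u: "u \<in> W" using NF_W[OF gen(2)] by simp
    have "kap (sc a \<otimes>\<^bsub>H\<^esub> hw u) f = a * pdelta (wfun u) f"
      using gen u by (simp add: kap_sc kap_hw NF_Lword[OF gen(2)])
    then show ?case using gen(1) p laurent_0 by (cases "f = wfun u") (simp_all add: pdelta_def)
  qed (auto simp: kap_zero laurent_0)
  then show "h \<in> carrier H \<Longrightarrow> kap h f \<in> laurent"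
    "h \<in> carrier H \<Longrightarrow> \<not> f permutes {1..r} \<Longrightarrow> kap h f = 0" using Sp_all by auto
qed

text \<open>Normal words span by \<open>Sp_all\<close> and are sent to deltas at distinct
  permutations, so \<open>\<sigma>\<close> rebuilds an element from its function. This is the
  faithfulness of the action and the independence of the standard basis in one.\<close>

lemma kap_inj:
  assumes "h \<in> carrier H" "h' \<in> carrier H" "\<And>f. f permutes {1..r} \<Longrightarrow> kap h f = kap h' f"
  shows "h = h'"
proof -
  define \<sigma> where "\<sigma> y = finsum H (\<lambda>u. sc (y (wfun u)) \<otimes>\<^bsub>H\<^esub> hw u) (NF r)" for y
  have W: "u \<in> W" if "u \<in> NF r" for u using NF_W that by auto
  have inv: "\<sigma> (kap h) = h" if "h \<in> Sp r" for h
    using that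
  proof (induction rule: Sp.induct)
    case zero
    have "\<sigma> (kap \<zero>\<^bsub>H\<^esub>) = finsum H (\<lambda>u. \<zero>\<^bsub>H\<^esub>) (NF r)"
      unfolding \<sigma>_def by (intro H.add.finprod_cong') (auto simp: kap_zero sc_zero W)
    then show ?case by simp
  next
    case (add x y)
    have c: "x \<in> carrier H" "y \<in> carrier H" using add Sp_closed by auto
    have "\<sigma> (kap (x \<oplus>\<^bsub>H\<^esub> y)) = finsum H (\<lambda>u. sc (kap x (wfun u)) \<otimes>\<^bsub>H\<^esub> hw u \<oplus>\<^bsub>H\<^esub> sc (kap y (wfun u)) \<otimes>\<^bsub>H\<^esub> hw u) (NF r)"
      unfolding \<sigma>_def using c
      by (intro H.add.finprod_cong') (auto simp: kap_add sc_add kap_laurent W H.l_distr)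
    also have "\<dots> = \<sigma> (kap x) \<oplus>\<^bsub>H\<^esub> \<sigma> (kap y)"
      unfolding \<sigma>_def using c by (intro H.finsum_addf) (auto simp: kap_laurent W)
    finally show ?case using add by simp
  next
    case (gen a u)
    have "\<sigma> (kap (sc a \<otimes>\<^bsub>H\<^esub> hw u)) = finsum H (\<lambda>v. if u = v then sc a \<otimes>\<^bsub>H\<^esub> hw v else \<zero>\<^bsub>H\<^esub>) (NF r)"
      unfolding \<sigma>_def
    proof (intro H.add.finprod_cong')
      fix v assume v: "v \<in> NF r"
      then have "wfun v = wfun u \<longleftrightarrow> v = u" using gen inj_onD[OF wfun_inj_NF] by blast
      then show "sc (kap (sc a \<otimes>\<^bsub>H\<^esub> hw u) (wfun v)) \<otimes>\<^bsub>H\<^esub> hw v = (if u = v then sc a \<otimes>\<^bsub>H\<^esub> hw v else \<zero>\<^bsub>H\<^esub>)"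
        using gen v by (auto simp: kap_sc kap_hw W NF_Lword pdelta_def sc_zero)
    qed (use gen W in auto)
    also have "\<dots> = sc a \<otimes>\<^bsub>H\<^esub> hw u" using gen W finite_NF by (intro H.add.finprod_singleton) auto
    finally show ?case .
  qed
  have "kap h = kap h'"
  proof
    fix f show "kap h f = kap h' f"
      using assms kap_supp[of h f] kap_supp[of h' f] by (cases "f permutes {1..r}") auto
  qed
  then have "\<sigma> (kap h) = \<sigma> (kap h')" by (rule arg_cong)
  then show ?thesis unfolding inv[OF Sp_all[OF assms(1)]] inv[OF Sp_all[OF assms(2)]] .
qed

end

section \<open>The standard basis and the anti-involution\<close>

definition inversions :: "nat \<Rightarrow> (nat \<Rightarrow> nat) \<Rightarrow> (nat \<times> nat) set" where
  "inversions r f = {(a, b). 1 \<le> a \<and> a < b \<and> b \<le> r \<and> f b < f a}"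

abbreviation ninv :: "nat \<Rightarrow> (nat \<Rightarrow> nat) \<Rightarrow> nat" where
  "ninv r f \<equiv> card (inversions r f)"

lemma finite_inversions: "finite (inversions r f)"
  by (rule finite_subset[of _ "{1..r} \<times> {1..r}"]) (auto simp: inversions_def)

lemma sw_less: "a < b \<Longrightarrow> (a, b) \<noteq> (i, Suc i) \<Longrightarrow> sw i a < sw i b"
  by (auto simp: transpose_def)

lemma sw_less_iff:
  assumes "a \<noteq> b" "{a, b} \<noteq> {i, Suc i}" shows "sw i a < sw i b \<longleftrightarrow> a < b"
proof (cases "a < b")
  case True
  then show ?thesis using sw_less[of a b i] assms by auto
next
  case False
  then have "sw i b < sw i a" using sw_less[of b a i] assms by (auto simp: insert_commute)
  then show ?thesis using False by simp
qed

text \<open>Swapping positions \<open>i\<close> and \<open>Suc i\<close> preserves the order of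
  every other pair of positions, hence carries the old inversions injectively to inversions; the
  pair \<open>(i, Suc i)\<close> is the one new inversion.\<close>

lemma ninv_swap:
  assumes "1 \<le> i" "i < r" "f i < f (Suc i)"
  shows "ninv r (f \<circ> sw i) = Suc (ninv r f)"
proof -
  let ?m = "\<lambda>(a, b). (sw i a, sw i b)"
  have rng: "1 \<le> sw i a \<longleftrightarrow> 1 \<le> a" "sw i a \<le> r \<longleftrightarrow> a \<le> r" for a
    using assms by (auto simp: transpose_def)
  have "inversions r (f \<circ> sw i) = insert (i, Suc i) (?m ` inversions r f)"
  proof (intro equalityI subsetI)
    fix p assume "p \<in> inversions r (f \<circ> sw i)"
    then obtain a b where p: "p = (a, b)" "1 \<le> a" "a < b" "b \<le> r" "f (sw i b) < f (sw i a)"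
      by (auto simp: inversions_def)
    show "p \<in> insert (i, Suc i) (?m ` inversions r f)"
    proof (cases "(a, b) = (i, Suc i)")
      case False
      then have "(sw i a, sw i b) \<in> inversions r f"
        using p rng sw_less[of a b i] by (auto simp: inversions_def)
      then have "?m (sw i a, sw i b) \<in> ?m ` inversions r f" by (rule imageI)
      then show ?thesis by (simp add: p)
    qed (simp add: p)
  next
    fix p assume "p \<in> insert (i, Suc i) (?m ` inversions r f)"
    then consider "p = (i, Suc i)" | a b where "(a, b) \<in> inversions r f" "p = (sw i a, sw i b)" by auto
    then show "p \<in> inversions r (f \<circ> sw i)"
    proof cases
      case 1 then show ?thesis using assms by (auto simp: inversions_def)
    next
      case (2 a b)
      then have "(a, b) \<noteq> (i, Suc i)" using assms by (auto simp: inversions_def)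
      then show ?thesis using 2 rng sw_less[of a b i] by (auto simp: inversions_def)
    qed
  qed
  moreover have "(i, Suc i) \<notin> ?m ` inversions r f"
  proof
    assume "(i, Suc i) \<in> ?m ` inversions r f"
    then obtain a b where "(a, b) \<in> inversions r f" "i = sw i a" "Suc i = sw i b" by auto
    then have "a = Suc i" "b = i" "a < b" by (auto simp: inversions_def transpose_def split: if_splits)
    then show False by simp
  qed
  moreover have "inj_on ?m (inversions r f)"
    by (rule inj_onI) (auto, (metis transpose_involutory)+)
  ultimately show ?thesis by (simp add: finite_inversions card_image)
qed

lemma ninv_swap_desc:
  assumes "1 \<le> i" "i < r" "f (Suc i) < f i"
  shows "ninv r f = Suc (ninv r (f \<circ> sw i))"
  using ninv_swap[of i r "f \<circ> sw i"] assms by (simp add: comp_assoc)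

text \<open>Strict growth forces \<open>i \<le> f i\<close> for every \<open>i\<close>, which a
  permutation of an initial segment satisfies only as the identity.\<close>

lemma ascending_permutes_id:
  assumes "f permutes {1..r}" "\<And>i. 1 \<le> i \<Longrightarrow> i < r \<Longrightarrow> f i < f (Suc i)"
  shows "f = id"
proof -
  have "i \<le> f i" if "1 \<le> i" "i \<le> r" for i
    using that
  proof (induction i rule: nat_induct_at_least)
    case base
    then show ?case using permutes_in_image[OF assms(1), of 1] by auto
  next
    case (Suc i) then show ?case using assms(2)[of i] by simp
  qed
  then show ?thesis using permutes_natset_ge[OF assms(1)] by auto
qed

lemma permutes_ne_Suc: "f permutes {1..r} \<Longrightarrow> f i \<noteq> f (Suc i)"
  by (metis n_not_Suc_n permutes_inj injD)

lemma permutes_comp_sw: "f permutes {1..r} \<Longrightarrow> 1 \<le> i \<Longrightarrow> i < r \<Longrightarrow> f \<circ> sw i permutes {1..r}"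
  by (rule permutes_compose[of "sw i" _ f]) (auto intro: permutes_swap_id)

lemma permutes_sw_comp: "f permutes {1..r} \<Longrightarrow> 1 \<le> i \<Longrightarrow> i < r \<Longrightarrow> sw i \<circ> f permutes {1..r}"
  by (rule permutes_compose[of f _ "sw i"]) (auto intro: permutes_swap_id)

lemma pinv_comp_sw: "bij f \<Longrightarrow> pinv (f \<circ> sw i) = sw i \<circ> pinv f"
  by (subst o_inv_distrib) auto

lemma pinv_sw_comp: "bij f \<Longrightarrow> pinv (sw i \<circ> f) = pinv f \<circ> sw i"
  by (subst o_inv_distrib) auto

text \<open>Right multiplication by T_i in the same encoding: w s_i corresponds to
  \<open>sw i \<circ> f\<close>, and its length is decided by the values of w, that is of
  \<open>pinv f\<close>, at \<open>i\<close> and \<open>Suc i\<close>.\<close>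

definition Rop :: "nat \<Rightarrow> pfun \<Rightarrow> pfun" where
  "Rop i y f = (if pinv f i < pinv f (Suc i) then qq * y (sw i \<circ> f) else y (sw i \<circ> f) + (qq - 1) * y f)"

text \<open>Associativity at the level of operators. A swap on one side leaves the comparison made
  on the other side unchanged, unless \<open>f\<close> maps the pair \<open>j, Suc j\<close> onto
  \<open>i, Suc i\<close>.\<close>

lemma Lop_Rop_comm:
  assumes "bij f" shows "Lop j (Rop i y) f = Rop i (Lop j y) f"
proof -
  let ?p = "pinv f"
  have pf: "?p (f x) = x" "f (?p x) = x" for x
    using assms by (simp_all add: bij_is_inj bij_is_surj surj_f_inv_f)
  have b: "bij (f \<circ> sw j)" "bij (sw i \<circ> f)" using assms by (auto intro: bij_comp)
  have pc: "pinv (f \<circ> sw j) = sw j \<circ> ?p" "pinv (sw i \<circ> f) = ?p \<circ> sw i"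
    using assms by (simp_all add: pinv_comp_sw pinv_sw_comp)
  consider (A) "{f j, f (Suc j)} \<noteq> {i, Suc i}" | (B) "f j = i" "f (Suc j) = Suc i" | (C) "f j = Suc i" "f (Suc j) = i"
    by (auto simp: doubleton_eq_iff)
  then show ?thesis
  proof cases
    case A
    have "{?p i, ?p (Suc i)} \<noteq> {j, Suc j}" 
    proof
      assume "{?p i, ?p (Suc i)} = {j, Suc j}"
      then have "f ` {?p i, ?p (Suc i)} = f ` {j, Suc j}" by simp
      then show False using A pf by simp
    qed
    moreover have "?p i \<noteq> ?p (Suc i)" using pf by (metis n_not_Suc_n)
    ultimately have c1: "(sw j \<circ> ?p) i < (sw j \<circ> ?p) (Suc i) \<longleftrightarrow> ?p i < ?p (Suc i)"
      using sw_less_iff by simp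
    have "f j \<noteq> f (Suc j)" using pf by (metis n_not_Suc_n)
    then have c2: "(sw i \<circ> f) j < (sw i \<circ> f) (Suc j) \<longleftrightarrow> f j < f (Suc j)"
      using A sw_less_iff by simp
    show ?thesis unfolding Lop_def Rop_def pc c1 c2 comp_assoc by (simp add: algebra_simps)
  next
    case B
    \<comment> \<open>In the exceptional position the two swaps have the same effect on
      \<open>f\<close>, so both sides are expressions in the values of \<open>y\<close> at
      \<open>f\<close> and \<open>h\<close> alone.\<close>
    have eq: "sw i \<circ> f = f \<circ> sw j"
    proof
      fix x show "(sw i \<circ> f) x = (f \<circ> sw j) x"
        using B pf(1)[of x] pf(1) by (auto simp: transpose_def) (metis pf(1))+
    qed
    have p: "?p i = j" "?p (Suc i) = Suc j" using B pf(1) by metis+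
    define h where "h = f \<circ> sw j"
    have sf: "f (sw j x) = sw i (f x)" for x using fun_cong[OF eq, of x] by simp
    have e: "f \<circ> sw j = h" "sw i \<circ> f = h" "sw i \<circ> h = f" "h \<circ> sw j = f"
      by (simp_all add: h_def eq) (simp_all add: fun_eq_iff sf)
    have hv: "h j = f (Suc j)" "h (Suc j) = f j" by (simp_all add: h_def)
    have ph: "pinv h x = sw j (?p x)" for x using pc(1) by (simp add: h_def)
    show ?thesis unfolding Lop_def Rop_def e hv ph by (simp add: B p algebra_simps)
  next
    case C
    have eq: "sw i \<circ> f = f \<circ> sw j"
    proof
      fix x show "(sw i \<circ> f) x = (f \<circ> sw j) x"
        using C pf(1)[of x] pf(1) by (auto simp: transpose_def) (metis pf(1))+
    qed
    have p: "?p i = Suc j" "?p (Suc i) = j" using C pf(1) by metis+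
    define h where "h = f \<circ> sw j"
    have sf: "f (sw j x) = sw i (f x)" for x using fun_cong[OF eq, of x] by simp
    have e: "f \<circ> sw j = h" "sw i \<circ> f = h" "sw i \<circ> h = f" "h \<circ> sw j = f"
      by (simp_all add: h_def eq) (simp_all add: fun_eq_iff sf)
    have hv: "h j = f (Suc j)" "h (Suc j) = f j" by (simp_all add: h_def)
    have ph: "pinv h x = sw j (?p x)" for x using pc(1) by (simp add: h_def)
    show ?thesis unfolding Lop_def Rop_def e hv ph by (simp add: C p algebra_simps)
  qed
qed

context hecke_rank
begin

abbreviation "P \<equiv> {f. f permutes {1..r}}"
abbreviation "Tw \<equiv> hecke_T r"

lemma finite_P: "finite P" by (simp add: finite_permutations)

lemma W_set: "w \<in> W \<longleftrightarrow> set w \<subseteq> {1..<r}" by (auto simp: W_def)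

text \<open>Each letter changes the number of inversions by one. A word whose length equals that
  number therefore climbs at every letter, and each operator just moves the delta.\<close>

lemma ninv_wfun_aux: "w \<in> W \<Longrightarrow> wfun w = f \<Longrightarrow> y = pdelta id \<Longrightarrow> ninv r f \<le> length w \<and>
  (ninv r f = length w \<longrightarrow> Lword w y = pdelta f)"
proof (induction w arbitrary: f)
  case Nil
  have "inversions r id = {}" by (auto simp: inversions_def)
  moreover have f: "f = id" using Nil.prems(2) by (simp add: fun_eq_iff)
  ultimately have "ninv r f = 0" by simp
  moreover have "Lword [] y = pdelta f" unfolding f Lword_simps by (rule Nil.prems(3))
  ultimately show ?case by simp
next
  case (Cons i w)
  then have i: "1 \<le> i" "i < r" and w: "w \<in> W" by auto
  obtain g where g: "wfun w = g" by simp
  have gp: "g permutes {1..r}" using w g wfun_permutes[of w r] by (simp add: W_set)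
  have f: "f = g \<circ> sw i" using Cons.prems(2) g by (simp add: fun_eq_iff)
  have IH: "ninv r g \<le> length w" "ninv r g = length w \<Longrightarrow> Lword w y = pdelta g"
    using Cons.IH[OF w g Cons.prems(3)] by auto
  show ?case
  proof (cases "g i < g (Suc i)")
    case True
    have "ninv r f = Suc (ninv r g)" "Lop i (pdelta g) = pdelta f"
      unfolding f by (rule ninv_swap[OF i True], rule Lop_pdelta[OF True])
    then show ?thesis using IH by simp
  next
    case False
    then have "g (Suc i) < g i" using permutes_ne_Suc[OF gp, of i] by simp
    then have "ninv r g = Suc (ninv r f)" unfolding f by (rule ninv_swap_desc[OF i])
    then show ?thesis using IH(1) by simp
  qed
qed

lemma ninv_wfun_le: "w \<in> W \<Longrightarrow> ninv r (wfun w) \<le> length w \<and>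
  (ninv r (wfun w) = length w \<longrightarrow> Lword w (pdelta id) = pdelta (wfun w))"
  by (rule ninv_wfun_aux) auto

lemma ninv_word_exists: "f \<in> P \<Longrightarrow> \<exists>w\<in>W. wfun w = f \<and> length w = ninv r f"
proof (induction "ninv r f" arbitrary: f)
  case 0
  have "f i < f (Suc i)" if "1 \<le> i" "i < r" for i
  proof (rule ccontr)
    assume "\<not> ?thesis"
    then have "f (Suc i) < f i" using permutes_ne_Suc[of f r i] 0 by simp
    then show False using ninv_swap_desc[of i r f] that 0(1) by simp
  qed
  then have "f = id" using ascending_permutes_id[of f r] 0 by auto
  then show ?case using 0 by (intro bexI[of _ "[]"]) auto
next
  case (Suc k)
  have "\<exists>i. 1 \<le> i \<and> i < r \<and> f (Suc i) < f i"
  proof (rule ccontr)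
    assume "\<not> ?thesis"
    then have "f = id" using ascending_permutes_id[of f r] Suc.prems permutes_ne_Suc[of f r]
      by (metis linorder_neqE_nat mem_Collect_eq)
    then have "inversions r f = {}" by (auto simp: inversions_def)
    then show False using Suc.hyps(2) by simp
  qed
  then obtain i where i: "1 \<le> i" "i < r" "f (Suc i) < f i" by auto
  then have "\<exists>w\<in>W. wfun w = f \<circ> sw i \<and> length w = ninv r (f \<circ> sw i)"
    using Suc ninv_swap_desc[OF i] permutes_comp_sw[of f r i] by (intro Suc.hyps(1)) auto
  then obtain w where "w \<in> W" "wfun w = f \<circ> sw i" "length w = ninv r (f \<circ> sw i)" by auto
  then show ?case using i ninv_swap_desc[OF i] by (intro bexI[of _ "i # w"]) (auto simp: comp_assoc)
qed

lemma reduced_wordD: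
  assumes "w \<in> P" "reduced_word r w u"
  shows "u \<in> W" "wfun u = pinv w" "length u = ninv r (pinv w)"
proof -
  show u: "u \<in> W" using assms by (simp add: reduced_word_def W_def)
  show wu: "wfun u = pinv w" using assms by (simp add: reduced_word_def wfun_inv)
  obtain v where v: "v \<in> W" "wfun v = pinv w" "length v = ninv r (pinv w)"
    using ninv_word_exists[of "pinv w"] assms permutes_inv by auto
  have "word_perm v = w"
    using v(2) assms(1) bij_word_perm[of v] unfolding wfun_inv by (metis inv_inv_eq mem_Collect_eq permutes_bij)
  then have "length u \<le> length v" using assms v(1) by (auto simp: reduced_word_def W_def)
  moreover have "ninv r (wfun u) \<le> length u" using ninv_wfun_le[OF u] by simp
  ultimately show "length u = ninv r (pinv w)" using v(3) wu by simp
qed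

lemma reduced_word_some:
  assumes "w \<in> P" shows "reduced_word r w (SOME u. reduced_word r w u)"
proof -
  obtain v where v: "v \<in> W" "wfun v = pinv w" "length v = ninv r (pinv w)"
    using ninv_word_exists[of "pinv w"] assms permutes_inv by auto
  have "length v \<le> length u" if "u \<in> W" "word_perm u = w" for u
    using ninv_wfun_le[OF that(1)] that v by (simp add: wfun_inv)
  moreover have "word_perm v = w"
    using v(2) assms(1) bij_word_perm[of v] unfolding wfun_inv by (metis inv_inv_eq mem_Collect_eq permutes_bij)
  ultimately have "reduced_word r w v" using v(1) by (auto simp: reduced_word_def W_def)
  then show ?thesis by (rule someI)
qed

text \<open>Any reduced word of \<open>w\<close> has as its function the delta at the inverse of
  \<open>w\<close>; by \<open>kap_inj\<close> the element does not depend on which reduced word is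
  chosen.\<close>

lemma Tw_closed: "w \<in> P \<Longrightarrow> Tw w \<in> carrier H"
  and kap_Tw: "w \<in> P \<Longrightarrow> kap (Tw w) = pdelta (pinv w)"
proof -
  assume w: "w \<in> P"
  define u where "u = (SOME u. reduced_word r w u)"
  have Tu: "Tw w = hw u" by (simp add: hecke_T_def hw_def u_def)
  note u = reduced_wordD[OF w reduced_word_some[OF w], folded u_def]
  show "Tw w \<in> carrier H" using u(1) by (simp add: Tu)
  show "kap (Tw w) = pdelta (pinv w)"
    using ninv_wfun_le[OF u(1)] u by (simp add: Tu kap_hw)
qed

lemma kap_surj:
  assumes "\<And>f. y f \<in> laurent" "\<And>f. f \<notin> P \<Longrightarrow> y f = 0"
  shows "\<exists>h\<in>carrier H. kap h = y"
proof -
  define h where "h = finsum H (\<lambda>g. sc (y g) \<otimes>\<^bsub>H\<^esub> Tw (pinv g)) P"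
  have cl: "sc (y g) \<otimes>\<^bsub>H\<^esub> Tw (pinv g) \<in> carrier H" if "g \<in> P" for g
  proof -
    have "pinv g \<in> P" using that permutes_inv by auto
    then show ?thesis using assms(1) Tw_closed by simp
  qed
  have "h \<in> carrier H" unfolding h_def using cl by (intro H.finsum_closed) auto
  moreover have "kap h f = y f" for f
  proof -
    have "kap h f = (\<Sum>g\<in>P. kap (sc (y g) \<otimes>\<^bsub>H\<^esub> Tw (pinv g)) f)"
      unfolding h_def by (rule kap_finsum[OF finite_P cl])
    also have "\<dots> = (\<Sum>g\<in>P. if f = g then y g else 0)"
    proof (rule sum.cong[OF refl])
      fix g assume g: "g \<in> P"
      then have "pinv g \<in> P" "pinv (pinv g) = g" using permutes_inv permutes_inv_inv by auto
      then show "kap (sc (y g) \<otimes>\<^bsub>H\<^esub> Tw (pinv g)) f = (if f = g then y g else 0)"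
        using assms(1) by (simp add: kap_sc Tw_closed kap_Tw pdelta_def)
    qed
    also have "\<dots> = y f" using finite_P assms(2)[of f] by (simp add: sum.delta)
    finally show ?thesis .
  qed
  ultimately show ?thesis by blast
qed

text \<open>Proved on words by induction from the left: each left letter is pulled out through
  \<open>Rop\<close> by \<open>Lop_Rop_comm\<close>. Only bijective \<open>f\<close> are considered
  because \<open>Rop\<close> refers to the inverse of \<open>f\<close>.\<close>

lemma kap_T_right:
  assumes "i \<in> {1..<r}" "h \<in> carrier H" "f \<in> P"
  shows "kap (h \<otimes>\<^bsub>H\<^esub> hw [i]) f = Rop i (kap h) f"
proof -
  have iW: "[i] \<in> W" using assms by simp
  have word: "kap (hw w \<otimes>\<^bsub>H\<^esub> hw [i]) f = Rop i (kap (hw w)) f" if "w \<in> W" "f \<in> P" for w f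
    using that
  proof (induction w arbitrary: f)
    case Nil
    then have f: "f permutes {1..r}" by simp
    then have pf: "f (pinv f x) = x" for x by (simp add: permutes_inverses)
    have k1: "kap (hw [i]) = pdelta (sw i)"
      using iW Lop_pdelta[of id i] by (simp add: kap_hw)
    have e: "sw i \<circ> f = id \<longleftrightarrow> f = sw i"
      by (metis comp_assoc comp_id id_comp transpose_comp_involutory)
    have "pdelta id \<noteq> (\<lambda>_. 0)" by (auto simp: pdelta_def fun_eq_iff)
    have ne: "sw i \<noteq> id" by (metis id_apply n_not_Suc_n transpose_apply_first)
    show ?case
    proof (cases "f = sw i")
      case True
      have "pinv f i = Suc i" "pinv f (Suc i) = i" by (simp_all add: True)
      then show ?thesis using True iW ne e by (simp add: hw_Nil k1 Rop_def kap_hw[of "[]", unfolded hw_Nil] pdelta_def)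
    next
      case False
      then show ?thesis using iW e by (auto simp: hw_Nil k1 Rop_def kap_hw[of "[]", unfolded hw_Nil] pdelta_def)
    qed
  next
    case (Cons j w)
    then have j: "j \<in> {1..<r}" and w: "w \<in> W" and f: "f permutes {1..r}" by auto
    have fj: "f \<circ> sw j \<in> P" using permutes_comp_sw[of f r j] f j by simp
    have "kap (hw (j # w) \<otimes>\<^bsub>H\<^esub> hw [i]) f = Lop j (kap (hw w \<otimes>\<^bsub>H\<^esub> hw [i])) f"
      using j w iW hw_Cons[OF j w] by (simp add: H.m_assoc kap_T_mult)
    also have "\<dots> = Lop j (Rop i (kap (hw w))) f"
    proof -
      have "kap (hw w \<otimes>\<^bsub>H\<^esub> hw [i]) (f \<circ> sw j) = Rop i (kap (hw w)) (f \<circ> sw j)"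
        by (rule Cons.IH[OF w fj])
      moreover have "kap (hw w \<otimes>\<^bsub>H\<^esub> hw [i]) f = Rop i (kap (hw w)) f"
        by (rule Cons.IH[OF w Cons.prems(2)])
      ultimately show ?thesis unfolding Lop_def by (simp only:)
    qed
    also have "\<dots> = Rop i (Lop j (kap (hw w))) f" using f by (intro Lop_Rop_comm permutes_bij)
    also have "Lop j (kap (hw w)) = kap (hw (j # w))"
      using j w by (simp add: kap_hw)
    finally show ?case .
  qed
  from assms(2) show ?thesis
  proof (induction h rule: hecke_induct)
    case zero then show ?case using iW by (simp add: kap_zero Rop_def)
  next
    case (add x y)
    then show ?case using iW by (simp add: H.l_distr kap_add Rop_def algebra_simps)
  next
    case (single a w)
    then show ?case using iW word[OF single(2) assms(3)]
      by (simp add: H.m_assoc kap_sc Rop_def algebra_simps)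
  qed
qed

text \<open>The anti-involution sending T_w to T_v with v the inverse of w, defined by its effect on
  coefficients; \<open>kap_surj\<close> provides the element and \<open>kap_inj\<close> makes it
  unique. It transfers statements about left ideals and columns to right ideals and rows.\<close>

definition star :: "hecke_elt \<Rightarrow> hecke_elt" where
  "star h = (SOME h'. h' \<in> carrier H \<and> kap h' = (\<lambda>f. if f \<in> P then kap h (pinv f) else 0))"

lemma star_closed: "h \<in> carrier H \<Longrightarrow> star h \<in> carrier H"
  and kap_star: "h \<in> carrier H \<Longrightarrow> f \<in> P \<Longrightarrow> kap (star h) f = kap h (pinv f)"
proof -
  assume h: "h \<in> carrier H"
  have "\<exists>h'\<in>carrier H. kap h' = (\<lambda>f. if f \<in> P then kap h (pinv f) else 0)"
    using h by (intro kap_surj) (auto simp: kap_laurent laurent_0)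
  then have "star h \<in> carrier H \<and> kap (star h) = (\<lambda>f. if f \<in> P then kap h (pinv f) else 0)"
    unfolding star_def by (intro someI_ex[of "\<lambda>h'. h' \<in> carrier H \<and> kap h' = (\<lambda>f. if f \<in> P then kap h (pinv f) else 0)"]) auto
  then show "star h \<in> carrier H" "f \<in> P \<Longrightarrow> kap (star h) f = kap h (pinv f)" by auto
qed

lemma kap_eqI: "h \<in> carrier H \<Longrightarrow> h' \<in> carrier H \<Longrightarrow> (\<And>f. f \<in> P \<Longrightarrow> kap h f = kap h' f) \<Longrightarrow> h = h'"
  using kap_inj by auto

lemma pinv_P: "f \<in> P \<Longrightarrow> pinv f \<in> P" and pinv_pinv: "f \<in> P \<Longrightarrow> pinv (pinv f) = f"
  using permutes_inv permutes_inv_inv by auto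

lemma star_star: "h \<in> carrier H \<Longrightarrow> star (star h) = h"
  by (rule kap_eqI) (auto simp: star_closed kap_star pinv_P[simplified] pinv_pinv[simplified])

lemma star_add: "h \<in> carrier H \<Longrightarrow> h' \<in> carrier H \<Longrightarrow> star (h \<oplus>\<^bsub>H\<^esub> h') = star h \<oplus>\<^bsub>H\<^esub> star h'"
  by (rule kap_eqI) (auto simp: star_closed kap_star kap_add)

lemma star_sc: "h \<in> carrier H \<Longrightarrow> a \<in> laurent \<Longrightarrow> star (sc a \<otimes>\<^bsub>H\<^esub> h) = sc a \<otimes>\<^bsub>H\<^esub> star h"
  by (rule kap_eqI) (auto simp: star_closed kap_star kap_sc)

lemma star_zero: "star \<zero>\<^bsub>H\<^esub> = \<zero>\<^bsub>H\<^esub>"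
  by (rule kap_eqI) (auto simp: star_closed kap_star kap_zero)

text \<open>Inversion turns precomposition with a swap into postcomposition, and thereby
  \<open>Lop\<close> into \<open>Rop\<close>.\<close>

lemma star_T:
  assumes i: "i \<in> {1..<r}" and h: "h \<in> carrier H"
  shows "star (hw [i] \<otimes>\<^bsub>H\<^esub> h) = star h \<otimes>\<^bsub>H\<^esub> hw [i]"
proof (rule kap_eqI)
  fix f assume f: "f \<in> P"
  have if': "sw i \<circ> f \<in> P" using permutes_sw_comp[of f r i] f i by simp
  have e: "pinv f \<circ> sw i = pinv (sw i \<circ> f)"
    using f by (simp add: pinv_sw_comp permutes_bij)
  have "kap (star (hw [i] \<otimes>\<^bsub>H\<^esub> h)) f = Lop i (kap h) (pinv f)"
    using i h f by (simp add: kap_star kap_T_mult)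
  also have "\<dots> = Rop i (kap (star h)) f"
    unfolding Lop_def Rop_def e using kap_star[OF h f] kap_star[OF h if'] by simp
  finally show "kap (star (hw [i] \<otimes>\<^bsub>H\<^esub> h)) f = kap (star h \<otimes>\<^bsub>H\<^esub> hw [i]) f"
    using i h f by (simp add: kap_T_right star_closed)
qed (use i h in \<open>auto simp: star_closed\<close>)

lemma star_mult:
  assumes "h \<in> carrier H" "h' \<in> carrier H"
  shows "star (h \<otimes>\<^bsub>H\<^esub> h') = star h' \<otimes>\<^bsub>H\<^esub> star h"
proof -
  have star_one: "star \<one>\<^bsub>H\<^esub> = \<one>\<^bsub>H\<^esub>"
  proof (rule kap_eqI)
    fix f assume "f \<in> P"
    then have "pinv f = id \<longleftrightarrow> f = id" by (metis inv_id permutes_inv_inv mem_Collect_eq)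
    then show "kap (star \<one>\<^bsub>H\<^esub>) f = kap \<one>\<^bsub>H\<^esub> f"
      using \<open>f \<in> P\<close> kap_hw[of "[]"] by (simp add: kap_star hw_Nil pdelta_def)
  qed (auto simp: star_closed)
  have word: "star (hw w \<otimes>\<^bsub>H\<^esub> z) = star z \<otimes>\<^bsub>H\<^esub> star (hw w)" if "w \<in> W" "z \<in> carrier H" for w z
    using that
  proof (induction w arbitrary: z)
    case Nil then show ?case by (simp add: hw_Nil star_one star_closed)
  next
    case (Cons i w)
    then have i: "i \<in> {1..<r}" and w: "w \<in> W" by auto
    have "star (hw (i # w) \<otimes>\<^bsub>H\<^esub> z) = star (hw [i] \<otimes>\<^bsub>H\<^esub> (hw w \<otimes>\<^bsub>H\<^esub> z))"
      using i w Cons.prems hw_Cons[OF i w] by (simp add: H.m_assoc)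
    also have "\<dots> = star z \<otimes>\<^bsub>H\<^esub> star (hw w) \<otimes>\<^bsub>H\<^esub> hw [i]"
      using i w Cons by (simp add: star_T)
    also have "\<dots> = star z \<otimes>\<^bsub>H\<^esub> (star (hw [i] \<otimes>\<^bsub>H\<^esub> hw w))"
      using i w Cons.prems by (simp add: star_T star_closed H.m_assoc)
    finally show ?case using hw_Cons[OF i w] by simp
  qed
  from assms(1) show ?thesis
  proof (induction h rule: hecke_induct)
    case (single a w)
    then show ?case using assms(2)
      by (simp add: H.m_assoc star_sc word star_closed)
        (metis H.m_assoc sc_central sc_closed star_closed hw_closed)
  qed (use assms in \<open>auto simp: star_zero star_closed star_add H.l_distr H.r_distr\<close>)
qed

end

section \<open>Young subgroups\<close>

context hecke_rank
begin

abbreviation blockmono :: "(nat \<Rightarrow> nat) \<Rightarrow> bool" where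
  "blockmono c \<equiv> \<forall>i j. 1 \<le> i \<longrightarrow> i \<le> j \<longrightarrow> j \<le> r \<longrightarrow> c i \<le> c j"

text \<open>A Young subgroup as the stabilizer of a coloring of the positions. For the coloring by
  the blocks of a composition it is the subgroup of the statement, see
  \<open>young_eq\<close>.\<close>

definition Yg :: "(nat \<Rightarrow> nat) \<Rightarrow> (nat \<Rightarrow> nat) set" where
  "Yg c = {u \<in> P. \<forall>k\<in>{1..r}. c (u k) = c k}"

lemma YgD: "u \<in> Yg c \<Longrightarrow> u permutes {1..r}" "u \<in> Yg c \<Longrightarrow> k \<in> {1..r} \<Longrightarrow> c (u k) = c k"
  by (auto simp: Yg_def)

lemma finite_Yg: "finite (Yg c)" by (rule finite_subset[OF _ finite_P]) (auto simp: Yg_def)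

lemma Yg_id: "id \<in> Yg c" by (auto simp: Yg_def permutes_id)

lemma Yg_comp: "u \<in> Yg c \<Longrightarrow> v \<in> Yg c \<Longrightarrow> u \<circ> v \<in> Yg c"
  unfolding Yg_def by (auto intro: permutes_compose) (metis atLeastAtMost_iff permutes_in_image)

lemma Yg_pinv:
  assumes "u \<in> Yg c" shows "pinv u \<in> Yg c"
proof -
  have up: "u permutes {1..r}" by (rule YgD(1)[OF assms])
  have "c (pinv u k) = c k" if "k \<in> {1..r}" for k
  proof -
    have "pinv u k \<in> {1..r}" using that permutes_in_image[OF permutes_inv[OF up]] by blast
    then show ?thesis using YgD(2)[OF assms, of "pinv u k"] permutes_inverses(1)[OF up] by simp
  qed
  then show ?thesis unfolding Yg_def using permutes_inv[OF up] by blast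
qed

lemma Yg_sw: "i \<in> {1..<r} \<Longrightarrow> c i = c (Suc i) \<Longrightarrow> sw i \<in> Yg c"
  unfolding Yg_def by (auto simp: transpose_def intro!: permutes_swap_id)

text \<open>The blocks are intervals in increasing order and are preserved by \<open>u\<close>, so
  an ascent between different blocks is automatic; ascents inside the blocks then make
  \<open>u\<close> increasing.\<close>

lemma Yg_ascending_id:
  assumes c: "blockmono c" and u: "u \<in> Yg c"
    and asc: "\<And>i. i \<in> {1..<r} \<Longrightarrow> c i = c (Suc i) \<Longrightarrow> u i < u (Suc i)"
  shows "u = id"
proof (rule ascending_permutes_id)
  show "u permutes {1..r}" using YgD(1)[OF u] .
  fix i assume i: "1 \<le> i" "i < r"
  show "u i < u (Suc i)"
  proof (cases "c i = c (Suc i)")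
    case False
    then have "c i < c (Suc i)" using c i by (simp add: le_neq_implies_less)
    then have lt: "c (u i) < c (u (Suc i))" using YgD(2)[OF u] i by simp
    show ?thesis
    proof (rule ccontr)
      assume "\<not> ?thesis"
      moreover have "u i \<in> {1..r}" "u (Suc i) \<in> {1..r}"
        using permutes_in_image[OF YgD(1)[OF u]] i by simp_all
      ultimately have "c (u (Suc i)) \<le> c (u i)" using c by simp
      then show False using lt by simp
    qed
  qed (use asc i in auto)
qed

text \<open>A descent inside a block can be removed by a swap from the subgroup, which lowers the
  number of inversions.\<close>

lemma Yg_induct [consumes 2, case_names id step]:
  assumes c: "blockmono c" and u: "u \<in> Yg c"
    and "Q id"
    and step: "\<And>i v. i \<in> {1..<r} \<Longrightarrow> c i = c (Suc i) \<Longrightarrow> v \<in> Yg c \<Longrightarrow> v i < v (Suc i) \<Longrightarrow> Q v \<Longrightarrow> Q (v \<circ> sw i)"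
  shows "Q u"
  using u
proof (induction "ninv r u" arbitrary: u rule: less_induct)
  case less
  show ?case
  proof (cases "\<exists>i\<in>{1..<r}. c i = c (Suc i) \<and> u (Suc i) < u i")
    case True
    then obtain i where i: "i \<in> {1..<r}" "c i = c (Suc i)" "u (Suc i) < u i" by auto
    let ?v = "u \<circ> sw i"
    have v: "?v \<in> Yg c" using Yg_comp[OF less.prems Yg_sw[OF i(1,2)]] .
    have "ninv r ?v < ninv r u" using ninv_swap_desc[of i r u] i by simp
    then have "Q ?v" using v by (rule less.hyps)
    moreover have "?v i < ?v (Suc i)" using i(3) by simp
    ultimately have "Q (?v \<circ> sw i)" by (intro step[OF i(1,2) v])
    then show ?thesis by (simp add: comp_assoc)
  next
    case False
    have "u = id"
      using False permutes_ne_Suc[OF YgD(1)[OF less.prems]]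
      by (intro Yg_ascending_id[OF c less.prems]) (meson linorder_neqE_nat)
    then show ?thesis using \<open>Q id\<close> by simp
  qed
qed

lemma Yg_invariant:
  assumes c: "blockmono c" and u: "u \<in> Yg c" and f: "f \<in> P"
    and inv: "\<And>i f. i \<in> {1..<r} \<Longrightarrow> c i = c (Suc i) \<Longrightarrow> f \<in> P \<Longrightarrow> y (f \<circ> sw i) = y f"
  shows "y (f \<circ> u) = (y f :: 'b)"
  using c u
proof (induction u rule: Yg_induct)
  case (step i v)
  have "f \<circ> v \<in> P" using f YgD(1)[OF step(3)] permutes_compose by auto
  then have "y (f \<circ> v \<circ> sw i) = y (f \<circ> v)" using step(1,2) by (intro inv)
  also have "y (f \<circ> v) = y f" by (rule step(5))
  finally show ?case unfolding comp_assoc .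
qed simp

text \<open>Distinguished coset representatives: \<open>d\<close> is increasing on each block of
  \<open>c\<close>.\<close>

definition ascb :: "(nat \<Rightarrow> nat) \<Rightarrow> (nat \<Rightarrow> nat) \<Rightarrow> bool" where
  "ascb c d \<longleftrightarrow> (\<forall>a b. 1 \<le> a \<longrightarrow> a < b \<longrightarrow> b \<le> r \<longrightarrow> c a = c b \<longrightarrow> d a < d b)"

lemma ascb_step:
  assumes c: "blockmono c" and "\<And>i. i \<in> {1..<r} \<Longrightarrow> c i = c (Suc i) \<Longrightarrow> d i < d (Suc i)"
  shows "ascb c d"
  unfolding ascb_def
proof (intro allI impI)
  fix a b :: nat assume ab: "1 \<le> a" "a < b" "b \<le> r" "c a = c b"
  from ab(2) have "Suc a \<le> b" by simp
  then show "d a < d b" using ab(1,3,4)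
  proof (induction b rule: dec_induct)
    case base
    then show ?case using assms(2)[of a] by simp
  next
    case (step b)
    have "c a \<le> c b" "c b \<le> c (Suc b)" using c step by auto
    then have "c a = c b" "c b = c (Suc b)" using step by auto
    then show ?case using step assms(2)[of b] by simp
  qed
qed

text \<open>Sorting the values of \<open>f\<close> inside each block, one adjacent swap at a time,
  terminates because the number of inversions drops.\<close>

lemma coset_rep_exists:
  assumes c: "blockmono c" and f: "f \<in> P"
  shows "\<exists>d u. d \<in> P \<and> u \<in> Yg c \<and> ascb c d \<and> f = d \<circ> u"
  using f
proof (induction "ninv r f" arbitrary: f rule: less_induct)
  case less
  show ?case
  proof (cases "\<exists>i\<in>{1..<r}. c i = c (Suc i) \<and> f (Suc i) < f i")
    case True
    then obtain i where i: "i \<in> {1..<r}" "c i = c (Suc i)" "f (Suc i) < f i" by auto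
    have v: "f \<circ> sw i \<in> P" using less.prems permutes_comp_sw[of f r i] i by simp
    have "ninv r (f \<circ> sw i) < ninv r f" using ninv_swap_desc[of i r f] i by simp
    from less.hyps[OF this v] obtain d u where du: "d \<in> P" "u \<in> Yg c" "ascb c d" "f \<circ> sw i = d \<circ> u" by auto
    have "f = d \<circ> (u \<circ> sw i)" using du(4) by (metis comp_assoc comp_id transpose_comp_involutory)
    then show ?thesis using du Yg_comp[OF du(2) Yg_sw[OF i(1,2)]] by blast
  next
    case False
    have "ascb c f"
      using False permutes_ne_Suc less.prems by (intro ascb_step[OF c]) (metis linorder_neqE_nat mem_Collect_eq)
    then show ?thesis using less.prems Yg_id by (intro exI[of _ f] exI[of _ id]) simp
  qed
qed

text \<open>The two representatives differ by an element \<open>?v\<close> of the Young subgroup.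
  Since both increase on the blocks, \<open>?v\<close> has no descent inside a block and is the
  identity.\<close>

lemma coset_rep_unique:
  assumes c: "blockmono c" and "d \<in> P" "d' \<in> P" "ascb c d" "ascb c d'" "u \<in> Yg c" "u' \<in> Yg c"
    and eq: "d \<circ> u = d' \<circ> u'"
  shows "d = d'" "u = u'"
proof -
  let ?v = "u' \<circ> pinv u"
  have v: "?v \<in> Yg c" using assms Yg_pinv Yg_comp by blast
  have dv: "d = d' \<circ> ?v"
  proof -
    have "d' \<circ> ?v = d \<circ> u \<circ> pinv u" using eq by (simp add: comp_assoc)
    also have "\<dots> = d" using permutes_inv_o(1)[OF YgD(1)[OF assms(6)]] by (simp add: comp_assoc)
    finally show ?thesis by simp
  qed
  have "?v = id"
  proof (rule Yg_ascending_id[OF c v])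
    fix i assume i: "i \<in> {1..<r}" "c i = c (Suc i)"
    have lt: "d i < d (Suc i)" using assms(4) i unfolding ascb_def by simp
    have vi: "?v i \<in> {1..r}" "?v (Suc i) \<in> {1..r}"
      using permutes_in_image[OF YgD(1)[OF v]] i by (simp_all del: o_apply)
    have cv: "c (?v (Suc i)) = c (?v i)" using YgD(2)[OF v, of i] YgD(2)[OF v, of "Suc i"] i by (simp del: o_apply)
    show "?v i < ?v (Suc i)"
    proof (rule ccontr)
      assume "\<not> ?thesis"
      then have "?v (Suc i) < ?v i" using permutes_ne_Suc[OF YgD(1)[OF v], of i] by simp
      then have "d' (?v (Suc i)) < d' (?v i)" using assms(5) vi cv unfolding ascb_def by (simp del: o_apply)
      then show False using lt dv by (metis comp_apply not_less_iff_gr_or_eq)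
    qed
  qed
  then show "d = d'" using dv by simp
  then show "u = u'" using eq assms(2)
    by (metis comp_assoc id_comp mem_Collect_eq permutes_inv_o(2))
qed

text \<open>For distinguished \<open>d\<close> the words of the Young subgroup act on \<open>T\<^sub>d\<close> without the quadratic relation.\<close>

lemma Tw_Yg_mult:
  assumes c: "blockmono c" and d: "d \<in> P" "ascb c d" and u: "u \<in> Yg c"
  shows "kap (Tw (pinv u) \<otimes>\<^bsub>H\<^esub> Tw (pinv d)) = pdelta (d \<circ> u)"
proof -
  \<comment> \<open>One word does both jobs: an ascent of \<open>v\<close> inside a block is an
    ascent of \<open>d \<circ> v\<close>, because \<open>v\<close> stays in the block and
    \<open>d\<close> is increasing there.\<close>
  have "\<exists>w\<in>W. Lword w (pdelta id) = pdelta u \<and> Lword w (pdelta d) = pdelta (d \<circ> u)"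
    using c u
  proof (induction u rule: Yg_induct)
    case id
    show ?case by (intro bexI[of _ "[]"]) simp_all
  next
    case (step i v)
    then obtain w where w: "w \<in> W" "Lword w (pdelta id) = pdelta v" "Lword w (pdelta d) = pdelta (d \<circ> v)" by blast
    have "v i \<in> {1..r}" "v (Suc i) \<in> {1..r}" "c (v i) = c (v (Suc i))"
      using permutes_in_image[OF YgD(1)[OF step(3)]] YgD(2)[OF step(3), of i] YgD(2)[OF step(3), of "Suc i"] step(1,2) by simp_all
    then have "(d \<circ> v) i < (d \<circ> v) (Suc i)" using d(2) step(4) unfolding ascb_def by simp
    then have "Lword (i # w) (pdelta d) = pdelta (d \<circ> (v \<circ> sw i))"
      using w by (simp add: Lop_pdelta comp_assoc del: o_apply)
    moreover have "Lword (i # w) (pdelta id) = pdelta (v \<circ> sw i)"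
      using w step(4) by (simp add: Lop_pdelta)
    moreover have "i # w \<in> W" using w step(1) by simp
    ultimately show ?case by blast
  qed
  then obtain w where w: "w \<in> W" "Lword w (pdelta id) = pdelta u" "Lword w (pdelta d) = pdelta (d \<circ> u)" by blast
  have uP: "u \<in> P" using YgD(1)[OF u] by simp
  have "kap (hw w) = kap (Tw (pinv u))"
    by (simp only: kap_hw[OF w(1)] w(2) kap_Tw[OF pinv_P[OF uP]] pinv_pinv[OF uP])
  then have "hw w = Tw (pinv u)"
    by (intro kap_eqI hw_closed w Tw_closed pinv_P uP) simp
  then have "kap (Tw (pinv u) \<otimes>\<^bsub>H\<^esub> Tw (pinv d)) = Lword w (kap (Tw (pinv d)))"
    using w d kap_hw_mult[OF w(1) Tw_closed[OF pinv_P[OF d(1)]]] by simp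
  then show ?thesis using w d(1) by (simp add: kap_Tw[OF pinv_P[OF d(1)]] pinv_pinv[OF d(1)])
qed

definition xc :: "(nat \<Rightarrow> nat) \<Rightarrow> hecke_elt" where
  "xc c = finsum H Tw (Yg c)"

lemma Yg_P: "u \<in> Yg c \<Longrightarrow> u \<in> P" by (simp add: Yg_def)

lemma xc_closed: "xc c \<in> carrier H"
  unfolding xc_def by (intro H.finsum_closed) (use Tw_closed Yg_P in blast)

lemma kap_Tw_sum:
  assumes "S \<subseteq> P"
  shows "kap (finsum H Tw S) f = (if f \<in> P \<and> pinv f \<in> S then 1 else 0)"
proof -
  have fin: "finite S" using assms finite_P finite_subset by blast
  have "kap (finsum H Tw S) f = (\<Sum>w\<in>S. kap (Tw w) f)"
    using assms by (intro kap_finsum[OF fin] Tw_closed) auto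
  also have "\<dots> = (\<Sum>w\<in>S. if w = pinv f then (if f \<in> P then 1 else 0) else 0)"
  proof (rule sum.cong[OF refl])
    fix w assume w: "w \<in> S"
    then have wP: "w \<in> P" using assms by auto
    have "f = pinv w \<longleftrightarrow> f \<in> P \<and> w = pinv f" using pinv_P[OF wP] pinv_pinv[OF wP] pinv_pinv[of f] by auto
    then show "kap (Tw w) f = (if w = pinv f then (if f \<in> P then 1 else 0) else 0)"
      using kap_Tw[OF wP] by (auto simp: pdelta_def)
  qed
  also have "\<dots> = (if f \<in> P \<and> pinv f \<in> S then 1 else 0)" using fin by (simp add: sum.delta)
  finally show ?thesis .
qed

lemma kap_xc: "kap (xc c) f = (if f \<in> Yg c then 1 else 0)"
proof -
  have "f \<in> P \<and> pinv f \<in> Yg c \<longleftrightarrow> f \<in> Yg c" using Yg_P[of f c] Yg_pinv pinv_pinv[of f] by metis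
  moreover have "Yg c \<subseteq> P" using Yg_P by blast
  ultimately show ?thesis unfolding xc_def by (simp only: kap_Tw_sum)
qed

lemma star_xc: "star (xc c) = xc c"
proof (rule kap_eqI[OF star_closed[OF xc_closed] xc_closed])
  fix f assume f: "f \<in> P"
  then have "pinv f \<in> Yg c \<longleftrightarrow> f \<in> Yg c" using Yg_pinv pinv_pinv[OF f] by metis
  then show "kap (star (xc c)) f = kap (xc c) f" by (simp add: kap_star[OF xc_closed f] kap_xc)
qed

text \<open>The right ideal generated by \<open>xc c\<close> in terms of coefficients, see
  \<open>Linv_eq\<close>. Invariance under adjacent swaps inside blocks is what can be compared with
  the relations T_i h = q h.\<close>

definition Linv :: "(nat \<Rightarrow> nat) \<Rightarrow> hecke_elt set" where
  "Linv c = {h \<in> carrier H. \<forall>i\<in>{1..<r}. c i = c (Suc i) \<longrightarrow> (\<forall>f\<in>P. kap h (f \<circ> sw i) = kap h f)}"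

text \<open>At a given \<open>f\<close> either branch of \<open>Lop\<close> turns T_i h = q h into
  the equality of the coefficients at \<open>f\<close> and \<open>f \<circ> sw i\<close>, since q
  can be cancelled.\<close>

lemma Linv_iff_T:
  "h \<in> Linv c \<longleftrightarrow> h \<in> carrier H \<and>
    (\<forall>i\<in>{1..<r}. c i = c (Suc i) \<longrightarrow> hw [i] \<otimes>\<^bsub>H\<^esub> h = sc qq \<otimes>\<^bsub>H\<^esub> h)"
proof -
  have "hw [i] \<otimes>\<^bsub>H\<^esub> h = sc qq \<otimes>\<^bsub>H\<^esub> h \<longleftrightarrow> (\<forall>f\<in>P. kap h (f \<circ> sw i) = kap h f)"
    if h: "h \<in> carrier H" and i: "i \<in> {1..<r}" for i
  proof
    assume eq: "hw [i] \<otimes>\<^bsub>H\<^esub> h = sc qq \<otimes>\<^bsub>H\<^esub> h"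
    show "\<forall>f\<in>P. kap h (f \<circ> sw i) = kap h f"
    proof
      fix f assume "f \<in> P"
      have "Lop i (kap h) f = qq * kap h f"
        using arg_cong[OF eq, of kap] h i by (simp add: kap_T_mult kap_sc laurent_qq fun_eq_iff)
      then show "kap h (f \<circ> sw i) = kap h f"
        by (cases "f i < f (Suc i)") (auto simp: Lop_def ups_nonzero algebra_simps simp del: comp_apply)
    qed
  next
    assume inv: "\<forall>f\<in>P. kap h (f \<circ> sw i) = kap h f"
    show "hw [i] \<otimes>\<^bsub>H\<^esub> h = sc qq \<otimes>\<^bsub>H\<^esub> h"
    proof (rule kap_eqI)
      fix f assume "f \<in> P"
      then have "kap h (f \<circ> sw i) = kap h f" using inv by blast
      then show "kap (hw [i] \<otimes>\<^bsub>H\<^esub> h) f = kap (sc qq \<otimes>\<^bsub>H\<^esub> h) f"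
        using h i by (simp add: kap_T_mult kap_sc laurent_qq Lop_def algebra_simps)
    qed (use h i laurent_qq in auto)
  qed
  then show ?thesis unfolding Linv_def by blast
qed

lemma Linv_right_mult: "h \<in> Linv c \<Longrightarrow> h' \<in> carrier H \<Longrightarrow> h \<otimes>\<^bsub>H\<^esub> h' \<in> Linv c"
  unfolding Linv_iff_T by (auto simp: laurent_qq simp flip: H.m_assoc)

lemma xc_Linv: "xc c \<in> Linv c"
proof -
  have "f \<circ> sw i \<in> Yg c \<longleftrightarrow> f \<in> Yg c" if "i \<in> {1..<r}" "c i = c (Suc i)" for f i
    using Yg_comp[OF _ Yg_sw[OF that]] by (metis comp_assoc comp_id transpose_comp_involutory)
  then show ?thesis unfolding Linv_def by (simp add: xc_closed kap_xc)
qed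

lemma Linv_Yg:
  assumes c: "blockmono c" and h: "h \<in> Linv c" and u: "u \<in> Yg c" and f: "f \<in> P"
  shows "kap h (f \<circ> u) = kap h f"
  using Yg_invariant[OF c u f, of "kap h"] h unfolding Linv_def by blast

text \<open>An invariant element is constant on cosets of the Young subgroup, and
  \<open>xc c\<close> times the T of a distinguished representative is the sum of all T over its
  coset. The coefficients at the distinguished representatives thus give the cofactor.\<close>

lemma Linv_eq:
  assumes c: "blockmono c"
  shows "Linv c = (\<lambda>h. xc c \<otimes>\<^bsub>H\<^esub> h) ` carrier H"
proof (intro equalityI subsetI)
  fix h assume "h \<in> (\<lambda>h. xc c \<otimes>\<^bsub>H\<^esub> h) ` carrier H"
  then show "h \<in> Linv c" using Linv_right_mult[OF xc_Linv] by auto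
next
  fix h assume h: "h \<in> Linv c"
  then have hc: "h \<in> carrier H" by (simp add: Linv_def)
  define D where "D = {d \<in> P. ascb c d}"
  have finD: "finite D" using finite_P by (simp add: D_def)
  \<comment> \<open>The cofactor: one term for each distinguished representative, weighted with the
    value of \<open>h\<close> on its coset.\<close>
  define h' where "h' = finsum H (\<lambda>d. sc (kap h d) \<otimes>\<^bsub>H\<^esub> Tw (pinv d)) D"
  have cl: "sc (kap h d) \<otimes>\<^bsub>H\<^esub> Tw (pinv d) \<in> carrier H" if "d \<in> D" for d
    using that Tw_closed[OF pinv_P] hc by (intro H.m_closed sc_closed kap_laurent) (auto simp: D_def)
  have h'c: "h' \<in> carrier H" unfolding h'_def using cl by (intro H.finsum_closed) auto
  have one: "kap (xc c \<otimes>\<^bsub>H\<^esub> (sc (kap h d) \<otimes>\<^bsub>H\<^esub> Tw (pinv d))) f = (if \<exists>u\<in>Yg c. f = d \<circ> u then kap h d else 0)"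
    if d: "d \<in> D" for d f
  proof -
    have dP: "d \<in> P" "ascb c d" using d by (auto simp: D_def)
    have Td: "Tw (pinv d) \<in> carrier H" using Tw_closed[OF pinv_P[OF dP(1)]] .
    have xe: "xc c = finsum H (\<lambda>u. Tw (pinv u)) (Yg c)"
    proof -
      have "bij_betw pinv (Yg c) (Yg c)"
        by (rule bij_betw_byWitness[where f' = pinv]) (use Yg_pinv pinv_pinv Yg_P in auto)
      then have "xc c = finsum H Tw (pinv ` Yg c)" by (simp add: xc_def bij_betw_def)
      also have "\<dots> = finsum H (\<lambda>u. Tw (pinv u)) (Yg c)"
        using \<open>bij_betw pinv (Yg c) (Yg c)\<close> Tw_closed Yg_P
        by (intro H.finsum_reindex) (auto simp: bij_betw_def)
      finally show ?thesis .
    qed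
    have Tu: "Tw (pinv u) \<in> carrier H" if "u \<in> Yg c" for u using Tw_closed[OF pinv_P[OF Yg_P[OF that]]] .
    have "xc c \<otimes>\<^bsub>H\<^esub> (sc (kap h d) \<otimes>\<^bsub>H\<^esub> Tw (pinv d)) = sc (kap h d) \<otimes>\<^bsub>H\<^esub> (xc c \<otimes>\<^bsub>H\<^esub> Tw (pinv d))"
      using Td hc xc_closed sc_central[of "kap h d" "xc c"] by (simp add: kap_laurent flip: H.m_assoc)
    then have "kap (xc c \<otimes>\<^bsub>H\<^esub> (sc (kap h d) \<otimes>\<^bsub>H\<^esub> Tw (pinv d))) f = kap h d * kap (xc c \<otimes>\<^bsub>H\<^esub> Tw (pinv d)) f"
      using Td hc xc_closed by (simp add: kap_sc kap_laurent)
    also have "xc c \<otimes>\<^bsub>H\<^esub> Tw (pinv d) = finsum H (\<lambda>u. Tw (pinv u) \<otimes>\<^bsub>H\<^esub> Tw (pinv d)) (Yg c)"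
      unfolding xe using Tu Td finite_Yg by (intro H.finsum_ldistr) auto
    also have "kap \<dots> f = (\<Sum>u\<in>Yg c. pdelta (d \<circ> u) f)"
      using Tu Td by (subst kap_finsum[OF finite_Yg]) (auto simp: Tw_Yg_mult[OF c dP])
    also have "\<dots> = (if \<exists>u\<in>Yg c. f = d \<circ> u then 1 else 0)"
    proof (cases "\<exists>u\<in>Yg c. f = d \<circ> u")
      case True
      then obtain u where u: "u \<in> Yg c" "f = d \<circ> u" by auto
      have "pdelta (d \<circ> v) f = (if v = u then 1 else 0)" if "v \<in> Yg c" for v
        using coset_rep_unique(2)[OF c dP(1) dP(1) dP(2) dP(2) that u(1)] u(2) by (auto simp: pdelta_def)
      then have "(\<Sum>v\<in>Yg c. pdelta (d \<circ> v) f) = (\<Sum>v\<in>Yg c. if v = u then 1 else 0)" by simp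
      then show ?thesis using True u finite_Yg by (simp add: sum.delta)
    next
      case False
      then have "(\<Sum>v\<in>Yg c. pdelta (d \<circ> v) f) = (\<Sum>v\<in>Yg c. 0)"
        by (intro sum.cong refl) (auto simp: pdelta_def)
      then show ?thesis using False by simp
    qed
    finally show ?thesis by simp
  qed
  have "xc c \<otimes>\<^bsub>H\<^esub> h' = h"
  proof (rule kap_eqI)
    fix f assume f: "f \<in> P"
    obtain d u where du: "d \<in> P" "u \<in> Yg c" "ascb c d" "f = d \<circ> u" using coset_rep_exists[OF c f] by blast
    have "xc c \<otimes>\<^bsub>H\<^esub> h' = finsum H (\<lambda>d. xc c \<otimes>\<^bsub>H\<^esub> (sc (kap h d) \<otimes>\<^bsub>H\<^esub> Tw (pinv d))) D"
      unfolding h'_def using cl xc_closed finD by (intro H.finsum_rdistr) auto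
    then have "kap (xc c \<otimes>\<^bsub>H\<^esub> h') f = (\<Sum>d'\<in>D. if \<exists>u\<in>Yg c. f = d' \<circ> u then kap h d' else 0)"
      using cl xc_closed by (simp add: kap_finsum finD one)
    also have "\<dots> = (\<Sum>d'\<in>D. if d' = d then kap h d else 0)"
    proof (rule sum.cong[OF refl])
      fix d' assume "d' \<in> D"
      then have d': "d' \<in> P" "ascb c d'" by (auto simp: D_def)
      have "(\<exists>u\<in>Yg c. f = d' \<circ> u) \<longleftrightarrow> d' = d"
        using coset_rep_unique(1)[OF c d'(1) du(1) d'(2) du(3) _ du(2)] du by metis
      then show "(if \<exists>u\<in>Yg c. f = d' \<circ> u then kap h d' else 0) = (if d' = d then kap h d else 0)" by auto
    qed
    also have "\<dots> = kap h d" using du finD by (simp add: D_def sum.delta)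
    also have "\<dots> = kap h f" using Linv_Yg[OF c h du(2,1)] du(4) by simp
    finally show "kap (xc c \<otimes>\<^bsub>H\<^esub> h') f = kap h f" .
  qed (use hc h'c xc_closed in auto)
  then show "h \<in> (\<lambda>h. xc c \<otimes>\<^bsub>H\<^esub> h) ` carrier H" using h'c by blast
qed

end

section \<open>Matrices and double cosets\<close>

text \<open>Equal class sizes mean equal multisets of colors, and these are related by a permutation
  of the positions. All statements about double cosets below are reduced to this matching.\<close>

lemma match_permutes:
  assumes "finite S" "\<And>x. card {k \<in> S. c k = x} = card {k \<in> S. c' k = x}"
  shows "\<exists>p. p permutes S \<and> (\<forall>k\<in>S. c k = c' (p k))"
proof -
  have cnt: "count (image_mset g (mset_set S)) x = card {k \<in> S. g k = x}" for g :: "'a \<Rightarrow> 'b" and x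
  proof -
    have "count (image_mset g (mset_set S)) x = (\<Sum>k\<in>g -` {x} \<inter> S. 1)"
      using assms(1) by (simp add: count_image_mset)
    also have "g -` {x} \<inter> S = {k \<in> S. g k = x}" by auto
    finally show ?thesis by simp
  qed
  have "image_mset c (mset_set S) = image_mset c' (mset_set S)"
    by (rule multiset_eqI) (simp add: cnt assms(2))
  from image_mset_eq_implies_permutes[OF assms(1) this] show ?thesis by blast
qed

lemma word_with_counts:
  assumes "finite Q" "(\<Sum>q\<in>Q. a q) = r"
  shows "\<exists>c. \<forall>q\<in>Q. card {k \<in> {1..r}. c k = q} = a q"
proof -
  define M where "M = (\<Sum>q\<in>Q. replicate_mset (a q) q)"
  have cM: "count M q = a q" if "q \<in> Q" for q
    using assms(1) that unfolding M_def by (simp add: count_sum sum.delta)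
  have sM: "size M = r" using assms unfolding M_def by (simp add: size_multiset_sum)
  obtain xs where xs: "mset xs = M" using ex_mset by blast
  have "card {k \<in> {1..r}. xs ! (k - 1) = q} = a q" if "q \<in> Q" for q
  proof -
    have len: "length xs = r" using sM xs by (metis size_mset)
    have "card {k \<in> {1..r}. xs ! (k - 1) = q} = card {i. i < length xs \<and> xs ! i = q}"
      by (rule bij_betw_same_card[of "\<lambda>k. k - 1"], rule bij_betw_byWitness[where f' = Suc])
        (auto simp: len)
    also have "\<dots> = length (filter (\<lambda>x. x = q) xs)" by (simp add: length_filter_conv_card)
    also have "\<dots> = count (mset xs) q" by (induction xs) auto
    finally show ?thesis by (simp add: xs cM that)
  qed
  then show ?thesis by (intro exI[of _ "\<lambda>k. xs ! (k - 1)"] ballI)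
qed

section \<open>Blocks of a composition\<close>

definition psum :: "(nat \<Rightarrow> nat) \<Rightarrow> nat \<Rightarrow> nat" where
  "psum l i = (\<Sum>j\<in>{1..i}. l j)"

lemma psum_0 [simp]: "psum l 0 = 0" and psum_Suc: "psum l (Suc i) = psum l i + l (Suc i)"
  by (simp_all add: psum_def)

lemma psum_mono: "i \<le> j \<Longrightarrow> psum l i \<le> psum l j"
  by (induction j rule: dec_induct) (auto simp: psum_Suc)

text \<open>The number of the block containing \<open>k\<close>, found as the first partial sum that
  reaches \<open>k\<close>; empty blocks are skipped by minimality.\<close>

definition blk :: "(nat \<Rightarrow> nat) \<Rightarrow> nat \<Rightarrow> nat" where
  "blk l k = (LEAST i. k \<le> psum l i)"

lemma block_psum: "1 \<le> i \<Longrightarrow> block l i = {psum l (i - 1)<..psum l i}"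
proof -
  assume "1 \<le> i"
  then have "{1..<i} = {1..i - 1}" by auto
  then show ?thesis by (auto simp: block_def psum_def)
qed

lemma blk_eq_iff:
  assumes "1 \<le> i" "k \<le> psum l N"
  shows "blk l k = i \<longleftrightarrow> psum l (i - 1) < k \<and> k \<le> psum l i"
proof
  assume e: "blk l k = i"
  have "k \<le> psum l (blk l k)" unfolding blk_def by (rule LeastI[of "\<lambda>i. k \<le> psum l i" N]) (rule assms(2))
  moreover have "\<not> k \<le> psum l (i - 1)"
  proof
    assume "k \<le> psum l (i - 1)"
    then have "blk l k \<le> i - 1" unfolding blk_def by (rule Least_le)
    then show False using e assms(1) by simp
  qed
  ultimately show "psum l (i - 1) < k \<and> k \<le> psum l i" using e by simp
next
  assume k: "psum l (i - 1) < k \<and> k \<le> psum l i"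
  show "blk l k = i" unfolding blk_def
  proof (rule Least_equality)
    fix j assume "k \<le> psum l j"
    then have "psum l (i - 1) < psum l j" using k by simp
    then have "\<not> j \<le> i - 1" using psum_mono[of j "i - 1" l] by auto
    then show "i \<le> j" by simp
  qed (use k in simp)
qed

locale qschur_rank = hecke_rank r for r :: nat +
  fixes n :: nat
begin

abbreviation "L \<equiv> Lam n r"
abbreviation "Th \<equiv> Theta n r"

lemma Lam_psum: "l \<in> L \<Longrightarrow> psum l n = r" by (simp add: Lam_def psum_def)

lemma blk_range: assumes "l \<in> L" "k \<in> {1..r}" shows "blk l k \<in> {1..n}"
proof -
  have k: "k \<le> psum l n" using assms Lam_psum by simp
  then have "blk l k \<le> n" unfolding blk_def by (rule Least_le)
  moreover have k2: "k \<le> psum l (blk l k)" unfolding blk_def by (rule LeastI[of "\<lambda>i. k \<le> psum l i" n]) (rule k)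
  have "blk l k \<noteq> 0"
  proof
    assume "blk l k = 0"
    then show False using k2 assms(2) by simp
  qed
  with \<open>blk l k \<le> n\<close> show ?thesis by simp
qed

lemma in_block: assumes "l \<in> L" "k \<in> {1..r}" "1 \<le> i" shows "k \<in> block l i \<longleftrightarrow> blk l k = i"
  using assms Lam_psum[OF assms(1)] by (subst blk_eq_iff[of i k l n]) (auto simp: block_psum)

lemma block_sub: "l \<in> L \<Longrightarrow> i \<in> {1..n} \<Longrightarrow> block l i \<subseteq> {1..r}"
  using psum_mono[of i n l] Lam_psum[of l] by (auto simp: block_psum)

lemma block_eq: "l \<in> L \<Longrightarrow> i \<in> {1..n} \<Longrightarrow> block l i = {k \<in> {1..r}. blk l k = i}"
  using in_block[of l _ i] block_sub[of l i] by fastforce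

lemma card_blk: assumes "l \<in> L" "i \<in> {1..n}" shows "card {k \<in> {1..r}. blk l k = i} = l i"
proof -
  have "card {k \<in> {1..r}. blk l k = i} = psum l i - psum l (i - 1)"
    unfolding block_eq[OF assms, symmetric] using assms(2) by (simp add: block_psum)
  also have "\<dots> = l i" using psum_Suc[of l "i - 1"] assms by simp
  finally show ?thesis .
qed

lemma blk_mono: assumes "l \<in> L" shows "blockmono (blk l)"
proof (intro allI impI)
  fix i j :: nat assume ij: "1 \<le> i" "i \<le> j" "j \<le> r"
  have "j \<le> psum l (blk l j)" unfolding blk_def
    by (rule LeastI[of "\<lambda>i. j \<le> psum l i" n]) (use ij Lam_psum[OF assms] in simp)
  then show "blk l i \<le> blk l j" unfolding blk_def[of l i] using ij by (intro Least_le) simp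
qed

lemma young_eq: assumes "l \<in> L" shows "young n r l = Yg (blk l)"
proof (intro equalityI subsetI)
  fix w assume w: "w \<in> young n r l"
  have "blk l (w k) = blk l k" if k: "k \<in> {1..r}" for k
  proof -
    let ?i = "blk l k"
    have i: "?i \<in> {1..n}" using blk_range[OF assms k] .
    then have "w ` block l ?i = block l ?i" using w unfolding young_def by blast
    moreover have "k \<in> block l ?i" using in_block[OF assms k] i by simp
    ultimately have "w k \<in> block l ?i" by blast
    then show ?thesis using block_eq[OF assms i] by simp
  qed
  then show "w \<in> Yg (blk l)" using w by (auto simp: young_def Yg_def)
next
  fix w assume w: "w \<in> Yg (blk l)"
  have "w ` block l i = block l i" if i: "i \<in> {1..n}" for i
  proof (rule card_subset_eq)
    show "finite (block l i)" using block_sub[OF assms i] finite_subset by blast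
    show "w ` block l i \<subseteq> block l i"
    proof
      fix x assume "x \<in> w ` block l i"
      then obtain k where k: "k \<in> {1..r}" "blk l k = i" "x = w k" using block_eq[OF assms i] by auto
      then have "x \<in> {1..r}" "blk l x = i"
        using YgD(2)[OF w k(1)] permutes_in_image[OF YgD(1)[OF w], of k] by auto
      then show "x \<in> block l i" using block_eq[OF assms i] by simp
    qed
    show "card (w ` block l i) = card (block l i)"
      using permutes_inj_on[OF YgD(1)[OF w]] by (rule card_image)
  qed
  then show "w \<in> young n r l" using YgD(1)[OF w] by (simp add: young_def)
qed

lemma hecke_x_eq: "l \<in> L \<Longrightarrow> hecke_x n r l = xc (blk l)"
  by (simp add: hecke_x_def xc_def young_eq)

text \<open>In terms of the intersection numbers of blocks, \<open>f\<close> stands for the inverse of \<open>w\<close>.\<close>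

definition mt :: "nvec \<Rightarrow> nvec \<Rightarrow> (nat \<Rightarrow> nat) \<Rightarrow> nmat" where
  "mt l m f = (\<lambda>i j. if i \<in> {1..n} \<and> j \<in> {1..n} then card {k \<in> {1..r}. blk l k = i \<and> blk m (f k) = j} else 0)"

lemma mt_eqI:
  assumes "\<And>i j. i \<in> {1..n} \<Longrightarrow> j \<in> {1..n} \<Longrightarrow> A i j = card {k \<in> {1..r}. blk l k = i \<and> blk m (f k) = j}"
    and "\<And>i j. i \<notin> {1..n} \<or> j \<notin> {1..n} \<Longrightarrow> A i j = 0"
  shows "mt l m f = A"
  using assms by (auto simp: mt_def fun_eq_iff)

lemma ro_Lam: assumes "A \<in> Th" shows "ro n A \<in> L"
  using assms by (auto simp: Theta_def Lam_def ro_def)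

lemma co_Lam: assumes "A \<in> Th" shows "co n A \<in> L"
  using assms by (auto simp: Theta_def Lam_def co_def intro: sum.swap[THEN trans])

lemma perm_range: "f \<in> P \<Longrightarrow> k \<in> {1..r} \<Longrightarrow> f k \<in> {1..r}"
  using permutes_in_image by fastforce

lemma ro_mt: assumes "l \<in> L" "m \<in> L" "f \<in> P" shows "ro n (mt l m f) = l"
proof
  fix i
  show "ro n (mt l m f) i = l i"
  proof (cases "i \<in> {1..n}")
    case True
    have "ro n (mt l m f) i = (\<Sum>j\<in>{1..n}. card {k \<in> {1..r}. blk l k = i \<and> blk m (f k) = j})"
      using True by (simp add: ro_def mt_def)
    also have "\<dots> = card (\<Union>j\<in>{1..n}. {k \<in> {1..r}. blk l k = i \<and> blk m (f k) = j})"
      by (rule card_UN_disjoint[symmetric]) auto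
    also have "(\<Union>j\<in>{1..n}. {k \<in> {1..r}. blk l k = i \<and> blk m (f k) = j}) = {k \<in> {1..r}. blk l k = i}"
      using blk_range[OF assms(2) perm_range[OF assms(3)]] by auto
    finally show ?thesis using card_blk[OF assms(1) True] by simp
  next
    case False
    then have "mt l m f i j = 0" for j by (auto simp: mt_def)
    moreover have "l i = 0" using False assms(1) by (auto simp: Lam_def)
    ultimately show ?thesis by (simp add: ro_def)
  qed
qed

lemma mt_transp:
  assumes "f \<in> P" shows "mt m l (pinv f) = transp (mt l m f)"
proof (rule mt_eqI)
  fix i j assume ij: "i \<in> {1..n}" "j \<in> {1..n}"
  have f: "f permutes {1..r}" using assms by simp
  have "card {k \<in> {1..r}. blk l k = j \<and> blk m (f k) = i} = card {k \<in> {1..r}. blk m k = i \<and> blk l (pinv f k) = j}"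
    using perm_range[OF assms] perm_range[OF pinv_P[OF assms]] permutes_inverses[OF f]
    by (intro bij_betw_same_card[of f] bij_betw_byWitness[where f' = "pinv f"]) auto
  then show "mt l m f j i = card {k \<in> {1..r}. blk m k = i \<and> blk l (pinv f k) = j}"
    using ij by (simp add: mt_def)
qed (auto simp: mt_def)

lemma ro_transp: "ro n (transp A) = co n A" and co_transp: "co n (transp A) = ro n A"
  by (simp_all add: ro_def co_def)

lemma co_mt: assumes "l \<in> L" "m \<in> L" "f \<in> P" shows "co n (mt l m f) = m"
  using ro_mt[OF assms(2,1) pinv_P[OF assms(3)]] mt_transp[OF assms(3), of m l] ro_transp by simp

lemma mt_Theta: assumes "l \<in> L" "m \<in> L" "f \<in> P" shows "mt l m f \<in> Th"
proof -
  have "(\<Sum>i\<in>{1..n}. ro n (mt l m f) i) = r" unfolding ro_mt[OF assms] using assms(1) by (simp add: Lam_def)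
  then show ?thesis by (simp add: Theta_def ro_def) (simp add: mt_def)
qed

lemma transp_Theta: "A \<in> Th \<Longrightarrow> transp A \<in> Th"
  by (auto simp: Theta_def intro: sum.swap[THEN trans])

text \<open>Color the positions by the cells of the matrix, cell (i, j) occurring
  \<open>A i j\<close> times. The row coordinate has the class sizes of the row blocks and the
  column coordinate those of the column blocks, so both can be matched by permutations.\<close>

lemma mt_surj: assumes A: "A \<in> Th" shows "\<exists>f\<in>P. mt (ro n A) (co n A) f = A"
proof -
  let ?Q = "{1..n} \<times> {1..n}"
  have "(\<Sum>q\<in>?Q. case_prod A q) = r"
    using A by (simp add: Theta_def sum.cartesian_product)
  then obtain c where c: "\<And>q. q \<in> ?Q \<Longrightarrow> card {k \<in> {1..r}. c k = q} = case_prod A q"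
    using word_with_counts[of ?Q "case_prod A" r] by auto
  \<comment> \<open>The cells of the matrix already account for all \<open>r\<close> positions, so
    no position is left for another color.\<close>
  have cQ: "c k \<in> ?Q" if "k \<in> {1..r}" for k
  proof (rule ccontr)
    assume n: "c k \<notin> ?Q"
    have "r = (\<Sum>q\<in>?Q. card {k \<in> {1..r}. c k = q})"
      using \<open>(\<Sum>q\<in>?Q. case_prod A q) = r\<close> c by simp
    also have "\<dots> = card (\<Union>q\<in>?Q. {k \<in> {1..r}. c k = q})"
      by (rule card_UN_disjoint[symmetric]) auto
    also have "\<dots> < card {1..r}"
    proof (rule psubset_card_mono)
      have "k \<notin> (\<Union>q\<in>?Q. {k \<in> {1..r}. c k = q})" using n by auto
      then show "(\<Union>q\<in>?Q. {k \<in> {1..r}. c k = q}) \<subset> {1..r}" using that by blast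
    qed simp
    finally show False by simp
  qed
  have r: "card {k \<in> {1..r}. blk (ro n A) k = i} = card {k \<in> {1..r}. fst (c k) = i}" for i
  proof (cases "i \<in> {1..n}")
    case True
    have "card {k \<in> {1..r}. fst (c k) = i} = card (\<Union>j\<in>{1..n}. {k \<in> {1..r}. c k = (i, j)})"
      using cQ by (intro arg_cong[of _ _ card]) (force simp: mem_Times_iff prod_eq_iff)
    also have "\<dots> = (\<Sum>j\<in>{1..n}. card {k \<in> {1..r}. c k = (i, j)})"
      by (rule card_UN_disjoint) auto
    also have "\<dots> = ro n A i"
      unfolding ro_def
    proof (rule sum.cong[OF refl])
      fix j assume "j \<in> {1..n}"
      then show "card {k \<in> {1..r}. c k = (i, j)} = A i j" using c[of "(i, j)"] True by simp
    qed
    finally show ?thesis using card_blk[OF ro_Lam[OF A] True] by simp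
  next
    case False
    then have "{k \<in> {1..r}. blk (ro n A) k = i} = {}" "{k \<in> {1..r}. fst (c k) = i} = {}"
      using blk_range[OF ro_Lam[OF A]] cQ by (auto simp: mem_Times_iff)
    then show ?thesis by (simp only:)
  qed
  have s: "card {k \<in> {1..r}. blk (co n A) k = j} = card {k \<in> {1..r}. snd (c k) = j}" for j
  proof (cases "j \<in> {1..n}")
    case True
    have "card {k \<in> {1..r}. snd (c k) = j} = card (\<Union>i\<in>{1..n}. {k \<in> {1..r}. c k = (i, j)})"
      using cQ by (intro arg_cong[of _ _ card]) (force simp: mem_Times_iff prod_eq_iff)
    also have "\<dots> = (\<Sum>i\<in>{1..n}. card {k \<in> {1..r}. c k = (i, j)})"
      by (rule card_UN_disjoint) auto
    also have "\<dots> = co n A j"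
      unfolding co_def
    proof (rule sum.cong[OF refl])
      fix i assume "i \<in> {1..n}"
      then show "card {k \<in> {1..r}. c k = (i, j)} = A i j" using c[of "(i, j)"] True by simp
    qed
    finally show ?thesis using card_blk[OF co_Lam[OF A] True] by simp
  next
    case False
    then have "{k \<in> {1..r}. blk (co n A) k = j} = {}" "{k \<in> {1..r}. snd (c k) = j} = {}"
      using blk_range[OF co_Lam[OF A]] cQ by (auto simp: mem_Times_iff)
    then show ?thesis by (simp only:)
  qed
  obtain a where a: "a permutes {1..r}" "\<And>k. k \<in> {1..r} \<Longrightarrow> blk (ro n A) k = fst (c (a k))"
    using match_permutes[of "{1..r}" "blk (ro n A)" "\<lambda>k. fst (c k)"] r by auto
  obtain b where b: "b permutes {1..r}" "\<And>k. k \<in> {1..r} \<Longrightarrow> blk (co n A) k = snd (c (b k))"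
    using match_permutes[of "{1..r}" "blk (co n A)" "\<lambda>k. snd (c k)"] s by auto
  have aP: "a \<in> P" and bP: "b \<in> P" using a b by auto
  \<comment> \<open>\<open>a\<close> carries row blocks to row coordinates and \<open>b\<close>
    column blocks to column coordinates; going along \<open>a\<close> and back along
    \<open>b\<close> makes the cell of \<open>a k\<close> the pair formed by the row block of
    \<open>k\<close> and the column block of its image.\<close>
  have f: "pinv b \<circ> a \<in> P" using permutes_compose[OF a(1) permutes_inv[OF b(1)]] by simp
  have "mt (ro n A) (co n A) (pinv b \<circ> a) = A"
  proof (rule mt_eqI)
    fix i j assume ij: "i \<in> {1..n}" "j \<in> {1..n}"
    have key: "blk (ro n A) k = fst (c (a k))" "blk (co n A) ((pinv b \<circ> a) k) = snd (c (a k))" if k: "k \<in> {1..r}" for k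
    proof -
      have "(pinv b \<circ> a) k \<in> {1..r}" using perm_range[OF f k] .
      then show "blk (co n A) ((pinv b \<circ> a) k) = snd (c (a k))" using b(2) permutes_inverses[OF b(1)] by simp
    qed (use a(2) k in simp)
    have "{k \<in> {1..r}. blk (ro n A) k = i \<and> blk (co n A) ((pinv b \<circ> a) k) = j} = {k \<in> {1..r}. c (a k) = (i, j)}"
      using key by (auto simp: prod_eq_iff simp del: o_apply)
    moreover have "card {k \<in> {1..r}. c (a k) = (i, j)} = card {k \<in> {1..r}. c k = (i, j)}"
      using perm_range[OF aP] perm_range[OF pinv_P[OF aP]] permutes_inverses[OF a(1)]
      by (intro bij_betw_same_card[of a] bij_betw_byWitness[where f' = "pinv a"]) auto
    ultimately show "A i j = card {k \<in> {1..r}. blk (ro n A) k = i \<and> blk (co n A) ((pinv b \<circ> a) k) = j}"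
      using c[of "(i, j)"] ij by simp
  qed (use A in \<open>auto simp: Theta_def\<close>)
  then show ?thesis using f by blast
qed

text \<open>Color position \<open>k\<close> by the pair (row block of \<open>k\<close>, column block
  of its image). Equal matrices mean equal class sizes for \<open>f\<close> and \<open>g\<close>;
  the matching permutation \<open>p\<close> preserves row blocks, and what remains of
  \<open>g\<close> after \<open>f\<close> and \<open>p\<close> preserves column blocks.\<close>

lemma mt_eq_coset:
  assumes l: "l \<in> L" and m: "m \<in> L" and f: "f \<in> P" and g: "g \<in> P" and eq: "mt l m f = mt l m g"
  shows "\<exists>u\<in>Yg (blk l). \<exists>v\<in>Yg (blk m). g = v \<circ> f \<circ> u"
proof -
  have "card {k \<in> {1..r}. (blk l k, blk m (g k)) = x} = card {k \<in> {1..r}. (blk l k, blk m (f k)) = x}" for x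
  proof (cases "x \<in> {1..n} \<times> {1..n}")
    case True
    then show ?thesis using fun_cong[OF fun_cong[OF eq, of "fst x"], of "snd x"]
      by (auto simp: mt_def prod_eq_iff)
  next
    case False
    have e: "{k \<in> {1..r}. (blk l k, blk m (h k)) = x} = {}" if "h \<in> P" for h
    proof -
      have "(blk l k, blk m (h k)) \<in> {1..n} \<times> {1..n}" if "k \<in> {1..r}" for k
        using blk_range[OF l that] blk_range[OF m perm_range[OF \<open>h \<in> P\<close> that]] by blast
      then show ?thesis using False by blast
    qed
    show ?thesis unfolding e[OF f] e[OF g] ..
  qed
  then obtain p where p: "p permutes {1..r}"
    "\<And>k. k \<in> {1..r} \<Longrightarrow> (blk l k, blk m (g k)) = (blk l (p k), blk m (f (p k)))"
    using match_permutes[of "{1..r}" "\<lambda>k. (blk l k, blk m (g k))" "\<lambda>k. (blk l k, blk m (f k))"] by auto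
  have fp: "f permutes {1..r}" "g permutes {1..r}" using f g by auto
  have pY: "p \<in> Yg (blk l)" unfolding Yg_def using p by auto
  let ?v = "g \<circ> pinv p \<circ> pinv f"
  have vP: "?v \<in> P"
    using permutes_compose[OF permutes_inv[OF fp(1)] permutes_compose[OF permutes_inv[OF p(1)] fp(2)]]
    by (simp add: comp_assoc)
  have "blk m (?v x) = blk m x" if x: "x \<in> {1..r}" for x
  proof -
    let ?k = "pinv p (pinv f x)"
    have k: "?k \<in> {1..r}"
      using x perm_range[OF pinv_P[OF f]] perm_range[of "pinv p"] permutes_inv[OF p(1)] by blast
    show ?thesis using p(2)[OF k] permutes_inverses[OF p(1)] permutes_inverses[OF fp(1)] by simp
  qed
  then have "?v \<in> Yg (blk m)" unfolding Yg_def using vP by blast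
  moreover have "g = ?v \<circ> f \<circ> p"
    using permutes_inverses[OF p(1)] permutes_inverses[OF fp(1)] by (simp add: fun_eq_iff)
  ultimately show ?thesis using pY by blast
qed

lemma mt_coset:
  assumes l: "l \<in> L" and m: "m \<in> L" and f: "f \<in> P" and u: "u \<in> Yg (blk l)" and v: "v \<in> Yg (blk m)"
  shows "mt l m (v \<circ> f \<circ> u) = mt l m f"
proof (rule mt_eqI)
  fix i j assume ij: "i \<in> {1..n}" "j \<in> {1..n}"
  have up: "u permutes {1..r}" "u \<in> P" using YgD(1)[OF u] by auto
  have k: "blk m ((v \<circ> f \<circ> u) k) = blk m (f (u k))" "blk l (u k) = blk l k" if "k \<in> {1..r}" for k
    using YgD(2)[OF v perm_range[OF f perm_range[OF up(2) that]]] YgD(2)[OF u that] by auto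
  have "{k \<in> {1..r}. blk l k = i \<and> blk m ((v \<circ> f \<circ> u) k) = j} = {k \<in> {1..r}. blk l (u k) = i \<and> blk m (f (u k)) = j}"
    using k by (auto simp del: o_apply)
  moreover have "card {k \<in> {1..r}. blk l (u k) = i \<and> blk m (f (u k)) = j} = card {k \<in> {1..r}. blk l k = i \<and> blk m (f k) = j}"
    using perm_range[OF up(2)] perm_range[OF pinv_P[OF up(2)]] permutes_inverses[OF up(1)]
    by (intro bij_betw_same_card[of u] bij_betw_byWitness[where f' = "pinv u"]) auto
  ultimately show "mt l m f i j = card {k \<in> {1..r}. blk l k = i \<and> blk m ((v \<circ> f \<circ> u) k) = j}"
    using ij by (simp add: mt_def)
qed (auto simp: mt_def)

lemma comp3_P: "u \<in> P \<Longrightarrow> f \<in> P \<Longrightarrow> v \<in> P \<Longrightarrow> v \<circ> f \<circ> u \<in> P"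
  by (simp add: permutes_compose)

lemma pinv_comp3: assumes "u \<in> P" "f \<in> P" "v \<in> P" shows "pinv (v \<circ> f \<circ> u) = pinv u \<circ> pinv f \<circ> pinv v"
  using assms by (simp add: o_inv_distrib permutes_bij bij_comp comp_assoc)

text \<open>The description in \<open>dcoset\<close> is unambiguous because every admissible
  \<open>w\<close> yields the same set, namely the fibre of the matrix map. The inverse enters
  through the convention for \<open>f\<close>.\<close>

lemma dcoset_eq: assumes A: "A \<in> Th" shows "dcoset n r A = {w \<in> P. mt (ro n A) (co n A) (pinv w) = A}"
proof -
  let ?l = "ro n A" and ?m = "co n A"
  have l: "?l \<in> L" and m: "?m \<in> L" using ro_Lam[OF A] co_Lam[OF A] .
  have card: "(\<forall>i\<in>{1..n}. \<forall>j\<in>{1..n}. A i j = card (block ?l i \<inter> w ` block ?m j)) \<longleftrightarrow> mt ?l ?m (pinv w) = A"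
    if w: "w \<in> P" for w
  proof -
    have "block ?l i \<inter> w ` block ?m j = {k \<in> {1..r}. blk ?l k = i \<and> blk ?m (pinv w k) = j}"
      if ij: "i \<in> {1..n}" "j \<in> {1..n}" for i j
    proof -
      have wp: "w permutes {1..r}" using w by simp
      have "x \<in> w ` block ?m j \<longleftrightarrow> pinv w x \<in> block ?m j" for x
        using permutes_inverses[OF wp] by (metis image_iff)
      moreover have "pinv w x \<in> {1..r}" if "x \<in> {1..r}" for x using perm_range[OF pinv_P[OF w] that] .
      ultimately show ?thesis unfolding block_eq[OF l ij(1)] block_eq[OF m ij(2)] by auto
    qed
    then have "mt ?l ?m (pinv w) = (\<lambda>i j. if i \<in> {1..n} \<and> j \<in> {1..n} then card (block ?l i \<inter> w ` block ?m j) else 0)"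
      by (auto simp: mt_def fun_eq_iff)
    moreover have "\<And>i j. i \<notin> {1..n} \<or> j \<notin> {1..n} \<Longrightarrow> A i j = 0" using A by (simp add: Theta_def)
    ultimately show ?thesis by (auto simp: fun_eq_iff)
  qed
  have dc: "{a \<circ> w \<circ> b | a b. a \<in> young n r ?l \<and> b \<in> young n r ?m} = {w \<in> P. mt ?l ?m (pinv w) = A}"
    if w: "w \<in> P" "mt ?l ?m (pinv w) = A" for w
  proof (intro equalityI subsetI)
    fix x assume "x \<in> {a \<circ> w \<circ> b | a b. a \<in> young n r ?l \<and> b \<in> young n r ?m}"
    then obtain a b where ab: "x = a \<circ> w \<circ> b" "a \<in> Yg (blk ?l)" "b \<in> Yg (blk ?m)"
      by (auto simp: young_eq l m)
    have "mt ?l ?m (pinv x) = A"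
      using mt_coset[OF l m pinv_P[OF w(1)] Yg_pinv[OF ab(2)] Yg_pinv[OF ab(3)]] w(2)
        pinv_comp3[OF Yg_P[OF ab(3)] w(1) Yg_P[OF ab(2)]] ab(1) by simp
    then show "x \<in> {w \<in> P. mt ?l ?m (pinv w) = A}"
      using comp3_P[OF Yg_P[OF ab(3)] w(1) Yg_P[OF ab(2)]] ab(1) by blast
  next
    fix x assume "x \<in> {w \<in> P. mt ?l ?m (pinv w) = A}"
    then have x: "x \<in> P" "mt ?l ?m (pinv x) = A" by auto
    then obtain u v where uv: "u \<in> Yg (blk ?l)" "v \<in> Yg (blk ?m)" "pinv x = v \<circ> pinv w \<circ> u"
      using mt_eq_coset[OF l m pinv_P[OF w(1)] pinv_P[OF x(1)]] w(2) by auto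
    have "x = pinv u \<circ> w \<circ> pinv v"
      using pinv_comp3[OF Yg_P[OF uv(1)] pinv_P[OF w(1)] Yg_P[OF uv(2)]] uv(3) pinv_pinv[OF x(1)] pinv_pinv[OF w(1)]
      by simp
    then show "x \<in> {a \<circ> w \<circ> b | a b. a \<in> young n r ?l \<and> b \<in> young n r ?m}"
      using Yg_pinv[OF uv(1)] Yg_pinv[OF uv(2)] young_eq l m by blast
  qed
  obtain f where f: "f \<in> P" "mt ?l ?m f = A" using mt_surj[OF A] by blast
  then have w: "pinv f \<in> P" "mt ?l ?m (pinv (pinv f)) = A" using pinv_P pinv_pinv by simp_all
  show ?thesis unfolding dcoset_def
  proof (rule the_equality)
    show "\<exists>w. w permutes {1..r} \<and> (\<forall>i\<in>{1..n}. \<forall>j\<in>{1..n}. A i j = card (block ?l i \<inter> w ` block ?m j)) \<and>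
       {w \<in> P. mt ?l ?m (pinv w) = A} = {a \<circ> w \<circ> b | a b. a \<in> young n r ?l \<and> b \<in> young n r ?m}"
      using w card[OF w(1)] dc[OF w] by blast
  next
    fix D assume "\<exists>w. w permutes {1..r} \<and> (\<forall>i\<in>{1..n}. \<forall>j\<in>{1..n}. A i j = card (block ?l i \<inter> w ` block ?m j)) \<and>
       D = {a \<circ> w \<circ> b | a b. a \<in> young n r ?l \<and> b \<in> young n r ?m}"
    then obtain w where w: "w \<in> P" "\<forall>i\<in>{1..n}. \<forall>j\<in>{1..n}. A i j = card (block ?l i \<inter> w ` block ?m j)"
       "D = {a \<circ> w \<circ> b | a b. a \<in> young n r ?l \<and> b \<in> young n r ?m}" by blast
    have "mt ?l ?m (pinv w) = A" using card[OF w(1)] w(2) by blast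
    then show "D = {w \<in> P. mt ?l ?m (pinv w) = A}" using dc[OF w(1)] w(3) by blast
  qed
qed

end

section \<open>Coordinates on the q-Schur algebra\<close>

context qschur_rank
begin

abbreviation "S \<equiv> qschur n r"
abbreviation "M \<equiv> perm_mod n r"
abbreviation "padd \<equiv> perm_add n r"
abbreviation "pact \<equiv> perm_act n r"
abbreviation "pin \<equiv> perm_inj n r"
abbreviation "X l \<equiv> hecke_x n r l"
abbreviation "Inv l \<equiv> Linv (blk l)"

lemma X_closed [simp]: "l \<in> L \<Longrightarrow> X l \<in> carrier H"
  by (simp add: hecke_x_eq xc_closed)

lemma Inv_eq: "l \<in> L \<Longrightarrow> Inv l = (\<lambda>h. X l \<otimes>\<^bsub>H\<^esub> h) ` carrier H"
  by (simp add: Linv_eq blk_mono hecke_x_eq)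

lemma Inv_closed: "y \<in> Inv l \<Longrightarrow> y \<in> carrier H"
  by (simp add: Linv_def)

lemma Inv_zero: "\<zero>\<^bsub>H\<^esub> \<in> Inv l"
  by (simp add: Linv_def kap_zero)

lemma Inv_add: "y \<in> Inv l \<Longrightarrow> z \<in> Inv l \<Longrightarrow> y \<oplus>\<^bsub>H\<^esub> z \<in> Inv l"
  by (auto simp: Linv_def kap_add)

lemma Inv_mult: "y \<in> Inv l \<Longrightarrow> h \<in> carrier H \<Longrightarrow> y \<otimes>\<^bsub>H\<^esub> h \<in> Inv l"
  by (rule Linv_right_mult)

text \<open>Membership in the ideal generated by each x becomes a condition on coefficients, which
  is easy to verify for sums and products.\<close>

lemma M_eq: "M = (\<Pi>\<^sub>E l\<in>L. Inv l)"
  unfolding perm_mod_def by (rule PiE_cong) (simp add: Inv_eq)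

lemma M_I: "z \<in> extensional L \<Longrightarrow> (\<And>l. l \<in> L \<Longrightarrow> z l \<in> Inv l) \<Longrightarrow> z \<in> M"
  by (auto simp: M_eq PiE_def)

lemma M_D: "z \<in> M \<Longrightarrow> l \<in> L \<Longrightarrow> z l \<in> Inv l" "z \<in> M \<Longrightarrow> z \<in> extensional L"
  by (auto simp: M_eq PiE_def)

lemma M_closed: "z \<in> M \<Longrightarrow> l \<in> L \<Longrightarrow> z l \<in> carrier H"
  using M_D Inv_closed by blast

lemma M_eqI: "z \<in> M \<Longrightarrow> z' \<in> M \<Longrightarrow> (\<And>l. l \<in> L \<Longrightarrow> z l = z' l) \<Longrightarrow> z = z'"
  using M_D(2) extensionalityI by blast

lemma padd_apply: "l \<in> L \<Longrightarrow> padd z z' l = z l \<oplus>\<^bsub>H\<^esub> z' l"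
  by (simp add: perm_add_def)

lemma pact_apply: "l \<in> L \<Longrightarrow> pact z h l = z l \<otimes>\<^bsub>H\<^esub> h"
  by (simp add: perm_act_def)

lemma pinj_apply: "l' \<in> L \<Longrightarrow> pin l h l' = (if l' = l then h else \<zero>\<^bsub>H\<^esub>)"
  by (simp add: perm_inj_def)

lemma pzero_apply: "l \<in> L \<Longrightarrow> perm_zero n r l = \<zero>\<^bsub>H\<^esub>"
  by (simp add: perm_zero_def)

lemma padd_M: "z \<in> M \<Longrightarrow> z' \<in> M \<Longrightarrow> padd z z' \<in> M"
  by (rule M_I) (auto simp: perm_add_def M_D Inv_add)

lemma pact_M: "z \<in> M \<Longrightarrow> h \<in> carrier H \<Longrightarrow> pact z h \<in> M"
  by (rule M_I) (auto simp: perm_act_def M_D Inv_mult)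

lemma pinj_M: "h \<in> Inv l \<Longrightarrow> pin l h \<in> M"
  by (rule M_I) (auto simp: perm_inj_def Inv_zero)

lemma pzero_M: "perm_zero n r \<in> M"
  by (rule M_I) (auto simp: perm_zero_def Inv_zero)

lemma S_carrier: "\<phi> \<in> carrier S \<longleftrightarrow> \<phi> \<in> M \<rightarrow>\<^sub>E M \<and>
    (\<forall>z\<in>M. \<forall>z'\<in>M. \<phi> (padd z z') = padd (\<phi> z) (\<phi> z')) \<and>
    (\<forall>z\<in>M. \<forall>h\<in>carrier H. \<phi> (pact z h) = pact (\<phi> z) h)"
  by (simp add: qschur_def Let_def)

lemma S_ops: "\<phi> \<otimes>\<^bsub>S\<^esub> \<psi> = compose M \<phi> \<psi>" "\<one>\<^bsub>S\<^esub> = (\<lambda>z\<in>M. z)" "\<zero>\<^bsub>S\<^esub> = (\<lambda>z\<in>M. perm_zero n r)"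
  "\<phi> \<oplus>\<^bsub>S\<^esub> \<psi> = (\<lambda>z\<in>M. padd (\<phi> z) (\<psi> z))" "a \<odot>\<^bsub>S\<^esub> \<phi> = (\<lambda>z\<in>M. pact (\<phi> z) (sc a))"
  by (simp_all add: qschur_def Let_def)

lemma S_M: "\<phi> \<in> carrier S \<Longrightarrow> z \<in> M \<Longrightarrow> \<phi> z \<in> M"
  by (auto simp: S_carrier)

lemma S_add: "\<phi> \<in> carrier S \<Longrightarrow> z \<in> M \<Longrightarrow> z' \<in> M \<Longrightarrow> \<phi> (padd z z') = padd (\<phi> z) (\<phi> z')"
  by (auto simp: S_carrier)

lemma S_act: "\<phi> \<in> carrier S \<Longrightarrow> z \<in> M \<Longrightarrow> h \<in> carrier H \<Longrightarrow> \<phi> (pact z h) = pact (\<phi> z) h"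
  by (auto simp: S_carrier)

lemma S_eqI: "\<phi> \<in> carrier S \<Longrightarrow> \<psi> \<in> carrier S \<Longrightarrow> (\<And>z. z \<in> M \<Longrightarrow> \<phi> z = \<psi> z) \<Longrightarrow> \<phi> = \<psi>"
  using PiE_ext[of \<phi> M "\<lambda>_. M" \<psi>] by (auto simp: S_carrier)

lemma S_I:
  assumes "\<phi> \<in> extensional M" "\<And>z. z \<in> M \<Longrightarrow> \<phi> z \<in> M"
    "\<And>z z'. z \<in> M \<Longrightarrow> z' \<in> M \<Longrightarrow> \<phi> (padd z z') = padd (\<phi> z) (\<phi> z')"
    "\<And>z h. z \<in> M \<Longrightarrow> h \<in> carrier H \<Longrightarrow> \<phi> (pact z h) = pact (\<phi> z) h"
  shows "\<phi> \<in> carrier S"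
  using assms by (auto simp: S_carrier PiE_def)

lemma padd_comm4: "a \<in> M \<Longrightarrow> b \<in> M \<Longrightarrow> c \<in> M \<Longrightarrow> d \<in> M \<Longrightarrow>
    padd (padd a b) (padd c d) = padd (padd a c) (padd b d)"
  by (rule M_eqI) (auto simp: padd_M padd_apply M_closed H.a_ac)

lemma padd_pact: "a \<in> M \<Longrightarrow> b \<in> M \<Longrightarrow> h \<in> carrier H \<Longrightarrow> pact (padd a b) h = padd (pact a h) (pact b h)"
  by (rule M_eqI) (auto simp: padd_M pact_M padd_apply pact_apply M_closed H.l_distr)

lemma pact_pact: "a \<in> M \<Longrightarrow> h \<in> carrier H \<Longrightarrow> h' \<in> carrier H \<Longrightarrow> pact (pact a h) h' = pact a (h \<otimes>\<^bsub>H\<^esub> h')"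
  by (rule M_eqI) (auto simp: pact_M pact_apply M_closed H.m_assoc)

lemma S_one_closed: "\<one>\<^bsub>S\<^esub> \<in> carrier S"
  by (rule S_I) (auto simp: S_ops padd_M pact_M)

lemma S_zero_closed: "\<zero>\<^bsub>S\<^esub> \<in> carrier S"
proof (rule S_I)
  fix z z' assume z: "z \<in> M" "z' \<in> M"
  show "\<zero>\<^bsub>S\<^esub> (padd z z') = padd (\<zero>\<^bsub>S\<^esub> z) (\<zero>\<^bsub>S\<^esub> z')"
    by (rule M_eqI) (auto simp: S_ops padd_M pact_M pzero_M z padd_apply pzero_apply)
next
  fix z h assume z: "z \<in> M" "h \<in> carrier H"
  show "\<zero>\<^bsub>S\<^esub> (pact z h) = pact (\<zero>\<^bsub>S\<^esub> z) h"
    by (rule M_eqI) (auto simp: S_ops padd_M pact_M pzero_M z pact_apply pzero_apply)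
qed (auto simp: S_ops pzero_M)

lemma S_add_closed: assumes "\<phi> \<in> carrier S" "\<psi> \<in> carrier S" shows "\<phi> \<oplus>\<^bsub>S\<^esub> \<psi> \<in> carrier S"
  by (rule S_I) (use assms in \<open>auto simp: S_ops padd_M pact_M S_M S_add S_act padd_comm4 padd_pact\<close>)

lemma S_mult_closed: assumes "\<phi> \<in> carrier S" "\<psi> \<in> carrier S" shows "\<phi> \<otimes>\<^bsub>S\<^esub> \<psi> \<in> carrier S"
  by (rule S_I) (use assms in \<open>auto simp: S_ops compose_def padd_M pact_M S_M S_add S_act\<close>)

lemma S_smult_closed: assumes "\<phi> \<in> carrier S" "a \<in> laurent" shows "a \<odot>\<^bsub>S\<^esub> \<phi> \<in> carrier S"
  by (rule S_I)
    (use assms in \<open>auto simp: S_ops padd_M pact_M S_M S_add S_act padd_pact pact_pact sc_central\<close>)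

lemma S_uminus: assumes "\<phi> \<in> carrier S" shows "((- 1) \<odot>\<^bsub>S\<^esub> \<phi>) \<oplus>\<^bsub>S\<^esub> \<phi> = \<zero>\<^bsub>S\<^esub>"
proof (rule S_eqI)
  have m1: "- 1 \<in> laurent" using laurent_uminus[OF laurent_1] .
  show "((- 1) \<odot>\<^bsub>S\<^esub> \<phi>) \<oplus>\<^bsub>S\<^esub> \<phi> \<in> carrier S" using assms m1 by (simp add: S_add_closed S_smult_closed)
  have z: "h \<otimes>\<^bsub>H\<^esub> sc (- 1) \<oplus>\<^bsub>H\<^esub> h = \<zero>\<^bsub>H\<^esub>" if "h \<in> carrier H" for h
    using that m1 by (intro kap_eqI) (auto simp: kap_add kap_sc_right kap_zero)
  fix x assume "x \<in> M"
  then show "(((- 1) \<odot>\<^bsub>S\<^esub> \<phi>) \<oplus>\<^bsub>S\<^esub> \<phi>) x = \<zero>\<^bsub>S\<^esub> x"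
    using assms m1 by (intro M_eqI)
      (auto simp: S_ops padd_M pact_M S_M pzero_M padd_apply pact_apply pzero_apply M_closed z)
qed (rule S_zero_closed)

lemma S_ring: "ring S"
proof (rule ringI)
  show "abelian_group S"
  proof (rule abelian_groupI)
    fix x y z assume c: "x \<in> carrier S" "y \<in> carrier S" "z \<in> carrier S"
    show "x \<oplus>\<^bsub>S\<^esub> y \<oplus>\<^bsub>S\<^esub> z = x \<oplus>\<^bsub>S\<^esub> (y \<oplus>\<^bsub>S\<^esub> z)"
      using c by (intro S_eqI S_add_closed) (auto simp: S_ops S_M padd_M padd_apply M_closed H.a_assoc intro!: M_eqI)
    show "x \<oplus>\<^bsub>S\<^esub> y = y \<oplus>\<^bsub>S\<^esub> x"
      using c by (intro S_eqI S_add_closed) (auto simp: S_ops S_M padd_M padd_apply M_closed H.a_comm intro!: M_eqI)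
    show "\<zero>\<^bsub>S\<^esub> \<oplus>\<^bsub>S\<^esub> x = x"
      using c by (intro S_eqI S_add_closed S_zero_closed)
        (auto simp: S_ops S_M padd_M pzero_M padd_apply pzero_apply M_closed intro!: M_eqI)
    show "\<exists>y\<in>carrier S. y \<oplus>\<^bsub>S\<^esub> x = \<zero>\<^bsub>S\<^esub>"
      using c(1) S_uminus S_smult_closed[OF c(1) laurent_uminus[OF laurent_1]] by blast
  qed (auto simp: S_add_closed S_zero_closed)
  show "monoid S"
  proof (rule monoidI)
    fix x y z assume c: "x \<in> carrier S" "y \<in> carrier S" "z \<in> carrier S"
    show "x \<otimes>\<^bsub>S\<^esub> y \<otimes>\<^bsub>S\<^esub> z = x \<otimes>\<^bsub>S\<^esub> (y \<otimes>\<^bsub>S\<^esub> z)"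
      using c by (intro S_eqI S_mult_closed) (auto simp: S_ops compose_def S_M)
    show "\<one>\<^bsub>S\<^esub> \<otimes>\<^bsub>S\<^esub> x = x" "x \<otimes>\<^bsub>S\<^esub> \<one>\<^bsub>S\<^esub> = x"
      using c by (intro S_eqI S_mult_closed S_one_closed; auto simp: S_ops compose_def S_M)+
  qed (auto simp: S_mult_closed S_one_closed)
  fix x y z assume c: "x \<in> carrier S" "y \<in> carrier S" "z \<in> carrier S"
  show "(x \<oplus>\<^bsub>S\<^esub> y) \<otimes>\<^bsub>S\<^esub> z = x \<otimes>\<^bsub>S\<^esub> z \<oplus>\<^bsub>S\<^esub> y \<otimes>\<^bsub>S\<^esub> z"
    using c by (intro S_eqI S_mult_closed S_add_closed) (auto simp: S_ops compose_def S_M)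
  show "z \<otimes>\<^bsub>S\<^esub> (x \<oplus>\<^bsub>S\<^esub> y) = z \<otimes>\<^bsub>S\<^esub> x \<oplus>\<^bsub>S\<^esub> z \<otimes>\<^bsub>S\<^esub> y"
    using c by (intro S_eqI S_mult_closed S_add_closed) (auto simp: S_ops compose_def S_M S_add padd_M)
qed

lemma S_smult_mult:
  assumes "\<phi> \<in> carrier S" "\<psi> \<in> carrier S" "a \<in> laurent"
  shows "(a \<odot>\<^bsub>S\<^esub> \<phi>) \<otimes>\<^bsub>S\<^esub> \<psi> = a \<odot>\<^bsub>S\<^esub> (\<phi> \<otimes>\<^bsub>S\<^esub> \<psi>)"
    "\<phi> \<otimes>\<^bsub>S\<^esub> (a \<odot>\<^bsub>S\<^esub> \<psi>) = a \<odot>\<^bsub>S\<^esub> (\<phi> \<otimes>\<^bsub>S\<^esub> \<psi>)"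
  using assms
  by (intro S_eqI S_mult_closed S_smult_closed; auto simp: S_ops compose_def S_M S_act pact_M)+

section \<open>Endomorphisms as matrices over the Hecke algebra\<close>

definition ent :: "qschur_elt \<Rightarrow> nvec \<Rightarrow> nvec \<Rightarrow> hecke_elt" where
  "ent \<phi> l m = \<phi> (pin m (X m)) l"

text \<open>The intersection of the right ideal generated by \<open>X l\<close> with the left ideal
  generated by \<open>X m\<close>, the latter expressed through the anti-involution.\<close>

definition Bi :: "nvec \<Rightarrow> nvec \<Rightarrow> hecke_elt set" where
  "Bi l m = {y \<in> Inv l. star y \<in> Inv m}"

lemma X_Inv: "l \<in> L \<Longrightarrow> X l \<in> Inv l"
  by (simp add: hecke_x_eq xc_Linv)

lemma star_X: "l \<in> L \<Longrightarrow> star (X l) = X l"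
  by (simp add: hecke_x_eq star_xc)

lemma ent_closed: "\<phi> \<in> carrier S \<Longrightarrow> l \<in> L \<Longrightarrow> m \<in> L \<Longrightarrow> ent \<phi> l m \<in> Inv l"
  unfolding ent_def by (rule M_D(1)[OF S_M[OF _ pinj_M[OF X_Inv]]])

lemma pinj_pact: "m \<in> L \<Longrightarrow> y \<in> Inv m \<Longrightarrow> h \<in> carrier H \<Longrightarrow> pact (pin m y) h = pin m (y \<otimes>\<^bsub>H\<^esub> h)"
  by (rule M_eqI) (auto simp: pact_M pinj_M Inv_mult pact_apply pinj_apply)

lemma S_pinj:
  assumes "\<phi> \<in> carrier S" "l \<in> L" "m \<in> L" "h \<in> carrier H"
  shows "\<phi> (pin m (X m \<otimes>\<^bsub>H\<^esub> h)) l = ent \<phi> l m \<otimes>\<^bsub>H\<^esub> h"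
proof -
  have "\<phi> (pin m (X m \<otimes>\<^bsub>H\<^esub> h)) = pact (\<phi> (pin m (X m))) h"
    using assms by (simp add: X_Inv pinj_M S_act flip: pinj_pact)
  then show ?thesis using assms by (simp add: pact_apply ent_def)
qed

lemma finite_L: "finite L"
proof -
  have "l \<in> {1..n} \<rightarrow> {0..r} \<and> (\<forall>i. i \<notin> {1..n} \<longrightarrow> l i = 0)" if "l \<in> L" for l
  proof -
    have "l i \<le> r" if i: "i \<in> {1..n}" for i
      using member_le_sum[of i "{1..n}" l] i \<open>l \<in> L\<close> by (simp add: Lam_def)
    then show ?thesis using \<open>l \<in> L\<close> by (auto simp: Lam_def)
  qed
  then have "L \<subseteq> {l. \<forall>i. (i \<in> {1..n} \<longrightarrow> l i \<in> {0..r}) \<and> (i \<notin> {1..n} \<longrightarrow> l i = 0)}" by blast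
  then show ?thesis by (rule finite_subset) (rule finite_set_of_finite_funs, auto)
qed

text \<open>The direct sum is modelled by functions on the finite set \<open>L\<close>, so an
  endomorphism is split over the summands by induction on the support.\<close>

lemma S_decomp:
  assumes \<phi>: "\<phi> \<in> carrier S" and z: "z \<in> M" and l: "l \<in> L"
  shows "\<phi> z l = (\<Oplus>\<^bsub>H\<^esub> m\<in>L. \<phi> (pin m (z m)) l)"
proof -
  \<comment> \<open>The truncation of \<open>z\<close> to the summands in \<open>T\<close>;
    enlarging \<open>T\<close> by one index adds one embedded component.\<close>
  define zz where "zz T = (\<lambda>m\<in>L. if m \<in> T then z m else \<zero>\<^bsub>H\<^esub>)" for T
  have zM: "zz T \<in> M" for T by (rule M_I) (auto simp: zz_def M_D[OF z] Inv_zero)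
  have za: "zz T m = (if m \<in> T then z m else \<zero>\<^bsub>H\<^esub>)" if "m \<in> L" for T m using that by (simp add: zz_def)
  have iM: "pin m' (z m') \<in> M" if "m' \<in> L" for m' using pinj_M M_D(1)[OF z that] by blast
  have "T \<subseteq> L \<Longrightarrow> \<phi> (zz T) l = (\<Oplus>\<^bsub>H\<^esub> m\<in>T. \<phi> (pin m (z m)) l)" if "finite T" for T
    using that
  proof (induction T rule: finite_induct)
    case empty
    let ?a = "\<phi> (zz {}) l"
    have a: "?a \<in> carrier H" by (rule M_closed[OF S_M[OF \<phi> zM] l])
    have "padd (zz {}) (zz {}) = zz {}" by (rule M_eqI) (simp_all add: zM padd_M padd_apply za)
    then have e: "?a \<oplus>\<^bsub>H\<^esub> ?a = ?a"
      using S_add[OF \<phi> zM[of "{}"] zM[of "{}"]] padd_apply[OF l, of "\<phi> (zz {})" "\<phi> (zz {})"] by simp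
    have "?a = \<zero>\<^bsub>H\<^esub>"
    proof (rule kap_eqI[OF a H.zero_closed])
      fix f show "kap ?a f = kap \<zero>\<^bsub>H\<^esub> f" using kap_add[OF a a, of f] unfolding e by (simp add: kap_zero)
    qed
    then show ?case by simp
  next
    case (insert m T)
    have m: "m \<in> L" "T \<subseteq> L" using insert.prems by auto
    have "zz (insert m T) = padd (pin m (z m)) (zz T)"
      using insert.hyps m M_closed[OF z] by (intro M_eqI padd_M iM zM) (auto simp: za padd_apply pinj_apply)
    then have "\<phi> (zz (insert m T)) l = \<phi> (pin m (z m)) l \<oplus>\<^bsub>H\<^esub> \<phi> (zz T) l"
      using S_add[OF \<phi> iM[OF m(1)] zM] padd_apply[OF l] by simp
    also have "\<phi> (zz T) l = (\<Oplus>\<^bsub>H\<^esub> m\<in>T. \<phi> (pin m (z m)) l)" by (rule insert.IH[OF m(2)])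
    also have "\<phi> (pin m (z m)) l \<oplus>\<^bsub>H\<^esub> \<dots> = (\<Oplus>\<^bsub>H\<^esub> m\<in>insert m T. \<phi> (pin m (z m)) l)"
    proof (rule H.finsum_insert[symmetric])
      show "(\<lambda>m. \<phi> (pin m (z m)) l) \<in> T \<rightarrow> carrier H"
        using M_closed[OF S_M[OF \<phi> iM] l] m by blast
      show "\<phi> (pin m (z m)) l \<in> carrier H" using M_closed[OF S_M[OF \<phi> iM] l] m by blast
    qed (use insert.hyps in auto)
    finally show ?case .
  qed
  from this[OF finite_L] have "\<phi> (zz L) l = (\<Oplus>\<^bsub>H\<^esub> m\<in>L. \<phi> (pin m (z m)) l)" by simp
  moreover have "zz L = z" by (rule M_eqI[OF zM z]) (simp add: za)
  ultimately show ?thesis by simp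
qed

lemma S_ent_eqI:
  assumes "\<phi> \<in> carrier S" "\<psi> \<in> carrier S" "\<And>l m. l \<in> L \<Longrightarrow> m \<in> L \<Longrightarrow> ent \<phi> l m = ent \<psi> l m"
  shows "\<phi> = \<psi>"
proof (rule S_eqI[OF assms(1,2)])
  fix z assume z: "z \<in> M"
  show "\<phi> z = \<psi> z"
  proof (rule M_eqI)
    fix l assume l: "l \<in> L"
    have "\<phi> (pin m (z m)) l = \<psi> (pin m (z m)) l" if m: "m \<in> L" for m
    proof -
      obtain h where "h \<in> carrier H" "z m = X m \<otimes>\<^bsub>H\<^esub> h" using M_D(1)[OF z m] Inv_eq[OF m] by auto
      then show ?thesis using assms l m by (simp add: S_pinj)
    qed
    moreover have "\<psi> (pin m (z m)) l \<in> carrier H" if m: "m \<in> L" for m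
      by (rule M_closed[OF S_M[OF assms(2) pinj_M[OF M_D(1)[OF z m]]] l])
    ultimately show "\<phi> z l = \<psi> z l"
      unfolding S_decomp[OF assms(1) z l] S_decomp[OF assms(2) z l] by (intro H.add.finprod_cong') auto
  qed (use assms z S_M in auto)
qed

lemma star_T': "i \<in> {1..<r} \<Longrightarrow> h \<in> carrier H \<Longrightarrow> star (h \<otimes>\<^bsub>H\<^esub> hw [i]) = hw [i] \<otimes>\<^bsub>H\<^esub> star h"
  using star_T[of i "star h"] star_star[of h] star_star[of "hw [i] \<otimes>\<^bsub>H\<^esub> star h"] by (simp add: star_closed)

lemma star_Inv_iff:
  assumes "y \<in> carrier H"
  shows "star y \<in> Linv c \<longleftrightarrow> (\<forall>i\<in>{1..<r}. c i = c (Suc i) \<longrightarrow> y \<otimes>\<^bsub>H\<^esub> hw [i] = y \<otimes>\<^bsub>H\<^esub> sc qq)"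
proof -
  have "hw [i] \<otimes>\<^bsub>H\<^esub> star y = sc qq \<otimes>\<^bsub>H\<^esub> star y \<longleftrightarrow> y \<otimes>\<^bsub>H\<^esub> hw [i] = y \<otimes>\<^bsub>H\<^esub> sc qq" if i: "i \<in> {1..<r}" for i
  proof -
    have a: "hw [i] \<otimes>\<^bsub>H\<^esub> star y = star (y \<otimes>\<^bsub>H\<^esub> hw [i])" using assms i by (simp add: star_T')
    have b: "sc qq \<otimes>\<^bsub>H\<^esub> star y = star (y \<otimes>\<^bsub>H\<^esub> sc qq)"
      using assms sc_central[OF laurent_qq assms] by (simp add: star_sc laurent_qq flip: sc_central)
    have c: "y \<otimes>\<^bsub>H\<^esub> hw [i] \<in> carrier H" "y \<otimes>\<^bsub>H\<^esub> sc qq \<in> carrier H" using assms i laurent_qq by auto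
    show ?thesis unfolding a b using star_star[OF c(1)] star_star[OF c(2)] by metis
  qed
  then show ?thesis unfolding Linv_iff_T using assms star_closed by blast
qed

text \<open>The generator \<open>X m\<close> satisfies x T_i = q x for the swaps of its Young
  subgroup, and an endomorphism carries this relation over to its entry.\<close>

lemma ent_Bi:
  assumes "\<phi> \<in> carrier S" "l \<in> L" "m \<in> L" shows "ent \<phi> l m \<in> Bi l m"
proof -
  have e: "ent \<phi> l m \<in> carrier H" using ent_closed[OF assms] by (rule Inv_closed)
  have "ent \<phi> l m \<otimes>\<^bsub>H\<^esub> hw [i] = ent \<phi> l m \<otimes>\<^bsub>H\<^esub> sc qq" if i: "i \<in> {1..<r}" "blk m i = blk m (Suc i)" for i
  proof -
    have "star (X m) \<in> Linv (blk m)" using assms(3) by (simp add: star_X X_Inv)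
    then have "X m \<otimes>\<^bsub>H\<^esub> hw [i] = X m \<otimes>\<^bsub>H\<^esub> sc qq"
      using i assms(3) star_Inv_iff[of "X m" "blk m"] by simp
    then show ?thesis using S_pinj[OF assms, of "hw [i]"] S_pinj[OF assms, of "sc qq"] i laurent_qq by simp
  qed
  then show ?thesis unfolding Bi_def using ent_closed[OF assms] star_Inv_iff[OF e, of "blk m"] by blast
qed

lemma Bi_closed: "y \<in> Bi l m \<Longrightarrow> y \<in> carrier H"
  by (auto simp: Bi_def intro: Inv_closed)

text \<open>Invariance under the row subgroup is used directly and under the column subgroup after
  \<open>star\<close>; together the coefficients are constant on double cosets, which the matrix
  classifies.\<close>

lemma Bi_kap_eq:
  assumes l: "l \<in> L" and m: "m \<in> L" and y: "y \<in> Bi l m" and f: "f \<in> P" and g: "g \<in> P" and eq: "mt l m f = mt l m g"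
  shows "kap y f = kap y g"
proof -
  obtain u v where uv: "u \<in> Yg (blk l)" "v \<in> Yg (blk m)" "g = v \<circ> f \<circ> u"
    using mt_eq_coset[OF l m f g eq] by blast
  have yc: "y \<in> carrier H" by (rule Bi_closed[OF y])
  have vf: "v \<circ> f \<in> P" using Yg_P[OF uv(2)] f permutes_compose by auto
  have pvf: "pinv (v \<circ> f) = pinv f \<circ> pinv v"
    using Yg_P[OF uv(2)] f by (simp add: o_inv_distrib permutes_bij)
  have "kap y g = kap y (v \<circ> f)"
    unfolding uv(3) using y by (intro Linv_Yg[OF blk_mono[OF l] _ uv(1) vf]) (simp add: Bi_def)
  also have "\<dots> = kap (star y) (pinv f \<circ> pinv v)"
    using kap_star[OF yc pinv_P[OF vf]] pinv_pinv[OF vf] pvf by simp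
  also have "\<dots> = kap (star y) (pinv f)"
    using y by (intro Linv_Yg[OF blk_mono[OF m] _ Yg_pinv[OF uv(2)] pinv_P[OF f]]) (simp add: Bi_def)
  also have "\<dots> = kap y f" using kap_star[OF yc pinv_P[OF f]] pinv_pinv[OF f] by simp
  finally show ?thesis by simp
qed

lemma Bi_factor:
  assumes "m \<in> L" "y \<in> Bi l m" shows "\<exists>k\<in>carrier H. y = k \<otimes>\<^bsub>H\<^esub> X m"
proof -
  have "star y \<in> Inv m" using assms(2) by (simp add: Bi_def)
  then obtain h where h: "h \<in> carrier H" "star y = X m \<otimes>\<^bsub>H\<^esub> h" using Inv_eq[OF assms(1)] by auto
  have "y = star (star y)" using star_star[OF Bi_closed[OF assms(2)]] by simp
  also have "\<dots> = star h \<otimes>\<^bsub>H\<^esub> X m" using h assms(1) by (simp add: star_mult star_X)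
  finally show ?thesis using h star_closed by blast
qed

definition rep :: "nmat \<Rightarrow> nat \<Rightarrow> nat" where
  "rep A = (SOME f. f \<in> P \<and> mt (ro n A) (co n A) f = A)"

lemma rep: assumes "A \<in> Th" shows "rep A \<in> P" "mt (ro n A) (co n A) (rep A) = A"
  using someI_ex[of "\<lambda>f. f \<in> P \<and> mt (ro n A) (co n A) f = A"] mt_surj[OF assms] unfolding rep_def by blast+

text \<open>The coefficient is read at one chosen representative of the double coset of
  \<open>A\<close>; by \<open>kap_ent\<close> every representative gives the same value.\<close>

definition crd :: "qschur_elt \<Rightarrow> nmat \<Rightarrow> ratfun" where
  "crd \<phi> A = kap (ent \<phi> (ro n A) (co n A)) (rep A)"

lemma kap_ent:
  assumes "\<phi> \<in> carrier S" "l \<in> L" "m \<in> L" "f \<in> P"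
  shows "kap (ent \<phi> l m) f = crd \<phi> (mt l m f)"
proof -
  have A: "mt l m f \<in> Th" "ro n (mt l m f) = l" "co n (mt l m f) = m"
    using mt_Theta ro_mt co_mt assms by auto
  show ?thesis unfolding crd_def A(2,3)
    using rep[OF A(1)] A by (intro Bi_kap_eq[OF assms(2,3) ent_Bi[OF assms(1-3)] assms(4)]) simp_all
qed

lemma crd_eqI:
  assumes "\<phi> \<in> carrier S" "\<psi> \<in> carrier S" "\<And>A. A \<in> Th \<Longrightarrow> crd \<phi> A = crd \<psi> A"
  shows "\<phi> = \<psi>"
proof (rule S_ent_eqI[OF assms(1,2)])
  fix l m assume lm: "l \<in> L" "m \<in> L"
  show "ent \<phi> l m = ent \<psi> l m"
    by (rule kap_eqI[OF Inv_closed[OF ent_closed[OF assms(1) lm]] Inv_closed[OF ent_closed[OF assms(2) lm]]])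
      (simp only: kap_ent[OF assms(1) lm] kap_ent[OF assms(2) lm] assms(3)[OF mt_Theta[OF lm]])
qed

lemma crd_add: "\<phi> \<in> carrier S \<Longrightarrow> \<psi> \<in> carrier S \<Longrightarrow> A \<in> Th \<Longrightarrow> crd (\<phi> \<oplus>\<^bsub>S\<^esub> \<psi>) A = crd \<phi> A + crd \<psi> A"
  using pinj_M[OF X_Inv[OF co_Lam]] ro_Lam
  by (simp add: crd_def ent_def S_ops padd_apply kap_add M_closed S_M)

lemma crd_smult: "\<phi> \<in> carrier S \<Longrightarrow> a \<in> laurent \<Longrightarrow> A \<in> Th \<Longrightarrow> crd (a \<odot>\<^bsub>S\<^esub> \<phi>) A = a * crd \<phi> A"
  using pinj_M[OF X_Inv[OF co_Lam]] ro_Lam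
  by (simp add: crd_def ent_def S_ops pact_apply kap_sc_right M_closed S_M)

lemma crd_laurent: "\<phi> \<in> carrier S \<Longrightarrow> A \<in> Th \<Longrightarrow> crd \<phi> A \<in> laurent"
  unfolding crd_def by (intro kap_laurent Inv_closed[OF ent_closed] ro_Lam co_Lam)

text \<open>Left multiplication by \<open>k\<close> from summand \<open>m\<close> to summand
  \<open>l\<close>. It commutes with the right action, so the only condition for an endomorphism is
  that \<open>k\<close> sends \<open>X m\<close> into the right ideal of \<open>l\<close>.\<close>

definition emap :: "nvec \<Rightarrow> nvec \<Rightarrow> hecke_elt \<Rightarrow> qschur_elt" where
  "emap l m k = (\<lambda>z\<in>M. pin l (k \<otimes>\<^bsub>H\<^esub> z m))"

lemma emap_S:
  assumes "l \<in> L" "m \<in> L" "k \<in> carrier H" "k \<otimes>\<^bsub>H\<^esub> X m \<in> Inv l"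
  shows "emap l m k \<in> carrier S"
proof (rule S_I)
  have inv: "k \<otimes>\<^bsub>H\<^esub> z m \<in> Inv l" if z: "z \<in> M" for z
  proof -
    obtain h where "h \<in> carrier H" "z m = X m \<otimes>\<^bsub>H\<^esub> h" using M_D(1)[OF z assms(2)] Inv_eq[OF assms(2)] by auto
    then show ?thesis using assms by (simp add: Inv_mult flip: H.m_assoc)
  qed
  show "emap l m k \<in> extensional M" by (simp add: emap_def)
  show "\<And>z. z \<in> M \<Longrightarrow> emap l m k z \<in> M" using inv by (simp add: emap_def pinj_M)
  show "emap l m k (padd z z') = padd (emap l m k z) (emap l m k z')" if "z \<in> M" "z' \<in> M" for z z'
    using that assms inv[of "padd z z'"] inv[of z] inv[of z']
    by (intro M_eqI) (auto simp: emap_def padd_M pinj_M padd_apply pinj_apply M_closed H.r_distr)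
  show "emap l m k (pact z h) = pact (emap l m k z) h" if "z \<in> M" "h \<in> carrier H" for z h
    using that assms inv[of "pact z h"] inv[of z]
    by (intro M_eqI) (auto simp: emap_def pact_M pinj_M pact_apply pinj_apply M_closed H.m_assoc)
qed

lemma ent_emap:
  assumes "m \<in> L" "k \<in> carrier H" "l' \<in> L" "m' \<in> L"
  shows "ent (emap l m k) l' m' = (if l' = l \<and> m' = m then k \<otimes>\<^bsub>H\<^esub> X m else \<zero>\<^bsub>H\<^esub>)"
  using assms by (auto simp: ent_def emap_def pinj_M X_Inv pinj_apply)

definition Yel :: "nmat \<Rightarrow> hecke_elt" where
  "Yel A = finsum H Tw (dcoset n r A)"

lemma dcoset_P: "A \<in> Th \<Longrightarrow> dcoset n r A \<subseteq> P" by (auto simp: dcoset_eq)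

lemma Yel_closed: "A \<in> Th \<Longrightarrow> Yel A \<in> carrier H"
  unfolding Yel_def by (intro H.finsum_closed) (use dcoset_P Tw_closed in blast)

lemma kap_Yel: assumes "A \<in> Th" "f \<in> P" shows "kap (Yel A) f = (if mt (ro n A) (co n A) f = A then 1 else 0)"
proof -
  have "f \<in> P \<and> pinv f \<in> dcoset n r A \<longleftrightarrow> mt (ro n A) (co n A) f = A"
    unfolding dcoset_eq[OF assms(1)] mem_Collect_eq pinv_pinv[OF assms(2)]
    using assms(2) pinv_P[OF assms(2)] by simp
  then show ?thesis unfolding Yel_def kap_Tw_sum[OF dcoset_P[OF assms(1)]] by (simp only:)
qed

lemma transp_eq_iff: "transp B = A \<longleftrightarrow> B = transp A" for A B :: nmat
proof
  assume e: "transp B = A" show "B = transp A" unfolding e[symmetric] by (rule refl)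
next
  assume e: "B = transp A" show "transp B = A" unfolding e by (rule refl)
qed

lemma star_Yel: assumes "A \<in> Th" shows "star (Yel A) = Yel (transp A)"
proof (rule kap_eqI[OF star_closed[OF Yel_closed[OF assms]] Yel_closed[OF transp_Theta[OF assms]]])
  fix f assume f: "f \<in> P"
  have "mt (ro n A) (co n A) (pinv f) = transp (mt (co n A) (ro n A) f)" by (rule mt_transp[OF f])
  moreover have "transp (mt (co n A) (ro n A) f) = A \<longleftrightarrow> mt (co n A) (ro n A) f = transp A" by (rule transp_eq_iff)
  ultimately show "kap (star (Yel A)) f = kap (Yel (transp A)) f"
    by (simp only: kap_star[OF Yel_closed[OF assms] f] kap_Yel[OF assms pinv_P[OF f]]
        kap_Yel[OF transp_Theta[OF assms] f] ro_transp[of A] co_transp[of A])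
qed

lemma Yel_Inv: assumes "A \<in> Th" shows "Yel A \<in> Inv (ro n A)"
  unfolding Linv_def
proof (intro CollectI conjI ballI impI)
  fix i f assume i: "i \<in> {1..<r}" "blk (ro n A) i = blk (ro n A) (Suc i)" and f: "f \<in> P"
  have l: "ro n A \<in> L" "co n A \<in> L" using ro_Lam co_Lam assms by auto
  have fs: "f \<circ> sw i \<in> P" using permutes_comp_sw[of f r i] f i by simp
  have "mt (ro n A) (co n A) (f \<circ> sw i) = mt (ro n A) (co n A) f"
    using mt_coset[OF l f Yg_sw[OF i] Yg_id] by simp
  then show "kap (Yel A) (f \<circ> sw i) = kap (Yel A) f"
    by (simp only: kap_Yel[OF assms f] kap_Yel[OF assms fs])
qed (rule Yel_closed[OF assms])

lemma Yel_Bi: assumes "A \<in> Th" shows "Yel A \<in> Bi (ro n A) (co n A)"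
  using Yel_Inv[OF assms] Yel_Inv[OF transp_Theta[OF assms]] by (simp add: Bi_def star_Yel[OF assms] ro_transp[of A])

text \<open>The double coset sum lies in the left ideal generated by x, hence is k x, and left
  multiplication by k satisfies the description of e_A. Uniqueness holds since the generators of the
  summands determine an endomorphism.\<close>

lemma basis_e_props:
  assumes A: "A \<in> Th"
  shows "basis_e n r A \<in> carrier S"
    and "\<And>l h. l \<in> L \<Longrightarrow> h \<in> carrier H \<Longrightarrow> basis_e n r A (pin l (X l \<otimes>\<^bsub>H\<^esub> h)) =
      (if l = co n A then pin (ro n A) (Yel A \<otimes>\<^bsub>H\<^esub> h) else perm_zero n r)"
    and "\<exists>k\<in>carrier H. k \<otimes>\<^bsub>H\<^esub> X (co n A) = Yel A \<and> basis_e n r A = emap (ro n A) (co n A) k"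
proof -
  have lm: "ro n A \<in> L" "co n A \<in> L" using ro_Lam co_Lam A by auto
  obtain k where k: "k \<in> carrier H" "Yel A = k \<otimes>\<^bsub>H\<^esub> X (co n A)"
    using Bi_factor[OF lm(2) Yel_Bi[OF A]] by auto
  let ?\<phi> = "emap (ro n A) (co n A) k"
  have S: "?\<phi> \<in> carrier S" using lm k Yel_Inv[OF A] by (intro emap_S) auto
  have val: "?\<phi> (pin l (X l \<otimes>\<^bsub>H\<^esub> h)) = (if l = co n A then pin (ro n A) (Yel A \<otimes>\<^bsub>H\<^esub> h) else perm_zero n r)"
    if l: "l \<in> L" and h: "h \<in> carrier H" for l h
  proof -
    have "pin l (X l \<otimes>\<^bsub>H\<^esub> h) \<in> M" using l h by (simp add: pinj_M Inv_mult X_Inv)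
    then have "?\<phi> (pin l (X l \<otimes>\<^bsub>H\<^esub> h)) = pin (ro n A) (k \<otimes>\<^bsub>H\<^esub> (if l = co n A then X l \<otimes>\<^bsub>H\<^esub> h else \<zero>\<^bsub>H\<^esub>))"
      using lm by (auto simp: emap_def pinj_apply)
    also have "\<dots> = (if l = co n A then pin (ro n A) (Yel A \<otimes>\<^bsub>H\<^esub> h) else perm_zero n r)"
    proof (cases "l = co n A")
      case True then show ?thesis using k lm h by (simp add: H.m_assoc)
    next
      case False
      have "k \<otimes>\<^bsub>H\<^esub> \<zero>\<^bsub>H\<^esub> = \<zero>\<^bsub>H\<^esub>" using k by simp
      then show ?thesis using False by (simp add: perm_inj_def perm_zero_def)
    qed
    finally show ?thesis .
  qed
  have uniq: "\<psi> = ?\<phi>" if \<psi>: "\<psi> \<in> carrier S" and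
    v: "\<And>l h. l \<in> L \<Longrightarrow> h \<in> carrier H \<Longrightarrow> \<psi> (pin l (X l \<otimes>\<^bsub>H\<^esub> h)) =
      (if l = co n A then pin (ro n A) (Yel A \<otimes>\<^bsub>H\<^esub> h) else perm_zero n r)" for \<psi>
  proof (rule S_ent_eqI[OF \<psi> S])
    fix l m assume "l \<in> L" "m \<in> L"
    then show "ent \<psi> l m = ent ?\<phi> l m"
      using v[of m "\<one>\<^bsub>H\<^esub>"] val[of m "\<one>\<^bsub>H\<^esub>"] by (simp add: ent_def)
  qed
  have "basis_e n r A = ?\<phi>"
    unfolding basis_e_def Yel_def[symmetric]
  proof (rule the_equality)
    show "?\<phi> \<in> carrier S \<and> (\<forall>l\<in>L. \<forall>h\<in>carrier H. ?\<phi> (pin l (X l \<otimes>\<^bsub>H\<^esub> h)) =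
      (if l = co n A then pin (ro n A) (Yel A \<otimes>\<^bsub>H\<^esub> h) else perm_zero n r))" using S val by blast
  next
    fix \<psi> assume "\<psi> \<in> carrier S \<and> (\<forall>l\<in>L. \<forall>h\<in>carrier H. \<psi> (pin l (X l \<otimes>\<^bsub>H\<^esub> h)) =
      (if l = co n A then pin (ro n A) (Yel A \<otimes>\<^bsub>H\<^esub> h) else perm_zero n r))"
    then show "\<psi> = ?\<phi>" by (intro uniq) blast+
  qed
  then show "basis_e n r A \<in> carrier S"
    "\<And>l h. l \<in> L \<Longrightarrow> h \<in> carrier H \<Longrightarrow> basis_e n r A (pin l (X l \<otimes>\<^bsub>H\<^esub> h)) =
      (if l = co n A then pin (ro n A) (Yel A \<otimes>\<^bsub>H\<^esub> h) else perm_zero n r)"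
    "\<exists>k\<in>carrier H. k \<otimes>\<^bsub>H\<^esub> X (co n A) = Yel A \<and> basis_e n r A = emap (ro n A) (co n A) k"
    using S val k by (simp_all, blast)
qed

lemma crd_basis_e:
  assumes A: "A \<in> Th" and B: "B \<in> Th"
  shows "crd (basis_e n r A) B = (if A = B then 1 else 0)"
proof -
  obtain k where k: "k \<in> carrier H" "k \<otimes>\<^bsub>H\<^esub> X (co n A) = Yel A" "basis_e n r A = emap (ro n A) (co n A) k"
    using basis_e_props(3)[OF A] by blast
  have "ent (basis_e n r A) (ro n B) (co n B) = (if ro n B = ro n A \<and> co n B = co n A then Yel A else \<zero>\<^bsub>H\<^esub>)"
    using ent_emap[OF co_Lam[OF A] k(1) ro_Lam[OF B] co_Lam[OF B], of "ro n A"] k by simp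
  note e = this
  show ?thesis
  proof (cases "ro n B = ro n A \<and> co n B = co n A")
    case True
    then have r: "ro n B = ro n A" and c: "co n B = co n A" by auto
    have m: "mt (ro n A) (co n A) (rep B) = B" using rep(2)[OF B] unfolding r c .
    have "crd (basis_e n r A) B = kap (Yel A) (rep B)" unfolding crd_def e using r c by (simp only: simp_thms if_True)
    also have "\<dots> = (if B = A then 1 else 0)" unfolding kap_Yel[OF A rep(1)[OF B]] m ..
    finally show ?thesis by (simp only: eq_commute[of A B])
  next
    case False
    then have "crd (basis_e n r A) B = 0" unfolding crd_def e by (simp only: if_False kap_zero)
    moreover have "A \<noteq> B" using False by auto
    ultimately show ?thesis by (simp only: if_False)
  qed
qed

text \<open>The factor k with k x = \<open>Yel C\<close> is a parameter, so that an explicit sum of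
  words can be inserted for near-diagonal \<open>C\<close>. The product sends the generator of the
  source summand to \<open>k\<close> times \<open>Yel A\<close>, because \<open>Yel A\<close> lies
  in the right ideal where e_C acts as \<open>k\<close>.\<close>

lemma crd_mult_basis:
  assumes A: "A \<in> Th" and B: "B \<in> Th" and C: "C \<in> Th" and k: "k \<in> carrier H" "k \<otimes>\<^bsub>H\<^esub> X (co n C) = Yel C"
    and f: "f \<in> P" "mt (ro n B) (co n B) f = B"
  shows "crd (basis_e n r C \<otimes>\<^bsub>S\<^esub> basis_e n r A) B =
    (if co n C = ro n A \<and> ro n B = ro n C \<and> co n B = co n A then kap (k \<otimes>\<^bsub>H\<^esub> Yel A) f else 0)"
proof -
  let ?eC = "basis_e n r C" and ?eA = "basis_e n r A"
  have L: "ro n A \<in> L" "co n A \<in> L" "ro n B \<in> L" "co n B \<in> L" "ro n C \<in> L" "co n C \<in> L"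
    using ro_Lam co_Lam A B C by auto
  have XM: "pin (co n B) (X (co n B)) \<in> M" using L by (simp add: pinj_M X_Inv)
  have eA: "?eA (pin (co n B) (X (co n B))) = (if co n B = co n A then pin (ro n A) (Yel A) else perm_zero n r)"
    using basis_e_props(2)[OF A L(4), of "\<one>\<^bsub>H\<^esub>"] L Yel_closed[OF A] by simp
  have e: "ent (?eC \<otimes>\<^bsub>S\<^esub> ?eA) (ro n B) (co n B) = ?eC (?eA (pin (co n B) (X (co n B)))) (ro n B)"
    using XM by (simp add: ent_def S_ops compose_def)
  obtain h where h: "h \<in> carrier H" "Yel A = X (ro n A) \<otimes>\<^bsub>H\<^esub> h" using Yel_Inv[OF A] Inv_eq[OF L(1)] by auto
  have z: "?eC (perm_zero n r) (ro n B) = \<zero>\<^bsub>H\<^esub>"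
  proof -
    have "perm_zero n r = pin (ro n B) (X (ro n B) \<otimes>\<^bsub>H\<^esub> \<zero>\<^bsub>H\<^esub>)" using L by (auto simp: perm_zero_def perm_inj_def)
    then show ?thesis using S_pinj[OF basis_e_props(1)[OF C] L(3) L(3) H.zero_closed]
        Inv_closed[OF ent_closed[OF basis_e_props(1)[OF C] L(3) L(3)]] by simp
  qed
  have y: "?eC (pin (ro n A) (Yel A)) (ro n B) = (if co n C = ro n A \<and> ro n B = ro n C then k \<otimes>\<^bsub>H\<^esub> Yel A else \<zero>\<^bsub>H\<^esub>)"
  proof -
    have "?eC (pin (ro n A) (Yel A)) (ro n B) =
      (if ro n A = co n C then pin (ro n C) (Yel C \<otimes>\<^bsub>H\<^esub> h) else perm_zero n r) (ro n B)"
      using basis_e_props(2)[OF C L(1) h(1)] h(2) by simp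
    also have "\<dots> = (if co n C = ro n A \<and> ro n B = ro n C then k \<otimes>\<^bsub>H\<^esub> Yel A else \<zero>\<^bsub>H\<^esub>)"
    proof (cases "ro n A = co n C")
      case True
      have "Yel C \<otimes>\<^bsub>H\<^esub> h = k \<otimes>\<^bsub>H\<^esub> Yel A" using k h L True by (simp add: H.m_assoc flip: k(2))
      then show ?thesis using True L by (simp add: pinj_apply)
    next
      case False then show ?thesis using L by (auto simp: pzero_apply)
    qed
    finally show ?thesis .
  qed
  have "crd (?eC \<otimes>\<^bsub>S\<^esub> ?eA) B = kap (ent (?eC \<otimes>\<^bsub>S\<^esub> ?eA) (ro n B) (co n B)) f"
    using kap_ent[OF S_mult_closed[OF basis_e_props(1)[OF C] basis_e_props(1)[OF A]] L(3,4) f(1)] f(2) by simp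
  then show ?thesis unfolding e eA using y z by (auto simp: kap_zero)
qed

text \<open>The anti-involution reverses the product of the two factorizations k x and exchanges row
  and column data. The transposes enter as opaque matrices \<open>A'\<close>, \<open>B'\<close>,
  \<open>C'\<close> with their characteristic facts.\<close>

lemma crd_mult_transp_aux:
  assumes A: "A \<in> Th" and B: "B \<in> Th" and C: "C \<in> Th"
    and A': "A' \<in> Th" "ro n A' = co n A" "co n A' = ro n A" "star (Yel A) = Yel A'"
    and B': "B' \<in> Th" "ro n B' = co n B" "co n B' = ro n B" "mt (co n B) (ro n B) (pinv (rep B)) = B'"
    and C': "C' \<in> Th" "ro n C' = co n C" "co n C' = ro n C" "star (Yel C') = Yel C"
  shows "crd (basis_e n r A \<otimes>\<^bsub>S\<^esub> basis_e n r C) B = crd (basis_e n r C' \<otimes>\<^bsub>S\<^esub> basis_e n r A') B'"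
proof -
  have L: "ro n A \<in> L" "co n A \<in> L" "ro n B \<in> L" "co n B \<in> L" "ro n C \<in> L" "co n C \<in> L"
    using ro_Lam co_Lam A B C by blast+
  obtain k where k: "k \<in> carrier H" "k \<otimes>\<^bsub>H\<^esub> X (co n A) = Yel A" using basis_e_props(3)[OF A] by blast
  obtain k' where k': "k' \<in> carrier H" "k' \<otimes>\<^bsub>H\<^esub> X (co n C') = Yel C'" using basis_e_props(3)[OF C'(1)] by blast
  note sk = star_closed[OF k(1)] star_closed[OF k'(1)]
  have kv: "kap (k \<otimes>\<^bsub>H\<^esub> Yel C) (rep B) = kap (k' \<otimes>\<^bsub>H\<^esub> Yel A') (rep B')"
    if c: "co n A = ro n C" "ro n B = ro n A" "co n B = co n C"
  proof -
    have YA: "Yel A' = X (co n A) \<otimes>\<^bsub>H\<^esub> star k"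
      using star_mult[OF k(1) X_closed[OF L(2)]] unfolding k(2) A'(4) star_X[OF L(2)] .
    have YC: "Yel C = X (co n A) \<otimes>\<^bsub>H\<^esub> star k'"
      using star_mult[OF k'(1) X_closed[OF L(5)]] k'(2) unfolding C'(3) c(1) by (simp only: C'(4) star_X[OF L(5)])
    have kX: "k' \<otimes>\<^bsub>H\<^esub> X (co n A) = Yel C'" using k'(2) unfolding C'(3) c(1) .
    have m: "k' \<otimes>\<^bsub>H\<^esub> Yel A' \<in> carrier H" using k' Yel_closed[OF A'(1)] by simp
    have e1: "k' \<otimes>\<^bsub>H\<^esub> Yel A' = Yel C' \<otimes>\<^bsub>H\<^esub> star k"
      unfolding YA kX[symmetric] by (rule H.m_assoc[symmetric, OF k'(1) X_closed[OF L(2)] sk(1)])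
    have e2: "k \<otimes>\<^bsub>H\<^esub> Yel C = Yel A \<otimes>\<^bsub>H\<^esub> star k'"
      unfolding YC k(2)[symmetric] by (rule H.m_assoc[symmetric, OF k(1) X_closed[OF L(2)] sk(2)])
    have "star (k' \<otimes>\<^bsub>H\<^esub> Yel A') = star (star k) \<otimes>\<^bsub>H\<^esub> star (Yel C')"
      unfolding e1 by (rule star_mult[OF Yel_closed[OF C'(1)] sk(1)])
    then have st: "star (k' \<otimes>\<^bsub>H\<^esub> Yel A') = k \<otimes>\<^bsub>H\<^esub> Yel C"
      unfolding C'(4) star_star[OF k(1)] .
    have "kap (k \<otimes>\<^bsub>H\<^esub> Yel C) (rep B) = kap (k' \<otimes>\<^bsub>H\<^esub> Yel A') (pinv (rep B))"
      unfolding st[symmetric] by (rule kap_star[OF m rep(1)[OF B]])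
    also have "\<dots> = kap (k' \<otimes>\<^bsub>H\<^esub> Yel A') (rep B')"
    proof (rule Bi_kap_eq[OF L(4,3)])
      have "Yel C' \<in> Inv (co n B)" using Yel_Inv[OF C'(1)] unfolding C'(2) c(3) .
      then have "k' \<otimes>\<^bsub>H\<^esub> Yel A' \<in> Inv (co n B)" unfolding e1 by (rule Inv_mult[OF _ sk(1)])
      moreover have "Yel A \<in> Inv (ro n B)" using Yel_Inv[OF A] unfolding c(2) .
      then have "k \<otimes>\<^bsub>H\<^esub> Yel C \<in> Inv (ro n B)" unfolding e2 by (rule Inv_mult[OF _ sk(2)])
      ultimately show "k' \<otimes>\<^bsub>H\<^esub> Yel A' \<in> Bi (co n B) (ro n B)" by (simp only: Bi_def st mem_Collect_eq simp_thms)
      show "pinv (rep B) \<in> P" by (rule pinv_P[OF rep(1)[OF B]])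
      show "rep B' \<in> P" by (rule rep(1)[OF B'(1)])
      show "mt (co n B) (ro n B) (pinv (rep B)) = mt (co n B) (ro n B) (rep B')"
        using rep(2)[OF B'(1)] unfolding B'(2-4) by (rule sym)
    qed
    finally show ?thesis .
  qed
  have l: "crd (basis_e n r A \<otimes>\<^bsub>S\<^esub> basis_e n r C) B =
      (if co n A = ro n C \<and> ro n B = ro n A \<and> co n B = co n C then kap (k \<otimes>\<^bsub>H\<^esub> Yel C) (rep B) else 0)"
    by (rule crd_mult_basis[OF C B A k rep[OF B]])
  have r: "crd (basis_e n r C' \<otimes>\<^bsub>S\<^esub> basis_e n r A') B' =
      (if ro n C = co n A \<and> co n B = co n C \<and> ro n B = ro n A then kap (k' \<otimes>\<^bsub>H\<^esub> Yel A') (rep B') else 0)"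
    using crd_mult_basis[OF A'(1) B'(1) C'(1) k' rep[OF B'(1)]] unfolding A'(2,3) B'(2,3) C'(2,3) .
  show ?thesis
  proof (cases "co n A = ro n C \<and> ro n B = ro n A \<and> co n B = co n C")
    case True
    then have c: "co n A = ro n C" "ro n B = ro n A" "co n B = co n C" by blast+
    then show ?thesis unfolding l r kv[OF c] by (simp only: simp_thms if_True)
  next
    case False
    then have "\<not> (ro n C = co n A \<and> co n B = co n C \<and> ro n B = ro n A)" by metis
    then show ?thesis unfolding l r using False by (simp only: if_False)
  qed
qed

lemma crd_mult_transp:
  assumes A: "A \<in> Th" and B: "B \<in> Th" and C: "C \<in> Th"
  shows "crd (basis_e n r A \<otimes>\<^bsub>S\<^esub> basis_e n r C) B =
    crd (basis_e n r (transp C) \<otimes>\<^bsub>S\<^esub> basis_e n r (transp A)) (transp B)"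
proof (rule crd_mult_transp_aux[OF A B C])
  show "mt (co n B) (ro n B) (pinv (rep B)) = transp B"
    by (rule trans[OF mt_transp[OF rep(1)[OF B]]]) (simp only: rep(2)[OF B])
  show "star (Yel (transp C)) = Yel C"
    using star_Yel[OF transp_Theta[OF C]] .
  show "transp A \<in> Th" "transp B \<in> Th" "transp C \<in> Th"
    by (rule transp_Theta[OF A], rule transp_Theta[OF B], rule transp_Theta[OF C])
  show "ro n (transp A) = co n A" "ro n (transp B) = co n B" "ro n (transp C) = co n C"
    by (rule ro_transp)+
  show "co n (transp A) = ro n A" "co n (transp B) = ro n B" "co n (transp C) = ro n C"
    by (rule co_transp)+
  show "star (Yel A) = Yel (transp A)" by (rule star_Yel[OF A])
qed

end

section \<open>Base change of an algebra with a basis\<close>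

lemma (in ring) add_right_cancel:
  assumes "a \<in> carrier R" "b \<in> carrier R" "c \<in> carrier R" "a \<oplus> c = b \<oplus> c"
  shows "a = b"
proof -
  have "(a \<oplus> c) \<oplus> \<ominus> c = (b \<oplus> c) \<oplus> \<ominus> c" using assms by simp
  then show ?thesis using assms(1-3) by (simp add: a_assoc r_neg)
qed

text \<open>An algebra over the Laurent polynomials that is free of finite rank: \<open>crd\<close>
  are the coordinates dual to the family \<open>e\<close>. Only this structure is used to pass to
  the field K.\<close>

locale based_algebra =
  fixes S :: "(ratfun, 's, 'y) module_scheme" and I :: "'i set" and e :: "'i \<Rightarrow> 's" and crd :: "'s \<Rightarrow> 'i \<Rightarrow> ratfun"
  assumes S_ring: "ring S" and finI: "finite I"
    and smult_closed: "\<And>a s. a \<in> laurent \<Longrightarrow> s \<in> carrier S \<Longrightarrow> a \<odot>\<^bsub>S\<^esub> s \<in> carrier S"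
    and smult_left: "\<And>a s t. a \<in> laurent \<Longrightarrow> s \<in> carrier S \<Longrightarrow> t \<in> carrier S \<Longrightarrow>
      (a \<odot>\<^bsub>S\<^esub> s) \<otimes>\<^bsub>S\<^esub> t = a \<odot>\<^bsub>S\<^esub> (s \<otimes>\<^bsub>S\<^esub> t)"
    and smult_right: "\<And>a s t. a \<in> laurent \<Longrightarrow> s \<in> carrier S \<Longrightarrow> t \<in> carrier S \<Longrightarrow>
      s \<otimes>\<^bsub>S\<^esub> (a \<odot>\<^bsub>S\<^esub> t) = a \<odot>\<^bsub>S\<^esub> (s \<otimes>\<^bsub>S\<^esub> t)"
    and crd_add: "\<And>s t i. s \<in> carrier S \<Longrightarrow> t \<in> carrier S \<Longrightarrow> i \<in> I \<Longrightarrow> crd (s \<oplus>\<^bsub>S\<^esub> t) i = crd s i + crd t i"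
    and crd_smult: "\<And>a s i. a \<in> laurent \<Longrightarrow> s \<in> carrier S \<Longrightarrow> i \<in> I \<Longrightarrow> crd (a \<odot>\<^bsub>S\<^esub> s) i = a * crd s i"
    and crd_laurent: "\<And>s i. s \<in> carrier S \<Longrightarrow> i \<in> I \<Longrightarrow> crd s i \<in> laurent"
    and crd_inj: "\<And>s t. s \<in> carrier S \<Longrightarrow> t \<in> carrier S \<Longrightarrow> (\<And>i. i \<in> I \<Longrightarrow> crd s i = crd t i) \<Longrightarrow> s = t"
    and e_closed: "\<And>i. i \<in> I \<Longrightarrow> e i \<in> carrier S"
    and crd_e: "\<And>i j. i \<in> I \<Longrightarrow> j \<in> I \<Longrightarrow> crd (e i) j = (if i = j then 1 else 0)"
begin

sublocale S: ring S by (rule S_ring)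

lemma crd_zero: assumes "i \<in> I" shows "crd \<zero>\<^bsub>S\<^esub> i = 0"
  using crd_add[OF S.zero_closed S.zero_closed assms] by simp

lemma crd_finsum:
  assumes "finite T" "\<And>x. x \<in> T \<Longrightarrow> g x \<in> carrier S" "i \<in> I"
  shows "crd (finsum S g T) i = (\<Sum>x\<in>T. crd (g x) i)"
  using assms(1,2)
proof (induction T rule: finite_induct)
  case (insert x T)
  have "finsum S g (insert x T) = g x \<oplus>\<^bsub>S\<^esub> finsum S g T"
    using insert by (intro S.finsum_insert) auto
  moreover have "finsum S g T \<in> carrier S" using insert by (intro S.finsum_closed) auto
  ultimately show ?case using insert assms(3) by (simp add: crd_add)
qed (simp add: crd_zero assms)

lemma expand:
  assumes s: "s \<in> carrier S" shows "s = finsum S (\<lambda>j. crd s j \<odot>\<^bsub>S\<^esub> e j) I"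
proof (rule crd_inj[OF s])
  have c: "crd s j \<odot>\<^bsub>S\<^esub> e j \<in> carrier S" if "j \<in> I" for j
    using that s by (intro smult_closed crd_laurent e_closed)
  then show "finsum S (\<lambda>j. crd s j \<odot>\<^bsub>S\<^esub> e j) I \<in> carrier S" by (intro S.finsum_closed) auto
  fix i assume i: "i \<in> I"
  have "crd (finsum S (\<lambda>j. crd s j \<odot>\<^bsub>S\<^esub> e j) I) i = (\<Sum>j\<in>I. if j = i then crd s j else 0)"
  proof -
    have "crd (finsum S (\<lambda>j. crd s j \<odot>\<^bsub>S\<^esub> e j) I) i = (\<Sum>j\<in>I. crd (crd s j \<odot>\<^bsub>S\<^esub> e j) i)"
      using c by (intro crd_finsum finI i)
    also have "\<dots> = (\<Sum>j\<in>I. if j = i then crd s j else 0)"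
      using i s by (intro sum.cong refl) (simp add: crd_smult crd_laurent e_closed crd_e)
    finally show ?thesis .
  qed
  then show "crd s i = crd (finsum S (\<lambda>j. crd s j \<odot>\<^bsub>S\<^esub> e j) I) i"
    using finI i by (simp add: sum.delta')
qed

lemma crd_mult_right:
  assumes s: "s \<in> carrier S" and t: "t \<in> carrier S" and i: "i \<in> I"
  shows "crd (s \<otimes>\<^bsub>S\<^esub> t) i = (\<Sum>j\<in>I. crd t j * crd (s \<otimes>\<^bsub>S\<^esub> e j) i)"
proof -
  have c: "crd t j \<odot>\<^bsub>S\<^esub> e j \<in> carrier S" if "j \<in> I" for j
    using that t by (intro smult_closed crd_laurent e_closed)
  have "s \<otimes>\<^bsub>S\<^esub> t = s \<otimes>\<^bsub>S\<^esub> finsum S (\<lambda>j. crd t j \<odot>\<^bsub>S\<^esub> e j) I" using expand[OF t] by simp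
  also have "\<dots> = finsum S (\<lambda>j. s \<otimes>\<^bsub>S\<^esub> (crd t j \<odot>\<^bsub>S\<^esub> e j)) I"
    using s c finI by (intro S.finsum_rdistr) auto
  finally have "crd (s \<otimes>\<^bsub>S\<^esub> t) i = (\<Sum>j\<in>I. crd (s \<otimes>\<^bsub>S\<^esub> (crd t j \<odot>\<^bsub>S\<^esub> e j)) i)"
    using s c i finI by (simp add: crd_finsum)
  also have "\<dots> = (\<Sum>j\<in>I. crd t j * crd (s \<otimes>\<^bsub>S\<^esub> e j) i)"
    using s t i by (intro sum.cong refl) (simp add: smult_right crd_laurent e_closed crd_smult)
  finally show ?thesis .
qed

lemma crd_mult_left:
  assumes s: "s \<in> carrier S" and t: "t \<in> carrier S" and i: "i \<in> I"
  shows "crd (s \<otimes>\<^bsub>S\<^esub> t) i = (\<Sum>j\<in>I. crd s j * crd (e j \<otimes>\<^bsub>S\<^esub> t) i)"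
proof -
  have c: "crd s j \<odot>\<^bsub>S\<^esub> e j \<in> carrier S" if "j \<in> I" for j
    using that s by (intro smult_closed crd_laurent e_closed)
  have "s \<otimes>\<^bsub>S\<^esub> t = finsum S (\<lambda>j. crd s j \<odot>\<^bsub>S\<^esub> e j) I \<otimes>\<^bsub>S\<^esub> t" using expand[OF s] by simp
  also have "\<dots> = finsum S (\<lambda>j. (crd s j \<odot>\<^bsub>S\<^esub> e j) \<otimes>\<^bsub>S\<^esub> t) I"
    using t c finI by (intro S.finsum_ldistr) auto
  finally have "crd (s \<otimes>\<^bsub>S\<^esub> t) i = (\<Sum>j\<in>I. crd ((crd s j \<odot>\<^bsub>S\<^esub> e j) \<otimes>\<^bsub>S\<^esub> t) i)"
    using t c i finI by (simp add: crd_finsum)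
  also have "\<dots> = (\<Sum>j\<in>I. crd s j * crd (e j \<otimes>\<^bsub>S\<^esub> t) i)"
    using s t i by (intro sum.cong refl) (simp add: smult_left crd_laurent e_closed crd_smult)
  finally show ?thesis .
qed

section \<open>Coordinates on the scalar extension\<close>

abbreviation "T \<equiv> tensor_free KK S"
abbreviation "J \<equiv> Idl\<^bsub>T\<^esub> (tensor_rels KK laurent S)"
abbreviation "Q \<equiv> T Quot J"
abbreviation "Kt \<equiv> base_change KK laurent S"
abbreviation "pt \<equiv> pure_tensor KK laurent S"
abbreviation tau :: "ratfun \<Rightarrow> 's \<Rightarrow> (ratfun \<times> 's \<Rightarrow> int)" where "tau k s \<equiv> mr_single \<Z> 1 (k, s)"

sublocale CM: coeff_monoid "KK \<times>\<times> S" "UNIV :: int set"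
proof -
  have "monoid KK" by (rule monoidI) auto
  then have "monoid (KK \<times>\<times> S)" by (rule DirProd_monoid[OF _ S.monoid_axioms])
  then show "coeff_monoid (KK \<times>\<times> S) (UNIV :: int set)"
    by (simp add: coeff_monoid_def coeff_monoid_axioms_def)
qed

lemma T_eq: "T = CM.MR" by (simp add: tensor_free_def)

sublocale T: ring T unfolding T_eq by (rule CM.ring_MR)

lemma KS_mult: "p \<otimes>\<^bsub>KK \<times>\<times> S\<^esub> q = (fst p * fst q, snd p \<otimes>\<^bsub>S\<^esub> snd q)"
  by (simp add: DirProd_def case_prod_unfold)

lemma KS_simps: "(k, s) \<otimes>\<^bsub>KK \<times>\<times> S\<^esub> (k', s') = (k * k', s \<otimes>\<^bsub>S\<^esub> s')" "carrier (KK \<times>\<times> S) = UNIV \<times> carrier S"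
  by (simp_all add: DirProd_def)

lemma tau_closed: "s \<in> carrier S \<Longrightarrow> mr_single \<Z> m (k, s) \<in> carrier T"
  unfolding T_eq by (rule CM.single_closed) (simp_all add: KS_simps)

text \<open>The additive extension of the bilinear expression k * crd s i from pairs (k, s) to the
  free abelian group; it vanishes on the bilinearity relations and so descends to tensors.\<close>

definition cf :: "(ratfun \<times> 's \<Rightarrow> int) \<Rightarrow> 'i \<Rightarrow> ratfun" where
  "cf f i = ev of_int (\<lambda>p. fst p * crd (snd p) i) f"

lemma cf_add: "f \<in> carrier T \<Longrightarrow> g \<in> carrier T \<Longrightarrow> cf (f \<oplus>\<^bsub>T\<^esub> g) i = cf f i + cf g i"
  by (simp add: cf_def T_eq CM.ev_add)

lemma cf_minus: "f \<in> carrier T \<Longrightarrow> g \<in> carrier T \<Longrightarrow> cf (f \<ominus>\<^bsub>T\<^esub> g) i = cf f i - cf g i"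
  by (simp add: cf_def T_eq CM.ev_minus)

lemma cf_single: "cf (mr_single \<Z> m (k, s)) i = of_int m * (k * crd s i)"
  unfolding cf_def by (subst CM.ev_single) simp_all

lemma T_supp: "f \<in> carrier T \<Longrightarrow> f p \<noteq> 0 \<Longrightarrow> snd p \<in> carrier S"
  unfolding T_eq CM.MR_carrier by (cases p) (auto simp: KS_simps subset_iff)

lemma ev_sum: "ev c (\<lambda>p. \<Sum>j\<in>A. a j * \<phi> j p) f = (\<Sum>j\<in>A. a j * ev c (\<phi> j) f)"
  unfolding ev_def sum_distrib_left by (subst sum.swap) (simp add: mult_ac)

text \<open>Expanding first the right and then the left factor in the basis \<open>e\<close>
  expresses the coordinates of a product by those of its factors and the structure constants of the
  algebra.\<close>

lemma cf_mult:
  assumes f: "f \<in> carrier T" and g: "g \<in> carrier T" and i: "i \<in> I"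
  shows "cf (f \<otimes>\<^bsub>T\<^esub> g) i = (\<Sum>j\<in>I. \<Sum>l\<in>I. cf f j * cf g l * crd (e j \<otimes>\<^bsub>S\<^esub> e l) i)"
proof -
  have "cf (f \<otimes>\<^bsub>T\<^esub> g) i = ev of_int (\<lambda>p. ev of_int (\<lambda>q. (fst p * fst q) * crd (snd p \<otimes>\<^bsub>S\<^esub> snd q) i) g) f"
    using f g by (simp add: cf_def T_eq CM.ev_mult KS_mult)
  also have "\<dots> = ev of_int (\<lambda>p. \<Sum>l\<in>I. cf g l * (fst p * crd (snd p \<otimes>\<^bsub>S\<^esub> e l) i)) f"
  proof (rule CM.ev_cong)
    fix p assume "f p \<noteq> 0"
    then have p: "snd p \<in> carrier S" using T_supp f by blast
    have "ev of_int (\<lambda>q. (fst p * fst q) * crd (snd p \<otimes>\<^bsub>S\<^esub> snd q) i) g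
        = ev of_int (\<lambda>q. \<Sum>l\<in>I. (fst p * crd (snd p \<otimes>\<^bsub>S\<^esub> e l) i) * (fst q * crd (snd q) l)) g"
      by (rule CM.ev_cong) (simp add: crd_mult_right[OF p _ i] T_supp[OF g] sum_distrib_left mult_ac)
    also have "\<dots> = (\<Sum>l\<in>I. (fst p * crd (snd p \<otimes>\<^bsub>S\<^esub> e l) i) * cf g l)"
      by (simp add: ev_sum cf_def)
    finally show "ev of_int (\<lambda>q. (fst p * fst q) * crd (snd p \<otimes>\<^bsub>S\<^esub> snd q) i) g
      = (\<Sum>l\<in>I. cf g l * (fst p * crd (snd p \<otimes>\<^bsub>S\<^esub> e l) i))" by (simp add: mult_ac)
  qed
  also have "\<dots> = (\<Sum>l\<in>I. cf g l * ev of_int (\<lambda>p. fst p * crd (snd p \<otimes>\<^bsub>S\<^esub> e l) i) f)" by (rule ev_sum)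
  also have "\<dots> = (\<Sum>l\<in>I. cf g l * (\<Sum>j\<in>I. crd (e j \<otimes>\<^bsub>S\<^esub> e l) i * cf f j))"
  proof (intro sum.cong refl arg_cong2[where f = "(*)"])
    fix l assume l: "l \<in> I"
    have "ev of_int (\<lambda>p. fst p * crd (snd p \<otimes>\<^bsub>S\<^esub> e l) i) f
        = ev of_int (\<lambda>p. \<Sum>j\<in>I. crd (e j \<otimes>\<^bsub>S\<^esub> e l) i * (fst p * crd (snd p) j)) f"
      by (rule CM.ev_cong) (simp add: crd_mult_left[OF _ e_closed[OF l] i] T_supp[OF f] sum_distrib_left mult_ac)
    also have "\<dots> = (\<Sum>j\<in>I. crd (e j \<otimes>\<^bsub>S\<^esub> e l) i * cf f j)" by (simp add: ev_sum cf_def)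
    finally show "ev of_int (\<lambda>p. fst p * crd (snd p \<otimes>\<^bsub>S\<^esub> e l) i) f = \<dots>" .
  qed
  also have "\<dots> = (\<Sum>l\<in>I. \<Sum>j\<in>I. cf f j * cf g l * crd (e j \<otimes>\<^bsub>S\<^esub> e l) i)"
    by (simp add: sum_distrib_left mult_ac)
  also have "\<dots> = (\<Sum>j\<in>I. \<Sum>l\<in>I. cf f j * cf g l * crd (e j \<otimes>\<^bsub>S\<^esub> e l) i)" by (rule sum.swap)
  finally show ?thesis .
qed

text \<open>By \<open>cf_mult\<close> a product has zero coordinates as soon as one factor has, on
  either side.\<close>

lemma kernel_ideal: "ideal {f \<in> carrier T. \<forall>i\<in>I. cf f i = 0} T" (is "ideal ?K T")
proof (rule idealI)
  show "ring T" by (rule T.ring_axioms)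
  have z: "cf \<zero>\<^bsub>T\<^esub> i = 0" for i using cf_add[of "\<zero>\<^bsub>T\<^esub>" "\<zero>\<^bsub>T\<^esub>" i] by simp
  show "subgroup ?K (add_monoid T)"
  proof (rule group.subgroupI)
    show "group (add_monoid T)" using T.a_group .
    show "?K \<noteq> {}" using z by auto
    fix a assume a: "a \<in> ?K"
    have "cf (\<zero>\<^bsub>T\<^esub> \<ominus>\<^bsub>T\<^esub> a) i = 0" if "i \<in> I" for i using a z that by (simp add: cf_minus)
    then have "\<ominus>\<^bsub>T\<^esub> a \<in> ?K" using a by (simp add: a_minus_def)
    then show "inv\<^bsub>add_monoid T\<^esub> a \<in> ?K" by (simp add: a_inv_def)
  qed (auto simp: cf_add)
next
  fix a x assume a: "a \<in> ?K" and x: "x \<in> carrier T"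
  then show "x \<otimes>\<^bsub>T\<^esub> a \<in> ?K" "a \<otimes>\<^bsub>T\<^esub> x \<in> ?K" by (auto simp: cf_mult)
qed

lemma rels_T: "tensor_rels KK laurent S \<subseteq> carrier T"
  unfolding tensor_rels_def Let_def
  by (auto intro!: T.minus_closed T.add.m_closed tau_closed smult_closed)

lemma J_ideal: "ideal J T" by (rule T.genideal_ideal[OF rels_T])

sublocale J: ideal J T by (rule J_ideal)
sublocale Q: ring Q by (rule J.quotient_is_ring)

lemma J_kernel: "J \<subseteq> {f \<in> carrier T. \<forall>i\<in>I. cf f i = 0}"
proof (rule T.genideal_minimal[OF kernel_ideal], rule subsetI)
  fix x assume x: "x \<in> tensor_rels KK laurent S"
  have "\<forall>i\<in>I. cf x i = 0"
    using x unfolding tensor_rels_def Let_def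
    by (auto simp: cf_minus cf_add tau_closed cf_single smult_closed crd_add crd_smult algebra_simps)
  then show "x \<in> {f \<in> carrier T. \<forall>i\<in>I. cf f i = 0}" using x rels_T by auto
qed

abbreviation tcls :: "(ratfun \<times> 's \<Rightarrow> int) \<Rightarrow> (ratfun \<times> 's \<Rightarrow> int) set" where "tcls f \<equiv> J +>\<^bsub>T\<^esub> f"

lemma tcls_hom: "tcls \<in> Ring.ring_hom T Q" by (rule J.rcos_ring_hom)

lemmas tcls_simps = ring_hom_closed[OF tcls_hom] ring_hom_mult[OF tcls_hom] ring_hom_add[OF tcls_hom]
  ring_hom_one[OF tcls_hom] ring_hom_zero[OF tcls_hom T.ring_axioms Q.ring_axioms]

lemma tcls_surj: "x \<in> carrier Q \<Longrightarrow> \<exists>f\<in>carrier T. x = tcls f"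
  by (auto simp: FactRing_def A_RCOSETS_def RCOSETS_def a_r_coset_def)

lemma tcls_eqI: "f \<in> carrier T \<Longrightarrow> g \<in> carrier T \<Longrightarrow> f \<ominus>\<^bsub>T\<^esub> g \<in> J \<Longrightarrow> tcls f = tcls g"
  using T.quotient_eq_iff_same_a_r_cos[OF J_ideal] by simp

text \<open>Coordinates of a class are computed on an arbitrary representative.\<close>

definition Phi :: "(ratfun \<times> 's \<Rightarrow> int) set \<Rightarrow> 'i \<Rightarrow> ratfun" where
  "Phi x i = cf (SOME f. f \<in> x) i"

lemma Phi_tcls: assumes "f \<in> carrier T" "i \<in> I" shows "Phi (tcls f) i = cf f i"
proof -
  have "f \<in> tcls f" using assms by (intro J.a_rcos_self)
  then have "(SOME f'. f' \<in> tcls f) \<in> tcls f" by (rule someI[of "\<lambda>z. z \<in> tcls f"])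
  then obtain k where k: "k \<in> J" "(SOME f'. f' \<in> tcls f) = k \<oplus>\<^bsub>T\<^esub> f"
    unfolding a_r_coset_def' by auto
  then have "k \<in> carrier T" "cf k i = 0" using J_kernel assms by auto
  then show ?thesis unfolding Phi_def k using assms by (simp add: cf_add)
qed

lemma pt_eq: "pt k s = tcls (tau k s)" by (simp add: pure_tensor_def)

lemma pt_closed: "s \<in> carrier S \<Longrightarrow> pt k s \<in> carrier Q"
  by (simp add: pt_eq tcls_simps tau_closed)

lemma Phi_pt: "s \<in> carrier S \<Longrightarrow> i \<in> I \<Longrightarrow> Phi (pt k s) i = k * crd s i"
  by (simp add: pt_eq Phi_tcls tau_closed cf_single)

lemma pt_add_left: assumes "s \<in> carrier S" shows "pt (k + k') s = pt k s \<oplus>\<^bsub>Q\<^esub> pt k' s"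
proof -
  have "tau (k + k') s \<ominus>\<^bsub>T\<^esub> (tau k s \<oplus>\<^bsub>T\<^esub> tau k' s) \<in> tensor_rels KK laurent S"
    unfolding tensor_rels_def Let_def using assms by auto
  then have "tcls (tau (k + k') s) = tcls (tau k s \<oplus>\<^bsub>T\<^esub> tau k' s)"
    using assms by (intro tcls_eqI subsetD[OF T.genideal_self[OF rels_T]]) (auto simp: tau_closed)
  then show ?thesis using assms by (simp add: pt_eq tcls_simps tau_closed)
qed

lemma pt_add_right: assumes "s \<in> carrier S" "s' \<in> carrier S" shows "pt k (s \<oplus>\<^bsub>S\<^esub> s') = pt k s \<oplus>\<^bsub>Q\<^esub> pt k s'"
proof -
  have "tau k (s \<oplus>\<^bsub>S\<^esub> s') \<ominus>\<^bsub>T\<^esub> (tau k s \<oplus>\<^bsub>T\<^esub> tau k s') \<in> tensor_rels KK laurent S"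
    unfolding tensor_rels_def Let_def using assms by auto
  then have "tcls (tau k (s \<oplus>\<^bsub>S\<^esub> s')) = tcls (tau k s \<oplus>\<^bsub>T\<^esub> tau k s')"
    using assms by (intro tcls_eqI subsetD[OF T.genideal_self[OF rels_T]]) (auto simp: tau_closed)
  then show ?thesis using assms by (simp add: pt_eq tcls_simps tau_closed)
qed

lemma pt_smult: assumes "s \<in> carrier S" "a \<in> laurent" shows "pt k (a \<odot>\<^bsub>S\<^esub> s) = pt (k * a) s"
proof -
  have "tau (k * a) s \<ominus>\<^bsub>T\<^esub> tau k (a \<odot>\<^bsub>S\<^esub> s) \<in> tensor_rels KK laurent S"
    unfolding tensor_rels_def Let_def using assms by auto
  then have "tcls (tau (k * a) s) = tcls (tau k (a \<odot>\<^bsub>S\<^esub> s))"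
    using assms by (intro tcls_eqI subsetD[OF T.genideal_self[OF rels_T]]) (auto simp: tau_closed smult_closed)
  then show ?thesis by (simp add: pt_eq)
qed

lemma pt_zero_left: assumes "s \<in> carrier S" shows "pt 0 s = \<zero>\<^bsub>Q\<^esub>"
proof -
  have "pt 0 s \<oplus>\<^bsub>Q\<^esub> pt 0 s = \<zero>\<^bsub>Q\<^esub> \<oplus>\<^bsub>Q\<^esub> pt 0 s" using pt_add_left[OF assms, of 0 0] pt_closed[OF assms] by simp
  then show ?thesis by (rule Q.add_right_cancel[OF pt_closed[OF assms] Q.zero_closed pt_closed[OF assms]])
qed

lemma pt_zero_right: "pt k \<zero>\<^bsub>S\<^esub> = \<zero>\<^bsub>Q\<^esub>"
proof -
  have "pt k \<zero>\<^bsub>S\<^esub> \<oplus>\<^bsub>Q\<^esub> pt k \<zero>\<^bsub>S\<^esub> = \<zero>\<^bsub>Q\<^esub> \<oplus>\<^bsub>Q\<^esub> pt k \<zero>\<^bsub>S\<^esub>"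
    using pt_add_right[OF S.zero_closed S.zero_closed, of k] pt_closed[OF S.zero_closed] by simp
  then show ?thesis
    by (rule Q.add_right_cancel[OF pt_closed[OF S.zero_closed] Q.zero_closed pt_closed[OF S.zero_closed]])
qed

lemma pt_finsum: "finite A \<Longrightarrow> (\<And>x. x \<in> A \<Longrightarrow> g x \<in> carrier S) \<Longrightarrow> pt k (finsum S g A) = finsum Q (\<lambda>x. pt k (g x)) A"
proof (induction A rule: finite_induct)
  case (insert x A)
  have "finsum S g (insert x A) = g x \<oplus>\<^bsub>S\<^esub> finsum S g A" using insert by (intro S.finsum_insert) auto
  moreover have "finsum S g A \<in> carrier S" using insert by (intro S.finsum_closed) auto
  moreover have "finsum Q (\<lambda>x. pt k (g x)) (insert x A) = pt k (g x) \<oplus>\<^bsub>Q\<^esub> finsum Q (\<lambda>x. pt k (g x)) A"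
    using insert by (intro Q.finsum_insert) (auto simp: pt_closed)
  ultimately show ?case using insert by (simp add: pt_add_right)
qed (simp add: pt_zero_right)

definition lin :: "('i \<Rightarrow> ratfun) \<Rightarrow> (ratfun \<times> 's \<Rightarrow> int) set" where
  "lin c = finsum Q (\<lambda>j. pt (c j) (e j)) I"

lemma lin_add: "lin (\<lambda>j. c j + d j) = lin c \<oplus>\<^bsub>Q\<^esub> lin d"
proof -
  have "lin (\<lambda>j. c j + d j) = finsum Q (\<lambda>j. pt (c j) (e j) \<oplus>\<^bsub>Q\<^esub> pt (d j) (e j)) I"
    unfolding lin_def by (intro Q.add.finprod_cong') (auto simp: pt_add_left e_closed pt_closed)
  then show ?thesis unfolding lin_def by (simp add: Q.finsum_addf e_closed pt_closed Pi_def)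
qed

lemma lin_cong: "(\<And>j. j \<in> I \<Longrightarrow> c j = d j) \<Longrightarrow> lin c = lin d"
  unfolding lin_def by (intro Q.add.finprod_cong') (auto simp: pt_closed e_closed)

lemma pt_lin: assumes s: "s \<in> carrier S" shows "pt k s = lin (\<lambda>j. k * crd s j)"
proof -
  have c: "crd s j \<odot>\<^bsub>S\<^esub> e j \<in> carrier S" if "j \<in> I" for j
    using that s by (intro smult_closed crd_laurent e_closed)
  have "pt k s = pt k (finsum S (\<lambda>j. crd s j \<odot>\<^bsub>S\<^esub> e j) I)" using expand[OF s] by simp
  also have "\<dots> = finsum Q (\<lambda>j. pt k (crd s j \<odot>\<^bsub>S\<^esub> e j)) I" by (rule pt_finsum[OF finI c])
  also have "\<dots> = lin (\<lambda>j. k * crd s j)"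
    unfolding lin_def using s by (intro Q.add.finprod_cong') (auto simp: pt_closed e_closed pt_smult crd_laurent)
  finally show ?thesis .
qed

text \<open>Integer multiplicities of a pair are absorbed into its scalar; the induction runs in
  both directions in order to reach negative integers.\<close>

lemma single_pt: assumes s: "s \<in> carrier S" shows "tcls (mr_single \<Z> m (k, s)) = pt (of_int m * k) s"
proof (induction m rule: int_induct[of _ 0])
  case base
  have "mr_single \<Z> 0 (k, s) = \<zero>\<^bsub>T\<^esub>" by (simp add: T_eq CM.MR_zero mr_single_def fun_eq_iff)
  then show ?case using s by (simp add: tcls_simps pt_zero_left)
next
  case (step1 m)
  have "mr_single \<Z> (m + 1) (k, s) = mr_single \<Z> m (k, s) \<oplus>\<^bsub>T\<^esub> tau k s"
    unfolding T_eq by (rule CM.single_add[symmetric])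
  then have "tcls (mr_single \<Z> (m + 1) (k, s)) = pt (of_int m * k) s \<oplus>\<^bsub>Q\<^esub> pt k s"
    using s step1 by (simp add: tcls_simps tau_closed pt_eq[of k])
  then show ?case using s by (simp add: algebra_simps flip: pt_add_left)
next
  case (step2 m)
  have "mr_single \<Z> m (k, s) = mr_single \<Z> (m - 1) (k, s) \<oplus>\<^bsub>T\<^esub> tau k s"
    using CM.single_add[of "m - 1" "(k, s)" 1] by (simp add: T_eq)
  then have "pt (of_int m * k) s = tcls (mr_single \<Z> (m - 1) (k, s)) \<oplus>\<^bsub>Q\<^esub> pt k s"
    using s step2 by (simp add: tcls_simps tau_closed pt_eq[of k])
  moreover have "pt (of_int m * k) s = pt (of_int (m - 1) * k) s \<oplus>\<^bsub>Q\<^esub> pt k s"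
    using s by (simp add: algebra_simps flip: pt_add_left)
  ultimately have "tcls (mr_single \<Z> (m - 1) (k, s)) \<oplus>\<^bsub>Q\<^esub> pt k s = pt (of_int (m - 1) * k) s \<oplus>\<^bsub>Q\<^esub> pt k s" by metis
  then show ?case
    by (rule Q.add_right_cancel[rotated 3]) (use s in \<open>auto simp: pt_closed tcls_simps tau_closed\<close>)
qed

text \<open>Injectivity of the coordinates: every class is the combination of the basis tensors with
  its own coordinates, since this is additive and holds for pure tensors by expanding the algebra
  element.\<close>

lemma lin_Phi: assumes "x \<in> carrier Q" shows "x = lin (Phi x)"
proof -
  obtain f where f: "f \<in> carrier T" "x = tcls f" using tcls_surj[OF assms] by auto
  have "tcls f = lin (cf f)"
    using f(1) unfolding T_eq
  proof (induction f rule: CM.MR_induct)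
    case zero
    have z: "cf \<zero>\<^bsub>T\<^esub> i = 0" for i using cf_add[of "\<zero>\<^bsub>T\<^esub>" "\<zero>\<^bsub>T\<^esub>" i] by simp
    have "lin (cf \<zero>\<^bsub>T\<^esub>) = finsum Q (\<lambda>j. \<zero>\<^bsub>Q\<^esub>) I"
      unfolding lin_def by (intro Q.add.finprod_cong') (auto simp: z pt_zero_left e_closed)
    then show ?case by (simp add: tcls_simps flip: T_eq)
  next
    case (add f g)
    then have fg: "f \<in> carrier T" "g \<in> carrier T" by (simp_all add: T_eq)
    have "lin (cf (f \<oplus>\<^bsub>T\<^esub> g)) = lin (cf f) \<oplus>\<^bsub>Q\<^esub> lin (cf g)"
      unfolding lin_add[symmetric] using fg by (intro lin_cong cf_add)
    then show ?case using add fg by (simp add: tcls_simps flip: T_eq)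
  next
    case (single m p)
    obtain k s where p: "p = (k, s)" by (cases p)
    then have s: "s \<in> carrier S" using single by (simp add: KS_simps)
    have "lin (cf (mr_single \<Z> m p)) = lin (\<lambda>j. (of_int m * k) * crd s j)"
      by (rule lin_cong) (simp add: p cf_single)
    then show ?case using single_pt[OF s] pt_lin[OF s] by (simp add: p flip: T_eq)
  qed
  also have "lin (cf f) = lin (Phi x)" using f by (intro lin_cong) (simp add: Phi_tcls)
  finally show ?thesis using f by simp
qed

lemma Kt_simps: "carrier Kt = carrier Q" "mult Kt = mult Q" "one Kt = one Q" "zero Kt = zero Q" "add Kt = add Q"
  "c \<odot>\<^bsub>Kt\<^esub> x = pt c \<one>\<^bsub>S\<^esub> \<otimes>\<^bsub>Q\<^esub> x"
  by (simp_all add: base_change_def Let_def)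

lemma Kt_eqI: "x \<in> carrier Kt \<Longrightarrow> y \<in> carrier Kt \<Longrightarrow> (\<And>i. i \<in> I \<Longrightarrow> Phi x i = Phi y i) \<Longrightarrow> x = y"
  using lin_Phi[of x] lin_Phi[of y] lin_cong[of "Phi x" "Phi y"] by (simp add: Kt_simps)

lemma Phi_add: "x \<in> carrier Kt \<Longrightarrow> y \<in> carrier Kt \<Longrightarrow> i \<in> I \<Longrightarrow> Phi (x \<oplus>\<^bsub>Kt\<^esub> y) i = Phi x i + Phi y i"
  using tcls_surj[of x] tcls_surj[of y] unfolding Kt_simps
  by (auto simp: Phi_tcls cf_add simp flip: tcls_simps(3))

lemma Phi_mult:
  "x \<in> carrier Kt \<Longrightarrow> y \<in> carrier Kt \<Longrightarrow> i \<in> I \<Longrightarrow>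
    Phi (x \<otimes>\<^bsub>Kt\<^esub> y) i = (\<Sum>j\<in>I. \<Sum>l\<in>I. Phi x j * Phi y l * crd (e j \<otimes>\<^bsub>S\<^esub> e l) i)"
  using tcls_surj[of x] tcls_surj[of y] unfolding Kt_simps
  by (auto simp: Phi_tcls cf_mult simp flip: tcls_simps(2) intro!: sum.cong)

lemma Phi_zero: "i \<in> I \<Longrightarrow> Phi \<zero>\<^bsub>Kt\<^esub> i = 0"
  using Phi_add[of "\<zero>\<^bsub>Kt\<^esub>" "\<zero>\<^bsub>Kt\<^esub>" i] by (simp add: Kt_simps)

lemma Kt_smult_closed: "x \<in> carrier Kt \<Longrightarrow> c \<odot>\<^bsub>Kt\<^esub> x \<in> carrier Kt"
  by (simp add: Kt_simps pt_closed)

lemma Phi_smult: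
  assumes "x \<in> carrier Kt" "i \<in> I" shows "Phi (c \<odot>\<^bsub>Kt\<^esub> x) i = c * Phi x i"
proof -
  have p: "pt c \<one>\<^bsub>S\<^esub> \<in> carrier Kt" by (simp add: Kt_simps pt_closed)
  \<comment> \<open>Scalars act through the tensor of the scalar with the unit; the coordinates of
    the unit, combined with the structure constants, act as the identity matrix.\<close>
  have one: "(\<Sum>j\<in>I. crd \<one>\<^bsub>S\<^esub> j * crd (e j \<otimes>\<^bsub>S\<^esub> e l) i) = (if l = i then 1 else 0)" if l: "l \<in> I" for l
    using crd_mult_left[OF S.one_closed e_closed[OF l] assms(2)] l assms(2) by (simp add: e_closed crd_e)
  have "c \<odot>\<^bsub>Kt\<^esub> x = pt c \<one>\<^bsub>S\<^esub> \<otimes>\<^bsub>Kt\<^esub> x" by (simp add: Kt_simps)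
  then have "Phi (c \<odot>\<^bsub>Kt\<^esub> x) i = (\<Sum>j\<in>I. \<Sum>l\<in>I. (c * crd \<one>\<^bsub>S\<^esub> j) * Phi x l * crd (e j \<otimes>\<^bsub>S\<^esub> e l) i)"
    using p assms by (simp add: Phi_mult Phi_pt)
  also have "\<dots> = (\<Sum>l\<in>I. \<Sum>j\<in>I. (c * crd \<one>\<^bsub>S\<^esub> j) * Phi x l * crd (e j \<otimes>\<^bsub>S\<^esub> e l) i)" by (rule sum.swap)
  also have "\<dots> = (\<Sum>l\<in>I. c * Phi x l * (\<Sum>j\<in>I. crd \<one>\<^bsub>S\<^esub> j * crd (e j \<otimes>\<^bsub>S\<^esub> e l) i))"
    by (simp add: sum_distrib_left mult_ac)
  also have "\<dots> = (\<Sum>l\<in>I. if l = i then c * Phi x l else 0)"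
    by (intro sum.cong refl) (simp add: one)
  finally show ?thesis using finI assms by (simp add: sum.delta)
qed

lemma Kt_ring: "ring Kt"
proof (rule ringI)
  show "abelian_group Kt"
  proof (rule abelian_groupI)
    fix x y assume "x \<in> carrier Kt" "y \<in> carrier Kt"
    then show "x \<oplus>\<^bsub>Kt\<^esub> y = y \<oplus>\<^bsub>Kt\<^esub> x" unfolding Kt_simps by (rule Q.a_comm)
  next
    fix x assume "x \<in> carrier Kt"
    then show "\<exists>y\<in>carrier Kt. y \<oplus>\<^bsub>Kt\<^esub> x = \<zero>\<^bsub>Kt\<^esub>"
      unfolding Kt_simps by (intro bexI[of _ "\<ominus>\<^bsub>Q\<^esub> x"] Q.l_neg) auto
  qed (simp_all add: Kt_simps Q.a_assoc)
  show "monoid Kt" by (rule monoidI) (auto simp: Kt_simps Q.m_assoc)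
qed (auto simp: Kt_simps Q.l_distr Q.r_distr)

sublocale Kt: ring Kt by (rule Kt_ring)

lemma Kt_module: "module KK Kt"
proof (rule moduleI)
  show "cring KK" by (rule class_cring.cring_axioms)
  show "abelian_group Kt" by (rule Kt.abelian_group_axioms)
  fix a b x y assume x: "x \<in> carrier Kt" and y: "y \<in> carrier Kt"
  show "a \<odot>\<^bsub>Kt\<^esub> x \<in> carrier Kt" using x by (rule Kt_smult_closed)
  show "(a \<oplus>\<^bsub>KK\<^esub> b) \<odot>\<^bsub>Kt\<^esub> x = a \<odot>\<^bsub>Kt\<^esub> x \<oplus>\<^bsub>Kt\<^esub> b \<odot>\<^bsub>Kt\<^esub> x"
    using x by (intro Kt_eqI Kt.a_closed Kt_smult_closed) (simp_all add: Kt_smult_closed Phi_smult Phi_add algebra_simps)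
  show "a \<odot>\<^bsub>Kt\<^esub> (x \<oplus>\<^bsub>Kt\<^esub> y) = a \<odot>\<^bsub>Kt\<^esub> x \<oplus>\<^bsub>Kt\<^esub> a \<odot>\<^bsub>Kt\<^esub> y"
    using x y by (intro Kt_eqI Kt.a_closed Kt_smult_closed) (simp_all add: Kt_smult_closed Phi_smult Phi_add algebra_simps)
  show "(a \<otimes>\<^bsub>KK\<^esub> b) \<odot>\<^bsub>Kt\<^esub> x = a \<odot>\<^bsub>Kt\<^esub> (b \<odot>\<^bsub>Kt\<^esub> x)"
    using x by (intro Kt_eqI Kt_smult_closed) (simp_all add: Kt_smult_closed Phi_smult)
  show "\<one>\<^bsub>KK\<^esub> \<odot>\<^bsub>Kt\<^esub> x = x"
    using x by (intro Kt_eqI Kt_smult_closed) (simp_all add: Phi_smult)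
qed

lemma Phi_minus: "x \<in> carrier Kt \<Longrightarrow> y \<in> carrier Kt \<Longrightarrow> i \<in> I \<Longrightarrow> Phi (x \<ominus>\<^bsub>Kt\<^esub> y) i = Phi x i - Phi y i"
  using Phi_add[of "x \<ominus>\<^bsub>Kt\<^esub> y" y i] Kt.minus_closed[of x y]
  by (simp add: a_minus_def Kt.a_assoc Kt.l_neg)

lemma Phi_finsum:
  assumes "finite A" "\<And>x. x \<in> A \<Longrightarrow> g x \<in> carrier Kt" "i \<in> I"
  shows "Phi (finsum Kt g A) i = (\<Sum>x\<in>A. Phi (g x) i)"
  using assms(1,2)
proof (induction A rule: finite_induct)
  case (insert x A)
  have "finsum Kt g (insert x A) = g x \<oplus>\<^bsub>Kt\<^esub> finsum Kt g A" using insert by (intro Kt.finsum_insert) auto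
  moreover have "finsum Kt g A \<in> carrier Kt" using insert by (intro Kt.finsum_closed) auto
  ultimately show ?case using insert assms(3) by (simp add: Phi_add)
qed (simp add: Phi_zero assms)

text \<open>By bilinearity, commuting with all basis tensors suffices; for these the condition is
  linear in the coordinates of \<open>z\<close>.\<close>

lemma center_iff:
  "z \<in> ring_center Kt \<longleftrightarrow> z \<in> carrier Kt \<and>
    (\<forall>l\<in>I. \<forall>i\<in>I. (\<Sum>j\<in>I. Phi z j * crd (e j \<otimes>\<^bsub>S\<^esub> e l) i) = (\<Sum>j\<in>I. Phi z j * crd (e l \<otimes>\<^bsub>S\<^esub> e j) i))"
proof (intro iffI conjI ballI)
  assume z: "z \<in> ring_center Kt"
  then show zc: "z \<in> carrier Kt" by (simp add: ring_center_def)
  fix l i assume l: "l \<in> I" and i: "i \<in> I"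
  have p: "pt 1 (e l) \<in> carrier Kt" using l by (simp add: Kt_simps pt_closed e_closed)
  have Pl: "Phi (pt 1 (e l)) k = (if k = l then 1 else 0)" if "k \<in> I" for k using l that by (simp add: Phi_pt e_closed crd_e)
  have "Phi (z \<otimes>\<^bsub>Kt\<^esub> pt 1 (e l)) i = Phi (pt 1 (e l) \<otimes>\<^bsub>Kt\<^esub> z) i" using z p by (simp add: ring_center_def)
  moreover have "Phi (z \<otimes>\<^bsub>Kt\<^esub> pt 1 (e l)) i = (\<Sum>j\<in>I. \<Sum>k\<in>I. if k = l then Phi z j * crd (e j \<otimes>\<^bsub>S\<^esub> e k) i else 0)"
    unfolding Phi_mult[OF zc p i] by (intro sum.cong refl) (simp add: Pl)
  moreover have "Phi (pt 1 (e l) \<otimes>\<^bsub>Kt\<^esub> z) i = (\<Sum>j\<in>I. \<Sum>k\<in>I. if k = l then Phi z j * crd (e k \<otimes>\<^bsub>S\<^esub> e j) i else 0)"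
    unfolding Phi_mult[OF p zc i] by (subst sum.swap, intro sum.cong refl) (simp add: Pl)
  ultimately show "(\<Sum>j\<in>I. Phi z j * crd (e j \<otimes>\<^bsub>S\<^esub> e l) i) = (\<Sum>j\<in>I. Phi z j * crd (e l \<otimes>\<^bsub>S\<^esub> e j) i)"
    using finI l by (simp add: sum.delta)
next
  assume a: "z \<in> carrier Kt \<and>
    (\<forall>l\<in>I. \<forall>i\<in>I. (\<Sum>j\<in>I. Phi z j * crd (e j \<otimes>\<^bsub>S\<^esub> e l) i) = (\<Sum>j\<in>I. Phi z j * crd (e l \<otimes>\<^bsub>S\<^esub> e j) i))"
  then have zc: "z \<in> carrier Kt" by simp
  have "z \<otimes>\<^bsub>Kt\<^esub> y = y \<otimes>\<^bsub>Kt\<^esub> z" if y: "y \<in> carrier Kt" for y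
  proof (rule Kt_eqI)
    fix i assume i: "i \<in> I"
    have "Phi (z \<otimes>\<^bsub>Kt\<^esub> y) i = (\<Sum>l\<in>I. \<Sum>j\<in>I. Phi z j * Phi y l * crd (e j \<otimes>\<^bsub>S\<^esub> e l) i)"
      unfolding Phi_mult[OF zc y i] by (rule sum.swap)
    also have "\<dots> = (\<Sum>l\<in>I. Phi y l * (\<Sum>j\<in>I. Phi z j * crd (e j \<otimes>\<^bsub>S\<^esub> e l) i))"
      by (simp add: sum_distrib_left mult_ac)
    also have "\<dots> = (\<Sum>l\<in>I. Phi y l * (\<Sum>j\<in>I. Phi z j * crd (e l \<otimes>\<^bsub>S\<^esub> e j) i))"
      using a i by (intro sum.cong refl) simp
    also have "\<dots> = Phi (y \<otimes>\<^bsub>Kt\<^esub> z) i" unfolding Phi_mult[OF y zc i] by (simp add: sum_distrib_left mult_ac)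
    finally show "Phi (z \<otimes>\<^bsub>Kt\<^esub> y) i = Phi (y \<otimes>\<^bsub>Kt\<^esub> z) i" .
  qed (use zc y in auto)
  then show "z \<in> ring_center Kt" using zc by (simp add: ring_center_def)
qed

lemma center_submodule: "submodule KK (ring_center Kt) Kt"
proof (intro submodule.intro Kt_module)
  show "ring_center Kt \<subseteq> carrier Kt" by (auto simp: ring_center_def)
  show "\<zero>\<^bsub>Kt\<^esub> \<in> ring_center Kt" by (simp add: ring_center_def)
  show "v \<oplus>\<^bsub>Kt\<^esub> w \<in> ring_center Kt" if "v \<in> ring_center Kt" "w \<in> ring_center Kt" for v w
    using that by (simp add: ring_center_def Kt.l_distr Kt.r_distr)
  show "c \<odot>\<^bsub>Kt\<^esub> v \<in> ring_center Kt" if "v \<in> ring_center Kt" for c v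
    using that unfolding center_iff
    by (simp add: Kt_smult_closed Phi_smult mult.assoc flip: sum_distrib_left)
qed

end

section \<open>Multiplication by near-diagonal basis elements\<close>

context qschur_rank
begin

text \<open>\<open>mt\<close> with an arbitrary coloring \<open>c\<close> in place of the row
  blocks, so that a single position can be recolored.\<close>

definition mtc :: "(nat \<Rightarrow> nat) \<Rightarrow> nvec \<Rightarrow> (nat \<Rightarrow> nat) \<Rightarrow> nmat" where
  "mtc c m f = (\<lambda>i j. if i \<in> {1..n} \<and> j \<in> {1..n} then card {k \<in> {1..r}. c k = i \<and> blk m (f k) = j} else 0)"

lemma mt_mtc: "mt l m f = mtc (blk l) m f" by (simp add: mt_def mtc_def)

lemma mtc_cong:
  assumes "\<And>k. k \<in> {1..r} \<Longrightarrow> c k = c' k" shows "mtc c m f = mtc c' m f"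
proof -
  have "{k \<in> {1..r}. c k = i \<and> blk m (f k) = j} = {k \<in> {1..r}. c' k = i \<and> blk m (f k) = j}" for i j
    using assms by auto
  then show ?thesis by (simp only: mtc_def)
qed

lemma sw_range: "i \<in> {1..<r} \<Longrightarrow> k \<in> {1..r} \<Longrightarrow> sw i k \<in> {1..r}"
  by (auto simp: transpose_def)

lemma mtc_sw: assumes i: "i \<in> {1..<r}" shows "mtc c m (f \<circ> sw i) = mtc (c \<circ> sw i) m f"
proof -
  have "card {k \<in> {1..r}. c k = a \<and> blk m ((f \<circ> sw i) k) = b} = card {k \<in> {1..r}. (c \<circ> sw i) k = a \<and> blk m (f k) = b}" for a b
  proof (rule bij_betw_same_card[of "sw i"], rule bij_betw_byWitness[where f' = "sw i"])
    show "sw i ` {k \<in> {1..r}. c k = a \<and> blk m ((f \<circ> sw i) k) = b} \<subseteq> {k \<in> {1..r}. (c \<circ> sw i) k = a \<and> blk m (f k) = b}"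
    proof (rule image_subsetI)
      fix k assume "k \<in> {k \<in> {1..r}. c k = a \<and> blk m ((f \<circ> sw i) k) = b}"
      then show "sw i k \<in> {k \<in> {1..r}. (c \<circ> sw i) k = a \<and> blk m (f k) = b}"
        using sw_range[OF i, of k] by simp
    qed
    show "sw i ` {k \<in> {1..r}. (c \<circ> sw i) k = a \<and> blk m (f k) = b} \<subseteq> {k \<in> {1..r}. c k = a \<and> blk m ((f \<circ> sw i) k) = b}"
    proof (rule image_subsetI)
      fix k assume "k \<in> {k \<in> {1..r}. (c \<circ> sw i) k = a \<and> blk m (f k) = b}"
      then show "sw i k \<in> {k \<in> {1..r}. c k = a \<and> blk m ((f \<circ> sw i) k) = b}"
        using sw_range[OF i, of k] by simp
    qed
  qed simp_all
  then show ?thesis by (simp only: mtc_def)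
qed

text \<open>A function on permutations given by a coloring \<open>c\<close> of the positions. Near-diagonal double cosets
  are disjoint unions of such sets for colorings that differ in one position, and one operator
  \<^const>\<open>Lop\<close> moves that position by one.\<close>

definition chi :: "(nat \<Rightarrow> nat) \<Rightarrow> nvec \<Rightarrow> (nat \<Rightarrow> nat) \<Rightarrow> ratfun" where
  "chi c m f = (if f \<in> P \<and> (\<forall>k\<in>{1..r}. blk m (f k) = c k) then 1 else 0)"

lemma chi_cong: "(\<And>k. k \<in> {1..r} \<Longrightarrow> c k = c' k) \<Longrightarrow> chi c m = chi c' m"
  by (simp add: chi_def fun_eq_iff)

lemma comp_sw_P: "i \<in> {1..<r} \<Longrightarrow> f \<circ> sw i \<in> P \<longleftrightarrow> f \<in> P"
proof
  assume i: "i \<in> {1..<r}" and "f \<circ> sw i \<in> P"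
  then have "(f \<circ> sw i) \<circ> sw i \<in> P" using permutes_comp_sw[of "f \<circ> sw i" r i] by simp
  then show "f \<in> P" by (simp add: o_assoc[symmetric])
qed (use permutes_comp_sw[of f r i] in simp)

lemma chi_comp_sw: assumes i: "i \<in> {1..<r}" shows "chi c m (f \<circ> sw i) = chi (c \<circ> sw i) m f"
proof -
  have "(\<forall>k\<in>{1..r}. blk m ((f \<circ> sw i) k) = c k) \<longleftrightarrow> (\<forall>k\<in>{1..r}. blk m (f k) = (c \<circ> sw i) k)"
  proof
    assume a: "\<forall>k\<in>{1..r}. blk m ((f \<circ> sw i) k) = c k"
    show "\<forall>k\<in>{1..r}. blk m (f k) = (c \<circ> sw i) k"
      using a[rule_format, OF sw_range[OF i]] by simp
  next
    assume a: "\<forall>k\<in>{1..r}. blk m (f k) = (c \<circ> sw i) k"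
    show "\<forall>k\<in>{1..r}. blk m ((f \<circ> sw i) k) = c k"
      using a[rule_format, OF sw_range[OF i]] by simp
  qed
  then show ?thesis unfolding chi_def comp_sw_P[OF i] by (simp only:)
qed

text \<open>Block numbers are monotone, so \<open>f\<close> cannot realize two colors in the order
  opposite to its values. If \<open>f i < f (Suc i)\<close> the swapped coloring is impossible and
  both sides vanish; otherwise the original coloring is impossible and the correction with
  \<open>qq - 1\<close> drops out.\<close>

lemma chi_sw:
  assumes m: "m \<in> L" and i: "i \<in> {1..<r}" and c: "c i < c (Suc i)"
  shows "Lop i (chi c m) = chi (c \<circ> sw i) m"
proof
  fix f
  show "Lop i (chi c m) f = chi (c \<circ> sw i) m f"
  proof (cases "f \<in> P")
    case False
    then have "f \<circ> sw i \<notin> P" using comp_sw_P[OF i] by blast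
    with False show ?thesis by (simp add: Lop_def chi_def)
  next
    case True
    have mono: "blk m (f a) \<le> blk m (f b)" if "f a < f b" "a \<in> {1..r}" "b \<in> {1..r}" for a b
      using blk_mono[OF m, rule_format, of "f a" "f b"] perm_range[OF True that(2)] perm_range[OF True that(3)] that(1) by simp
    have i': "i \<in> {1..r}" "Suc i \<in> {1..r}" using i by auto
    show ?thesis
    proof (cases "f i < f (Suc i)")
      case True
      then have "blk m (f i) \<le> blk m (f (Suc i))" using mono i' by blast
      then have "\<not> (blk m (f i) = c (Suc i) \<and> blk m (f (Suc i)) = c i)" using c by simp
      then have "\<not> (\<forall>k\<in>{1..r}. blk m (f k) = (c \<circ> sw i) k)" using i' by fastforce
      then have "chi (c \<circ> sw i) m f = 0" by (simp add: chi_def)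
      then show ?thesis using True by (simp add: Lop_def chi_comp_sw[OF i])
    next
      case False
      then have "f (Suc i) < f i" using permutes_ne_Suc[of f r i] True by simp
      then have "blk m (f (Suc i)) \<le> blk m (f i)" using mono i' by blast
      then have "\<not> (blk m (f i) = c i \<and> blk m (f (Suc i)) = c (Suc i))" using c by simp
      then have "\<not> (\<forall>k\<in>{1..r}. blk m (f k) = c k)" using i' by blast
      then have "chi c m f = 0" by (simp add: chi_def)
      then show ?thesis using False by (simp add: Lop_def chi_comp_sw[OF i])
    qed
  qed
qed

lemma upd_comp_sw: "c i = c (Suc i) \<Longrightarrow> c(Suc i := g) \<circ> sw i = c(i := g)"
  "c i = c (Suc i) \<Longrightarrow> c(i := g) \<circ> sw i = c(Suc i := g)"
  by (auto simp: fun_eq_iff transpose_def)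

text \<open>The exceptional color \<open>g\<close> travels from position \<open>l\<close> down to
  \<open>k\<close> through positions of the smaller color \<open>h\<close>, one letter per step;
  \<open>chi_chain_down\<close> is the mirror image for a smaller exceptional color.\<close>

lemma chi_chain_up:
  assumes m: "m \<in> L" and "1 \<le> k" "k \<le> l" "l \<le> r" and c: "\<And>j. k \<le> j \<Longrightarrow> j \<le> l \<Longrightarrow> c j = h" and g: "h < g"
  shows "Lword [k..<l] (chi (c(l := g)) m) = chi (c(k := g)) m"
  using assms(3,2) c
proof (induction k rule: inc_induct)
  case (step k)
  have IH: "Lword [Suc k..<l] (chi (c(l := g)) m) = chi (c(Suc k := g)) m"
    by (rule step.IH) (use step.prems in auto)
  have "[k..<l] = k # [Suc k..<l]" using step by (simp add: upt_conv_Cons)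
  moreover have ce: "c k = c (Suc k)" using step by simp
  moreover have "Lop k (chi (c(Suc k := g)) m) = chi (c(Suc k := g) \<circ> sw k) m"
    by (rule chi_sw[OF m]) (use step assms(4) g in auto)
  ultimately show ?case by (simp only: Lword_simps IH upd_comp_sw(1)[OF ce])
qed simp

lemma chi_chain_down:
  assumes m: "m \<in> L" and "1 \<le> l" "l \<le> k" "k \<le> r" and c: "\<And>j. l \<le> j \<Longrightarrow> j \<le> k \<Longrightarrow> c j = h" and g: "g < h"
  shows "Lword (rev [l..<k]) (chi (c(l := g)) m) = chi (c(k := g)) m"
  using assms(3,4) c
proof (induction k rule: dec_induct)
  case (step k)
  have IH: "Lword (rev [l..<k]) (chi (c(l := g)) m) = chi (c(k := g)) m"
    by (rule step.IH) (use step.prems in auto)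
  have "rev [l..<Suc k] = k # rev [l..<k]" using step by simp
  moreover have ce: "c k = c (Suc k)" using step by simp
  moreover have "Lop k (chi (c(k := g)) m) = chi (c(k := g) \<circ> sw k) m"
    by (rule chi_sw[OF m]) (use step assms(2) g in auto)
  ultimately show ?case by (simp only: Lword_simps IH upd_comp_sw(2)[OF ce])
qed simp

definition ymat :: "nmat \<Rightarrow> nvec \<Rightarrow> (nat \<Rightarrow> nat) \<Rightarrow> (nat \<Rightarrow> nat) \<Rightarrow> ratfun" where
  "ymat A m c f = (if f \<in> P \<and> mtc c m f = A then 1 else 0)"

lemma ymat_cong:
  assumes "\<And>k. k \<in> {1..r} \<Longrightarrow> c k = c' k" shows "ymat A m c = ymat A m c'"
proof
  fix f
  have e: "mtc c m f = mtc c' m f" by (rule mtc_cong[OF assms])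
  show "ymat A m c f = ymat A m c' f" unfolding ymat_def e ..
qed

lemma ymat_sw: "i \<in> {1..<r} \<Longrightarrow> ymat A m c (f \<circ> sw i) = ymat A m (c \<circ> sw i) f"
  unfolding ymat_def by (simp only: mtc_sw comp_sw_P)

text \<open>Here \<open>f k\<close> lies below the values that follow, so the outermost operator
  takes its first branch and gives a factor q. The swap moves this small value to
  \<open>Suc k\<close>, where the same hypothesis holds for the remaining word.\<close>

lemma ymat_chain_up:
  assumes "1 \<le> k" "k \<le> l" "l \<le> r" and c: "\<And>j. k \<le> j \<Longrightarrow> j \<le> l \<Longrightarrow> c j = h"
    and f: "\<And>j. k < j \<Longrightarrow> j \<le> l \<Longrightarrow> f k < f j"
  shows "Lword [k..<l] (ymat A m (c(l := g))) f = qq ^ (l - k) * ymat A m (c(k := g)) f"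
  using assms(2,1) c f
proof (induction k arbitrary: f rule: inc_induct)
  case (step k)
  have IH: "Lword [Suc k..<l] (ymat A m (c(l := g))) (f \<circ> sw k) = qq ^ (l - Suc k) * ymat A m (c(Suc k := g)) (f \<circ> sw k)"
    by (rule step.IH) (use step in \<open>auto simp: transpose_def\<close>)
  have u: "[k..<l] = k # [Suc k..<l]" using step by (simp add: upt_conv_Cons)
  have ce: "c k = c (Suc k)" using step by simp
  have k: "k \<in> {1..<r}" using step assms(3) by auto
  have "f k < f (Suc k)" using step by simp
  then have "Lword [k..<l] (ymat A m (c(l := g))) f = qq * Lword [Suc k..<l] (ymat A m (c(l := g))) (f \<circ> sw k)"
    unfolding u Lword_simps Lop_def by (simp only: if_True)
  also have "\<dots> = qq * (qq ^ (l - Suc k) * ymat A m (c(k := g)) f)"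
    by (simp only: IH ymat_sw[OF k] upd_comp_sw(1)[OF ce])
  also have "\<dots> = qq ^ (l - k) * ymat A m (c(k := g)) f"
    using step(2) by (metis Suc_diff_Suc mult.assoc power_Suc)
  finally show ?case .
qed simp

lemma ymat_chain_down:
  assumes "1 \<le> l" "l \<le> k" "k \<le> r" and c: "\<And>j. l \<le> j \<Longrightarrow> j \<le> k \<Longrightarrow> c j = h"
    and f: "\<And>j. l \<le> j \<Longrightarrow> j < k \<Longrightarrow> f j < f k"
  shows "Lword (rev [l..<k]) (ymat A m (c(l := g))) f = qq ^ (k - l) * ymat A m (c(k := g)) f"
  using assms(2,3) c f
proof (induction k arbitrary: f rule: dec_induct)
  case (step k)
  have IH: "Lword (rev [l..<k]) (ymat A m (c(l := g))) (f \<circ> sw k) = qq ^ (k - l) * ymat A m (c(k := g)) (f \<circ> sw k)"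
    by (rule step.IH) (use step in \<open>auto simp: transpose_def\<close>)
  have u: "rev [l..<Suc k] = k # rev [l..<k]" using step by simp
  have ce: "c k = c (Suc k)" using step by simp
  have k: "k \<in> {1..<r}" using step assms(1) by auto
  have "f k < f (Suc k)" using step by simp
  then have "Lword (rev [l..<Suc k]) (ymat A m (c(l := g))) f = qq * Lword (rev [l..<k]) (ymat A m (c(l := g))) (f \<circ> sw k)"
    unfolding u Lword_simps Lop_def by (simp only: if_True)
  also have "\<dots> = qq * (qq ^ (k - l) * ymat A m (c(Suc k := g)) f)"
    by (simp only: IH ymat_sw[OF k] upd_comp_sw(2)[OF ce])
  also have "\<dots> = qq ^ (Suc k - l) * ymat A m (c(Suc k := g)) f"
    using step(1) by (metis Suc_diff_le mult.assoc power_Suc)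
  finally show ?case .
qed simp

lemma kap_Yel_ymat: assumes "A \<in> Th" shows "kap (Yel A) = ymat A (co n A) (blk (ro n A))"
proof
  fix f show "kap (Yel A) f = ymat A (co n A) (blk (ro n A)) f"
    using kap_Yel[OF assms, of f] kap_supp[OF Yel_closed[OF assms], of f]
    by (cases "f permutes {1..r}") (simp_all add: ymat_def mt_mtc)
qed

lemma kap_X_chi: assumes "l \<in> L" shows "kap (X l) = chi (blk l) l"
  by (rule ext) (auto simp: hecke_x_eq[OF assms] kap_xc Yg_def chi_def)

text \<open>The diagonal matrix of \<open>v\<close> with one unit of column \<open>g\<close> moved
  off the diagonal to row \<open>h\<close>: column sums \<open>v\<close>, row sums
  \<open>shift h g v\<close>. For neighbouring indices these are the generators of BLM type.\<close>

definition offd :: "nat \<Rightarrow> nat \<Rightarrow> nvec \<Rightarrow> nmat" where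
  "offd h g v = (\<lambda>i j. if i = j then v i - of_bool (i = g) else of_bool (i = h \<and> j = g))"

definition diagm :: "nvec \<Rightarrow> nmat" where "diagm v = (\<lambda>i j. if i = j then v i else 0)"

definition shift :: "nat \<Rightarrow> nat \<Rightarrow> nvec \<Rightarrow> nvec" where
  "shift h g v = (\<lambda>i. v i - of_bool (i = g) + of_bool (i = h))"

lemma Lam_out: "v \<in> L \<Longrightarrow> i \<notin> {1..n} \<Longrightarrow> v i = 0" and Lam_sum: "v \<in> L \<Longrightarrow> (\<Sum>i\<in>{1..n}. v i) = r"
  unfolding Lam_def by blast+

lemma Theta_sum_co:
  assumes "\<And>i j. i \<notin> {1..n} \<or> j \<notin> {1..n} \<Longrightarrow> A i j = 0" "co n A \<in> L" shows "A \<in> Th"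
  using Lam_sum[OF assms(2)] assms(1) unfolding Theta_def co_def by (subst (asm) sum.swap) simp

context
  fixes h g v assumes hg: "h \<in> {1..n}" "g \<in> {1..n}" "h \<noteq> g" and v: "v \<in> L" "0 < v g"
begin

lemma co_offd: "co n (offd h g v) = v"
proof
  fix j
  have "(\<Sum>i\<in>{1..n}. offd h g v i j) = (\<Sum>i\<in>{1..n}. (if i = j then v j - of_bool (j = g) else 0) + (if i = h then of_bool (j = g) else 0))"
    by (intro sum.cong refl) (use hg in \<open>auto simp: offd_def\<close>)
  also have "\<dots> = v j"
    using hg v Lam_out[OF v(1), of j] by (auto simp: sum.distrib sum.delta)
  finally show "co n (offd h g v) j = v j" by (simp add: co_def)
qed

lemma ro_offd: "ro n (offd h g v) = shift h g v"
proof
  fix i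
  have "(\<Sum>j\<in>{1..n}. offd h g v i j) = (\<Sum>j\<in>{1..n}. (if j = i then v i - of_bool (i = g) else 0) + (if j = g then of_bool (i = h) else 0))"
    by (intro sum.cong refl) (use hg in \<open>auto simp: offd_def\<close>)
  also have "\<dots> = shift h g v i"
    using hg v Lam_out[OF v(1), of i] by (auto simp: sum.distrib sum.delta shift_def)
  finally show "ro n (offd h g v) i = shift h g v i" by (simp add: ro_def)
qed

lemma offd_Theta: "offd h g v \<in> Th"
proof (rule Theta_sum_co)
  show "co n (offd h g v) \<in> L" by (simp add: co_offd v)
  show "offd h g v i j = 0" if "i \<notin> {1..n} \<or> j \<notin> {1..n}" for i j
    using that hg Lam_out[OF v(1), of i] by (auto simp: offd_def)
qed

lemma shift_L: "shift h g v \<in> L" using ro_Lam[OF offd_Theta] by (simp add: ro_offd)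

lemma psum_shift: "int (psum (shift h g v) i) = int (psum v i) + of_bool (h \<le> i) - of_bool (g \<le> i)"
  by (induction i) (use hg v in \<open>auto simp: psum_Suc shift_def le_Suc_eq of_nat_diff\<close>)

text \<open>A permutation belongs to the double coset of \<open>offd h g v\<close> iff exactly one
  position of row block \<open>h\<close> has column block \<open>g\<close> and all others keep their
  block number; the sum runs over that one position.\<close>

lemma sum_chi:
  assumes f: "f \<in> P"
  shows "(\<Sum>k\<in>{k \<in> {1..r}. blk (shift h g v) k = h}. chi ((blk (shift h g v))(k := g)) v f) =
    (if mt (shift h g v) v f = offd h g v then 1 else 0)"
proof -
  let ?l = "shift h g v" and ?C = "offd h g v"
  let ?K = "{k \<in> {1..r}. blk ?l k = h}"
  let ?ind = "\<lambda>k. \<forall>j\<in>{1..r}. blk v (f j) = ((blk ?l)(k := g)) j"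
  have rng: "blk ?l k \<in> {1..n}" "blk v (f k) \<in> {1..n}" if "k \<in> {1..r}" for k
    using blk_range[OF shift_L that] blk_range[OF v(1) perm_range[OF f that]] by auto
  show ?thesis
  proof (cases "mt ?l v f = ?C")
    case True
    have C: "card {k \<in> {1..r}. blk ?l k = i \<and> blk v (f k) = j} = ?C i j" if "i \<in> {1..n}" "j \<in> {1..n}" for i j
      using fun_cong[OF fun_cong[OF True, of i], of j] that by (simp add: mt_def)
    have "card {k \<in> {1..r}. blk ?l k = h \<and> blk v (f k) = g} = 1"
      using C[OF hg(1,2)] hg by (simp add: offd_def)
    then obtain k0 where k0: "{k \<in> {1..r}. blk ?l k = h \<and> blk v (f k) = g} = {k0}"
      using card_1_singletonE by blast
    have dg: "blk v (f j) = blk ?l j" if j: "j \<in> {1..r}" "j \<noteq> k0" for j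
    proof (rule ccontr)
      assume ne: "blk v (f j) \<noteq> blk ?l j"
      have "\<not> (blk ?l j = h \<and> blk v (f j) = g)" using k0 j by blast
      then have "?C (blk ?l j) (blk v (f j)) = 0" using ne by (simp add: offd_def)
      then have "card {k \<in> {1..r}. blk ?l k = blk ?l j \<and> blk v (f k) = blk v (f j)} = 0"
        using C rng[OF j(1)] by simp
      then show False using j(1) by auto
    qed
    have k0': "k0 \<in> ?K" "blk v (f k0) = g" using k0 by auto
    have "chi ((blk ?l)(k := g)) v f = (if k = k0 then 1 else 0)" if k: "k \<in> ?K" for k
    proof (cases "k = k0")
      case True then show ?thesis using dg k0' f by (simp add: chi_def)
    next
      case False
      then have "blk v (f k) \<noteq> g" using dg[of k] k hg by simp
      then have "\<not> ?ind k" using k by auto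
      then show ?thesis using False by (simp add: chi_def)
    qed
    then have "(\<Sum>k\<in>?K. chi ((blk ?l)(k := g)) v f) = (\<Sum>k\<in>?K. if k = k0 then 1 else 0)"
      by (intro sum.cong refl)
    also have "\<dots> = 1" using k0' by (simp add: sum.delta)
    finally show ?thesis using True by simp
  next
    case False
    have "\<not> ?ind k" if k: "k \<in> ?K" for k
    proof
      assume ind: "?ind k"
      have off: "mt ?l v f i j = ?C i j" if "i \<noteq> j" for i j
      proof (cases "i \<in> {1..n} \<and> j \<in> {1..n}")
        case True
        have "{k \<in> {1..r}. blk ?l k = i \<and> blk v (f k) = j} = (if i = h \<and> j = g then {k} else {})"
          using ind k that by (auto split: if_splits)
        then show ?thesis using True that by (simp add: mt_def offd_def)
      next
        case False then show ?thesis using that hg by (auto simp: mt_def offd_def)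
      qed
      \<comment> \<open>The coloring gives the entries off the diagonal; the known row sums then
        force the diagonal ones.\<close>
      have "mt ?l v f i i = ?C i i" for i
      proof (cases "i \<in> {1..n}")
        case True
        have "(\<Sum>j\<in>{1..n}. mt ?l v f i j) = (\<Sum>j\<in>{1..n}. ?C i j)"
          using fun_cong[OF ro_mt[OF shift_L v(1) f], of i] fun_cong[OF ro_offd, of i] by (simp add: ro_def)
        then have "mt ?l v f i i + (\<Sum>j\<in>{1..n}-{i}. mt ?l v f i j) = ?C i i + (\<Sum>j\<in>{1..n}-{i}. ?C i j)"
          using True by (simp add: sum.remove)
        moreover have "(\<Sum>j\<in>{1..n}-{i}. mt ?l v f i j) = (\<Sum>j\<in>{1..n}-{i}. ?C i j)"
          by (intro sum.cong refl) (use off in auto)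
        ultimately show ?thesis by simp
      next
        case False
        then show ?thesis using Lam_out[OF v(1), of i] by (auto simp: mt_def offd_def)
      qed
      then have "mt ?l v f = ?C" using off by (intro ext) metis
      then show False using \<open>mt ?l v f \<noteq> ?C\<close> by blast
    qed
    then have "(\<Sum>k\<in>?K. chi ((blk ?l)(k := g)) v f) = 0"
      by (intro sum.neutral ballI) (simp only: chi_def simp_thms if_False)
    then show ?thesis using False by simp
  qed
qed

end

text \<open>If two compositions differ only in the partial sum at \<open>h\<close>, and there by
  one, then exactly one position, the last of block \<open>h\<close> of \<open>l\<close>, changes
  its block, from \<open>h\<close> to \<open>Suc h\<close>.\<close>

lemma blk_shift:
  assumes l: "l \<in> L" and l': "l' \<in> L" and h: "1 \<le> h" "h < n" and p: "\<And>i. psum l i = psum l' i + of_bool (i = h)"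
  shows "psum l h \<in> {1..r}" "blk l (psum l h) = h"
    "k \<in> {1..r} \<Longrightarrow> blk l' k = (if k = psum l h then Suc h else blk l k)"
proof -
  have r: "psum l n = r" "psum l' n = r" using Lam_psum l l' by auto
  have "psum l h \<le> psum l n" using h by (intro psum_mono) simp
  moreover have m1: "psum l (h - 1) < psum l h"
    using p[of h] p[of "h - 1"] psum_mono[of "h - 1" h l'] h by simp
  ultimately show m: "psum l h \<in> {1..r}" using r by simp
  show bh: "blk l (psum l h) = h"
    using m1 h(1) m r by (subst blk_eq_iff[of _ _ _ n]) auto
  assume k: "k \<in> {1..r}"
  show "blk l' k = (if k = psum l h then Suc h else blk l k)"
  proof (cases "k = psum l h")
    case True
    have "psum l h \<le> psum l (Suc h)" by (intro psum_mono) simp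
    then have "blk l' k = Suc h" using True p[of h] p[of "Suc h"] k r
      by (subst blk_eq_iff[of _ _ _ n]) auto
    then show ?thesis using True by simp
  next
    case False
    have i: "1 \<le> blk l k" using blk_range[OF l k] by simp
    have "psum l (blk l k - 1) < k \<and> k \<le> psum l (blk l k)"
      using blk_eq_iff[OF i, of k l n] k r by simp
    then have "psum l' (blk l k - 1) < k \<and> k \<le> psum l' (blk l k)"
      using p[of "blk l k"] p[of "blk l k - 1"] False by (auto split: if_splits simp: of_bool_def)
    then have "blk l' k = blk l k" using blk_eq_iff[OF i, of k l' n] k r by simp
    then show ?thesis using False by simp
  qed
qed

lemma blk_set: "l \<in> L \<Longrightarrow> i \<in> {1..n} \<Longrightarrow> {k \<in> {1..r}. blk l k = i} = {psum l (i - 1)<..psum l i}"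
  using block_eq[of l i] block_psum[of i l] by simp

end

text \<open>A monotone \<open>g\<close> takes the value \<open>p\<close> on one run of consecutive
  positions. The distance from the run to the right end is the number of larger values, and the run
  itself contributes a geometric sum.\<close>

lemma sum_mono_up:
  assumes "a \<le> m" "\<And>j k. a < j \<Longrightarrow> j \<le> k \<Longrightarrow> k \<le> m \<Longrightarrow> g j \<le> (g k :: nat)"
  shows "(\<Sum>k\<in>{k \<in> {a<..m}. g k = p}. qq ^ (m - k)) =
    qq ^ card {k \<in> {a<..m}. p < g k} * qint (card {k \<in> {a<..m}. g k = p})"
  using assms
proof (induction a rule: inc_induct)
  case (step a)
  have IH: "(\<Sum>k\<in>{k \<in> {Suc a<..m}. g k = p}. qq ^ (m - k)) =
    qq ^ card {k \<in> {Suc a<..m}. p < g k} * qint (card {k \<in> {Suc a<..m}. g k = p})"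
    by (rule step.IH) (use step.prems in auto)
  have ins: "{k \<in> {a<..m}. Q k} = (if Q (Suc a) then insert (Suc a) {k \<in> {Suc a<..m}. Q k} else {k \<in> {Suc a<..m}. Q k})" for Q
  proof -
    have "k \<in> {a<..m} \<longleftrightarrow> k = Suc a \<or> k \<in> {Suc a<..m}" for k using step(2) by auto
    then show ?thesis by auto
  qed
  have ge: "g (Suc a) \<le> g k" if "k \<in> {Suc a<..m}" for k using step.prems[of "Suc a" k] that by auto
  consider "g (Suc a) < p" | "g (Suc a) = p" | "p < g (Suc a)" by linarith
  then show ?case
  proof cases
    case 1 then show ?thesis using IH by (simp only: ins) (simp del: greaterThanAtMost_iff)
  next
    case 2
    have "card {k \<in> {Suc a<..m}. p < g k} + card {k \<in> {Suc a<..m}. g k = p} = card ({k \<in> {Suc a<..m}. p < g k} \<union> {k \<in> {Suc a<..m}. g k = p})"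
      by (rule card_Un_disjoint[symmetric]) auto
    also have "{k \<in> {Suc a<..m}. p < g k} \<union> {k \<in> {Suc a<..m}. g k = p} = {Suc a<..m}"
      using ge 2 le_neq_implies_less by fastforce
    finally have c: "m - Suc a = card {k \<in> {Suc a<..m}. p < g k} + card {k \<in> {Suc a<..m}. g k = p}" by simp
    have x: "finite {k \<in> {Suc a<..m}. g k = p}" "Suc a \<notin> {k \<in> {Suc a<..m}. g k = p}" by simp_all
    show ?thesis using 2 IH by (simp only: ins simp_thms if_True less_irrefl if_False sum.insert[OF x] card_insert_disjoint[OF x] c)
        (simp add: qint_def power_add algebra_simps del: greaterThanAtMost_iff)
  next
    case 3
    then have "{k \<in> {Suc a<..m}. g k = p} = {}" using ge by fastforce
    then show ?thesis using 3 by (simp only: ins) (simp add: qint_def del: greaterThanAtMost_iff)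
  qed
qed (simp add: qint_def)

text \<open>The same with distances measured from the left end, so that the smaller values determine
  the exponent.\<close>

lemma sum_mono_down:
  assumes "a \<le> b" "\<And>j k. a < j \<Longrightarrow> j \<le> k \<Longrightarrow> k \<le> b \<Longrightarrow> g j \<le> (g k :: nat)"
  shows "(\<Sum>k\<in>{k \<in> {a<..b}. g k = p}. qq ^ (k - Suc a)) =
    qq ^ card {k \<in> {a<..b}. g k < p} * qint (card {k \<in> {a<..b}. g k = p})"
  using assms
proof (induction b rule: dec_induct)
  case (step b)
  have IH: "(\<Sum>k\<in>{k \<in> {a<..b}. g k = p}. qq ^ (k - Suc a)) =
    qq ^ card {k \<in> {a<..b}. g k < p} * qint (card {k \<in> {a<..b}. g k = p})"
    by (rule step.IH) (use step.prems in auto)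
  have ins: "{k \<in> {a<..Suc b}. Q k} = (if Q (Suc b) then insert (Suc b) {k \<in> {a<..b}. Q k} else {k \<in> {a<..b}. Q k})" for Q
  proof -
    have "k \<in> {a<..Suc b} \<longleftrightarrow> k = Suc b \<or> k \<in> {a<..b}" for k using step(1) by auto
    then show ?thesis by auto
  qed
  have ge: "g k \<le> g (Suc b)" if "k \<in> {a<..b}" for k using step.prems[of k "Suc b"] that by auto
  consider "g (Suc b) < p" | "g (Suc b) = p" | "p < g (Suc b)" by linarith
  then show ?case
  proof cases
    case 3 then show ?thesis using IH by (simp only: ins) (simp del: greaterThanAtMost_iff)
  next
    case 2
    have "card {k \<in> {a<..b}. g k < p} + card {k \<in> {a<..b}. g k = p} = card ({k \<in> {a<..b}. g k < p} \<union> {k \<in> {a<..b}. g k = p})"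
      by (rule card_Un_disjoint[symmetric]) auto
    also have "{k \<in> {a<..b}. g k < p} \<union> {k \<in> {a<..b}. g k = p} = {a<..b}"
      using ge 2 le_neq_implies_less by fastforce
    finally have c: "b - a = card {k \<in> {a<..b}. g k < p} + card {k \<in> {a<..b}. g k = p}" by simp
    have x: "finite {k \<in> {a<..b}. g k = p}" "Suc b \<notin> {k \<in> {a<..b}. g k = p}" by simp_all
    show ?thesis using 2 IH by (simp only: ins simp_thms if_True less_irrefl if_False sum.insert[OF x] card_insert_disjoint[OF x] diff_Suc_Suc c)
        (simp add: qint_def power_add algebra_simps del: greaterThanAtMost_iff)
  next
    case 1
    then have "{k \<in> {a<..b}. g k = p} = {}" using ge by fastforce
    then show ?thesis using 1 by (simp only: ins) (simp add: qint_def del: greaterThanAtMost_iff)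
  qed
qed (simp add: qint_def)

lemma sum_card_fibre:
  assumes "finite K" "finite J" shows "(\<Sum>j\<in>J. card {k \<in> K. g k = j}) = card {k \<in> K. g k \<in> J}"
proof -
  have "card (\<Union>j\<in>J. {k \<in> K. g k = j}) = (\<Sum>j\<in>J. card {k \<in> K. g k = j})"
    by (rule card_UN_disjoint) (use assms in auto)
  moreover have "(\<Union>j\<in>J. {k \<in> K. g k = j}) = {k \<in> K. g k \<in> J}" by auto
  ultimately show ?thesis by simp
qed

context qschur_rank
begin

text \<open>Recoloring position \<open>k\<close> from \<open>h\<close> to \<open>g\<close> moves one
  unit from row \<open>h\<close> to row \<open>g\<close> in the column to which \<open>f k\<close>
  belongs.\<close>

lemma mtc_move:
  assumes f: "f \<in> P" and k: "k \<in> {1..r}" "blk l k = h" and m: "m \<in> L" and hg: "h \<in> {1..n}" "g \<in> {1..n}" "h \<noteq> g"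
  shows "mtc ((blk l)(k := g)) m f = move (mt l m f) (h, blk m (f k)) (g, blk m (f k))"
proof (intro ext)
  fix i j
  let ?p = "blk m (f k)"
  have p: "?p \<in> {1..n}" using blk_range[OF m perm_range[OF f k(1)]] .
  show "mtc ((blk l)(k := g)) m f i j = move (mt l m f) (h, ?p) (g, ?p) i j"
  proof (cases "i \<in> {1..n} \<and> j \<in> {1..n}")
    case False
    then have "\<not> ((i, j) = (h, ?p) \<or> (i, j) = (g, ?p))" using p hg by auto
    moreover have "mtc ((blk l)(k := g)) m f i j = 0" "mt l m f i j = 0"
      using False unfolding mtc_def mt_def by (rule if_not_P)+
    ultimately show ?thesis by (simp add: move_def)
  next
    case True
    define A where "A = {x \<in> {1..r}. blk l x = i \<and> blk m (f x) = j}"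
    have fin: "finite A" by (simp add: A_def)
    have e: "{x \<in> {1..r}. ((blk l)(k := g)) x = i \<and> blk m (f x) = j} =
      (if (i, j) = (h, ?p) then A - {k} else if (i, j) = (g, ?p) then insert k A else A)"
      using k hg by (auto simp: A_def)
    have kA: "(i, j) = (h, ?p) \<Longrightarrow> k \<in> A" "(i, j) = (g, ?p) \<Longrightarrow> k \<notin> A"
      using k hg by (auto simp: A_def)
    have "mtc ((blk l)(k := g)) m f i j = card (if (i, j) = (h, ?p) then A - {k} else if (i, j) = (g, ?p) then insert k A else A)"
      using True unfolding mtc_def e by (rule if_P)
    also have "\<dots> = card A - of_bool ((i, j) = (h, ?p)) + of_bool ((i, j) = (g, ?p))"
    proof (cases "(i, j) = (h, ?p)")
      case True
      then have "(i, j) \<noteq> (g, ?p)" using hg by auto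
      then show ?thesis using True kA(1)[OF True] by (simp add: card_Diff_singleton del: prod.inject)
    next
      case False
      then show ?thesis using kA(2) fin by (simp add: del: prod.inject)
    qed
    also have "card A = mt l m f i j" using True by (simp add: mt_def A_def)
    finally show ?thesis by (simp only: move_def)
  qed
qed

text \<open>The coefficient of a double coset may be read at any of its members; one that increases
  on the row blocks keeps all operators in their first branch.\<close>

lemma ascending_rep:
  assumes B: "B \<in> Th" shows "\<exists>f\<in>P. mt (ro n B) (co n B) f = B \<and> ascb (blk (ro n B)) f"
proof -
  obtain d u where d: "d \<in> P" "u \<in> Yg (blk (ro n B))" "ascb (blk (ro n B)) d" "rep B = d \<circ> u"
    using coset_rep_exists[OF blk_mono[OF ro_Lam[OF B]] rep(1)[OF B]] by blast
  have "mt (ro n B) (co n B) (id \<circ> d \<circ> u) = mt (ro n B) (co n B) d"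
    by (rule mt_coset[OF ro_Lam[OF B] co_Lam[OF B] d(1,2) Yg_id])
  then have "mt (ro n B) (co n B) d = B" using rep(2)[OF B] d(4) by simp
  then show ?thesis using d(1,3) by (intro bexI conjI)
qed

lemma hw_sum_mult:
  assumes "finite K" "\<And>k. k \<in> K \<Longrightarrow> w k \<in> W" "y \<in> carrier H"
  shows "finsum H (\<lambda>k. hw (w k)) K \<in> carrier H"
    "kap (finsum H (\<lambda>k. hw (w k)) K \<otimes>\<^bsub>H\<^esub> y) f = (\<Sum>k\<in>K. Lword (w k) (kap y) f)"
proof -
  show "finsum H (\<lambda>k. hw (w k)) K \<in> carrier H" by (intro H.finsum_closed) (use assms in auto)
  have "finsum H (\<lambda>k. hw (w k)) K \<otimes>\<^bsub>H\<^esub> y = finsum H (\<lambda>k. hw (w k) \<otimes>\<^bsub>H\<^esub> y) K"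
    by (rule H.finsum_ldistr) (use assms in auto)
  also have "kap \<dots> f = (\<Sum>k\<in>K. kap (hw (w k) \<otimes>\<^bsub>H\<^esub> y) f)"
    by (rule kap_finsum) (use assms in auto)
  also have "\<dots> = (\<Sum>k\<in>K. Lword (w k) (kap y) f)"
    by (intro sum.cong refl) (simp add: kap_hw_mult assms)
  finally show "kap (finsum H (\<lambda>k. hw (w k)) K \<otimes>\<^bsub>H\<^esub> y) f = (\<Sum>k\<in>K. Lword (w k) (kap y) f)" .
qed

text \<open>Produces the cofactor k with k x = \<open>Yel (offd h g v)\<close> as a sum of words,
  one for each place in row block \<open>h\<close> to which the exceptional position can be
  moved.\<close>

lemma ro_offd_kap_eqI:
  assumes hg: "h \<in> {1..n}" "g \<in> {1..n}" "h \<noteq> g" and v: "v \<in> L" "0 < v g"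
    and w: "\<And>k. k \<in> {1..r} \<Longrightarrow> blk (shift h g v) k = h \<Longrightarrow> w k \<in> W \<and> Lword (w k) (chi (blk v) v) = chi ((blk (shift h g v))(k := g)) v"
  shows "finsum H (\<lambda>k. hw (w k)) {k \<in> {1..r}. blk (shift h g v) k = h} \<otimes>\<^bsub>H\<^esub> X v = Yel (offd h g v)"
    (is "finsum H _ ?K \<otimes>\<^bsub>H\<^esub> X v = Yel ?C")
proof (rule kap_inj)
  have wW: "w k \<in> W" if "k \<in> ?K" for k using w that by blast
  have fin: "finite ?K" by simp
  have cX: "X v \<in> carrier H" by (rule X_closed[OF v(1)])
  have c1: "finsum H (\<lambda>k. hw (w k)) ?K \<in> carrier H" by (rule hw_sum_mult(1)[OF fin wW cX])
  show "finsum H (\<lambda>k. hw (w k)) ?K \<otimes>\<^bsub>H\<^esub> X v \<in> carrier H" by (rule H.m_closed[OF c1 cX])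
  have CT: "?C \<in> Th" by (rule offd_Theta[OF hg v])
  show "Yel ?C \<in> carrier H" by (rule Yel_closed[OF CT])
  fix f assume "f permutes {1..r}"
  then have f: "f \<in> P" by simp
  have "kap (finsum H (\<lambda>k. hw (w k)) ?K \<otimes>\<^bsub>H\<^esub> X v) f = (\<Sum>k\<in>?K. Lword (w k) (kap (X v)) f)"
    by (rule hw_sum_mult(2)[OF fin wW cX])
  also have "\<dots> = (\<Sum>k\<in>?K. chi ((blk (shift h g v))(k := g)) v f)"
    unfolding kap_X_chi[OF v(1)] by (intro sum.cong refl) (use w in simp)
  also have "\<dots> = kap (Yel ?C) f"
    unfolding sum_chi[OF hg v f] kap_Yel[OF CT f] ro_offd[OF hg v] co_offd[OF hg v] ..
  finally show "kap (finsum H (\<lambda>k. hw (w k)) ?K \<otimes>\<^bsub>H\<^esub> X v) f = kap (Yel ?C) f" .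
qed

text \<open>Common part of the raising and lowering formulas. They differ in the words
  \<open>w\<close>, in the number \<open>e k\<close> of letters each of which contributes q, and in
  the resulting sum \<open>z p\<close> over the positions with column \<open>p\<close>.\<close>

lemma crd_offd_gen:
  assumes hg: "h \<in> {1..n}" "g \<in> {1..n}" "h \<noteq> g" and A: "A \<in> Th" "0 < ro n A g" and B: "B \<in> Th"
    and roB: "ro n B = shift h g (ro n A)" and coB: "co n B = co n A"
    and w: "\<And>k. k \<in> {1..r} \<Longrightarrow> blk (ro n B) k = h \<Longrightarrow> w k \<in> W \<and>
      Lword (w k) (chi (blk (ro n A)) (ro n A)) = chi ((blk (ro n B))(k := g)) (ro n A)"
    and f: "f \<in> P" "mt (ro n B) (co n B) f = B"
    and y: "\<And>k. k \<in> {1..r} \<Longrightarrow> blk (ro n B) k = h \<Longrightarrow>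
      Lword (w k) (ymat A (co n A) (blk (ro n A))) f = qq ^ e k * ymat A (co n A) ((blk (ro n B))(k := g)) f"
    and s: "\<And>p. p \<in> {1..n} \<Longrightarrow> (\<Sum>k\<in>{k \<in> {k \<in> {1..r}. blk (ro n B) k = h}. blk (co n A) (f k) = p}. qq ^ e k) = z p"
  shows "crd (basis_e n r (offd h g (ro n A)) \<otimes>\<^bsub>S\<^esub> basis_e n r A) B =
    (\<Sum>p\<in>{1..n}. if move B (h, p) (g, p) = A then z p else 0)"
proof -
  let ?v = "ro n A" and ?l = "ro n B" and ?m = "co n A"
  let ?K = "{k \<in> {1..r}. blk ?l k = h}" and ?C = "offd h g ?v"
  let ?k = "finsum H (\<lambda>k. hw (w k)) ?K"
  have v: "?v \<in> L" using ro_Lam A by blast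
  have m: "?m \<in> L" using co_Lam A by blast
  have wW: "w k \<in> W" if "k \<in> ?K" for k using w that by blast
  have fin: "finite ?K" by simp
  have kc: "?k \<in> carrier H" by (rule hw_sum_mult(1)[OF fin wW X_closed[OF v]])
  have kY: "?k \<otimes>\<^bsub>H\<^esub> X ?v = Yel ?C"
    using ro_offd_kap_eqI[OF hg v A(2), of w] w unfolding roB by blast
  have CT: "?C \<in> Th" by (rule offd_Theta[OF hg v A(2)])
  have coC: "co n ?C = ?v" by (rule co_offd[OF hg v A(2)])
  have roC: "ro n ?C = ?l" using ro_offd[OF hg v A(2)] roB by simp
  have "crd (basis_e n r ?C \<otimes>\<^bsub>S\<^esub> basis_e n r A) B = kap (?k \<otimes>\<^bsub>H\<^esub> Yel A) f"
    using crd_mult_basis[OF A(1) B CT kc _ f] kY coC roC coB by simp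
  also have "\<dots> = (\<Sum>k\<in>?K. Lword (w k) (kap (Yel A)) f)"
    by (rule hw_sum_mult(2)[OF fin wW Yel_closed[OF A(1)]])
  also have "\<dots> = (\<Sum>k\<in>?K. if move B (h, blk ?m (f k)) (g, blk ?m (f k)) = A then qq ^ e k else 0)"
  proof (intro sum.cong refl)
    fix k assume k: "k \<in> ?K"
    have "mtc ((blk ?l)(k := g)) ?m f = move B (h, blk ?m (f k)) (g, blk ?m (f k))"
      using mtc_move[OF f(1) _ _ m hg, of k ?l] k f(2) coB by simp
    then show "Lword (w k) (kap (Yel A)) f = (if move B (h, blk ?m (f k)) (g, blk ?m (f k)) = A then qq ^ e k else 0)"
      using y[of k] k f(1) by (simp add: kap_Yel_ymat[OF A(1)] ymat_def)
  qed
  \<comment> \<open>Grouping by the column block of \<open>f k\<close>, because the matrix reached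
    depends on that column alone.\<close>
  also have "\<dots> = (\<Sum>p\<in>{1..n}. \<Sum>k\<in>{k \<in> ?K. blk ?m (f k) = p}.
      if move B (h, blk ?m (f k)) (g, blk ?m (f k)) = A then qq ^ e k else 0)"
    by (rule sum.group[symmetric]) (use blk_range[OF m perm_range[OF f(1)]] in auto)
  also have "\<dots> = (\<Sum>p\<in>{1..n}. if move B (h, p) (g, p) = A then z p else 0)"
  proof (intro sum.cong refl)
    fix p assume p: "p \<in> {1..n}"
    have "(\<Sum>k\<in>{k \<in> ?K. blk ?m (f k) = p}. if move B (h, blk ?m (f k)) (g, blk ?m (f k)) = A then qq ^ e k else 0)
      = (\<Sum>k\<in>{k \<in> ?K. blk ?m (f k) = p}. if move B (h, p) (g, p) = A then qq ^ e k else 0)"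
      by (intro sum.cong refl) simp
    also have "\<dots> = (if move B (h, p) (g, p) = A then z p else 0)"
      using s[OF p] by simp
    finally show "(\<Sum>k\<in>{k \<in> ?K. blk ?m (f k) = p}. if move B (h, blk ?m (f k)) (g, blk ?m (f k)) = A then qq ^ e k else 0)
      = (if move B (h, p) (g, p) = A then z p else 0)" .
  qed
  finally show ?thesis .
qed

text \<open>Translates the cardinalities occurring in \<open>sum_mono_up\<close> and
  \<open>sum_mono_down\<close> into an entry and partial sums of a row of the matrix.\<close>

lemma block_entries:
  assumes l: "l \<in> L" and m: "m \<in> L" and f: "f \<in> P" and h: "h \<in> {1..n}"
  shows "p \<in> {1..n} \<Longrightarrow> card {k \<in> {psum l (h - 1)<..psum l h}. blk m (f k) = p} = mt l m f h p"
    and "card {k \<in> {psum l (h - 1)<..psum l h}. p < blk m (f k)} = (\<Sum>j\<in>{p<..n}. mt l m f h j)"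
    and "card {k \<in> {psum l (h - 1)<..psum l h}. blk m (f k) < p} = (\<Sum>j\<in>{1..<p}. mt l m f h j)"
proof -
  let ?K = "{psum l (h - 1)<..psum l h}"
  have K: "?K = {k \<in> {1..r}. blk l k = h}" using blk_set[OF l h] by simp
  have c: "card {k \<in> ?K. blk m (f k) = p} = mt l m f h p" if "p \<in> {1..n}" for p
  proof -
    have "{k \<in> ?K. blk m (f k) = p} = {k \<in> {1..r}. blk l k = h \<and> blk m (f k) = p}" unfolding K by blast
    then show ?thesis using h that by (simp add: mt_def)
  qed
  show "p \<in> {1..n} \<Longrightarrow> card {k \<in> ?K. blk m (f k) = p} = mt l m f h p" by (rule c)
  have rng: "blk m (f k) \<in> {1..n}" if "k \<in> ?K" for k
    using blk_range[OF m perm_range[OF f]] that unfolding K by blast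
  have out: "mt l m f h j = 0" if "j \<notin> {1..n}" for j using that by (auto simp: mt_def)
  have "(\<Sum>j\<in>{p<..n}. mt l m f h j) = (\<Sum>j\<in>{p<..n} \<inter> {1..n}. mt l m f h j)"
    using out by (intro sum.mono_neutral_right) auto
  also have "\<dots> = (\<Sum>j\<in>{p<..n} \<inter> {1..n}. card {k \<in> ?K. blk m (f k) = j})"
    by (intro sum.cong refl) (use c in auto)
  also have "\<dots> = card {k \<in> ?K. blk m (f k) \<in> {p<..n} \<inter> {1..n}}" by (rule sum_card_fibre) auto
  also have "{k \<in> ?K. blk m (f k) \<in> {p<..n} \<inter> {1..n}} = {k \<in> ?K. p < blk m (f k)}"
    by (intro Collect_cong conj_cong refl) (use rng in fastforce)
  finally show "card {k \<in> ?K. p < blk m (f k)} = (\<Sum>j\<in>{p<..n}. mt l m f h j)" by simp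
  have "(\<Sum>j\<in>{1..<p}. mt l m f h j) = (\<Sum>j\<in>{1..<p} \<inter> {1..n}. mt l m f h j)"
    using out by (intro sum.mono_neutral_right) auto
  also have "\<dots> = (\<Sum>j\<in>{1..<p} \<inter> {1..n}. card {k \<in> ?K. blk m (f k) = j})"
    by (intro sum.cong refl) (use c in auto)
  also have "\<dots> = card {k \<in> ?K. blk m (f k) \<in> {1..<p} \<inter> {1..n}}" by (rule sum_card_fibre) auto
  also have "{k \<in> ?K. blk m (f k) \<in> {1..<p} \<inter> {1..n}} = {k \<in> ?K. blk m (f k) < p}"
    by (intro Collect_cong conj_cong refl) (use rng in fastforce)
  finally show "card {k \<in> ?K. blk m (f k) < p} = (\<Sum>j\<in>{1..<p}. mt l m f h j)" by simp
qed

lemma ascb_block: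
  assumes l: "l \<in> L" and m: "m \<in> L" and f: "f \<in> P" "ascb (blk l) f" and h: "h \<in> {1..n}"
    and j: "psum l (h - 1) < j" "j \<le> k" "k \<le> psum l h"
  shows "j \<noteq> k \<Longrightarrow> f j < f k" "blk m (f j) \<le> blk m (f k)"
proof -
  have "j \<in> {k \<in> {1..r}. blk l k = h}" "k \<in> {k \<in> {1..r}. blk l k = h}"
    using j blk_set[OF l h] by auto
  then have jk: "j \<in> {1..r}" "k \<in> {1..r}" "blk l j = h" "blk l k = h" by auto
  show lt: "j \<noteq> k \<Longrightarrow> f j < f k" using f(2) jk j unfolding ascb_def by simp
  show "blk m (f j) \<le> blk m (f k)"
    using lt blk_mono[OF m, rule_format, of "f j" "f k"] perm_range[OF f(1) jk(1)] perm_range[OF f(1) jk(2)]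
    by (cases "j = k") auto
qed

text \<open>The raising formula: the words lead from the end \<open>e\<close> of row block
  \<open>h\<close> of \<open>B\<close> down to a position \<open>k\<close>, so the exponent counts
  the entries of row \<open>h\<close> to the right of \<open>p\<close>.\<close>

lemma crd_E:
  assumes A: "A \<in> Th" "0 < ro n A (Suc h)" and B: "B \<in> Th" and h: "1 \<le> h" "h < n"
    and roB: "ro n B = shift h (Suc h) (ro n A)" and coB: "co n B = co n A"
  shows "crd (basis_e n r (offd h (Suc h) (ro n A)) \<otimes>\<^bsub>S\<^esub> basis_e n r A) B =
    (\<Sum>p\<in>{1..n}. if move B (h, p) (Suc h, p) = A then qq ^ (\<Sum>j\<in>{p<..n}. B h j) * qint (B h p) else 0)"
proof -
  let ?v = "ro n A" and ?l = "ro n B" and ?m = "co n A"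
  have v: "?v \<in> L" and m: "?m \<in> L" and l: "?l \<in> L" using ro_Lam co_Lam A B by blast+
  have hg: "h \<in> {1..n}" "Suc h \<in> {1..n}" "h \<noteq> Suc h" using h by auto
  obtain f where f: "f \<in> P" "mt ?l ?m f = B" "ascb (blk ?l) f" using ascending_rep[OF B] coB by auto
  have ps: "psum ?l i = psum ?v i + of_bool (i = h)" for i
    using psum_shift[OF hg v A(2), of i] unfolding roB by (cases i h rule: linorder_cases) auto
  \<comment> \<open>The only position whose row block differs between \<open>A\<close> and
    \<open>B\<close>: it ends block \<open>h\<close> of \<open>ro n B\<close> and lies in block
    \<open>Suc h\<close> of \<open>ro n A\<close>.\<close>
  define e where "e = psum ?l h"
  define a where "a = psum ?l (h - 1)"
  note bs = blk_shift[OF l v h ps, folded e_def]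
  have er: "e \<le> r" using bs(1) by simp
  have K: "{k \<in> {1..r}. blk ?l k = h} = {a<..e}" unfolding a_def e_def by (rule blk_set[OF l hg(1)])
  have vl: "blk ?v k = ((blk ?l)(e := Suc h)) k" if "k \<in> {1..r}" for k
    using bs(3)[OF that] by (cases "k = e") simp_all
  have cong: "chi (blk ?v) ?v = chi ((blk ?l)(e := Suc h)) ?v" by (rule chi_cong[OF vl])
  have cong': "ymat A ?m (blk ?v) = ymat A ?m ((blk ?l)(e := Suc h))"
    by (rule ymat_cong[OF vl])
  have blkh: "blk ?l j = h" if "a < j" "j \<le> e" for j
  proof -
    have "j \<in> {k \<in> {1..r}. blk ?l k = h}" unfolding K using that by simp
    then show ?thesis by simp
  qed
  have asc: "j \<noteq> k \<Longrightarrow> f j < f k" "blk ?m (f j) \<le> blk ?m (f k)" if "a < j" "j \<le> k" "k \<le> e" for j k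
    using ascb_block[OF l m f(1,3) hg(1)] that unfolding a_def e_def by blast+
  have ae: "a \<le> e" unfolding a_def e_def by (rule psum_mono) simp
  show ?thesis
  proof (rule crd_offd_gen[OF hg A B roB coB, where w = "\<lambda>k. [k..<e]" and e = "\<lambda>k. e - k"])
    fix k assume "k \<in> {1..r}" "blk ?l k = h"
    then have "k \<in> {a<..e}" using K by blast
    then have k: "a < k" "k \<le> e" "1 \<le> k" by auto
    have "Lword [k..<e] (chi ((blk ?l)(e := Suc h)) ?v) = chi ((blk ?l)(k := Suc h)) ?v"
      by (rule chi_chain_up[OF v k(3,2) er, of "blk ?l" h]) (use blkh k in auto)
    then show "[k..<e] \<in> W \<and> Lword [k..<e] (chi (blk ?v) ?v) = chi ((blk ?l)(k := Suc h)) ?v"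
      unfolding cong using W_upt(2)[OF k(3) er] by blast
    show "Lword [k..<e] (ymat A ?m (blk ?v)) f = qq ^ (e - k) * ymat A ?m ((blk ?l)(k := Suc h)) f"
      unfolding cong' by (rule ymat_chain_up[OF k(3,2) er, of "blk ?l" h]) (use blkh asc k in auto)
  next
    show "f \<in> P" "mt ?l (co n B) f = B" using f coB by simp_all
    fix p assume p: "p \<in> {1..n}"
    show "(\<Sum>k\<in>{k \<in> {k \<in> {1..r}. blk ?l k = h}. blk ?m (f k) = p}. qq ^ (e - k)) = qq ^ (\<Sum>j\<in>{p<..n}. B h j) * qint (B h p)"
      unfolding K using sum_mono_up[OF ae, of "\<lambda>k. blk ?m (f k)" p] asc(2)
        block_entries(1)[OF l m f(1) hg(1) p] block_entries(2)[OF l m f(1) hg(1), of p] f(2)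
      unfolding a_def e_def by metis
  qed
qed

text \<open>The lowering formula: the exceptional position now starts at the beginning of block
  \<open>Suc h\<close> of \<open>B\<close> and moves to the right, so the entries to the left of
  \<open>p\<close> are counted.\<close>

lemma crd_F:
  assumes A: "A \<in> Th" "0 < ro n A h" and B: "B \<in> Th" and h: "1 \<le> h" "h < n"
    and roB: "ro n B = shift (Suc h) h (ro n A)" and coB: "co n B = co n A"
  shows "crd (basis_e n r (offd (Suc h) h (ro n A)) \<otimes>\<^bsub>S\<^esub> basis_e n r A) B =
    (\<Sum>p\<in>{1..n}. if move B (Suc h, p) (h, p) = A then qq ^ (\<Sum>j\<in>{1..<p}. B (Suc h) j) * qint (B (Suc h) p) else 0)"
proof -
  let ?v = "ro n A" and ?l = "ro n B" and ?m = "co n A"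
  have v: "?v \<in> L" and m: "?m \<in> L" and l: "?l \<in> L" using ro_Lam co_Lam A B by blast+
  have hg: "Suc h \<in> {1..n}" "h \<in> {1..n}" "Suc h \<noteq> h" using h by auto
  obtain f where f: "f \<in> P" "mt ?l ?m f = B" "ascb (blk ?l) f" using ascending_rep[OF B] coB by auto
  have ps: "psum ?v i = psum ?l i + of_bool (i = h)" for i
    using psum_shift[OF hg v A(2), of i] unfolding roB by (cases i h rule: linorder_cases) auto
  define e where "e = psum ?v h"
  define a where "a = psum ?l h"
  define b where "b = psum ?l (Suc h)"
  \<comment> \<open>The exceptional position is the last of block \<open>h\<close> of
    \<open>ro n A\<close> and the first of block \<open>Suc h\<close> of \<open>ro n B\<close>,
    hence the offset by one.\<close>
  have ea: "e = Suc a" using ps[of h] by (simp add: e_def a_def)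
  note bs = blk_shift[OF v l h ps, folded e_def]
  have e1: "1 \<le> e" using bs(1) by simp
  have K: "{k \<in> {1..r}. blk ?l k = Suc h} = {a<..b}" unfolding a_def b_def using blk_set[OF l hg(1)] by simp
  have vl: "blk ?v k = ((blk ?l)(e := h)) k" if "k \<in> {1..r}" for k
    using bs(2) bs(3)[OF that] by (cases "k = e") simp_all
  have cong: "chi (blk ?v) ?v = chi ((blk ?l)(e := h)) ?v" by (rule chi_cong[OF vl])
  have cong': "ymat A ?m (blk ?v) = ymat A ?m ((blk ?l)(e := h))"
    by (rule ymat_cong[OF vl])
  have blkh: "blk ?l j = Suc h" if "e \<le> j" "j \<le> b" for j
  proof -
    have "j \<in> {k \<in> {1..r}. blk ?l k = Suc h}" unfolding K using that ea by simp
    then show ?thesis by simp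
  qed
  have asc: "j \<noteq> k \<Longrightarrow> f j < f k" "blk ?m (f j) \<le> blk ?m (f k)" if "a < j" "j \<le> k" "k \<le> b" for j k
    using ascb_block[OF l m f(1,3) hg(1), of j k] that unfolding a_def b_def by simp_all
  have ab: "a \<le> b" unfolding a_def b_def by (rule psum_mono) simp
  show ?thesis
  proof (rule crd_offd_gen[OF hg A B roB coB, where w = "\<lambda>k. rev [e..<k]" and e = "\<lambda>k. k - e"])
    fix k assume kr: "k \<in> {1..r}" and "blk ?l k = Suc h"
    then have "k \<in> {a<..b}" using K by blast
    then have k: "e \<le> k" "k \<le> b" "k \<le> r" using kr ea by auto
    have "Lword (rev [e..<k]) (chi ((blk ?l)(e := h)) ?v) = chi ((blk ?l)(k := h)) ?v"
      by (rule chi_chain_down[OF v e1 k(1,3), of "blk ?l" "Suc h"]) (use blkh k in auto)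
    moreover have "rev [e..<k] \<in> W" using e1 k by (auto simp: W_set)
    ultimately show "rev [e..<k] \<in> W \<and> Lword (rev [e..<k]) (chi (blk ?v) ?v) = chi ((blk ?l)(k := h)) ?v"
      unfolding cong by blast
    show "Lword (rev [e..<k]) (ymat A ?m (blk ?v)) f = qq ^ (k - e) * ymat A ?m ((blk ?l)(k := h)) f"
      unfolding cong' by (rule ymat_chain_down[OF e1 k(1,3), of "blk ?l" "Suc h"]) (use blkh asc(1) k ea in auto)
  next
    show "f \<in> P" "mt ?l (co n B) f = B" using f coB by simp_all
    fix p assume p: "p \<in> {1..n}"
    show "(\<Sum>k\<in>{k \<in> {k \<in> {1..r}. blk ?l k = Suc h}. blk ?m (f k) = p}. qq ^ (k - e)) = qq ^ (\<Sum>j\<in>{1..<p}. B (Suc h) j) * qint (B (Suc h) p)"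
      unfolding K using sum_mono_down[OF ab, of "\<lambda>k. blk ?m (f k)" p] asc(2)
        block_entries(1)[OF l m f(1) hg(1) p] block_entries(3)[OF l m f(1) hg(1), of p] f(2) diff_Suc_1
      unfolding a_def b_def ea by metis
  qed
qed

lemma ro_diagm: "v \<in> L \<Longrightarrow> ro n (diagm v) = v" and co_diagm: "v \<in> L \<Longrightarrow> co n (diagm v) = v"
  using Lam_out[of v] by (auto simp: fun_eq_iff ro_def co_def diagm_def sum.delta sum.delta')

lemma diagm_Theta: assumes "v \<in> L" shows "diagm v \<in> Th"
proof (rule Theta_sum_co)
  show "co n (diagm v) \<in> L" by (simp add: co_diagm assms)
  show "diagm v i j = 0" if "i \<notin> {1..n} \<or> j \<notin> {1..n}" for i j
    using that Lam_out[OF assms, of i] by (auto simp: diagm_def)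
qed

text \<open>The double coset of a diagonal matrix is the Young subgroup itself, so its sum is the
  generator and the cofactor is 1.\<close>

lemma Yel_diagm:
  assumes v: "v \<in> L" shows "Yel (diagm v) = X v"
proof (rule kap_inj[OF Yel_closed[OF diagm_Theta[OF v]] X_closed[OF v]])
  fix f assume "f permutes {1..r}"
  then have f: "f \<in> P" by simp
  have "mt v v f = diagm v \<longleftrightarrow> (\<forall>k\<in>{1..r}. blk v (f k) = blk v k)"
  proof
    assume e: "mt v v f = diagm v"
    show "\<forall>k\<in>{1..r}. blk v (f k) = blk v k"
    proof (intro ballI, rule ccontr)
      fix k assume k: "k \<in> {1..r}" and ne: "blk v (f k) \<noteq> blk v k"
      have "mt v v f (blk v k) (blk v (f k)) = 0" unfolding e using ne by (simp add: diagm_def)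
      then have "card {j \<in> {1..r}. blk v j = blk v k \<and> blk v (f j) = blk v (f k)} = 0"
        using blk_range[OF v k] blk_range[OF v perm_range[OF f k]] by (simp add: mt_def)
      then show False using k by auto
    qed
  next
    assume a: "\<forall>k\<in>{1..r}. blk v (f k) = blk v k"
    show "mt v v f = diagm v"
    proof (rule mt_eqI)
      fix i j assume ij: "i \<in> {1..n}" "j \<in> {1..n}"
      have "{k \<in> {1..r}. blk v k = i \<and> blk v (f k) = j} = (if i = j then {k \<in> {1..r}. blk v k = i} else {})"
        using a by auto
      then show "diagm v i j = card {k \<in> {1..r}. blk v k = i \<and> blk v (f k) = j}"
        by (cases "i = j") (simp_all only: diagm_def if_True if_False card.empty card_blk[OF v ij(1)] simp_thms card_blk[OF v ij(2)])
    next
      fix i j assume "i \<notin> {1..n} \<or> j \<notin> {1..n}"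
      then show "diagm v i j = 0" using Lam_out[OF v, of i] by (auto simp: diagm_def)
    qed
  qed
  then show "kap (Yel (diagm v)) f = kap (X v) f"
    using f unfolding kap_Yel[OF diagm_Theta[OF v] f] kap_X_chi[OF v] ro_diagm[OF v] co_diagm[OF v] chi_def by simp
qed

lemma crd_diag:
  assumes A: "A \<in> Th" and B: "B \<in> Th" and v: "v \<in> L"
  shows "crd (basis_e n r (diagm v) \<otimes>\<^bsub>S\<^esub> basis_e n r A) B = (if ro n A = v \<and> A = B then 1 else 0)"
proof -
  have "crd (basis_e n r (diagm v) \<otimes>\<^bsub>S\<^esub> basis_e n r A) B =
    (if v = ro n A \<and> ro n B = v \<and> co n B = co n A then kap (\<one>\<^bsub>H\<^esub> \<otimes>\<^bsub>H\<^esub> Yel A) (rep B) else 0)"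
    using crd_mult_basis[OF A B diagm_Theta[OF v] H.one_closed _ rep[OF B]] H.l_one[OF X_closed[OF v]]
    unfolding Yel_diagm[OF v] ro_diagm[OF v] co_diagm[OF v] by blast
  also have "\<dots> = (if ro n A = v \<and> A = B then 1 else 0)"
  proof (cases "v = ro n A \<and> ro n B = v \<and> co n B = co n A")
    case True
    then have "mt (ro n A) (co n A) (rep B) = B" using rep(2)[OF B] by simp
    then show ?thesis unfolding H.l_one[OF Yel_closed[OF A]] kap_Yel[OF A rep(1)[OF B]] using True by auto
  next
    case False
    then have "\<not> (ro n A = v \<and> A = B)" by blast
    then show ?thesis using False by (simp only: if_False)
  qed
  finally show ?thesis .
qed

end

section \<open>Generation by near-diagonal elements\<close>

context based_algebra
begin

abbreviation bE :: "'i \<Rightarrow> (ratfun \<times> 's \<Rightarrow> int) set" where "bE i \<equiv> pt 1 (e i)"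

lemma bE_closed: "i \<in> I \<Longrightarrow> bE i \<in> carrier Kt" by (simp add: Kt_simps pt_closed e_closed)

lemma Phi_bE: "i \<in> I \<Longrightarrow> j \<in> I \<Longrightarrow> Phi (bE i) j = (if i = j then 1 else 0)"
  by (simp add: Phi_pt e_closed crd_e)

lemma Phi_mult_bE:
  assumes "z \<in> carrier Kt" "l \<in> I" "i \<in> I"
  shows "Phi (z \<otimes>\<^bsub>Kt\<^esub> bE l) i = (\<Sum>j\<in>I. Phi z j * crd (e j \<otimes>\<^bsub>S\<^esub> e l) i)"
    "Phi (bE l \<otimes>\<^bsub>Kt\<^esub> z) i = (\<Sum>j\<in>I. Phi z j * crd (e l \<otimes>\<^bsub>S\<^esub> e j) i)"
proof -
  have "Phi (z \<otimes>\<^bsub>Kt\<^esub> bE l) i = (\<Sum>j\<in>I. \<Sum>m\<in>I. Phi z j * Phi (bE l) m * crd (e j \<otimes>\<^bsub>S\<^esub> e m) i)"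
    by (rule Phi_mult[OF assms(1) bE_closed[OF assms(2)] assms(3)])
  also have "\<dots> = (\<Sum>j\<in>I. \<Sum>m\<in>I. if m = l then Phi z j * crd (e j \<otimes>\<^bsub>S\<^esub> e l) i else 0)"
    by (intro sum.cong refl) (auto simp: Phi_bE assms)
  finally show "Phi (z \<otimes>\<^bsub>Kt\<^esub> bE l) i = (\<Sum>j\<in>I. Phi z j * crd (e j \<otimes>\<^bsub>S\<^esub> e l) i)"
    using assms finI by simp
  have "Phi (bE l \<otimes>\<^bsub>Kt\<^esub> z) i = (\<Sum>m\<in>I. \<Sum>j\<in>I. Phi (bE l) m * Phi z j * crd (e m \<otimes>\<^bsub>S\<^esub> e j) i)"
    by (rule Phi_mult[OF bE_closed[OF assms(2)] assms(1,3)])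
  also have "\<dots> = (\<Sum>j\<in>I. \<Sum>m\<in>I. Phi (bE l) m * Phi z j * crd (e m \<otimes>\<^bsub>S\<^esub> e j) i)" by (rule sum.swap)
  also have "\<dots> = (\<Sum>j\<in>I. \<Sum>m\<in>I. if m = l then Phi z j * crd (e l \<otimes>\<^bsub>S\<^esub> e j) i else 0)"
    by (intro sum.cong refl) (auto simp: Phi_bE assms)
  finally show "Phi (bE l \<otimes>\<^bsub>Kt\<^esub> z) i = (\<Sum>j\<in>I. Phi z j * crd (e l \<otimes>\<^bsub>S\<^esub> e j) i)"
    using assms finI by simp
qed

abbreviation com :: "(ratfun \<times> 's \<Rightarrow> int) set \<Rightarrow> (ratfun \<times> 's \<Rightarrow> int) set \<Rightarrow> bool" where
  "com z w \<equiv> z \<otimes>\<^bsub>Kt\<^esub> w = w \<otimes>\<^bsub>Kt\<^esub> z"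

lemma com_bE_iff:
  assumes z: "z \<in> carrier Kt" and l: "l \<in> I"
  shows "com z (bE l) \<longleftrightarrow> (\<forall>i\<in>I. (\<Sum>j\<in>I. Phi z j * crd (e j \<otimes>\<^bsub>S\<^esub> e l) i) = (\<Sum>j\<in>I. Phi z j * crd (e l \<otimes>\<^bsub>S\<^esub> e j) i))"
proof -
  have "com z (bE l) \<longleftrightarrow> (\<forall>i\<in>I. Phi (z \<otimes>\<^bsub>Kt\<^esub> bE l) i = Phi (bE l \<otimes>\<^bsub>Kt\<^esub> z) i)"
    using Kt_eqI[OF Kt.m_closed[OF z bE_closed[OF l]] Kt.m_closed[OF bE_closed[OF l] z]] by auto
  then show ?thesis using Phi_mult_bE[OF z l] by simp
qed

lemma center_iff_com: "z \<in> ring_center Kt \<longleftrightarrow> z \<in> carrier Kt \<and> (\<forall>l\<in>I. com z (bE l))"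
  using center_iff[of z] com_bE_iff[of z] by blast

text \<open>\<open>z\<close> commutes with the product of \<open>e l\<close> and \<open>e j\<close>,
  a combination of basis elements. If it commutes with all those that occur except
  \<open>i0\<close>, only \<open>i0\<close> survives in the commutator, and its coefficient is
  nonzero.\<close>

lemma com_step:
  assumes z: "z \<in> carrier Kt" and l: "l \<in> I" "com z (bE l)" and j: "j \<in> I" "com z (bE j)"
    and i0: "i0 \<in> I" "crd (e l \<otimes>\<^bsub>S\<^esub> e j) i0 \<noteq> 0"
    and o: "\<And>i. i \<in> I \<Longrightarrow> i \<noteq> i0 \<Longrightarrow> crd (e l \<otimes>\<^bsub>S\<^esub> e j) i \<noteq> 0 \<Longrightarrow> com z (bE i)"
  shows "com z (bE i0)"
proof -
  define w where "w = bE l \<otimes>\<^bsub>Kt\<^esub> bE j"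
  have w: "w \<in> carrier Kt" unfolding w_def by (intro Kt.m_closed bE_closed l j)
  have Pw: "Phi w m = crd (e l \<otimes>\<^bsub>S\<^esub> e j) m" if "m \<in> I" for m
  proof -
    have "Phi w m = (\<Sum>p\<in>I. Phi (bE l) p * crd (e p \<otimes>\<^bsub>S\<^esub> e j) m)"
      unfolding w_def by (rule Phi_mult_bE(1)[OF bE_closed[OF l(1)] j(1) that])
    also have "\<dots> = (\<Sum>p\<in>I. if p = l then crd (e l \<otimes>\<^bsub>S\<^esub> e j) m else 0)"
      by (intro sum.cong refl) (auto simp: Phi_bE l)
    finally show ?thesis using l finI by simp
  qed
  have cw: "com z w"
  proof -
    have "z \<otimes>\<^bsub>Kt\<^esub> w = (z \<otimes>\<^bsub>Kt\<^esub> bE l) \<otimes>\<^bsub>Kt\<^esub> bE j"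
      unfolding w_def by (rule Kt.m_assoc[symmetric]) (intro z bE_closed l j)+
    also have "\<dots> = bE l \<otimes>\<^bsub>Kt\<^esub> (z \<otimes>\<^bsub>Kt\<^esub> bE j)" unfolding l(2) by (rule Kt.m_assoc) (intro z bE_closed l j)+
    also have "\<dots> = w \<otimes>\<^bsub>Kt\<^esub> z" unfolding w_def j(2) by (rule Kt.m_assoc[symmetric]) (intro z bE_closed l j)+
    finally show ?thesis .
  qed
  \<comment> \<open>The coordinates of the commutator of \<open>z\<close> with the m-th basis
    element.\<close>
  define a where "a m i = Phi (z \<otimes>\<^bsub>Kt\<^esub> bE m) i - Phi (bE m \<otimes>\<^bsub>Kt\<^esub> z) i" for m i
  have a0: "com z (bE m) \<Longrightarrow> a m i = 0" for m i by (simp add: a_def)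
  show ?thesis
  proof (rule Kt_eqI[OF Kt.m_closed[OF z bE_closed[OF i0(1)]] Kt.m_closed[OF bE_closed[OF i0(1)] z]])
    fix i assume i: "i \<in> I"
    have r: "Phi (z \<otimes>\<^bsub>Kt\<^esub> w) i = (\<Sum>m\<in>I. Phi w m * Phi (z \<otimes>\<^bsub>Kt\<^esub> bE m) i)"
    proof -
      have "Phi (z \<otimes>\<^bsub>Kt\<^esub> w) i = (\<Sum>m\<in>I. \<Sum>p\<in>I. Phi z m * Phi w p * crd (e m \<otimes>\<^bsub>S\<^esub> e p) i)"
        by (rule Phi_mult[OF z w i])
      also have "\<dots> = (\<Sum>p\<in>I. \<Sum>m\<in>I. Phi z m * Phi w p * crd (e m \<otimes>\<^bsub>S\<^esub> e p) i)" by (rule sum.swap)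
      also have "\<dots> = (\<Sum>p\<in>I. Phi w p * (\<Sum>m\<in>I. Phi z m * crd (e m \<otimes>\<^bsub>S\<^esub> e p) i))"
        by (simp add: sum_distrib_left mult_ac)
      finally show ?thesis by (simp add: Phi_mult_bE(1)[OF z _ i])
    qed
    have l': "Phi (w \<otimes>\<^bsub>Kt\<^esub> z) i = (\<Sum>m\<in>I. Phi w m * Phi (bE m \<otimes>\<^bsub>Kt\<^esub> z) i)"
    proof -
      have "Phi (w \<otimes>\<^bsub>Kt\<^esub> z) i = (\<Sum>m\<in>I. \<Sum>p\<in>I. Phi w m * Phi z p * crd (e m \<otimes>\<^bsub>S\<^esub> e p) i)"
        by (rule Phi_mult[OF w z i])
      also have "\<dots> = (\<Sum>m\<in>I. Phi w m * (\<Sum>p\<in>I. Phi z p * crd (e m \<otimes>\<^bsub>S\<^esub> e p) i))"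
        by (simp add: sum_distrib_left mult_ac)
      finally show ?thesis by (simp add: Phi_mult_bE(2)[OF z _ i])
    qed
    have "0 = (\<Sum>m\<in>I. Phi w m * a m i)"
      using r l' cw by (simp add: a_def sum_subtractf right_diff_distrib)
    also have "\<dots> = (\<Sum>m\<in>I. if m = i0 then crd (e l \<otimes>\<^bsub>S\<^esub> e j) i0 * a i0 i else 0)"
    proof (intro sum.cong refl)
      fix m assume m: "m \<in> I"
      show "Phi w m * a m i = (if m = i0 then crd (e l \<otimes>\<^bsub>S\<^esub> e j) i0 * a i0 i else 0)"
        using Pw[OF m] o[OF m] a0[of m i] by (cases "crd (e l \<otimes>\<^bsub>S\<^esub> e j) m = 0") auto
    qed
    also have "\<dots> = crd (e l \<otimes>\<^bsub>S\<^esub> e j) i0 * a i0 i" using i0 finI by simp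
    finally show "Phi (z \<otimes>\<^bsub>Kt\<^esub> bE i0) i = Phi (bE i0 \<otimes>\<^bsub>Kt\<^esub> z) i" using i0(2) by (simp add: a_def)
  qed
qed

end

context qschur_rank
begin

lemma finite_Th: "finite Th"
proof (rule finite_subset)
  show "Th \<subseteq> (\<lambda>(l, m, f). mt l m f) ` (L \<times> L \<times> P)"
  proof
    fix A assume A: "A \<in> Th"
    have "A = (\<lambda>(l, m, f). mt l m f) (ro n A, co n A, rep A)" using rep(2)[OF A] by simp
    then show "A \<in> (\<lambda>(l, m, f). mt l m f) ` (L \<times> L \<times> P)"
      by (rule image_eqI) (use A ro_Lam co_Lam rep(1)[OF A] in blast)
  qed
qed (intro finite_imageI finite_cartesian_product finite_L finite_P)

sublocale BA: based_algebra S Th "basis_e n r" crd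
proof (rule based_algebra.intro)
  show "crd (basis_e n r i) j = (if i = j then 1 else 0)" if "i \<in> Th" "j \<in> Th" for i j
    by (rule crd_basis_e[OF that])
qed (simp_all only: S_ring finite_Th S_smult_closed S_smult_mult crd_add crd_smult crd_laurent basis_e_props(1), blast intro: crd_eqI)

lemma move_pos:
  assumes "x \<noteq> y" "0 < B (fst x) (snd x)"
  shows "int (move B x y i j) = int (B i j) - of_bool ((i, j) = x) + of_bool ((i, j) = y)"
  using assms by (cases x; cases y) (auto simp: move_def)

lemma move_back:
  assumes "x \<noteq> y" "0 < B (fst x) (snd x)" shows "move (move B x y) y x = B"
  using assms by (intro ext; cases x; cases y) (auto simp: move_def)

lemma move_ro:
  assumes hg: "h \<in> {1..n}" "g \<in> {1..n}" "h \<noteq> g" and p: "p \<in> {1..n}" "0 < B h p"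
  shows "ro n (move B (h, p) (g, p)) = shift g h (ro n B)"
proof
  fix i
  have "int (ro n (move B (h, p) (g, p)) i) = (\<Sum>j\<in>{1..n}. int (B i j) - (if j = p then of_bool (i = h) else 0) + (if j = p then of_bool (i = g) else 0))"
    unfolding ro_def of_nat_sum by (intro sum.cong refl) (use hg p in \<open>auto simp: move_pos\<close>)
  also have "\<dots> = int (ro n B i) - of_bool (i = h) + of_bool (i = g)"
    using p by (simp add: sum.distrib sum_subtractf ro_def del: of_bool_eq_iff)
  finally have e: "int (ro n (move B (h, p) (g, p)) i) = int (ro n B i) - of_bool (i = h) + of_bool (i = g)" .
  have "B h p \<le> ro n B h" unfolding ro_def using p by (intro member_le_sum) auto
  then show "ro n (move B (h, p) (g, p)) i = shift g h (ro n B) i"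
    using e p by (auto simp: shift_def of_bool_def split: if_splits)
qed

lemma move_co:
  assumes hg: "h \<in> {1..n}" "g \<in> {1..n}" "h \<noteq> g" and p: "p \<in> {1..n}" "0 < B h p"
  shows "co n (move B (h, p) (g, p)) = co n B"
proof
  fix i
  have "int (co n (move B (h, p) (g, p)) i) = (\<Sum>j\<in>{1..n}. int (B j i) - (if j = h then of_bool (i = p) else 0) + (if j = g then of_bool (i = p) else 0))"
    unfolding co_def of_nat_sum by (intro sum.cong refl) (use hg p in \<open>auto simp: move_pos\<close>)
  also have "\<dots> = int (co n B i)"
    using hg by (simp add: sum.distrib sum_subtractf co_def del: of_bool_eq_iff)
  finally show "co n (move B (h, p) (g, p)) i = co n B i" by simp
qed

lemma move_Th:
  assumes hg: "h \<in> {1..n}" "g \<in> {1..n}" "h \<noteq> g" and p: "p \<in> {1..n}" "0 < B h p" and B: "B \<in> Th"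
  shows "move B (h, p) (g, p) \<in> Th"
proof (rule Theta_sum_co)
  show "co n (move B (h, p) (g, p)) \<in> L" unfolding move_co[where B = B, OF hg p] by (rule co_Lam[OF B])
  fix i j assume "i \<notin> {1..n} \<or> j \<notin> {1..n}"
  moreover from this have "B i j = 0" using B unfolding Theta_def by blast
  ultimately show "move B (h, p) (g, p) i j = 0" using hg p by (auto simp: move_def)
qed

lemma shift_shift: "0 < v g \<Longrightarrow> h \<noteq> g \<Longrightarrow> shift g h (shift h g v) = v"
  by (auto simp: shift_def fun_eq_iff)

section \<open>Leading terms of products\<close>

definition adj :: "nat \<Rightarrow> nat \<Rightarrow> bool" where
  "adj h g \<longleftrightarrow> h \<in> {1..n} \<and> g \<in> {1..n} \<and> (g = Suc h \<or> h = Suc g)"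

lemma adjD: "adj h g \<Longrightarrow> h \<in> {1..n}" "adj h g \<Longrightarrow> g \<in> {1..n}" "adj h g \<Longrightarrow> h \<noteq> g" "adj h g \<Longrightarrow> adj g h"
  by (auto simp: adj_def)

text \<open>The exponents of \<open>crd_E\<close> and \<open>crd_F\<close> in one notation: entries
  to the right of \<open>p\<close> for a raising step, to the left for a lowering step.\<close>

definition lw :: "nat \<Rightarrow> nat \<Rightarrow> nmat \<Rightarrow> nat \<Rightarrow> nat" where
  "lw h g B p = (if g = Suc h then \<Sum>j\<in>{p<..n}. B h j else \<Sum>j\<in>{1..<p}. B h j)"

text \<open>The coefficient of \<open>B\<close> in a near-diagonal element times \<open>A\<close>.
  Subtraction in \<open>move\<close> is truncated, so the positivity guard keeps
  \<open>move B (h, p) (g, p)\<close> meaningful; the terms it removes carry the quantum integer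
  0.\<close>

definition lterm :: "nat \<Rightarrow> nat \<Rightarrow> nmat \<Rightarrow> nmat \<Rightarrow> ratfun" where
  "lterm h g B A = (\<Sum>p\<in>{1..n}. if 0 < B h p \<and> move B (h, p) (g, p) = A then qq ^ lw h g B p * qint (B h p) else 0)"

lemma crd_left:
  assumes hg: "adj h g" and A: "A \<in> Th" and B: "B \<in> Th" and v: "v \<in> L" "0 < v g"
  shows "crd (basis_e n r (offd h g v) \<otimes>\<^bsub>S\<^esub> basis_e n r A) B =
    (if ro n A = v \<and> ro n B = shift h g v \<and> co n B = co n A then lterm h g B A else 0)"
proof (cases "ro n A = v \<and> ro n B = shift h g v \<and> co n B = co n A")
  case True
  have z: "(\<Sum>p\<in>{1..n}. if move B (h, p) (g, p) = A then qq ^ k p * qint (B h p) else 0) =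
    (\<Sum>p\<in>{1..n}. if 0 < B h p \<and> move B (h, p) (g, p) = A then qq ^ k p * qint (B h p) else 0)" for k h g
    by (intro sum.cong refl) (auto simp: qint_def)
  show ?thesis
  proof (cases "g = Suc h")
    case g: True
    have "h < n" "1 \<le> h" using hg g by (auto simp: adj_def)
    have pos: "0 < ro n A (Suc h)" using True v g by simp
    have "crd (basis_e n r (offd h (Suc h) (ro n A)) \<otimes>\<^bsub>S\<^esub> basis_e n r A) B = lterm h (Suc h) B A"
      unfolding lterm_def lw_def if_P[OF refl]
      by (subst z[symmetric], rule crd_E[OF A pos B]) (use True \<open>h < n\<close> \<open>1 \<le> h\<close> g in auto)
    then show ?thesis using True g by simp
  next
    case False
    then have g: "h = Suc g" "g < n" "1 \<le> g" using hg by (auto simp: adj_def)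
    have pos: "0 < ro n A g" using True v by simp
    have ne: "g \<noteq> Suc (Suc g)" by simp
    have "crd (basis_e n r (offd (Suc g) g (ro n A)) \<otimes>\<^bsub>S\<^esub> basis_e n r A) B = lterm (Suc g) g B A"
      unfolding lterm_def lw_def if_not_P[OF ne]
      by (subst z[symmetric], rule crd_F[OF A pos B g(3,2)]) (use True g in auto)
    then show ?thesis using True g by simp
  qed
next
  case False
  have C: "offd h g v \<in> Th" "co n (offd h g v) = v" "ro n (offd h g v) = shift h g v"
    using offd_Theta co_offd ro_offd adjD[OF hg] v by auto
  obtain k where k: "k \<in> carrier H" "k \<otimes>\<^bsub>H\<^esub> X (co n (offd h g v)) = Yel (offd h g v)"
    using basis_e_props(3)[OF C(1)] by blast
  have "\<not> (v = ro n A \<and> ro n B = shift h g v \<and> co n B = co n A)" using False by blast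
  then show ?thesis using crd_mult_basis[OF A B C(1) k rep[OF B]] False unfolding C(2,3) by (simp only: if_False)
qed

definition wgt :: "nat \<Rightarrow> nat \<Rightarrow> int" where "wgt i j = (int i - int j)\<^sup>2"

text \<open>For the column \<open>p\<close> chosen as an extremal one with an entry above (or below) the diagonal, the terms of
  \<open>e\<^sub>C e\<^sub>A\<close> other than the intended one have smaller \<open>Q\<close>.\<close>

definition Qf :: "nmat \<Rightarrow> int" where "Qf A = (\<Sum>i\<in>{1..n}. \<Sum>j\<in>{1..n}. int (A i j) * wgt i j)"

lemma Qf_nonneg: "0 \<le> Qf A" by (auto simp: Qf_def wgt_def intro!: sum_nonneg)

lemma Qf_move:
  assumes hg: "h \<in> {1..n}" "g \<in> {1..n}" "h \<noteq> g" and p: "p \<in> {1..n}" "0 < B h p"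
  shows "Qf (move B (h, p) (g, p)) = Qf B - wgt h p + wgt g p"
proof -
  have "Qf (move B (h, p) (g, p)) = (\<Sum>i\<in>{1..n}. \<Sum>j\<in>{1..n}. int (B i j) * wgt i j - (if j = p then (if i = h then wgt h p else 0) else 0) + (if j = p then (if i = g then wgt g p else 0) else 0))"
    unfolding Qf_def by (intro sum.cong refl) (use hg p in \<open>auto simp: move_pos algebra_simps\<close>)
  also have "\<dots> = Qf B - wgt h p + wgt g p"
    using hg p by (simp add: sum.distrib sum_subtractf Qf_def)
  finally show ?thesis .
qed

text \<open>The smaller matrix moves one unit of column \<open>p\<close> from row \<open>h\<close>
  to row \<open>g\<close>. Multiplying it by the near-diagonal element brings the unit back in
  column \<open>p\<close>, which gives \<open>A\<close>, or fetches one from another column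
  \<open>p'\<close>; hypothesis \<open>lt\<close> says that the latter results have smaller
  \<open>Qf\<close>.\<close>

lemma com_move:
  assumes z: "z \<in> carrier BA.Kt" and A: "A \<in> Th" and hg: "adj h g" and p: "p \<in> {1..n}" "0 < A h p"
    and dec: "wgt g p < wgt h p"
    and lt: "\<And>p'. p' \<in> {1..n} \<Longrightarrow> p' \<noteq> p \<Longrightarrow> 0 < A g p' \<Longrightarrow> wgt g p - wgt h p + wgt h p' - wgt g p' < 0"
    and gen: "\<And>v. v \<in> L \<Longrightarrow> 0 < v g \<Longrightarrow> BA.com z (BA.bE (offd h g v))"
    and IH: "\<And>B. B \<in> Th \<Longrightarrow> Qf B < Qf A \<Longrightarrow> BA.com z (BA.bE B)"
  shows "BA.com z (BA.bE A)"
proof -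
  note hg' = adjD(1-3)[OF hg]
  let ?A = "move A (h, p) (g, p)"
  have A0: "?A \<in> Th" by (rule move_Th[where B = A, OF hg' p A])
  have Q0: "Qf ?A = Qf A - wgt h p + wgt g p" by (rule Qf_move[where B = A, OF hg' p])
  have ro0: "ro n ?A = shift g h (ro n A)" and co0: "co n ?A = co n A"
    by (rule move_ro[where B = A, OF hg' p], rule move_co[where B = A, OF hg' p])
  have roA: "0 < ro n A h" unfolding ro_def using p by (intro sum_pos2[of _ p]) auto
  have pos: "0 < ro n ?A g" unfolding ro0 using hg' by (simp add: shift_def)
  have v: "ro n ?A \<in> L" by (rule ro_Lam[OF A0])
  have sh: "shift h g (ro n ?A) = ro n A" unfolding ro0 by (rule shift_shift[where v = "ro n A", OF roA hg'(3)[symmetric]])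
  \<comment> \<open>Comparing the entries in row \<open>h\<close> identifies the column, so a single
    term contributes to the coefficient of \<open>A\<close>: a power of q times a nonzero quantum
    integer.\<close>
  have inj: "p' = p" if "0 < A h p'" "move A (h, p') (g, p') = ?A" for p'
  proof (rule ccontr)
    assume "p' \<noteq> p"
    then have "?A h p' = A h p'" using hg' by (simp add: move_def)
    moreover have "move A (h, p') (g, p') h p' = A h p' - 1" using hg' by (simp add: move_def)
    ultimately show False using that by simp
  qed
  show ?thesis
  proof (rule BA.com_step[OF z offd_Theta[OF hg' v pos] gen[OF v pos] A0 IH[OF A0] A])
    show "Qf ?A < Qf A" using Q0 dec by simp
    have "lterm h g A ?A = (\<Sum>p'\<in>{1..n}. if p' = p then qq ^ lw h g A p * qint (A h p) else 0)"
      unfolding lterm_def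
    proof (intro sum.cong refl)
      fix p' :: nat
      show "(if 0 < A h p' \<and> move A (h, p') (g, p') = ?A then qq ^ lw h g A p' * qint (A h p') else 0) =
        (if p' = p then qq ^ lw h g A p * qint (A h p) else 0)"
        using inj[of p'] p by (cases "p' = p") auto
    qed
    then have "lterm h g A ?A = qq ^ lw h g A p * qint (A h p)" using p by simp
    moreover have "\<dots> \<noteq> 0" using qint_nonzero[OF p(2)] ups_nonzero by simp
    ultimately show "crd (basis_e n r (offd h g (ro n ?A)) \<otimes>\<^bsub>S\<^esub> basis_e n r ?A) A \<noteq> 0"
      unfolding crd_left[OF hg A0 A v pos] using sh co0 by simp
    fix B assume B: "B \<in> Th" "B \<noteq> A" and nz: "crd (basis_e n r (offd h g (ro n ?A)) \<otimes>\<^bsub>S\<^esub> basis_e n r ?A) B \<noteq> 0"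
    have "lterm h g B ?A \<noteq> 0"
    proof
      assume "lterm h g B ?A = 0"
      then show False using nz unfolding crd_left[OF hg A0 B(1) v pos] by (simp only: if_cancel)
    qed
    then obtain p' where p': "p' \<in> {1..n}" "0 < B h p'" "move B (h, p') (g, p') = ?A"
    proof -
      have "\<exists>p'\<in>{1..n}. (if 0 < B h p' \<and> move B (h, p') (g, p') = ?A then qq ^ lw h g B p' * qint (B h p') else 0) \<noteq> 0"
        using \<open>lterm h g B ?A \<noteq> 0\<close> unfolding lterm_def by (rule contrapos_np) (intro sum.neutral, blast)
      then obtain p' where p': "p' \<in> {1..n}" "(if 0 < B h p' \<and> move B (h, p') (g, p') = ?A then qq ^ lw h g B p' * qint (B h p') else 0) \<noteq> 0" ..
      show thesis by (rule that[OF p'(1)]) (use p'(2) in \<open>meson\<close>)+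
    qed
    have pp: "p' \<noteq> p"
    proof
      assume e: "p' = p"
      have ne: "(h, p) \<noteq> (g, p)" using hg' by simp
      have "B = move (move B (h, p) (g, p)) (g, p) (h, p)"
        by (rule move_back[OF ne, symmetric]) (use p'(2) e in simp)
      also have "\<dots> = move ?A (g, p) (h, p)" using p'(3) e by (simp only:)
      also have "\<dots> = A" by (rule move_back[OF ne]) (use p(2) in simp)
      finally have "B = A" .
      then show False using B by simp
    qed
    \<comment> \<open>A competing term takes its unit from row \<open>g\<close>, where
      \<open>A\<close> must therefore have a positive entry in column \<open>p'\<close>; this is the
      premise of \<open>lt\<close>.\<close>
    have "move B (h, p') (g, p') g p' = B g p' + 1" using hg' by (simp add: move_def)
    moreover have "?A g p' = A g p'" using pp hg' by (simp add: move_def)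
    ultimately have Ag: "0 < A g p'" using p'(3) by simp
    have "Qf ?A = Qf B - wgt h p' + wgt g p'" using Qf_move[where B = B, OF hg' p'(1,2)] p'(3) by simp
    then have "Qf B < Qf A" using Q0 lt[OF p'(1) pp Ag] by simp
    then show "BA.com z (BA.bE B)" by (rule IH[OF B(1)])
  qed
qed

text \<open>Strong induction on \<open>Qf\<close>. Entries above the diagonal are treated first,
  then those below, each with a unit moved towards the diagonal; a matrix with neither is
  diagonal.\<close>

lemma com_all:
  assumes z: "z \<in> carrier BA.Kt" and dg: "\<And>v. v \<in> L \<Longrightarrow> BA.com z (BA.bE (diagm v))"
    and gen: "\<And>h g v. adj h g \<Longrightarrow> v \<in> L \<Longrightarrow> 0 < v g \<Longrightarrow> BA.com z (BA.bE (offd h g v))"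
    and A: "A \<in> Th"
  shows "BA.com z (BA.bE A)"
  using A
proof (induction "nat (Qf A)" arbitrary: A rule: less_induct)
  case less
  have IH: "BA.com z (BA.bE B)" if "B \<in> Th" "Qf B < Qf A" for B
    by (rule less.hyps) (use that Qf_nonneg[of B] in auto)
  have out: "A i j = 0" if "i \<notin> {1..n} \<or> j \<notin> {1..n}" for i j using less.prems that by (auto simp: Theta_def)
  let ?U = "{p. \<exists>h. h < p \<and> 0 < A h p}" and ?V = "{p. \<exists>h. p < h \<and> 0 < A h p}"
  have sub: "?U \<subseteq> {1..n}" "?V \<subseteq> {1..n}"
    using out neq0_conv by blast+
  show ?case
  proof (cases "?U = {}")
    case False
    have fU: "finite ?U" using sub(1) finite_subset by blast
    \<comment> \<open>The rightmost column with an entry above the diagonal: a column further right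
      with an entry in row \<open>Suc h\<close> would have it above the diagonal as well.\<close>
    define p where "p = Max ?U"
    have "p \<in> ?U" unfolding p_def by (rule Max_in[OF fU False])
    then obtain h where h: "h < p" "0 < A h p" by blast
    have pn: "p \<in> {1..n}" "h \<in> {1..n}" using out h neq0_conv by blast+
    have mx: "p' \<le> p" if "p' \<in> ?U" for p' unfolding p_def by (rule Max_ge[OF fU that])
    show ?thesis
    proof (rule com_move[OF z less.prems _ pn(1) h(2) _ _ _ IH])
      show a: "adj h (Suc h)" using pn h by (auto simp: adj_def)
      show "wgt (Suc h) p < wgt h p" using h by (simp add: wgt_def power2_eq_square algebra_simps)
      fix p' assume p': "p' \<in> {1..n}" "p' \<noteq> p" "0 < A (Suc h) p'"
      have "p' < p"
      proof (rule ccontr)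
        assume "\<not> p' < p"
        then have "p < p'" using p' by simp
        then have "p' \<in> ?U" using h p' by (intro CollectI exI[of _ "Suc h"]) simp
        then show False using mx[of p'] \<open>p < p'\<close> by simp
      qed
      \<comment> \<open>The left-hand side equals 2(p' - p).\<close>
      then show "wgt (Suc h) p - wgt h p + wgt h p' - wgt (Suc h) p' < 0"
        by (simp add: wgt_def power2_eq_square algebra_simps)
    next
      fix v assume "v \<in> L" "0 < v (Suc h)"
      then show "BA.com z (BA.bE (offd h (Suc h) v))" using pn h by (intro gen) (auto simp: adj_def)
    qed
  next
    case U: True
    show ?thesis
    proof (cases "?V = {}")
      case False
      have fV: "finite ?V" using sub(2) finite_subset by blast
      \<comment> \<open>The mirror choice: the leftmost column with an entry below the diagonal, for
        which the change of weight is 2(p - p').\<close>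
      define p where "p = Min ?V"
      have "p \<in> ?V" unfolding p_def by (rule Min_in[OF fV False])
      then obtain h' where h': "p < h'" "0 < A h' p" by blast
      then obtain h where hh: "h' = Suc h" by (cases h') auto
      have h: "p \<le> h" "0 < A (Suc h) p" using h' hh by auto
      have pn: "p \<in> {1..n}" "Suc h \<in> {1..n}" using out h neq0_conv by blast+
      have mn: "p \<le> p'" if "p' \<in> ?V" for p' unfolding p_def by (rule Min_le[OF fV that])
      have a: "adj (Suc h) h" using pn h by (auto simp: adj_def)
      show ?thesis
      proof (rule com_move[OF z less.prems a pn(1) h(2) _ _ _ IH])
        show "wgt h p < wgt (Suc h) p" using h by (simp add: wgt_def power2_eq_square algebra_simps)
        fix p' assume p': "p' \<in> {1..n}" "p' \<noteq> p" "0 < A h p'"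
        have "p < p'"
        proof (rule ccontr)
          assume "\<not> p < p'"
          then have "p' < p" using p' by simp
          then have "p' \<in> ?V" using h p' by (intro CollectI exI[of _ h]) simp
          then show False using mn[of p'] \<open>p' < p\<close> by simp
        qed
        then show "wgt h p - wgt (Suc h) p + wgt (Suc h) p' - wgt h p' < 0"
          by (simp add: wgt_def power2_eq_square algebra_simps)
      next
        fix v assume "v \<in> L" "0 < v h"
        then show "BA.com z (BA.bE (offd (Suc h) h v))" by (rule gen[OF a])
      qed
    next
      case V: True
      have dz: "A h p = 0" if "h \<noteq> p" for h p
        using that U V by (cases h p rule: linorder_cases) auto
      have "A = diagm (ro n A)"
      proof (intro ext)
        fix i j
        have "ro n A i = (\<Sum>j\<in>{1..n}. if j = i then A i i else 0)"
          unfolding ro_def by (intro sum.cong refl) (use dz in auto)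
        also have "\<dots> = A i i" using out[of i i] by simp
        finally show "A i j = diagm (ro n A) i j" using dz[of i j] by (cases "i = j") (simp_all add: diagm_def)
      qed
      then show ?thesis using dg[OF ro_Lam[OF less.prems]] by metis
    qed
  qed
qed

end

section \<open>The center equations\<close>

text \<open>Conjugation of the quantum integer costs the power -2m of \<upsilon>. Comparing a
  coefficient of the center equations with a structure constant is thereby reduced to an equation
  between integer exponents.\<close>

lemma coef_eq:
  assumes "b - 2 * int m = N + 2 * int k"
  shows "\<upsilon> powi b * bar (dbrack (int m + 1)) = \<upsilon> powi N * (qq ^ k * qint (Suc m))"
proof -
  have "\<upsilon> powi b * \<upsilon> powi (- 2 * int m) = \<upsilon> powi (N + 2 * int k)"
    using assms by (simp add: power_int_add[symmetric] ups_nonzero)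
  also have "\<dots> = \<upsilon> powi N * \<upsilon> powi int (2 * k)" by (simp add: power_int_add ups_nonzero)
  also have "\<upsilon> powi int (2 * k) = qq ^ k" by (simp only: power_int_of_nat power_mult)
  finally show ?thesis by (simp add: bar_dbrack mult_ac flip: mult.assoc)
qed

section \<open>The normalizing exponent under a move\<close>

context fixes n :: nat
begin

text \<open>The exponent d_A is the value of this bilinear form at (A, A). Over the integers,
  removing and adding a matrix unit can be expanded by bilinearity.\<close>

definition bf :: "(nat \<Rightarrow> nat \<Rightarrow> int) \<Rightarrow> (nat \<Rightarrow> nat \<Rightarrow> int) \<Rightarrow> int" where
  "bf A B = (\<Sum>i\<in>{1..n}. \<Sum>j\<in>{1..n}. \<Sum>k\<in>{1..n}. \<Sum>l\<in>{1..n}. of_bool (k \<le> i \<and> j < l) * (A i j * B k l))"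

lemma d_exp_bf: "int (d_exp n A) = bf (\<lambda>i j. int (A i j)) (\<lambda>i j. int (A i j))"
proof -
  let ?N = "{1..n}"
  have s: "{(i, j, k, l). i \<in> ?N \<and> j \<in> ?N \<and> k \<in> ?N \<and> l \<in> ?N \<and> i \<ge> k \<and> j < l} =
    {x \<in> ?N \<times> ?N \<times> ?N \<times> ?N. case x of (i, j, k, l) \<Rightarrow> k \<le> i \<and> j < l}" by auto
  have "d_exp n A = (\<Sum>x\<in>?N \<times> ?N \<times> ?N \<times> ?N. if (case x of (i, j, k, l) \<Rightarrow> k \<le> i \<and> j < l) then (case x of (i, j, k, l) \<Rightarrow> A i j * A k l) else 0)"
    unfolding d_exp_def s by (rule sum.inter_filter) simp
  also have "\<dots> = (\<Sum>(i, j, k, l)\<in>?N \<times> ?N \<times> ?N \<times> ?N. of_bool (k \<le> i \<and> j < l) * (A i j * A k l))"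
    by (intro sum.cong refl) auto
  also have "\<dots> = (\<Sum>i\<in>?N. \<Sum>j\<in>?N. \<Sum>k\<in>?N. \<Sum>l\<in>?N. of_bool (k \<le> i \<and> j < l) * (A i j * A k l))"
    by (simp only: sum.cartesian_product)
  finally show ?thesis unfolding bf_def by (simp only: of_nat_sum of_nat_mult of_nat_of_bool)
qed

lemma bf_left: "bf (\<lambda>i j. A i j - B i j + C i j) D = bf A D - bf B D + bf C D"
proof -
  have "x * ((a - b + c) * d) = x * (a * d) - x * (b * d) + x * (c * d)" for x a b c d :: int
    by (simp add: algebra_simps)
  then show ?thesis unfolding bf_def by (simp only: sum.distrib sum_subtractf)
qed

lemma bf_right: "bf D (\<lambda>i j. A i j - B i j + C i j) = bf D A - bf D B + bf D C"
proof -
  have "x * (d * (a - b + c)) = x * (d * a) - x * (d * b) + x * (d * c)" for x a b c d :: int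
    by (simp add: algebra_simps)
  then show ?thesis unfolding bf_def by (simp only: sum.distrib sum_subtractf)
qed

abbreviation Em :: "nat \<Rightarrow> nat \<Rightarrow> nat \<Rightarrow> nat \<Rightarrow> int" where "Em p q \<equiv> \<lambda>i j. of_bool ((i, j) = (p, q))"

lemma bf_Em_left:
  assumes "p \<in> {1..n}" "q \<in> {1..n}" shows "bf (Em p q) C = (\<Sum>k\<in>{1..p}. \<Sum>l\<in>{q<..n}. C k l)"
proof -
  have "bf (Em p q) C = (\<Sum>i\<in>{1..n}. \<Sum>j\<in>{1..n}. if j = q then if i = p then (\<Sum>k\<in>{1..n}. \<Sum>l\<in>{1..n}. of_bool (k \<le> p \<and> q < l) * C k l) else 0 else 0)"
    unfolding bf_def by (intro sum.cong refl) auto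
  also have "\<dots> = (\<Sum>k\<in>{1..n}. \<Sum>l\<in>{1..n}. of_bool (k \<le> p \<and> q < l) * C k l)" using assms by simp
  also have "\<dots> = (\<Sum>k\<in>{1..n}. if k \<in> {1..p} then \<Sum>l\<in>{q<..n}. C k l else 0)"
  proof (intro sum.cong refl)
    fix k assume k: "k \<in> {1..n}"
    have "(\<Sum>l\<in>{1..n}. of_bool (k \<le> p \<and> q < l) * C k l) = (\<Sum>l\<in>{1..n}. if l \<in> {q<..n} then of_bool (k \<le> p) * C k l else 0)"
      by (intro sum.cong refl) auto
    also have "\<dots> = (\<Sum>l\<in>{1..n} \<inter> {q<..n}. of_bool (k \<le> p) * C k l)" by (rule sum.inter_restrict[symmetric]) simp
    also have "{1..n} \<inter> {q<..n} = {q<..n}" by auto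
    finally show "(\<Sum>l\<in>{1..n}. of_bool (k \<le> p \<and> q < l) * C k l) = (if k \<in> {1..p} then \<Sum>l\<in>{q<..n}. C k l else 0)"
      using k by auto
  qed
  also have "\<dots> = (\<Sum>k\<in>{1..n} \<inter> {1..p}. \<Sum>l\<in>{q<..n}. C k l)" by (rule sum.inter_restrict[symmetric]) simp
  also have "{1..n} \<inter> {1..p} = {1..p}" using assms by auto
  finally show ?thesis .
qed

lemma bf_Em_right:
  assumes "p \<in> {1..n}" "q \<in> {1..n}" shows "bf C (Em p q) = (\<Sum>i\<in>{p..n}. \<Sum>j\<in>{1..<q}. C i j)"
proof -
  have "bf C (Em p q) = (\<Sum>i\<in>{1..n}. \<Sum>j\<in>{1..n}. of_bool (p \<le> i \<and> j < q) * C i j)"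
    unfolding bf_def
  proof (intro sum.cong refl)
    fix i j
    have "(\<Sum>k\<in>{1..n}. \<Sum>l\<in>{1..n}. of_bool (k \<le> i \<and> j < l) * (C i j * of_bool ((k, l) = (p, q)))) =
      (\<Sum>k\<in>{1..n}. \<Sum>l\<in>{1..n}. if l = q then if k = p then of_bool (p \<le> i \<and> j < q) * C i j else 0 else 0)"
      by (intro sum.cong refl) auto
    then show "(\<Sum>k\<in>{1..n}. \<Sum>l\<in>{1..n}. of_bool (k \<le> i \<and> j < l) * (C i j * of_bool ((k, l) = (p, q)))) = of_bool (p \<le> i \<and> j < q) * C i j"
      using assms by simp
  qed
  also have "\<dots> = (\<Sum>i\<in>{1..n}. if i \<in> {p..n} then \<Sum>j\<in>{1..<q}. C i j else 0)"
  proof (intro sum.cong refl)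
    fix i assume i: "i \<in> {1..n}"
    have "(\<Sum>j\<in>{1..n}. of_bool (p \<le> i \<and> j < q) * C i j) = (\<Sum>j\<in>{1..n}. if j \<in> {1..<q} then of_bool (p \<le> i) * C i j else 0)"
      by (intro sum.cong refl) auto
    also have "\<dots> = (\<Sum>j\<in>{1..n} \<inter> {1..<q}. of_bool (p \<le> i) * C i j)" by (rule sum.inter_restrict[symmetric]) simp
    also have "{1..n} \<inter> {1..<q} = {1..<q}" using assms by auto
    finally show "(\<Sum>j\<in>{1..n}. of_bool (p \<le> i \<and> j < q) * C i j) = (if i \<in> {p..n} then \<Sum>j\<in>{1..<q}. C i j else 0)"
      using i by auto
  qed
  also have "\<dots> = (\<Sum>i\<in>{1..n} \<inter> {p..n}. \<Sum>j\<in>{1..<q}. C i j)" by (rule sum.inter_restrict[symmetric]) simp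
  also have "{1..n} \<inter> {p..n} = {p..n}" using assms by auto
  finally show ?thesis .
qed

lemma bf_Em:
  assumes "p \<in> {1..n}" "q \<in> {1..n}" "s \<in> {1..n}" "t \<in> {1..n}"
  shows "bf (Em p q) (Em s t) = of_bool (s \<le> p \<and> q < t)"
proof -
  have "bf (Em p q) (Em s t) = (\<Sum>k\<in>{1..p}. \<Sum>l\<in>{q<..n}. if l = t then if k = s then 1 else 0 else 0)"
    unfolding bf_Em_left[OF assms(1,2)] by (intro sum.cong refl) auto
  also have "\<dots> = (\<Sum>k\<in>{1..p}. if k = s then of_bool (q < t) else 0)"
    by (intro sum.cong refl) (use assms in auto)
  also have "\<dots> = of_bool (s \<le> p \<and> q < t)" using assms by auto
  finally show ?thesis .
qed

text \<open>Bilinear expansion at B - E + E'. The diagonal terms of E and E' vanish, and the last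
  two summands are the mixed terms of E with E'.\<close>

lemma d_exp_move:
  assumes "a \<in> {1..n}" "b \<in> {1..n}" "c \<in> {1..n}" "d \<in> {1..n}" "(a, b) \<noteq> (c, d)" "0 < B a b"
  shows "int (d_exp n (move B (a, b) (c, d))) = int (d_exp n B)
    - (\<Sum>k\<in>{1..a}. \<Sum>l\<in>{b<..n}. int (B k l)) + (\<Sum>k\<in>{1..c}. \<Sum>l\<in>{d<..n}. int (B k l))
    - (\<Sum>i\<in>{a..n}. \<Sum>j\<in>{1..<b}. int (B i j)) + (\<Sum>i\<in>{c..n}. \<Sum>j\<in>{1..<d}. int (B i j))
    - of_bool (c \<le> a \<and> b < d) - of_bool (a \<le> c \<and> d < b)"
proof -
  let ?B = "\<lambda>i j. int (B i j)"
  have e: "(\<lambda>i j. int (move B (a, b) (c, d) i j)) = (\<lambda>i j. ?B i j - Em a b i j + Em c d i j)"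
    using assms(5,6) by (intro ext) (auto simp: move_def)
  show ?thesis unfolding d_exp_bf e bf_left bf_right
    bf_Em[OF assms(1,2) assms(1,2)] bf_Em[OF assms(1,2) assms(3,4)] bf_Em[OF assms(3,4) assms(1,2)] bf_Em[OF assms(3,4) assms(3,4)]
    bf_Em_left[OF assms(1,2)] bf_Em_left[OF assms(3,4)] bf_Em_right[OF assms(1,2)] bf_Em_right[OF assms(3,4)]
    by simp
qed

text \<open>Rows \<open>h\<close> and \<open>Suc h\<close> bound nested ranges, so the four partial
  sums of \<open>d_exp_move\<close> cancel except for one part of each of the two rows.\<close>

lemma d_exp_move_row:
  assumes h: "1 \<le> h" "h < n" and u: "u \<in> {1..n}" "0 < B h u"
  shows "int (d_exp n (move B (h, u) (Suc h, u))) =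
    int (d_exp n B) + (\<Sum>l\<in>{u<..n}. int (B (Suc h) l)) - (\<Sum>j\<in>{1..<u}. int (B h j))"
proof -
  have "{h..n} = insert h {Suc h..n}" using h by auto
  then show ?thesis using h u by (subst d_exp_move) (auto simp: sum.atLeast1_atMost_eq)
qed

lemma d_exp_move_col:
  assumes h: "1 \<le> h" "h < n" and u: "u \<in> {1..n}" "0 < B u (Suc h)"
  shows "int (d_exp n (move B (u, Suc h) (u, h))) =
    int (d_exp n B) + (\<Sum>k\<in>{1..u}. int (B k (Suc h))) - (\<Sum>i\<in>{u..n}. int (B i h)) - 1"
proof -
  have "{h<..n} = insert (Suc h) {Suc h<..n}" "{1..<Suc h} = insert h {1..<h}" using h by auto
  then show ?thesis using h u by (subst d_exp_move) (auto simp: sum.distrib)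
qed

end

lemma sum_split3:
  fixes f :: "nat \<Rightarrow> int"
  assumes "u \<in> {1..n}"
  shows "(\<Sum>j\<in>{1..n}. f j) = (\<Sum>j\<in>{1..<u}. f j) + f u + (\<Sum>j\<in>{u<..n}. f j)"
    and "(\<Sum>j\<in>{u..n}. f j) = f u + (\<Sum>j\<in>{u<..n}. f j)"
    and "(\<Sum>j\<in>{1..u}. f j) = (\<Sum>j\<in>{1..<u}. f j) + f u"
proof -
  have "{1..n} = {1..<u} \<union> insert u {u<..n}" "{u..n} = insert u {u<..n}" "{1..u} = insert u {1..<u}" using assms by auto
  moreover have "{1..<u} \<inter> insert u {u<..n} = {}" by auto
  ultimately show "(\<Sum>j\<in>{1..n}. f j) = (\<Sum>j\<in>{1..<u}. f j) + f u + (\<Sum>j\<in>{u<..n}. f j)"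
    "(\<Sum>j\<in>{u..n}. f j) = f u + (\<Sum>j\<in>{u<..n}. f j)"
    "(\<Sum>j\<in>{1..u}. f j) = (\<Sum>j\<in>{1..<u}. f j) + f u"
    by (simp_all add: sum.union_disjoint)
qed

context qschur_rank
begin

section \<open>Coefficients of the center equations as structure constants\<close>

lemma int_ro: "int (ro n A i) = (\<Sum>j\<in>{1..n}. int (A i j))" and int_co: "int (co n A i) = (\<Sum>j\<in>{1..n}. int (A j i))"
  by (simp_all add: ro_def co_def)

text \<open>The exponent is d_B - d_C - d_A for C = \<open>offd h (Suc h) (co n B)\<close>, whose
  normalizing exponent is \<open>co n B h\<close>. The coefficient is thus that of [B] in [C][A],
  and the same prefactor returns in \<open>R_plus_term\<close>.\<close>

lemma L_plus_term:
  assumes h: "1 \<le> h" "h < n" and u: "u \<in> {1..n}" "0 < B h u" and ro: "ro n B h = Suc (co n B h)"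
  shows "L_plus n h u (move B (h, u) (Suc h, u)) =
    \<upsilon> powi (int (d_exp n B) - int (co n B h) - int (d_exp n (move B (h, u) (Suc h, u)))) * (qq ^ lw h (Suc h) B u * qint (B h u))"
proof -
  let ?A = "move B (h, u) (Suc h, u)"
  have Au: "int (?A h u) = int (B h u) - 1" "Suc (?A h u) = B h u" using u by (auto simp: move_def)
  have s: "(\<Sum>j\<in>{u<..n}. int (?A h j)) = (\<Sum>j\<in>{u<..n}. int (B h j))" 
    "(\<Sum>j\<in>{u<..n}. int (?A (Suc h) j)) = (\<Sum>j\<in>{u<..n}. int (B (Suc h) j))"
    by (intro sum.cong refl; simp add: move_def)+
  \<comment> \<open>The total of row \<open>h\<close> exceeds \<open>co n B h\<close> by one, which
    turns the row sums in \<open>beta\<close> into the column sum shared by both sides of the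
    equation.\<close>
  have r: "int (co n B h) = (\<Sum>j\<in>{1..<u}. int (B h j)) + int (B h u) + (\<Sum>j\<in>{u<..n}. int (B h j)) - 1"
    using int_ro[of B h] sum_split3(1)[OF u(1), of "\<lambda>j. int (B h j)"] ro by linarith
  have "beta n u ?A h - 2 * int (?A h u) = (int (d_exp n B) - int (co n B h) - int (d_exp n ?A)) + 2 * int (lw h (Suc h) B u)"
    unfolding beta_def sum_split3(2)[OF u(1)] lw_def if_P[OF refl] of_nat_sum d_exp_move_row[where B = B, OF h u] Suc_eq_plus1[symmetric] s Au(1)
    unfolding r by (simp only: algebra_simps)
  from coef_eq[OF this] show ?thesis unfolding L_plus_def Au(2) .
qed

lemma R_plus_term:
  assumes h: "1 \<le> h" "h < n" and u: "u \<in> {1..n}" "0 < B u (Suc h)"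
  shows "R_plus h u (move B (u, Suc h) (u, h)) =
    \<upsilon> powi (int (d_exp n B) - int (co n B h) - int (d_exp n (move B (u, Suc h) (u, h)))) * (qq ^ lw (Suc h) h (transp B) u * qint (B u (Suc h)))"
proof -
  let ?A = "move B (u, Suc h) (u, h)"
  have Au: "int (?A u (Suc h)) = int (B u (Suc h)) - 1" "Suc (?A u (Suc h)) = B u (Suc h)" using u by (auto simp: move_def)
  have s: "(\<Sum>j\<in>{1..<u}. int (?A j (Suc h))) = (\<Sum>j\<in>{1..<u}. int (B j (Suc h)))"
    "(\<Sum>j\<in>{1..<u}. int (?A j h)) = (\<Sum>j\<in>{1..<u}. int (B j h))"
    by (intro sum.cong refl; simp add: move_def)+
  have ne: "h \<noteq> Suc (Suc h)" by simp
  have r: "int (co n B h) = (\<Sum>j\<in>{1..<u}. int (B j h)) + int (B u h) + (\<Sum>j\<in>{u<..n}. int (B j h))"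
    using int_co[of B h] sum_split3(1)[OF u(1), of "\<lambda>j. int (B j h)"] by simp
  have "beta' u (transp ?A) h - 2 * int (?A u (Suc h)) = (int (d_exp n B) - int (co n B h) - int (d_exp n ?A)) + 2 * int (lw (Suc h) h (transp B) u)"
    unfolding beta'_def sum_split3(3)[OF u(1)] lw_def if_not_P[OF ne] of_nat_sum d_exp_move_col[where B = B, OF h u] Suc_eq_plus1[symmetric] s Au(1) sum_split3(2)[OF u(1)]
    unfolding r by (simp only: algebra_simps)
  from coef_eq[OF this] show ?thesis unfolding R_plus_def Suc_eq_plus1[symmetric] Au(2) .
qed

text \<open>For C = \<open>offd (Suc h) h (co n B)\<close> the normalizing exponent is
  \<open>co n B (Suc h)\<close>, so the prefactor is again that of [B] in [C][A].\<close>

lemma L_minus_term: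
  assumes h: "1 \<le> h" "h < n" and u: "u \<in> {1..n}" "0 < B (Suc h) u" and ro: "ro n B (Suc h) = Suc (co n B (Suc h))"
  shows "L_minus h u (move B (Suc h, u) (h, u)) =
    \<upsilon> powi (int (d_exp n B) - int (co n B (Suc h)) - int (d_exp n (move B (Suc h, u) (h, u)))) * (qq ^ lw (Suc h) h B u * qint (B (Suc h) u))"
proof -
  let ?A = "move B (Suc h, u) (h, u)"
  have Au: "int (?A (Suc h) u) = int (B (Suc h) u) - 1" "Suc (?A (Suc h) u) = B (Suc h) u" using u by (auto simp: move_def)
  have s: "(\<Sum>j\<in>{1..<u}. int (?A h j)) = (\<Sum>j\<in>{1..<u}. int (B h j))"
    "(\<Sum>j\<in>{1..<u}. int (?A (Suc h) j)) = (\<Sum>j\<in>{1..<u}. int (B (Suc h) j))"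
    "(\<Sum>j\<in>{u<..n}. int (?A (Suc h) j)) = (\<Sum>j\<in>{u<..n}. int (B (Suc h) j))"
    by (intro sum.cong refl; simp add: move_def)+
  have ne: "h \<noteq> Suc (Suc h)" by simp
  have Ah: "0 < ?A h u" by (simp add: move_def)
  have bk: "move ?A (h, u) (Suc h, u) = B" by (rule move_back) (use u in auto)
  \<comment> \<open>A lowering move is read backwards: the exponent formula for raising moves is
    applied to \<open>?A\<close>, which it takes back to \<open>B\<close>.\<close>
  note d = d_exp_move_row[of h n u ?A, OF h u(1) Ah, unfolded bk]
  have r: "int (co n B (Suc h)) = (\<Sum>j\<in>{1..<u}. int (B (Suc h) j)) + int (B (Suc h) u) + (\<Sum>j\<in>{u<..n}. int (B (Suc h) j)) - 1"
    using int_ro[of B "Suc h"] sum_split3(1)[OF u(1), of "\<lambda>j. int (B (Suc h) j)"] ro by linarith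
  have "beta' u ?A h - 2 * int (?A (Suc h) u) = (int (d_exp n B) - int (co n B (Suc h)) - int (d_exp n ?A)) + 2 * int (lw (Suc h) h B u)"
    unfolding beta'_def sum_split3(3)[OF u(1)] lw_def if_not_P[OF ne] of_nat_sum d Suc_eq_plus1[symmetric] s Au(1)
    unfolding r by (simp only: algebra_simps)
  from coef_eq[OF this] show ?thesis unfolding L_minus_def Suc_eq_plus1[symmetric] Au(2) .
qed

lemma R_minus_term:
  assumes h: "1 \<le> h" "h < n" and u: "u \<in> {1..n}" "0 < B u h"
  shows "R_minus n h u (move B (u, h) (u, Suc h)) =
    \<upsilon> powi (int (d_exp n B) - int (co n B (Suc h)) - int (d_exp n (move B (u, h) (u, Suc h)))) * (qq ^ lw h (Suc h) (transp B) u * qint (B u h))"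
proof -
  let ?A = "move B (u, h) (u, Suc h)"
  have Au: "int (?A u h) = int (B u h) - 1" "Suc (?A u h) = B u h" "int (?A u (Suc h)) = int (B u (Suc h)) + 1"
    using u by (auto simp: move_def)
  have s: "(\<Sum>j\<in>{1..<u}. int (?A j (Suc h))) = (\<Sum>j\<in>{1..<u}. int (B j (Suc h)))"
    "(\<Sum>j\<in>{u<..n}. int (?A j h)) = (\<Sum>j\<in>{u<..n}. int (B j h))"
    "(\<Sum>j\<in>{u<..n}. int (?A j (Suc h))) = (\<Sum>j\<in>{u<..n}. int (B j (Suc h)))"
    by (intro sum.cong refl; simp add: move_def)+
  have Ah: "0 < ?A u (Suc h)" by (simp add: move_def)
  have bk: "move ?A (u, Suc h) (u, h) = B" by (rule move_back) (use u in auto)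
  note d = d_exp_move_col[of h n u ?A, OF h u(1) Ah, unfolded bk]
  have r: "int (co n B (Suc h)) = (\<Sum>j\<in>{1..<u}. int (B j (Suc h))) + int (B u (Suc h)) + (\<Sum>j\<in>{u<..n}. int (B j (Suc h)))"
    using int_co[of B "Suc h"] sum_split3(1)[OF u(1), of "\<lambda>j. int (B j (Suc h))"] by simp
  have "beta n u (transp ?A) h - 2 * int (?A u h) = (int (d_exp n B) - int (co n B (Suc h)) - int (d_exp n ?A)) + 2 * int (lw h (Suc h) (transp B) u)"
    unfolding beta_def sum_split3(2,3)[OF u(1)] lw_def if_P[OF refl] of_nat_sum d Suc_eq_plus1[symmetric] s Au(1,3)
    unfolding r by (simp only: algebra_simps)
  from coef_eq[OF this] show ?thesis unfolding R_minus_def Au(2) .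
qed

section \<open>Multiplication from the right and commutators\<close>

lemma transp_offd: "0 < v g \<Longrightarrow> h \<noteq> g \<Longrightarrow> transp (offd h g v) = offd g h (shift h g v)"
  by (auto simp: offd_def shift_def fun_eq_iff)

lemma transp_diagm: "transp (diagm v) = diagm v" by (auto simp: diagm_def fun_eq_iff)

lemma crd_diag_right:
  assumes A: "A \<in> Th" and B: "B \<in> Th" and v: "v \<in> L"
  shows "crd (basis_e n r A \<otimes>\<^bsub>S\<^esub> basis_e n r (diagm v)) B = (if co n A = v \<and> A = B then 1 else 0)"
proof -
  have "transp A = transp B \<longleftrightarrow> A = B" by (metis transp_eq_iff)
  then show ?thesis
    unfolding crd_mult_transp[OF A B diagm_Theta[OF v]] transp_diagm
      crd_diag[OF transp_Theta[OF A] transp_Theta[OF B] v] ro_transp[of A] by simp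
qed

text \<open>Transposition reverses products and sends \<open>offd h g v\<close> to the near-diagonal
  matrix with the two indices exchanged, so the left formula applies.\<close>

lemma crd_right:
  assumes hg: "adj h g" and A: "A \<in> Th" and B: "B \<in> Th" and v: "v \<in> L" "0 < v g"
  shows "crd (basis_e n r A \<otimes>\<^bsub>S\<^esub> basis_e n r (offd h g v)) B =
    (if co n A = shift h g v \<and> co n B = v \<and> ro n B = ro n A then lterm g h (transp B) (transp A) else 0)"
proof -
  note hg' = adjD[OF hg]
  have s: "shift h g v \<in> L" "0 < shift h g v h" using shift_L[OF hg'(1-3) v] by (auto simp: shift_def)
  show ?thesis
    unfolding crd_mult_transp[OF A B offd_Theta[OF hg'(1-3) v]] transp_offd[where v = v, OF v(2) hg'(3)]
      crd_left[OF hg'(4) transp_Theta[OF A] transp_Theta[OF B] s]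
      ro_transp[of A] co_transp[of A] ro_transp[of B] co_transp[of B] shift_shift[where v = v, OF v(2) hg'(3)] by simp
qed

lemma lterm_nz:
  assumes hg: "adj h g" and nz: "lterm h g B A \<noteq> 0"
  shows "ro n A = shift g h (ro n B)" "co n A = co n B"
proof -
  have "\<exists>p\<in>{1..n}. 0 < B h p \<and> move B (h, p) (g, p) = A"
  proof (rule ccontr)
    assume "\<not> ?thesis"
    then have "lterm h g B A = 0" unfolding lterm_def by (intro sum.neutral) auto
    then show False using nz by blast
  qed
  then obtain p where p: "p \<in> {1..n}" "0 < B h p" and A: "A = move B (h, p) (g, p)" by blast
  show "ro n A = shift g h (ro n B)" "co n A = co n B"
    unfolding A by (rule move_ro[where B = B, OF adjD(1-3)[OF hg] p], rule move_co[where B = B, OF adjD(1-3)[OF hg] p])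
qed

text \<open>A nonzero \<open>lterm\<close> already ties the row and column sums of \<open>A\<close>
  to those of \<open>B\<close>. For balanced \<open>A\<close> the conditions on \<open>A\<close>
  then follow from those on \<open>B\<close>, and they become the same for both products.\<close>

lemma crd_balanced:
  assumes hg: "adj h g" and A: "A \<in> Omega n r" and B: "B \<in> Th" and v: "v \<in> L" "0 < v g"
  shows "crd (basis_e n r (offd h g v) \<otimes>\<^bsub>S\<^esub> basis_e n r A) B =
      (if ro n B = shift h g v \<and> co n B = v then lterm h g B A else 0)"
    and "crd (basis_e n r A \<otimes>\<^bsub>S\<^esub> basis_e n r (offd h g v)) B =
      (if ro n B = shift h g v \<and> co n B = v then lterm g h (transp B) (transp A) else 0)"
proof -
  have AT: "A \<in> Th" and bal: "ro n A = co n A" using A by (auto simp: Omega_def)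
  have sv: "shift g h (shift h g v) = v" by (rule shift_shift[where v = v, OF v(2) adjD(3)[OF hg]])
  show "crd (basis_e n r (offd h g v) \<otimes>\<^bsub>S\<^esub> basis_e n r A) B =
      (if ro n B = shift h g v \<and> co n B = v then lterm h g B A else 0)"
  proof (cases "lterm h g B A = 0")
    case False
    show ?thesis unfolding crd_left[OF hg AT B v] using lterm_nz[OF hg False] bal sv by auto
  qed (simp add: crd_left[OF hg AT B v])
  show "crd (basis_e n r A \<otimes>\<^bsub>S\<^esub> basis_e n r (offd h g v)) B =
      (if ro n B = shift h g v \<and> co n B = v then lterm g h (transp B) (transp A) else 0)"
  proof (cases "lterm g h (transp B) (transp A) = 0")
    case False
    show ?thesis unfolding crd_right[OF hg AT B v]
      using lterm_nz[OF adjD(4)[OF hg] False] bal unfolding ro_transp[of A] co_transp[of A] ro_transp[of B] co_transp[of B] by auto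
  qed (simp add: crd_right[OF hg AT B v])
qed

text \<open>Multiplying by the idempotent of \<open>v\<close> on the left keeps the coordinates with
  row sums \<open>v\<close>, on the right those with column sums \<open>v\<close>. Taking for
  \<open>v\<close> the column sums of a supported matrix yields balance.\<close>

lemma com_diag_iff:
  assumes z: "z \<in> carrier BA.Kt"
  shows "(\<forall>v\<in>L. BA.com z (BA.bE (diagm v))) \<longleftrightarrow> (\<forall>A\<in>Th. BA.Phi z A \<noteq> 0 \<longrightarrow> A \<in> Omega n r)"
proof -
  have "BA.com z (BA.bE (diagm v)) \<longleftrightarrow> (\<forall>B\<in>Th. BA.Phi z B \<noteq> 0 \<longrightarrow> (co n B = v \<longleftrightarrow> ro n B = v))" if v: "v \<in> L" for v
  proof -
    have 1: "(\<Sum>A\<in>Th. BA.Phi z A * crd (basis_e n r A \<otimes>\<^bsub>S\<^esub> basis_e n r (diagm v)) B) = (if co n B = v then BA.Phi z B else 0)"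
      if B: "B \<in> Th" for B
    proof -
      have "(\<Sum>A\<in>Th. BA.Phi z A * crd (basis_e n r A \<otimes>\<^bsub>S\<^esub> basis_e n r (diagm v)) B) =
        (\<Sum>A\<in>Th. if A = B then if co n B = v then BA.Phi z B else 0 else 0)"
        by (intro sum.cong refl) (auto simp: crd_diag_right[OF _ B v])
      then show ?thesis using B finite_Th by simp
    qed
    have 2: "(\<Sum>A\<in>Th. BA.Phi z A * crd (basis_e n r (diagm v) \<otimes>\<^bsub>S\<^esub> basis_e n r A) B) = (if ro n B = v then BA.Phi z B else 0)"
      if B: "B \<in> Th" for B
    proof -
      have "(\<Sum>A\<in>Th. BA.Phi z A * crd (basis_e n r (diagm v) \<otimes>\<^bsub>S\<^esub> basis_e n r A) B) =
        (\<Sum>A\<in>Th. if A = B then if ro n B = v then BA.Phi z B else 0 else 0)"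
        by (intro sum.cong refl) (auto simp: crd_diag[OF _ B v])
      then show ?thesis using B finite_Th by simp
    qed
    show ?thesis unfolding BA.com_bE_iff[OF z diagm_Theta[OF v]]
      by (rule ball_cong[OF refl]) (simp only: 1 2, auto)
  qed
  note e = this
  show ?thesis
  proof
    assume a: "\<forall>v\<in>L. BA.com z (BA.bE (diagm v))"
    show "\<forall>A\<in>Th. BA.Phi z A \<noteq> 0 \<longrightarrow> A \<in> Omega n r"
    proof (intro ballI impI)
      fix A assume A: "A \<in> Th" and nz: "BA.Phi z A \<noteq> 0"
      have "co n A = co n A \<longleftrightarrow> ro n A = co n A"
        using bspec[OF bspec[OF a co_Lam[OF A], unfolded e[OF co_Lam[OF A]]] A] nz by (rule mp)
      then show "A \<in> Omega n r" using A by (simp add: Omega_def)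
    qed
  next
    assume a: "\<forall>A\<in>Th. BA.Phi z A \<noteq> 0 \<longrightarrow> A \<in> Omega n r"
    show "\<forall>v\<in>L. BA.com z (BA.bE (diagm v))"
    proof
      fix v assume v: "v \<in> L"
      show "BA.com z (BA.bE (diagm v))" unfolding e[OF v] using a by (simp add: Omega_def)
    qed
  qed
qed

text \<open>With balanced support, the coordinate at \<open>B\<close> of the commutator can be
  nonzero only if \<open>ro n B = shift h g v\<close> and \<open>co n B = v\<close>; each such
  \<open>B\<close> contributes one linear equation.\<close>

lemma com_offd_iff:
  assumes z: "z \<in> carrier BA.Kt" and supp: "\<forall>A\<in>Th. BA.Phi z A \<noteq> 0 \<longrightarrow> A \<in> Omega n r"
    and hg: "adj h g" and v: "v \<in> L" "0 < v g"
  shows "BA.com z (BA.bE (offd h g v)) \<longleftrightarrow> (\<forall>B\<in>Th. ro n B = shift h g v \<and> co n B = v \<longrightarrow>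
    (\<Sum>A\<in>Omega n r. BA.Phi z A * (lterm h g B A - lterm g h (transp B) (transp A))) = 0)"
proof -
  have sub: "Omega n r \<subseteq> Th" by (auto simp: Omega_def)
  have red: "(\<Sum>A\<in>Th. BA.Phi z A * g A) = (\<Sum>A\<in>Omega n r. BA.Phi z A * g A)" for g
    by (rule sum.mono_neutral_right[OF finite_Th sub]) (use supp in auto)
  have "((\<Sum>A\<in>Th. BA.Phi z A * crd (basis_e n r A \<otimes>\<^bsub>S\<^esub> basis_e n r (offd h g v)) B) =
      (\<Sum>A\<in>Th. BA.Phi z A * crd (basis_e n r (offd h g v) \<otimes>\<^bsub>S\<^esub> basis_e n r A) B)) \<longleftrightarrow>
    (ro n B = shift h g v \<and> co n B = v \<longrightarrow>
    (\<Sum>A\<in>Omega n r. BA.Phi z A * (lterm h g B A - lterm g h (transp B) (transp A))) = 0)" if B: "B \<in> Th" for B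
  proof (cases "ro n B = shift h g v \<and> co n B = v")
    case True
    have "(\<Sum>A\<in>Th. BA.Phi z A * crd (basis_e n r A \<otimes>\<^bsub>S\<^esub> basis_e n r (offd h g v)) B) =
        (\<Sum>A\<in>Omega n r. BA.Phi z A * lterm g h (transp B) (transp A))"
      unfolding red by (intro sum.cong refl) (simp only: crd_balanced(2)[OF hg _ B v] if_P[OF True])
    moreover have "(\<Sum>A\<in>Th. BA.Phi z A * crd (basis_e n r (offd h g v) \<otimes>\<^bsub>S\<^esub> basis_e n r A) B) =
        (\<Sum>A\<in>Omega n r. BA.Phi z A * lterm h g B A)"
      unfolding red by (intro sum.cong refl) (simp only: crd_balanced(1)[OF hg _ B v] if_P[OF True])
    ultimately show ?thesis using True by (auto simp: right_diff_distrib sum_subtractf)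
  next
    case False
    have "(\<Sum>A\<in>Th. BA.Phi z A * crd (basis_e n r A \<otimes>\<^bsub>S\<^esub> basis_e n r (offd h g v)) B) = 0"
      unfolding red by (intro sum.neutral ballI) (simp only: crd_balanced(2)[OF hg _ B v] if_not_P[OF False] mult_zero_right)
    moreover have "(\<Sum>A\<in>Th. BA.Phi z A * crd (basis_e n r (offd h g v) \<otimes>\<^bsub>S\<^esub> basis_e n r A) B) = 0"
      unfolding red by (intro sum.neutral ballI) (simp only: crd_balanced(1)[OF hg _ B v] if_not_P[OF False] mult_zero_right)
    ultimately show ?thesis by (simp only: False simp_thms)
  qed
  then show ?thesis unfolding BA.com_bE_iff[OF z offd_Theta[OF adjD(1-3)[OF hg] v]] by blast
qed

lemma transp_move: "move (transp B) (g, p) (h, p) = transp A \<longleftrightarrow> move B (p, g) (p, h) = A"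
proof
  assume e: "move (transp B) (g, p) (h, p) = transp A"
  show "move B (p, g) (p, h) = A"
  proof (intro ext)
    fix i j show "move B (p, g) (p, h) i j = A i j"
      using fun_cong[OF fun_cong[OF e, of j], of i] unfolding move_def prod.inject by (simp add: conj_commute)
  qed
next
  assume e: "move B (p, g) (p, h) = A"
  show "move (transp B) (g, p) (h, p) = transp A"
    unfolding e[symmetric] by (intro ext) (simp add: move_def conj_commute)
qed

lemma lterm_filter:
  assumes "\<And>u. u \<in> {1..n} \<Longrightarrow> 0 < B h u \<Longrightarrow> move B (h, u) (g, u) = A \<Longrightarrow> f u = c * (qq ^ lw h g B u * qint (B h u))"
  shows "(\<Sum>u | u \<in> {1..n} \<and> B h u > 0. if move B (h, u) (g, u) = A then f u else 0) = c * lterm h g B A"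
proof -
  have "(\<Sum>u | u \<in> {1..n} \<and> B h u > 0. if move B (h, u) (g, u) = A then f u else 0) =
    (\<Sum>u\<in>{1..n}. if B h u > 0 then if move B (h, u) (g, u) = A then f u else 0 else 0)"
    by (rule sum.inter_filter) simp
  also have "\<dots> = c * lterm h g B A"
    unfolding lterm_def sum_distrib_left by (intro sum.cong refl) (use assms in auto)
  finally show ?thesis .
qed

lemma lterm_filter_transp:
  assumes "\<And>u. u \<in> {1..n} \<Longrightarrow> 0 < B u h \<Longrightarrow> move B (u, h) (u, g) = A \<Longrightarrow> f u = c * (qq ^ lw h g (transp B) u * qint (B u h))"
  shows "(\<Sum>u | u \<in> {1..n} \<and> B u h > 0. if move B (u, h) (u, g) = A then f u else 0) = c * lterm h g (transp B) (transp A)"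
  using lterm_filter[of "transp B" h g "transp A" f c] assms unfolding transp_move by blast

text \<open>Both halves of the equation carry the same power of \<upsilon>, which splits into a
  factor depending on the equation and one depending on the unknown.\<close>

lemma eq_coeff_plus:
  assumes h: "1 \<le> h" "h < n" and ro: "ro n B h = Suc (co n B h)"
  shows "eq_coeff n (EqPlus h B) A = \<upsilon> powi (int (d_exp n B) - int (co n B h) - int (d_exp n A)) *
    (lterm h (Suc h) B A - lterm (Suc h) h (transp B) (transp A))"
proof -
  note 1 = lterm_filter[of B h "Suc h" A "\<lambda>u. L_plus n h u A" "\<upsilon> powi (int (d_exp n B) - int (co n B h) - int (d_exp n A))"]
  note 2 = lterm_filter_transp[of B "Suc h" h A "\<lambda>u. R_plus h u A" "\<upsilon> powi (int (d_exp n B) - int (co n B h) - int (d_exp n A))"]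
  show ?thesis unfolding eq_coeff.simps right_diff_distrib Suc_eq_plus1[symmetric]
  proof (intro arg_cong2[where f = minus] 1 2)
    fix u assume u: "u \<in> {1..n}"
    show "L_plus n h u A = \<upsilon> powi (int (d_exp n B) - int (co n B h) - int (d_exp n A)) * (qq ^ lw h (Suc h) B u * qint (B h u))"
      if "0 < B h u" "move B (h, u) (Suc h, u) = A"
      using L_plus_term[where B = B, OF h u that(1) ro] unfolding that(2) .
    show "R_plus h u A = \<upsilon> powi (int (d_exp n B) - int (co n B h) - int (d_exp n A)) * (qq ^ lw (Suc h) h (transp B) u * qint (B u (Suc h)))"
      if "0 < B u (Suc h)" "move B (u, Suc h) (u, h) = A"
      using R_plus_term[where B = B, OF h u that(1)] unfolding that(2) .
  qed
qed

lemma eq_coeff_minus: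
  assumes h: "1 \<le> h" "h < n" and ro: "ro n B (Suc h) = Suc (co n B (Suc h))"
  shows "eq_coeff n (EqMinus h B) A = \<upsilon> powi (int (d_exp n B) - int (co n B (Suc h)) - int (d_exp n A)) *
    (lterm (Suc h) h B A - lterm h (Suc h) (transp B) (transp A))"
proof -
  note 1 = lterm_filter[of B "Suc h" h A "\<lambda>u. L_minus h u A" "\<upsilon> powi (int (d_exp n B) - int (co n B (Suc h)) - int (d_exp n A))"]
  note 2 = lterm_filter_transp[of B h "Suc h" A "\<lambda>u. R_minus n h u A" "\<upsilon> powi (int (d_exp n B) - int (co n B (Suc h)) - int (d_exp n A))"]
  show ?thesis unfolding eq_coeff.simps right_diff_distrib Suc_eq_plus1[symmetric]
  proof (intro arg_cong2[where f = minus] 1 2)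
    fix u assume u: "u \<in> {1..n}"
    show "L_minus h u A = \<upsilon> powi (int (d_exp n B) - int (co n B (Suc h)) - int (d_exp n A)) * (qq ^ lw (Suc h) h B u * qint (B (Suc h) u))"
      if "0 < B (Suc h) u" "move B (Suc h, u) (h, u) = A"
      using L_minus_term[where B = B, OF h u that(1) ro] unfolding that(2) .
    show "R_minus n h u A = \<upsilon> powi (int (d_exp n B) - int (co n B (Suc h)) - int (d_exp n A)) * (qq ^ lw h (Suc h) (transp B) u * qint (B u h))"
      if "0 < B u h" "move B (u, h) (u, Suc h) = A"
      using R_minus_term[where B = B, OF h u that(1)] unfolding that(2) .
  qed
qed

text \<open>At index \<open>g\<close> the difference is -1, which forces a positive column sum and
  makes the truncated subtraction in \<open>shift\<close> exact.\<close>

lemma diff_shift_iff: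
  assumes B: "B \<in> Th" and hg: "h \<in> {1..n}" "g \<in> {1..n}" "h \<noteq> g"
  shows "(\<forall>i\<in>{1..n}. int (ro n B i) - int (co n B i) = of_bool (i = h) - of_bool (i = g)) \<longleftrightarrow>
    0 < co n B g \<and> ro n B = shift h g (co n B)"
proof
  assume a: "\<forall>i\<in>{1..n}. int (ro n B i) - int (co n B i) = of_bool (i = h) - of_bool (i = g)"
  have pos: "0 < co n B g" using bspec[OF a hg(2)] hg by simp
  have "ro n B i = shift h g (co n B) i" for i
  proof (cases "i \<in> {1..n}")
    case True
    show ?thesis using bspec[OF a True] pos by (auto simp: shift_def of_bool_def split: if_splits)
  next
    case False
    then show ?thesis using Lam_out[OF ro_Lam[OF B] False] Lam_out[OF co_Lam[OF B] False] hg by (auto simp: shift_def)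
  qed
  then show "0 < co n B g \<and> ro n B = shift h g (co n B)" using pos by blast
next
  assume "0 < co n B g \<and> ro n B = shift h g (co n B)"
  then show "\<forall>i\<in>{1..n}. int (ro n B i) - int (co n B i) = of_bool (i = h) - of_bool (i = g)"
    using hg by (auto simp: shift_def of_bool_def)
qed

lemma Theta_plus_iff:
  assumes "1 \<le> h" "h < n"
  shows "B \<in> Theta_plus n r h \<longleftrightarrow> B \<in> Th \<and> 0 < co n B (Suc h) \<and> ro n B = shift h (Suc h) (co n B)"
proof (cases "B \<in> Th")
  case True
  have "h \<in> {1..n}" "Suc h \<in> {1..n}" "h \<noteq> Suc h" using assms by auto
  from diff_shift_iff[OF True this] show ?thesis
    using True unfolding Theta_plus_def alpha_def mem_Collect_eq Suc_eq_plus1[symmetric] by (simp only: simp_thms)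
qed (simp add: Theta_plus_def)

lemma Theta_minus_iff:
  assumes "1 \<le> h" "h < n"
  shows "B \<in> Theta_minus n r h \<longleftrightarrow> B \<in> Th \<and> 0 < co n B h \<and> ro n B = shift (Suc h) h (co n B)"
proof (cases "B \<in> Th")
  case True
  have "Suc h \<in> {1..n}" "h \<in> {1..n}" "Suc h \<noteq> h" using assms by auto
  from diff_shift_iff[OF True this] show ?thesis
    using True unfolding Theta_minus_def alpha_def mem_Collect_eq Suc_eq_plus1[symmetric] minus_diff_eq by (simp only: simp_thms)
qed (simp add: Theta_minus_def)



text \<open>Coordinates with respect to the normalized basis: [A] is e_A divided by the power d_A of
  \<upsilon>, so the coordinate is multiplied by it.\<close>

definition bcoord :: "(ratfun \<times> qschur_elt \<Rightarrow> int) set \<Rightarrow> nmat \<Rightarrow> ratfun" where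
  "bcoord z A = \<upsilon> powi int (d_exp n A) * BA.Phi z A"

text \<open>Passing to normalized coordinates absorbs the part of the prefactor that depends on the
  unknown; what remains is a unit common to the whole equation.\<close>

lemma eq_sum:
  assumes "\<And>A. eq_coeff n E A = \<upsilon> powi (N - int (d_exp n A)) * t A"
  shows "(\<Sum>A\<in>Omega n r. eq_coeff n E A * bcoord z A) = \<upsilon> powi N * (\<Sum>A\<in>Omega n r. BA.Phi z A * t A)"
  unfolding sum_distrib_left
proof (intro sum.cong refl)
  fix A
  have "\<upsilon> powi ((N - int (d_exp n A)) + int (d_exp n A)) = \<upsilon> powi (N - int (d_exp n A)) * \<upsilon> powi int (d_exp n A)"
    by (rule power_int_add) (simp add: ups_nonzero)
  then have e: "\<upsilon> powi N = \<upsilon> powi (N - int (d_exp n A)) * \<upsilon> powi int (d_exp n A)"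
    unfolding diff_add_cancel .
  show "eq_coeff n E A * bcoord z A = \<upsilon> powi N * (BA.Phi z A * t A)"
    unfolding assms bcoord_def e by (simp only: mult_ac)
qed

text \<open>A center equation is a pair of an index \<open>h\<close> and a matrix \<open>B\<close>;
  its commutator counterpart is a near-diagonal element, given by neighbouring indices and
  \<open>v = co n B\<close>, together with the coordinate \<open>B\<close> of the
  commutator.\<close>

lemma center_eqs_iff:
  assumes z: "z \<in> carrier BA.Kt" and supp: "\<forall>A\<in>Th. BA.Phi z A \<noteq> 0 \<longrightarrow> A \<in> Omega n r"
  shows "(\<forall>E\<in>center_eqs n r. (\<Sum>A\<in>Omega n r. eq_coeff n E A * bcoord z A) = 0) \<longleftrightarrow>
    (\<forall>h g v. adj h g \<longrightarrow> v \<in> L \<longrightarrow> 0 < v g \<longrightarrow> BA.com z (BA.bE (offd h g v)))" (is "?l \<longleftrightarrow> ?r")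
proof -
  let ?s = "\<lambda>h g B. (\<Sum>A\<in>Omega n r. BA.Phi z A * (lterm h g B A - lterm g h (transp B) (transp A)))"
  let ?c = "\<lambda>h g. \<forall>B\<in>Th. 0 < co n B g \<and> ro n B = shift h g (co n B) \<longrightarrow> ?s h g B = 0"
  have r: "(\<forall>v. v \<in> L \<longrightarrow> 0 < v g \<longrightarrow> BA.com z (BA.bE (offd h g v))) \<longleftrightarrow> ?c h g" if "adj h g" for h g
  proof
    assume a: "\<forall>v. v \<in> L \<longrightarrow> 0 < v g \<longrightarrow> BA.com z (BA.bE (offd h g v))"
    show "?c h g"
    proof (intro ballI impI)
      fix B assume B: "B \<in> Th" "0 < co n B g \<and> ro n B = shift h g (co n B)"
      have v: "co n B \<in> L" "0 < co n B g" using co_Lam B by auto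
      have "BA.com z (BA.bE (offd h g (co n B)))" using a v by blast
      then show "?s h g B = 0" unfolding com_offd_iff[OF z supp that v] using B by blast
    qed
  next
    assume a: "?c h g"
    show "\<forall>v. v \<in> L \<longrightarrow> 0 < v g \<longrightarrow> BA.com z (BA.bE (offd h g v))"
    proof (intro allI impI)
      fix v assume v: "v \<in> L" "0 < v g"
      show "BA.com z (BA.bE (offd h g v))" unfolding com_offd_iff[OF z supp that v] using a v by blast
    qed
  qed
  have p: "(\<Sum>A\<in>Omega n r. eq_coeff n (EqPlus h B) A * bcoord z A) = 0 \<longleftrightarrow> ?s h (Suc h) B = 0"
    if h: "1 \<le> h" "h < n" and B: "0 < co n B (Suc h) \<and> ro n B = shift h (Suc h) (co n B)" for h B
  proof -
    have "ro n B h = Suc (co n B h)" using B by (simp add: shift_def)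
    from eq_sum[OF eq_coeff_plus[OF h this]] show ?thesis by (simp only: mult_eq_0_iff power_int_eq_0_iff ups_nonzero simp_thms)
  qed
  have m: "(\<Sum>A\<in>Omega n r. eq_coeff n (EqMinus h B) A * bcoord z A) = 0 \<longleftrightarrow> ?s (Suc h) h B = 0"
    if h: "1 \<le> h" "h < n" and B: "0 < co n B h \<and> ro n B = shift (Suc h) h (co n B)" for h B
  proof -
    have "ro n B (Suc h) = Suc (co n B (Suc h))" using B by (simp add: shift_def)
    from eq_sum[OF eq_coeff_minus[OF h this]] show ?thesis by (simp only: mult_eq_0_iff power_int_eq_0_iff ups_nonzero simp_thms)
  qed
  have l: "?l \<longleftrightarrow> (\<forall>h. 1 \<le> h \<longrightarrow> h < n \<longrightarrow> ?c h (Suc h) \<and> ?c (Suc h) h)"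
  proof
    assume a: ?l
    show "\<forall>h. 1 \<le> h \<longrightarrow> h < n \<longrightarrow> ?c h (Suc h) \<and> ?c (Suc h) h"
    proof (intro allI impI conjI ballI)
      fix h B assume h: "1 \<le> h" "h < n" and B: "B \<in> Th"
      show "?s h (Suc h) B = 0" if q: "0 < co n B (Suc h) \<and> ro n B = shift h (Suc h) (co n B)"
      proof -
        have "B \<in> Theta_plus n r h" unfolding Theta_plus_iff[OF h] using B q by blast
        then have "EqPlus h B \<in> center_eqs n r" unfolding center_eqs_def using h by blast
        then show ?thesis using a p[OF h q] by blast
      qed
      show "?s (Suc h) h B = 0" if q: "0 < co n B h \<and> ro n B = shift (Suc h) h (co n B)"
      proof -
        have "B \<in> Theta_minus n r h" unfolding Theta_minus_iff[OF h] using B q by blast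
        then have "EqMinus h B \<in> center_eqs n r" unfolding center_eqs_def using h by blast
        then show ?thesis using a m[OF h q] by blast
      qed
    qed
  next
    assume a: "\<forall>h. 1 \<le> h \<longrightarrow> h < n \<longrightarrow> ?c h (Suc h) \<and> ?c (Suc h) h"
    show ?l
    proof
      fix E assume "E \<in> center_eqs n r"
      then consider (plus) h B where "E = EqPlus h B" "1 \<le> h" "h < n" "B \<in> Theta_plus n r h"
        | (minus) h B where "E = EqMinus h B" "1 \<le> h" "h < n" "B \<in> Theta_minus n r h"
        unfolding center_eqs_def by blast
      then show "(\<Sum>A\<in>Omega n r. eq_coeff n E A * bcoord z A) = 0"
      proof cases
        case plus
        have B: "B \<in> Th" "0 < co n B (Suc h) \<and> ro n B = shift h (Suc h) (co n B)"
          using plus(4) unfolding Theta_plus_iff[OF plus(2,3)] by blast+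
        have "?c h (Suc h)" using a plus(2,3) by blast
        then show ?thesis unfolding plus(1) p[OF plus(2,3) B(2)] using B by blast
      next
        case minus
        have B: "B \<in> Th" "0 < co n B h \<and> ro n B = shift (Suc h) h (co n B)"
          using minus(4) unfolding Theta_minus_iff[OF minus(2,3)] by blast+
        have "?c (Suc h) h" using a minus(2,3) by blast
        then show ?thesis unfolding minus(1) m[OF minus(2,3) B(2)] using B by blast
      qed
    qed
  qed
  have ad: "(\<forall>h g. adj h g \<longrightarrow> R h g) \<longleftrightarrow> (\<forall>h. 1 \<le> h \<longrightarrow> h < n \<longrightarrow> R h (Suc h) \<and> R (Suc h) h)" for R
    unfolding adj_def by (auto simp: Suc_le_eq)
  define V where "V h g \<longleftrightarrow> (\<forall>v. v \<in> L \<longrightarrow> 0 < v g \<longrightarrow> BA.com z (BA.bE (offd h g v)))" for h g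
  define U where "U h g \<longleftrightarrow> ?c h g" for h g
  have "?r \<longleftrightarrow> (\<forall>h g. adj h g \<longrightarrow> V h g)" unfolding V_def by (simp only: all_simps)
  also have "\<dots> \<longleftrightarrow> (\<forall>h g. adj h g \<longrightarrow> U h g)"
    using r unfolding V_def[symmetric] U_def[symmetric] by blast
  also have "\<dots> \<longleftrightarrow> ?l" unfolding l ad U_def ..
  finally show ?thesis by (rule sym)
qed

theorem center_char:
  "z \<in> ring_center BA.Kt \<longleftrightarrow> z \<in> carrier BA.Kt \<and> (\<forall>A\<in>Th. BA.Phi z A \<noteq> 0 \<longrightarrow> A \<in> Omega n r) \<and>
    (\<forall>E\<in>center_eqs n r. (\<Sum>A\<in>Omega n r. eq_coeff n E A * bcoord z A) = 0)"
proof (cases "z \<in> carrier BA.Kt")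
  case z: True
  have "(\<forall>A\<in>Th. BA.com z (BA.bE A)) \<longleftrightarrow> (\<forall>v\<in>L. BA.com z (BA.bE (diagm v))) \<and>
    (\<forall>h g v. adj h g \<longrightarrow> v \<in> L \<longrightarrow> 0 < v g \<longrightarrow> BA.com z (BA.bE (offd h g v)))" (is "_ \<longleftrightarrow> ?r")
  proof
    assume a: "\<forall>A\<in>Th. BA.com z (BA.bE A)"
    show ?r
    proof (intro conjI ballI allI impI)
      show "BA.com z (BA.bE (diagm v))" if "v \<in> L" for v using a diagm_Theta[OF that] by blast
      show "BA.com z (BA.bE (offd h g v))" if "adj h g" "v \<in> L" "0 < v g" for h g v
        using a offd_Theta[OF adjD(1-3)[OF that(1)] that(2,3)] by blast
    qed
  next
    assume a: ?r
    show "\<forall>A\<in>Th. BA.com z (BA.bE A)"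
    proof
      fix A assume "A \<in> Th"
      then show "BA.com z (BA.bE A)" by (rule com_all[OF z, rotated 2]) (use a in blast)+
    qed
  qed
  note c = this
  have "z \<in> ring_center BA.Kt \<longleftrightarrow> (\<forall>A\<in>Th. BA.com z (BA.bE A))"
    unfolding BA.center_iff_com using z by (simp only: simp_thms)
  also have "\<dots> \<longleftrightarrow> (\<forall>A\<in>Th. BA.Phi z A \<noteq> 0 \<longrightarrow> A \<in> Omega n r) \<and>
    (\<forall>h g v. adj h g \<longrightarrow> v \<in> L \<longrightarrow> 0 < v g \<longrightarrow> BA.com z (BA.bE (offd h g v)))"
    unfolding c com_diag_iff[OF z] ..
  also have "\<dots> \<longleftrightarrow> (\<forall>A\<in>Th. BA.Phi z A \<noteq> 0 \<longrightarrow> A \<in> Omega n r) \<and>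
    (\<forall>E\<in>center_eqs n r. (\<Sum>A\<in>Omega n r. eq_coeff n E A * bcoord z A) = 0)"
    by (rule conj_cong[OF refl], rule center_eqs_iff[OF z, symmetric])
  finally show ?thesis using z by (simp only: simp_thms)
next
  case False
  then show ?thesis unfolding BA.center_iff_com by (simp only: simp_thms)
qed

end

section \<open>Reduced row echelon forms and the basis\<close>

lemma col_of:
  assumes "distinct As" "A \<in> set As" shows "col_of As A < length As" "As ! col_of As A = A"
proof -
  obtain j where j: "j < length As" "As ! j = A" using assms(2) by (auto simp: in_set_conv_nth)
  have "col_of As A = j" unfolding col_of_def
    by (rule the_equality) (use j assms(1) nth_eq_iff_index_eq in blast)+
  then show "col_of As A < length As" "As ! col_of As A = A" using j by auto
qed

lemma col_of_nth: "distinct As \<Longrightarrow> j < length As \<Longrightarrow> col_of As (As ! j) = j"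
  using col_of[of As "As ! j"] nth_eq_iff_index_eq[of As] by auto

text \<open>A pivot function gives the column of the leading entry of each row and, for zero rows,
  the number of columns; this is what the bound on \<open>j\<close> excludes.\<close>

lemma leading_iff:
  fixes R :: "'a :: field mat"
  assumes p: "pivot_fun R f (dim_col R)"
  shows "leading R i j \<longleftrightarrow> i < dim_row R \<and> f i = j \<and> j < dim_col R"
proof
  note pD = pivot_funD[OF refl p]
  assume l: "leading R i j"
  then have i: "i < dim_row R" and j: "j < dim_col R" "R $$ (i, j) \<noteq> 0" "\<And>j'. j' < j \<Longrightarrow> R $$ (i, j') = 0"
    by (auto simp: leading_def)
  have "f i \<le> j" using pD(2)[OF i, of j] j(2) by (meson not_le)
  then have "R $$ (i, f i) = 1" using pD(4)[OF i] j(1) by simp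
  then have "\<not> f i < j" using j(3) by auto
  then show "i < dim_row R \<and> f i = j \<and> j < dim_col R" using \<open>f i \<le> j\<close> i j(1) by simp
next
  note pD = pivot_funD[OF refl p]
  assume "i < dim_row R \<and> f i = j \<and> j < dim_col R"
  then show "leading R i j" using pD(2)[of i] pD(4)[of i] by (simp add: leading_def)
qed

lemma pivot_fun_inj:
  fixes R :: "'a :: field mat"
  assumes p: "pivot_fun R f (dim_col R)" and "i < dim_row R" "i' < dim_row R" "f i = f i'" "f i < dim_col R"
  shows "i = i'"
proof (rule ccontr)
  note pD = pivot_funD[OF refl p]
  assume "i \<noteq> i'"
  then have "R $$ (i, f i') = 0" using pD(5)[of i' i] assms by auto
  then show False using pD(4)[of i] assms by simp
qed

context
  fixes As :: "nmat list" and M R :: "ratfun mat" and m :: nat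
  assumes As: "distinct As" and M: "M \<in> carrier_mat m (length As)" and R: "R = rref M"
begin

lemma rref_props: "R \<in> carrier_mat m (length As)" "\<exists>f. pivot_fun R f (dim_col R)"
  using gauss_jordan_single(2,3)[OF M] by (auto simp: R rref_def row_echelon_form_def)

lemma pivotsE:
  assumes "P \<in> pivots R As" "pivot_fun R f (dim_col R)"
  shows "pivot_row R As P < m" "f (pivot_row R As P) = col_of As P"
proof -
  have PA: "P \<in> set As" and "\<exists>i. leading R i (col_of As P)" using assms(1) by (auto simp: pivots_def)
  then obtain i where i: "i < dim_row R" "f i = col_of As P" "col_of As P < dim_col R"
    unfolding leading_iff[OF assms(2)] by blast
  have "pivot_row R As P = i" unfolding pivot_row_def leading_iff[OF assms(2)]
    by (rule the_equality) (use i pivot_fun_inj[OF assms(2)] in auto)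
  then show "pivot_row R As P < m" "f (pivot_row R As P) = col_of As P" using i rref_props(1) by auto
qed

lemma finite_pivots: "finite (pivots R As)" "finite (frees R As)" "pivots R As \<union> frees R As = set As" "pivots R As \<inter> frees R As = {}"
  by (auto simp: pivots_def frees_def)

text \<open>Row reduction preserves the kernel, and each nonzero row of the reduced form expresses
  its pivot variable through the free ones.\<close>

lemma rref_kernel:
  "(\<forall>i<m. (\<Sum>j<length As. M $$ (i, j) * x (As ! j)) = 0) \<longleftrightarrow>
    (\<forall>P\<in>pivots R As. x P = - (\<Sum>F\<in>frees R As. R $$ (pivot_row R As P, col_of As F) * x F))"
proof -
  let ?N = "length As"
  define v where "v = vec ?N (\<lambda>j. x (As ! j))"
  have v: "v \<in> carrier_vec ?N" by (simp add: v_def)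
  have Rc: "R \<in> carrier_mat m ?N" by (rule rref_props(1))
  then have dims: "dim_row R = m" "dim_col R = ?N" by auto
  have ker: "B *\<^sub>v v = 0\<^sub>v m \<longleftrightarrow> (\<forall>i<m. (\<Sum>j<?N. B $$ (i, j) * x (As ! j)) = 0)" if B: "B \<in> carrier_mat m ?N" for B
  proof -
    have "(B *\<^sub>v v) $ i = (\<Sum>j<?N. B $$ (i, j) * x (As ! j))" if "i < m" for i
      using that B by (auto simp: v_def scalar_prod_def lessThan_atLeast0 intro!: sum.cong)
    moreover have "dim_vec (B *\<^sub>v v) = m" using B by auto
    ultimately show ?thesis by (auto simp: vec_eq_iff)
  qed
  have "(\<forall>i<m. (\<Sum>j<?N. M $$ (i, j) * x (As ! j)) = 0) \<longleftrightarrow> M *\<^sub>v v = 0\<^sub>v m" by (rule ker[OF M, symmetric])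
  also have "\<dots> \<longleftrightarrow> R *\<^sub>v v = 0\<^sub>v m" using gauss_jordan_single(1)[OF M _ v, of R] R by (simp add: rref_def)
  also have "\<dots> \<longleftrightarrow> (\<forall>i<m. (\<Sum>j<?N. R $$ (i, j) * x (As ! j)) = 0)" by (rule ker[OF Rc])
  also have "\<dots> \<longleftrightarrow> (\<forall>i<m. (\<Sum>A\<in>set As. R $$ (i, col_of As A) * x A) = 0)"
  proof -
    have "(\<Sum>j<?N. R $$ (i, j) * x (As ! j)) = (\<Sum>A\<in>set As. R $$ (i, col_of As A) * x A)" for i
      using sum.reindex_bij_betw[OF bij_betw_nth[OF As refl refl], of "\<lambda>A. R $$ (i, col_of As A) * x A"]
      by (simp add: col_of_nth[OF As])
    then show ?thesis by simp
  qed
  also have "\<dots> \<longleftrightarrow> (\<forall>P\<in>pivots R As. x P = - (\<Sum>F\<in>frees R As. R $$ (pivot_row R As P, col_of As F) * x F))"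
  proof -
    obtain f where f: "pivot_fun R f (dim_col R)" using rref_props(2) by blast
    note pD = pivot_funD[OF dims(1) f, unfolded dims(2)]
    have row: "(\<Sum>A\<in>set As. R $$ (pivot_row R As P, col_of As A) * x A) =
      x P + (\<Sum>F\<in>frees R As. R $$ (pivot_row R As P, col_of As F) * x F)" if P: "P \<in> pivots R As" for P
    proof -
      let ?i = "pivot_row R As P"
      have i: "?i < m" "f ?i = col_of As P" by (rule pivotsE[OF P f])+
      have PA: "P \<in> set As" using P by (simp add: pivots_def)
      have cP: "col_of As P < ?N" by (rule col_of(1)[OF As PA])
      have one: "R $$ (?i, col_of As P) = 1" using pD(4)[OF i(1)] i(2) cP by simp
      \<comment> \<open>Here the form being reduced matters: the column of another pivot is zero in
        row \<open>?i\<close>.\<close>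
      have "R $$ (?i, col_of As A) * x A = 0" if A: "A \<in> pivots R As - {P}" for A
      proof -
        have AP: "A \<in> pivots R As" and AA: "A \<in> set As" using A by (auto simp: pivots_def)
        have k: "pivot_row R As A < m" "f (pivot_row R As A) = col_of As A" by (rule pivotsE[OF AP f])+
        have cA: "col_of As A < ?N" by (rule col_of(1)[OF As AA])
        have "col_of As A \<noteq> col_of As P" using col_of(2)[OF As AA] col_of(2)[OF As PA] A by auto
        then have "?i \<noteq> pivot_row R As A" using i(2) k(2) by auto
        then show ?thesis using pD(5)[OF k(1) _ i(1)] k(2) cA by simp
      qed
      then have "(\<Sum>A\<in>pivots R As - {P}. R $$ (?i, col_of As A) * x A) = 0" by (intro sum.neutral) blast
      then have "(\<Sum>A\<in>pivots R As. R $$ (?i, col_of As A) * x A) = x P"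
        using sum.remove[OF finite_pivots(1) P, of "\<lambda>A. R $$ (?i, col_of As A) * x A"] one by simp
      then show ?thesis
        using sum.union_disjoint[OF finite_pivots(1,2,4), of "\<lambda>A. R $$ (?i, col_of As A) * x A"] finite_pivots(3) by simp
    qed
    show ?thesis
    proof (intro iffI ballI allI impI)
      fix P assume a: "\<forall>i<m. (\<Sum>A\<in>set As. R $$ (i, col_of As A) * x A) = 0" and P: "P \<in> pivots R As"
      then show "x P = - (\<Sum>F\<in>frees R As. R $$ (pivot_row R As P, col_of As F) * x F)"
        using row[OF P] pivotsE(1)[OF P f] by (simp add: eq_neg_iff_add_eq_0)
    next
      fix i assume a: "\<forall>P\<in>pivots R As. x P = - (\<Sum>F\<in>frees R As. R $$ (pivot_row R As P, col_of As F) * x F)" and i: "i < m"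
      show "(\<Sum>A\<in>set As. R $$ (i, col_of As A) * x A) = 0"
      \<comment> \<open>A zero row gives a trivial equation; any other row belongs to the label of
        its pivot column.\<close>
      proof (cases "f i = ?N")
        case True
        then have "R $$ (i, col_of As A) = 0" if "A \<in> set As" for A
          using pD(2)[OF i] col_of(1)[OF As that] by simp
        then show ?thesis by (intro sum.neutral) simp
      next
        case False
        then have fi: "f i < ?N" using pD(1)[OF i] by simp
        let ?P = "As ! f i"
        have "leading R i (col_of As ?P)" unfolding leading_iff[OF f] using i fi dims by (simp add: col_of_nth[OF As])
        then have P: "?P \<in> pivots R As" using fi by (auto simp: pivots_def)
        have "pivot_row R As ?P = i"
          using pivotsE[OF P f] pivot_fun_inj[OF f] i fi dims by (simp add: col_of_nth[OF As])
        then show ?thesis using row[OF P] bspec[OF a P] by simp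
      qed
    qed
  qed
  finally show ?thesis .
qed

end

section \<open>The candidate elements in normalized coordinates\<close>

context qschur_rank
begin

lemma qschurK_eq: "qschurK n r = BA.Kt" by (simp only: qschurK_def)

lemma BLM_props:
  assumes A: "A \<in> Th"
  shows "BLM n r A \<in> carrier BA.Kt" "B \<in> Th \<Longrightarrow> bcoord (BLM n r A) B = (if A = B then 1 else 0)"
proof -
  have c: "normalized_e n r A \<in> carrier S" unfolding normalized_e_def
    by (rule S_smult_closed[OF basis_e_props(1)[OF A] laurent_powi])
  show "BLM n r A \<in> carrier BA.Kt" unfolding BLM_def BA.Kt_simps by (rule BA.pt_closed[OF c])
  assume B: "B \<in> Th"
  have "BA.Phi (BLM n r A) B = \<upsilon> powi (- int (d_exp n A)) * (if A = B then 1 else 0)"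
    unfolding BLM_def BA.Phi_pt[OF c B] unfolding normalized_e_def
      crd_smult[OF basis_e_props(1)[OF A] laurent_powi B] crd_basis_e[OF A B] by simp
  then show "bcoord (BLM n r A) B = (if A = B then 1 else 0)"
    by (simp add: bcoord_def power_int_minus ups_nonzero)
qed

lemma bcoord_eqI:
  assumes "z \<in> carrier BA.Kt" "w \<in> carrier BA.Kt" "\<And>A. A \<in> Th \<Longrightarrow> bcoord z A = bcoord w A"
  shows "z = w"
  by (rule BA.Kt_eqI[OF assms(1,2)]) (use assms(3) in \<open>simp add: bcoord_def ups_nonzero\<close>)

lemma bcoord_simps:
  "z \<in> carrier BA.Kt \<Longrightarrow> w \<in> carrier BA.Kt \<Longrightarrow> A \<in> Th \<Longrightarrow> bcoord (z \<oplus>\<^bsub>BA.Kt\<^esub> w) A = bcoord z A + bcoord w A"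
  "z \<in> carrier BA.Kt \<Longrightarrow> w \<in> carrier BA.Kt \<Longrightarrow> A \<in> Th \<Longrightarrow> bcoord (z \<ominus>\<^bsub>BA.Kt\<^esub> w) A = bcoord z A - bcoord w A"
  "z \<in> carrier BA.Kt \<Longrightarrow> A \<in> Th \<Longrightarrow> bcoord (c \<odot>\<^bsub>BA.Kt\<^esub> z) A = c * bcoord z A"
  "A \<in> Th \<Longrightarrow> bcoord \<zero>\<^bsub>BA.Kt\<^esub> A = 0"
  by (simp_all add: bcoord_def BA.Phi_add BA.Phi_minus BA.Phi_smult BA.Phi_zero algebra_simps)

lemma bcoord_finsum:
  assumes "finite T" "\<And>x. x \<in> T \<Longrightarrow> g x \<in> carrier BA.Kt" "A \<in> Th"
  shows "bcoord (finsum BA.Kt g T) A = (\<Sum>x\<in>T. bcoord (g x) A)"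
proof -
  have "BA.Phi (finsum BA.Kt g T) A = (\<Sum>x\<in>T. BA.Phi (g x) A)" by (rule BA.Phi_finsum[OF assms])
  then show ?thesis by (simp only: bcoord_def sum_distrib_left)
qed

abbreviation "Zs \<equiv> ring_center BA.Kt"
abbreviation "CS \<equiv> center_space n r"

lemma CS_eq: "CS = BA.Kt\<lparr>carrier := Zs\<rparr>" by (simp only: center_space_def qschurK_eq)

lemma CS_simps: "carrier CS = Zs" "x \<oplus>\<^bsub>CS\<^esub> y = x \<oplus>\<^bsub>BA.Kt\<^esub> y" "c \<odot>\<^bsub>CS\<^esub> x = c \<odot>\<^bsub>BA.Kt\<^esub> x" "\<zero>\<^bsub>CS\<^esub> = \<zero>\<^bsub>BA.Kt\<^esub>"
  by (simp_all add: CS_eq)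

lemma CS_vectorspace: "vectorspace KK CS"
proof (rule vectorspace.intro)
  show "module KK CS" unfolding CS_eq by (rule module.submodule_is_module[OF BA.Kt_module BA.center_submodule])
  show "field KK" by (rule class_field.field_axioms)
qed

lemma Zs_Kt: "z \<in> Zs \<Longrightarrow> z \<in> carrier BA.Kt" by (simp only: center_char)

lemma bcoord_CS_finsum:
  assumes "finite T" "\<And>x. x \<in> T \<Longrightarrow> g x \<in> Zs" "A \<in> Th"
  shows "finsum CS g T \<in> Zs" "bcoord (finsum CS g T) A = (\<Sum>x\<in>T. bcoord (g x) A)"
proof -
  interpret V: vectorspace KK CS by (rule CS_vectorspace)
  have "finsum CS g T \<in> Zs \<and> bcoord (finsum CS g T) A = (\<Sum>x\<in>T. bcoord (g x) A)"
    using assms(1,2)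
  proof (induction T rule: finite_induct)
    case empty
    have "finsum CS g {} = \<zero>\<^bsub>CS\<^esub>" by (rule V.finsum_empty)
    then show ?case using bcoord_simps(4)[OF assms(3)] V.zero_closed by (simp add: CS_simps)
  next
    case (insert x T)
    have gx: "g x \<in> Zs" using insert by blast
    have IH: "finsum CS g T \<in> Zs" "bcoord (finsum CS g T) A = (\<Sum>x\<in>T. bcoord (g x) A)" using insert by blast+
    have e: "finsum CS g (insert x T) = g x \<oplus>\<^bsub>CS\<^esub> finsum CS g T"
      by (rule V.finsum_insert) (use insert CS_simps in auto)
    have "g x \<oplus>\<^bsub>CS\<^esub> finsum CS g T \<in> Zs" using V.a_closed[of "g x" "finsum CS g T"] gx IH(1) by (simp add: CS_simps)
    moreover have "bcoord (g x \<oplus>\<^bsub>CS\<^esub> finsum CS g T) A = bcoord (g x) A + bcoord (finsum CS g T) A"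
      unfolding CS_simps by (rule bcoord_simps(1)[OF Zs_Kt[OF gx] Zs_Kt[OF IH(1)] assms(3)])
    ultimately show ?case unfolding e using insert IH(2) by simp
  qed
  then show "finsum CS g T \<in> Zs" "bcoord (finsum CS g T) A = (\<Sum>x\<in>T. bcoord (g x) A)" by auto
qed

context
  fixes As :: "nmat list" and eqs :: "center_eq list" and R :: "ratfun mat"
  assumes As: "distinct As" "set As = Omega n r" and eqs: "set eqs = center_eqs n r"
    and R: "R = rref (center_mat n eqs As)"
begin

lemma cm_carrier: "center_mat n eqs As \<in> carrier_mat (length eqs) (length As)"
  by (simp add: center_mat_def)

lemma Omega_Th: "A \<in> Omega n r \<Longrightarrow> A \<in> Th" by (simp add: Omega_def)

lemma kernel_iff:
  "(\<forall>E\<in>center_eqs n r. (\<Sum>A\<in>Omega n r. eq_coeff n E A * x A) = 0) \<longleftrightarrow>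
    (\<forall>P\<in>pivots R As. x P = - (\<Sum>F\<in>frees R As. R $$ (pivot_row R As P, col_of As F) * x F))"
proof -
  have row: "(\<Sum>j<length As. center_mat n eqs As $$ (i, j) * x (As ! j)) = (\<Sum>A\<in>Omega n r. eq_coeff n (eqs ! i) A * x A)"
    if "i < length eqs" for i
  proof -
    have "(\<Sum>j<length As. center_mat n eqs As $$ (i, j) * x (As ! j)) = (\<Sum>j<length As. eq_coeff n (eqs ! i) (As ! j) * x (As ! j))"
      by (intro sum.cong refl) (simp add: center_mat_def that)
    also have "\<dots> = (\<Sum>A\<in>set As. eq_coeff n (eqs ! i) A * x A)"
      by (rule sum.reindex_bij_betw[OF bij_betw_nth[OF As(1) refl refl]])
    finally show ?thesis unfolding As(2) .
  qed
  have "(\<forall>E\<in>center_eqs n r. (\<Sum>A\<in>Omega n r. eq_coeff n E A * x A) = 0) \<longleftrightarrow>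
    (\<forall>i<length eqs. (\<Sum>A\<in>Omega n r. eq_coeff n (eqs ! i) A * x A) = 0)"
    unfolding eqs[symmetric] all_set_conv_all_nth ..
  also have "\<dots> \<longleftrightarrow> (\<forall>i<length eqs. (\<Sum>j<length As. center_mat n eqs As $$ (i, j) * x (As ! j)) = 0)"
    using row by simp
  finally show ?thesis unfolding rref_kernel[OF As(1) cm_carrier R] .
qed

lemma pf_Omega: "A \<in> pivots R As \<Longrightarrow> A \<in> Omega n r" "A \<in> frees R As \<Longrightarrow> A \<in> Omega n r"
  using As(2) by (auto simp: pivots_def frees_def)

lemma finite_pf: "finite (pivots R As)" "finite (frees R As)" by (auto simp: pivots_def frees_def)

lemma pf_cases: "A \<in> Omega n r \<Longrightarrow> A \<notin> frees R As \<Longrightarrow> A \<in> pivots R As"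
  "A \<in> frees R As \<Longrightarrow> A \<notin> pivots R As"
  using As(2) by (auto simp: frees_def)

text \<open>A central element vanishes off the balanced matrices and is determined on pivot labels
  by its free coordinates, which can be prescribed arbitrarily.\<close>

lemma center_bcoord:
  "z \<in> Zs \<longleftrightarrow> z \<in> carrier BA.Kt \<and> (\<forall>A\<in>Th. A \<notin> Omega n r \<longrightarrow> bcoord z A = 0) \<and>
    (\<forall>P\<in>pivots R As. bcoord z P = - (\<Sum>F\<in>frees R As. R $$ (pivot_row R As P, col_of As F) * bcoord z F))"
proof -
  have "bcoord z A = 0 \<longleftrightarrow> BA.Phi z A = 0" for A by (simp add: bcoord_def ups_nonzero)
  then have s: "(\<forall>A\<in>Th. BA.Phi z A \<noteq> 0 \<longrightarrow> A \<in> Omega n r) \<longleftrightarrow> (\<forall>A\<in>Th. A \<notin> Omega n r \<longrightarrow> bcoord z A = 0)" by auto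
  show ?thesis unfolding center_char kernel_iff s ..
qed

lemma C_elt_props:
  assumes A0: "A0 \<in> frees R As"
  shows "C_elt n r R As A0 \<in> carrier BA.Kt"
    and "B \<in> Th \<Longrightarrow> bcoord (C_elt n r R As A0) B = (if B = A0 then 1 else 0) -
      (if B \<in> pivots R As then R $$ (pivot_row R As B, col_of As A0) else 0)"
proof -
  let ?g = "\<lambda>P. R $$ (pivot_row R As P, col_of As A0) \<odot>\<^bsub>BA.Kt\<^esub> BLM n r P"
  have AT: "A0 \<in> Th" by (rule Omega_Th[OF pf_Omega(2)[OF A0]])
  have PT: "P \<in> Th" if "P \<in> pivots R As" for P by (rule Omega_Th[OF pf_Omega(1)[OF that]])
  have g: "?g P \<in> carrier BA.Kt" if "P \<in> pivots R As" for P
    by (rule BA.Kt_smult_closed[OF BLM_props(1)[OF PT[OF that]]])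
  have fs: "finsum BA.Kt ?g (pivots R As) \<in> carrier BA.Kt" by (rule BA.Kt.finsum_closed) (use g in blast)
  have C: "C_elt n r R As A0 = BLM n r A0 \<ominus>\<^bsub>BA.Kt\<^esub> finsum BA.Kt ?g (pivots R As)"
    by (simp only: C_elt_def qschurK_eq)
  show "C_elt n r R As A0 \<in> carrier BA.Kt" unfolding C
    by (rule BA.Kt.minus_closed[OF BLM_props(1)[OF AT] fs])
  assume B: "B \<in> Th"
  have "bcoord (finsum BA.Kt ?g (pivots R As)) B = (\<Sum>P\<in>pivots R As. bcoord (?g P) B)"
    by (rule bcoord_finsum[OF finite_pf(1) g B])
  also have "\<dots> = (\<Sum>P\<in>pivots R As. if P = B then R $$ (pivot_row R As B, col_of As A0) else 0)"
  proof (intro sum.cong refl)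
    fix P assume P: "P \<in> pivots R As"
    show "bcoord (?g P) B = (if P = B then R $$ (pivot_row R As B, col_of As A0) else 0)"
      unfolding bcoord_simps(3)[OF BLM_props(1)[OF PT[OF P]] B] BLM_props(2)[OF PT[OF P] B] by simp
  qed
  also have "\<dots> = (if B \<in> pivots R As then R $$ (pivot_row R As B, col_of As A0) else 0)"
    using finite_pf(1) by simp
  finally have f: "bcoord (finsum BA.Kt ?g (pivots R As)) B = (if B \<in> pivots R As then R $$ (pivot_row R As B, col_of As A0) else 0)" .
  show "bcoord (C_elt n r R As A0) B = (if B = A0 then 1 else 0) -
      (if B \<in> pivots R As then R $$ (pivot_row R As B, col_of As A0) else 0)"
    unfolding C bcoord_simps(2)[OF BLM_props(1)[OF AT] fs B] f BLM_props(2)[OF AT B] by (simp add: eq_commute)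
qed

lemma C_elt_free:
  assumes "A0 \<in> frees R As" "A \<in> frees R As"
  shows "bcoord (C_elt n r R As A0) A = (if A = A0 then 1 else 0)"
  using C_elt_props(2)[OF assms(1) Omega_Th[OF pf_Omega(2)[OF assms(2)]]] pf_cases(2)[OF assms(2)] by simp

lemma C_elt_pivot:
  assumes "A0 \<in> frees R As" "A \<in> pivots R As"
  shows "bcoord (C_elt n r R As A0) A = - R $$ (pivot_row R As A, col_of As A0)"
proof -
  have "A \<noteq> A0" using assms pf_cases(2) by blast
  then show ?thesis using C_elt_props(2)[OF assms(1) Omega_Th[OF pf_Omega(1)[OF assms(2)]]] assms(2) by simp
qed

text \<open>Each candidate is the solution with one free coordinate equal to 1 and the others 0, so
  in its pivot equations the sum over free labels collapses to one term.\<close>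

lemma C_elt_Zs:
  assumes A0: "A0 \<in> frees R As" shows "C_elt n r R As A0 \<in> Zs"
  unfolding center_bcoord
proof (intro conjI ballI impI)
  show "C_elt n r R As A0 \<in> carrier BA.Kt" by (rule C_elt_props(1)[OF A0])
  show "bcoord (C_elt n r R As A0) A = 0" if A: "A \<in> Th" "A \<notin> Omega n r" for A
  proof -
    have "A \<noteq> A0" "A \<notin> pivots R As" using A(2) pf_Omega A0 by blast+
    then show ?thesis using C_elt_props(2)[OF A0 A(1)] by simp
  qed
  fix P assume P: "P \<in> pivots R As"
  have "(\<Sum>F\<in>frees R As. R $$ (pivot_row R As P, col_of As F) * bcoord (C_elt n r R As A0) F) =
    (\<Sum>F\<in>frees R As. if F = A0 then R $$ (pivot_row R As P, col_of As A0) else 0)"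
    by (intro sum.cong refl) (simp add: C_elt_free[OF A0])
  also have "\<dots> = R $$ (pivot_row R As P, col_of As A0)" using A0 finite_pf(2) by simp
  finally show "bcoord (C_elt n r R As A0) P = - (\<Sum>F\<in>frees R As. R $$ (pivot_row R As P, col_of As F) * bcoord (C_elt n r R As A0) F)"
    using C_elt_pivot[OF A0 P] by simp
qed

text \<open>The free coordinates form a dual system to the candidates. This gives independence and
  the coefficients of any central element; agreement at the pivots comes from
  \<open>center_bcoord\<close>.\<close>

lemma C_basis: "vectorspace.basis KK CS {C_elt n r R As A0 | A0. A0 \<in> frees R As}"
proof -
  interpret V: vectorspace KK CS by (rule CS_vectorspace)
  let ?C = "C_elt n r R As"
  let ?B = "{?C A0 | A0. A0 \<in> frees R As}"
  have Bim: "?B = ?C ` frees R As" by blast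
  have BZ: "?B \<subseteq> Zs" using C_elt_Zs by blast
  have smZ: "c \<odot>\<^bsub>BA.Kt\<^esub> z \<in> Zs" if "z \<in> Zs" for c z
    using V.smult_closed[of c z] that by (simp add: CS_simps)
  \<comment> \<open>The basis is stated as a set, so distinct free labels must give distinct
    elements before sums over the set can be reindexed by labels.\<close>
  have inj: "inj_on ?C (frees R As)"
  proof (rule inj_onI)
    fix F F' assume F: "F \<in> frees R As" "F' \<in> frees R As" "?C F = ?C F'"
    show "F = F'" using C_elt_free[OF F(1) F(1)] C_elt_free[OF F(2) F(1)] F(3) by (simp split: if_splits)
  qed
  have lc: "V.lincomb a T \<in> Zs" "A \<in> Th \<Longrightarrow> bcoord (V.lincomb a T) A = (\<Sum>v\<in>T. a v * bcoord v A)"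
    if T: "finite T" "T \<subseteq> Zs" for a T A
  proof -
    have g: "a v \<odot>\<^bsub>CS\<^esub> v \<in> Zs" if "v \<in> T" for v using smZ that T(2) by (auto simp: CS_simps)
    have "finsum CS (\<lambda>v. a v \<odot>\<^bsub>CS\<^esub> v) T \<in> carrier CS" by (rule V.finsum_closed) (use g in \<open>auto simp: CS_simps(1)\<close>)
    then show "V.lincomb a T \<in> Zs" by (simp only: V.lincomb_def CS_simps(1))
    assume A: "A \<in> Th"
    show "bcoord (V.lincomb a T) A = (\<Sum>v\<in>T. a v * bcoord v A)"
    proof -
      have "bcoord (V.lincomb a T) A = (\<Sum>v\<in>T. bcoord (a v \<odot>\<^bsub>CS\<^esub> v) A)"
        unfolding V.lincomb_def by (rule bcoord_CS_finsum(2)[OF T(1) g A])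
      also have "\<dots> = (\<Sum>v\<in>T. a v * bcoord v A)"
      proof (intro sum.cong refl)
        fix v assume "v \<in> T"
        then have "v \<in> carrier BA.Kt" using T(2) Zs_Kt by blast
        then show "bcoord (a v \<odot>\<^bsub>CS\<^esub> v) A = a v * bcoord v A"
          unfolding CS_simps(3) by (rule bcoord_simps(3)[OF _ A])
      qed
      finally show ?thesis .
    qed
  qed
  have "V.lin_indpt ?B"
  proof
    assume "V.lin_dep ?B"
    then obtain T a v where T: "finite T" "T \<subseteq> ?B" "V.lincomb a T = \<zero>\<^bsub>CS\<^esub>" "v \<in> T" "a v \<noteq> \<zero>\<^bsub>KK\<^esub>"
      unfolding V.lin_dep_def by blast
    obtain F where F: "F \<in> frees R As" "v = ?C F" using T by blast
    have FT: "F \<in> Th" by (rule Omega_Th[OF pf_Omega(2)[OF F(1)]])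
    have "0 = bcoord (V.lincomb a T) F" unfolding T(3) CS_simps(4) using bcoord_simps(4)[OF FT] by simp
    also have "\<dots> = (\<Sum>w\<in>T. a w * bcoord w F)" by (rule lc(2)[OF T(1) order_trans[OF T(2) BZ] FT])
    also have "\<dots> = (\<Sum>w\<in>T. if w = v then a v else 0)"
    proof (intro sum.cong refl)
      fix w assume "w \<in> T"
      then obtain F' where F': "F' \<in> frees R As" "w = ?C F'" using T(2) by blast
      have "w = v \<longleftrightarrow> F = F'" using inj_onD[OF inj] F F' by auto
      then show "a w * bcoord w F = (if w = v then a v else 0)"
        using C_elt_free[OF F'(1) F(1)] F'(2) F(2) by (cases "F = F'") simp_all
    qed
    also have "\<dots> = a v" using T by simp
    finally show False using T(5) by simp
  qed
  moreover have "V.span ?B = carrier CS"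
  proof
    show "V.span ?B \<subseteq> carrier CS"
      unfolding V.span_def CS_simps(1) using lc(1) BZ by (auto intro: subset_trans)
    show "carrier CS \<subseteq> V.span ?B"
    proof
      fix z assume "z \<in> carrier CS"
      then have z: "z \<in> Zs" by (simp only: CS_simps(1))
      \<comment> \<open>The coefficient of a candidate is the coordinate of \<open>z\<close> at its
        free label, recovered by inverting the injective labelling.\<close>
      define a where "a v = bcoord z (inv_into (frees R As) ?C v)" for v
      have fB: "finite ?B" unfolding Bim using finite_pf(2) by blast
      have sumB: "(\<Sum>v\<in>?B. a v * bcoord v A) = (\<Sum>F\<in>frees R As. bcoord z F * bcoord (?C F) A)" for A
        unfolding Bim sum.reindex[OF inj] by (intro sum.cong refl) (simp add: a_def inv_into_f_f[OF inj])
      have "z = V.lincomb a ?B"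
      proof (rule bcoord_eqI[OF Zs_Kt[OF z] Zs_Kt[OF lc(1)[OF fB BZ]]])
        fix A assume A: "A \<in> Th"
        have "(\<Sum>F\<in>frees R As. bcoord z F * bcoord (?C F) A) = bcoord z A"
        proof (cases "A \<in> Omega n r")
          case False
          have "bcoord (?C F) A = 0" if "F \<in> frees R As" for F
            using C_elt_Zs[OF that] A False unfolding center_bcoord by blast
          then have "(\<Sum>F\<in>frees R As. bcoord z F * bcoord (?C F) A) = 0" by (intro sum.neutral) simp
          then show ?thesis using z A False unfolding center_bcoord by simp
        next
          case AO: True
          show ?thesis
          proof (cases "A \<in> frees R As")
            case True
            have "(\<Sum>F\<in>frees R As. bcoord z F * bcoord (?C F) A) = (\<Sum>F\<in>frees R As. if F = A then bcoord z A else 0)"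
              by (intro sum.cong refl) (use C_elt_free True in auto)
            then show ?thesis using True finite_pf(2) by simp
          next
            case False
            then have P: "A \<in> pivots R As" using pf_cases(1) AO by blast
            have "(\<Sum>F\<in>frees R As. bcoord z F * bcoord (?C F) A) =
              - (\<Sum>F\<in>frees R As. R $$ (pivot_row R As A, col_of As F) * bcoord z F)"
              unfolding sum_negf[symmetric] by (intro sum.cong refl) (simp add: C_elt_pivot[OF _ P])
            also have "\<dots> = bcoord z A" using z P unfolding center_bcoord by simp
            finally show ?thesis .
          qed
        qed
        then show "bcoord z A = bcoord (V.lincomb a ?B) A" unfolding lc(2)[OF fB BZ A] sumB ..
      qed
      moreover have "V.lincomb a ?B \<in> V.span ?B"
        unfolding V.span_def using fB by (intro CollectI exI[of _ a] exI[of _ ?B]) auto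
      ultimately show "z \<in> V.span ?B" by (simp only:)
    qed
  qed
  moreover have "?B \<subseteq> carrier CS" using BZ by (simp only: CS_simps(1))
  ultimately show ?thesis unfolding V.basis_def by blast
qed

end

end

theorem theorem2p8:
  fixes n r :: nat and As :: "nmat list" and eqs :: "center_eq list" and R :: "ratfun mat"
  assumes As: "distinct As" "set As = Omega n r"
    and eqs: "distinct eqs" "set eqs = center_eqs n r"
    and R: "R = rref (center_mat n eqs As)"
  shows "vectorspace KK (center_space n r) \<and>
    vectorspace.basis KK (center_space n r) {C_elt n r R As A0 | A0. A0 \<in> frees R As}"
  using qschur_rank.CS_vectorspace qschur_rank.C_basis[OF As eqs(2) R] by (rule conjI)

end
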